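(* Let $k$ be an algebraically closed field and let $\mathcal{A}$ be a framed $E_2$-algebra in $\mathsf{Pr}$ that has enough compact projective objects, that is compact rigid with a compact monoidal unit, and whose balancing is compatible with duals. Then $\mathcal{A}$ carries a cyclic framed $E_2$-algebra structure in $\mathsf{Pr}$.
   Context: $\mathsf{Pr}$ is the symmetric monoidal bicategory of $k$-linear presentable categories, cocontinuous functors and linear natural isomorphisms, with the Kelly-Deligne tensor product $\boxtimes$ and unit $\mathsf{Vect}$. A framed $E_2$-algebra in $\mathsf{Pr}$ is a balanced braided monoidal category in $\mathsf{Pr}$: an object $\mathcal{A}\in\mathsf{Pr}$ with a cocontinuous monoidal product $\otimes:\mathcal{A}\boxtimes\mathcal{A}\to\mathcal{A}$, unit $I$, coherent associativity and unit isomorphisms, a braiding $c_{X,Y}:X\otimes Y\cong Y\otimes X$ satisfying the hexagon relations, and a balancing, i.e. a natural isomorphism $\theta_X:X\cong X$ with $\theta_{X\otimes Y}=c_{Y,X}c_{X,Y}(\theta_X\otimes\theta_Y)$ and $\theta_I=\mathrm{id}_I$. An object $X$ is compact (resp. compact projective) if $\mathrm{Hom}_{\mathcal{A}}(X,-):\mathcal{A}\to\mathsf{Vect}$ preserves filtered (resp. all) colimits. $\mathcal{A}$ has enough compact projective objects if every object is a colimit of compact projective objects. $\mathcal{A}$ is compact rigid if every compact object is dualizable, i.e. has a left and a right dual; the left dual $X^\vee$ comes with $\mathrm{ev}_X:X^\vee\otimes X\to I$, $\mathrm{coev}_X:I\to X\otimes X^\vee$. The balancing is compatible with duals if $\theta_X^\vee=\theta_{X^\vee}$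 for every dualizable $X$. A cyclic framed $E_2$-algebra in $\mathsf{Pr}$ is a cyclic algebra in $\mathsf{Pr}$ over the (cyclic) framed little 2-disks operad. By a known theorem of Müller and Woike this is equivalent to the following structure, a self-dual balanced braided algebra, which may be taken as the definition: a framed $E_2$-algebra $\mathcal{A}$ in $\mathsf{Pr}$ together with a cocontinuous pairing $\kappa:\mathcal{A}\boxtimes\mathcal{A}\to\mathsf{Vect}$ that is non-degenerate (there is a copairing $\Delta:\mathsf{Vect}\to\mathcal{A}\boxtimes\mathcal{A}$ such that the snake relations hold up to isomorphism) and a natural isomorphism $\gamma_{X,Y}:\kappa(X,Y)\cong\kappa(I,X\otimes Y)$ such that (U) $\gamma_{I,Y}:\kappa(I,Y)\cong\kappa(I,I\otimes Y)$ is the isomorphism induced by the unit isomorphism $Y\cong I\otimes Y$; (PB) for all $X,Y\in\mathcal{A}$, the automorphisms $\kappa(\theta_X,\mathrm{id}_Y)$ and $\kappa(\mathrm{id}_X,\theta_Y)$ of $\kappa(X,Y)$ coincide. Saying that $\mathcal{A}$ carries such a structure means that the given framed $E_2$-algebra $\mathcal{A}$ underlies one. *)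

theory Defs
  imports "HOL-Algebra.Algebraic_Closure"
begin

unbundle cardinal_syntax
no_notation var (\<open>X\<index>\<close>)

section \<open>Smallness\<close>

text \<open>
  A type \<open>'u\<close> of regular infinite cardinality plays the role of the universe of sets: classes are
  sets over \<open>'u\<close>, and a class is small if it has fewer elements than \<open>'u\<close>. All objects of \<open>Pr\<close> have
  their objects and arrows in \<open>'u\<close>. If the cardinality of \<open>'u\<close> is strongly inaccessible, this is
  \<open>Pr\<close> over a Grothendieck universe (every locally small category with a class of objects is
  isomorphic to one over \<open>'u\<close>). Inaccessibility is not demanded, since no type can be shown in HOL to
  have that property.
\<close>

definition regular_universe :: "'u itself \<Rightarrow> bool" where
  "regular_universe _ \<longleftrightarrow> cinfinite |UNIV :: 'u set| \<and> regularCard |UNIV :: 'u set|"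

definition small :: "'u set \<Rightarrow> bool" where
  "small S \<longleftrightarrow> |S| <o |UNIV :: 'u set|"


section \<open>Categories, functors, natural transformations\<close>

record ('o, 'a) cat =
  Obj :: "'o set"
  Arr :: "'a set"
  Dom :: "'a \<Rightarrow> 'o"
  Cod :: "'a \<Rightarrow> 'o"
  Cmp :: "'a \<Rightarrow> 'a \<Rightarrow> 'a"   \<comment> \<open>\<open>Cmp C g f\<close> is \<open>g\<close> after \<open>f\<close>\<close>
  Idt :: "'o \<Rightarrow> 'a"

definition homs :: "('o, 'a, 'z) cat_scheme \<Rightarrow> 'o \<Rightarrow> 'o \<Rightarrow> 'a set" where
  "homs C X Y = {f \<in> Arr C. Dom C f = X \<and> Cod C f = Y}"

definition category :: "('o, 'a, 'z) cat_scheme \<Rightarrow> bool" where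
  "category C \<longleftrightarrow>
     (\<forall>f \<in> Arr C. Dom C f \<in> Obj C \<and> Cod C f \<in> Obj C) \<and>
     (\<forall>X \<in> Obj C. Idt C X \<in> homs C X X) \<and>
     (\<forall>X \<in> Obj C. \<forall>Y \<in> Obj C. \<forall>Z \<in> Obj C. \<forall>f \<in> homs C X Y. \<forall>g \<in> homs C Y Z.
        Cmp C g f \<in> homs C X Z) \<and>
     (\<forall>X \<in> Obj C. \<forall>Y \<in> Obj C. \<forall>f \<in> homs C X Y.
        Cmp C f (Idt C X) = f \<and> Cmp C (Idt C Y) f = f) \<and>
     (\<forall>W \<in> Obj C. \<forall>X \<in> Obj C. \<forall>Y \<in> Obj C. \<forall>Z \<in> Obj C.
        \<forall>f \<in> homs C W X. \<forall>g \<in> homs C X Y. \<forall>h \<in> homs C Y Z.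
        Cmp C h (Cmp C g f) = Cmp C (Cmp C h g) f)"

definition inverse_arrows :: "('o, 'a, 'z) cat_scheme \<Rightarrow> 'a \<Rightarrow> 'a \<Rightarrow> bool" where
  "inverse_arrows C f g \<longleftrightarrow> f \<in> Arr C \<and> g \<in> homs C (Cod C f) (Dom C f) \<and>
     Cmp C g f = Idt C (Dom C f) \<and> Cmp C f g = Idt C (Cod C f)"

definition is_iso :: "('o, 'a, 'z) cat_scheme \<Rightarrow> 'a \<Rightarrow> bool" where
  "is_iso C f \<longleftrightarrow> (\<exists>g. inverse_arrows C f g)"

definition inv_arr :: "('o, 'a, 'z) cat_scheme \<Rightarrow> 'a \<Rightarrow> 'a" where
  "inv_arr C f = (THE g. inverse_arrows C f g)"

record ('o, 'a, 'p, 'b) functr =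
  fobj :: "'o \<Rightarrow> 'p"
  farr :: "'a \<Rightarrow> 'b"

definition is_functor ::
  "('o, 'a, 'y) cat_scheme \<Rightarrow> ('p, 'b, 'z) cat_scheme \<Rightarrow> ('o, 'a, 'p, 'b) functr \<Rightarrow> bool" where
  "is_functor C D F \<longleftrightarrow> category C \<and> category D \<and>
     (\<forall>X \<in> Obj C. fobj F X \<in> Obj D) \<and>
     (\<forall>X \<in> Obj C. \<forall>Y \<in> Obj C. \<forall>f \<in> homs C X Y. farr F f \<in> homs D (fobj F X) (fobj F Y)) \<and>
     (\<forall>X \<in> Obj C. farr F (Idt C X) = Idt D (fobj F X)) \<and>
     (\<forall>X \<in> Obj C. \<forall>Y \<in> Obj C. \<forall>Z \<in> Obj C. \<forall>f \<in> homs C X Y. \<forall>g \<in> homs C Y Z.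
        farr F (Cmp C g f) = Cmp D (farr F g) (farr F f))"

definition nat_trans ::
  "('o, 'a, 'y) cat_scheme \<Rightarrow> ('p, 'b, 'z) cat_scheme \<Rightarrow>
   ('o, 'a, 'p, 'b) functr \<Rightarrow> ('o, 'a, 'p, 'b) functr \<Rightarrow> ('o \<Rightarrow> 'b) \<Rightarrow> bool" where
  "nat_trans C D F G \<tau> \<longleftrightarrow> is_functor C D F \<and> is_functor C D G \<and>
     (\<forall>X \<in> Obj C. \<tau> X \<in> homs D (fobj F X) (fobj G X)) \<and>
     (\<forall>X \<in> Obj C. \<forall>Y \<in> Obj C. \<forall>f \<in> homs C X Y.
        Cmp D (\<tau> Y) (farr F f) = Cmp D (farr G f) (\<tau> X))"

definition nat_iso ::
  "('o, 'a, 'y) cat_scheme \<Rightarrow> ('p, 'b, 'z) cat_scheme \<Rightarrow>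
   ('o, 'a, 'p, 'b) functr \<Rightarrow> ('o, 'a, 'p, 'b) functr \<Rightarrow> ('o \<Rightarrow> 'b) \<Rightarrow> bool" where
  "nat_iso C D F G \<tau> \<longleftrightarrow> nat_trans C D F G \<tau> \<and> (\<forall>X \<in> Obj C. is_iso D (\<tau> X))"

definition id_fun :: "('o, 'a, 'o, 'a) functr" where
  "id_fun = \<lparr>fobj = id, farr = id\<rparr>"

definition comp_fun ::
  "('p, 'b, 'q, 'c) functr \<Rightarrow> ('o, 'a, 'p, 'b) functr \<Rightarrow> ('o, 'a, 'q, 'c) functr" where
  "comp_fun G F = \<lparr>fobj = fobj G \<circ> fobj F, farr = farr G \<circ> farr F\<rparr>"

definition prod_cat ::
  "('o, 'a, 'y) cat_scheme \<Rightarrow> ('p, 'b, 'z) cat_scheme \<Rightarrow> ('o \<times> 'p, 'a \<times> 'b) cat" where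
  "prod_cat C D = \<lparr>Obj = Obj C \<times> Obj D, Arr = Arr C \<times> Arr D,
     Dom = map_prod (Dom C) (Dom D), Cod = map_prod (Cod C) (Cod D),
     Cmp = (\<lambda>(g, g') (f, f'). (Cmp C g f, Cmp D g' f')),
     Idt = map_prod (Idt C) (Idt D)\<rparr>"

definition prod_fun ::
  "('o, 'a, 'p, 'b) functr \<Rightarrow> ('q, 'c, 'r, 'd) functr \<Rightarrow>
   ('o \<times> 'q, 'a \<times> 'c, 'p \<times> 'r, 'b \<times> 'd) functr" where
  "prod_fun F G = \<lparr>fobj = map_prod (fobj F) (fobj G), farr = map_prod (farr F) (farr G)\<rparr>"

definition swap_fun :: "('o \<times> 'p, 'a \<times> 'b, 'p \<times> 'o, 'b \<times> 'a) functr" where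
  "swap_fun = \<lparr>fobj = prod.swap, farr = prod.swap\<rparr>"

definition rebracket ::
  "('o \<times> 'p \<times> 'q, 'a \<times> 'b \<times> 'c, ('o \<times> 'p) \<times> 'q, ('a \<times> 'b) \<times> 'c) functr" where
  "rebracket = \<lparr>fobj = (\<lambda>(X, Y, Z). ((X, Y), Z)), farr = (\<lambda>(f, g, h). ((f, g), h))\<rparr>"

text \<open>\<open>F(X, -)\<close> and \<open>F(-, Y)\<close> for a functor \<open>F\<close> on a product category\<close>

definition fix_left ::
  "('o, 'a, 'z) cat_scheme \<Rightarrow> ('o \<times> 'p, 'a \<times> 'b, 'q, 'c) functr \<Rightarrow> 'o \<Rightarrow> ('p, 'b, 'q, 'c) functr" where
  "fix_left C F X = \<lparr>fobj = (\<lambda>Y. fobj F (X, Y)), farr = (\<lambda>g. farr F (Idt C X, g))\<rparr>"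

definition fix_right ::
  "('p, 'b, 'z) cat_scheme \<Rightarrow> ('o \<times> 'p, 'a \<times> 'b, 'q, 'c) functr \<Rightarrow> 'p \<Rightarrow> ('o, 'a, 'q, 'c) functr" where
  "fix_right D F Y = \<lparr>fobj = (\<lambda>X. fobj F (X, Y)), farr = (\<lambda>f. farr F (f, Idt D Y))\<rparr>"


section \<open>Colimits\<close>

definition is_cocone ::
  "('j, 'i, 'y) cat_scheme \<Rightarrow> ('o, 'a, 'z) cat_scheme \<Rightarrow> ('j, 'i, 'o, 'a) functr \<Rightarrow>
   'o \<Rightarrow> ('j \<Rightarrow> 'a) \<Rightarrow> bool" where
  "is_cocone J C E X \<iota> \<longleftrightarrow> is_functor J C E \<and> X \<in> Obj C \<and>
     (\<forall>j \<in> Obj J. \<iota> j \<in> homs C (fobj E j) X) \<and>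
     (\<forall>i \<in> Obj J. \<forall>j \<in> Obj J. \<forall>u \<in> homs J i j. Cmp C (\<iota> j) (farr E u) = \<iota> i)"

definition is_colimit ::
  "('j, 'i, 'y) cat_scheme \<Rightarrow> ('o, 'a, 'z) cat_scheme \<Rightarrow> ('j, 'i, 'o, 'a) functr \<Rightarrow>
   'o \<Rightarrow> ('j \<Rightarrow> 'a) \<Rightarrow> bool" where
  "is_colimit J C E X \<iota> \<longleftrightarrow> is_cocone J C E X \<iota> \<and>
     (\<forall>Y \<tau>. is_cocone J C E Y \<tau> \<longrightarrow>
        (\<exists>!h. h \<in> homs C X Y \<and> (\<forall>j \<in> Obj J. Cmp C h (\<iota> j) = \<tau> j)))"

definition small_category :: "('u, 'u) cat \<Rightarrow> bool" where
  "small_category J \<longleftrightarrow> category J \<and> small (Obj J) \<and> small (Arr J)"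

text \<open>\<open>J\<close> is \<open>r\<close>-filtered, for a regular cardinal \<open>r\<close>, if every diagram in \<open>J\<close> with fewer than \<open>r\<close>
  arrows has a cocone; \<open>natLeq\<close> is the cardinal of the natural numbers.\<close>

definition card_filtered :: "'c rel \<Rightarrow> ('u, 'u) cat \<Rightarrow> bool" where
  "card_filtered r J \<longleftrightarrow> category J \<and>
     (\<forall>(I :: ('u, 'u) cat) E. category I \<and> |Arr I| <o r \<and> is_functor I J E \<longrightarrow>
        (\<exists>j \<iota>. is_cocone I J E j \<iota>))"

definition filtered :: "('u, 'u) cat \<Rightarrow> bool" where
  "filtered J \<longleftrightarrow> card_filtered natLeq J"

text \<open>Preservation of the small colimits whose shape satisfies \<open>P\<close>\<close>

definition preserves_colimits ::
  "(('u, 'u) cat \<Rightarrow> bool) \<Rightarrow> ('o, 'a, 'y) cat_scheme \<Rightarrow> ('p, 'b, 'z) cat_scheme \<Rightarrow>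
   ('o, 'a, 'p, 'b) functr \<Rightarrow> bool" where
  "preserves_colimits P C D F \<longleftrightarrow>
     (\<forall>J E X \<iota>. small_category J \<and> P J \<and> is_colimit J C E X \<iota> \<longrightarrow>
        is_colimit J D (comp_fun F E) (fobj F X) (\<lambda>j. farr F (\<iota> j)))"


section \<open>Linear categories and \<open>Vect\<close>\<close>

record ('o, 'a, 's) lincat = "('o, 'a) cat" +
  HAdd :: "'a \<Rightarrow> 'a \<Rightarrow> 'a"
  HZero :: "'o \<Rightarrow> 'o \<Rightarrow> 'a"
  HScale :: "'s \<Rightarrow> 'a \<Rightarrow> 'a"

text \<open>The library's modules are records extending rings; the fields \<open>mult\<close> and \<open>one\<close> of a module
  carry no meaning.\<close>

definition hom_space :: "('o, 'a, 's) lincat \<Rightarrow> 'o \<Rightarrow> 'o \<Rightarrow> ('s, 'a) module" where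
  "hom_space C X Y = \<lparr>carrier = homs C X Y, monoid.mult = (\<lambda>_ _. HZero C X Y), one = HZero C X Y,
     zero = HZero C X Y, add = HAdd C, smult = HScale C\<rparr>"

definition linear_category :: "'s ring \<Rightarrow> ('o, 'a, 's) lincat \<Rightarrow> bool" where
  "linear_category k C \<longleftrightarrow> field k \<and> category C \<and>
     (\<forall>X \<in> Obj C. \<forall>Y \<in> Obj C. module k (hom_space C X Y)) \<and>
     (\<forall>X \<in> Obj C. \<forall>Y \<in> Obj C. \<forall>Z \<in> Obj C.
        (\<forall>f \<in> homs C X Y. \<forall>f' \<in> homs C X Y. \<forall>g \<in> homs C Y Z.
           Cmp C g (HAdd C f f') = HAdd C (Cmp C g f) (Cmp C g f')) \<and>
        (\<forall>f \<in> homs C X Y. \<forall>g \<in> homs C Y Z. \<forall>g' \<in> homs C Y Z.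
           Cmp C (HAdd C g g') f = HAdd C (Cmp C g f) (Cmp C g' f)) \<and>
        (\<forall>f \<in> homs C X Y. \<forall>g \<in> homs C Y Z. \<forall>a \<in> carrier k.
           Cmp C g (HScale C a f) = HScale C a (Cmp C g f) \<and>
           Cmp C (HScale C a g) f = HScale C a (Cmp C g f)))"

definition linear_functor ::
  "'s ring \<Rightarrow> ('o, 'a, 's) lincat \<Rightarrow> ('p, 'b, 's) lincat \<Rightarrow> ('o, 'a, 'p, 'b) functr \<Rightarrow> bool" where
  "linear_functor k C D F \<longleftrightarrow> linear_category k C \<and> linear_category k D \<and> is_functor C D F \<and>
     (\<forall>X \<in> Obj C. \<forall>Y \<in> Obj C. \<forall>f \<in> homs C X Y.
        (\<forall>g \<in> homs C X Y. farr F (HAdd C f g) = HAdd D (farr F f) (farr F g)) \<and>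
        (\<forall>a \<in> carrier k. farr F (HScale C a f) = HScale D a (farr F f)))"

definition linear_maps ::
  "'s ring \<Rightarrow> ('s, 'v) module \<Rightarrow> ('s, 'v) module \<Rightarrow> ('v \<Rightarrow> 'v) set" where
  "linear_maps k V W = {f \<in> carrier V \<rightarrow>\<^sub>E carrier W.
     (\<forall>x \<in> carrier V. \<forall>y \<in> carrier V. f (x \<oplus>\<^bsub>V\<^esub> y) = f x \<oplus>\<^bsub>W\<^esub> f y) \<and>
     (\<forall>a \<in> carrier k. \<forall>x \<in> carrier V. f (a \<odot>\<^bsub>V\<^esub> x) = a \<odot>\<^bsub>W\<^esub> f x)}"

type_synonym 'u vs = "('u, 'u) module"
type_synonym 'u vmap = "'u vs \<times> 'u vs \<times> ('u \<Rightarrow> 'u)"   \<comment> \<open>domain, codomain, map\<close>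

definition Vect :: "'u ring \<Rightarrow> ('u vs, 'u vmap, 'u) lincat" where
  "Vect k = \<lparr>
     Obj = {V. module k V \<and> small (carrier V)},
     Arr = {(V, W, f). module k V \<and> small (carrier V) \<and> module k W \<and> small (carrier W) \<and>
              f \<in> linear_maps k V W},
     Dom = (\<lambda>(V, W, f). V),
     Cod = (\<lambda>(V, W, f). W),
     Cmp = (\<lambda>(V', W', g) (V, W, f). (V, W', \<lambda>x \<in> carrier V. g (f x))),
     Idt = (\<lambda>V. (V, V, \<lambda>x \<in> carrier V. x)),
     HAdd = (\<lambda>(V, W, f) (V', W', g). (V, W, \<lambda>x \<in> carrier V. f x \<oplus>\<^bsub>W\<^esub> g x)),
     HZero = (\<lambda>V W. (V, W, \<lambda>x \<in> carrier V. \<zero>\<^bsub>W\<^esub>)),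
     HScale = (\<lambda>a (V, W, f). (V, W, \<lambda>x \<in> carrier V. a \<odot>\<^bsub>W\<^esub> f x))\<rparr>"

definition unit_space :: "'u ring \<Rightarrow> 'u vs" where
  "unit_space k = \<lparr>carrier = carrier k, monoid.mult = monoid.mult k, one = one k, zero = zero k, add = add k,
     smult = monoid.mult k\<rparr>"

definition hom_functor :: "('u, 'u, 'u) lincat \<Rightarrow> 'u \<Rightarrow> ('u, 'u, 'u vs, 'u vmap) functr" where
  "hom_functor C X = \<lparr>fobj = (\<lambda>Y. hom_space C X Y),
     farr = (\<lambda>g. (hom_space C X (Dom C g), hom_space C X (Cod C g),
                   \<lambda>f \<in> homs C X (Dom C g). Cmp C g f))\<rparr>"


section \<open>Presentable categories and the Kelly tensor product\<close>

definition cocontinuous ::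
  "'u ring \<Rightarrow> ('o, 'a, 'u) lincat \<Rightarrow> ('p, 'b, 'u) lincat \<Rightarrow> ('o, 'a, 'p, 'b) functr \<Rightarrow> bool" where
  "cocontinuous k C D F \<longleftrightarrow> linear_functor k C D F \<and>
     preserves_colimits (\<lambda>J :: ('u, 'u) cat. True) C D F"

definition bicocontinuous ::
  "'u ring \<Rightarrow> ('o, 'a, 'u) lincat \<Rightarrow> ('p, 'b, 'u) lincat \<Rightarrow> ('q, 'c, 'u) lincat \<Rightarrow>
   ('o \<times> 'p, 'a \<times> 'b, 'q, 'c) functr \<Rightarrow> bool" where
  "bicocontinuous k C D E F \<longleftrightarrow> is_functor (prod_cat C D) E F \<and>
     (\<forall>X \<in> Obj C. cocontinuous k D E (fix_left C F X)) \<and>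
     (\<forall>Y \<in> Obj D. cocontinuous k C E (fix_right D F Y))"

definition locally_small :: "('u, 'u, 'u) lincat \<Rightarrow> bool" where
  "locally_small C \<longleftrightarrow> (\<forall>X \<in> Obj C. \<forall>Y \<in> Obj C. small (homs C X Y))"

definition cocomplete :: "('u, 'u, 'u) lincat \<Rightarrow> bool" where
  "cocomplete C \<longleftrightarrow> (\<forall>(J :: ('u, 'u) cat) E. small_category J \<and> is_functor J C E \<longrightarrow>
     (\<exists>X \<iota>. is_colimit J C E X \<iota>))"

definition accessible :: "'u ring \<Rightarrow> ('u, 'u, 'u) lincat \<Rightarrow> bool" where
  "accessible k C \<longleftrightarrow>
     (\<exists>r :: 'u rel. Card_order r \<and> cinfinite r \<and> regularCard r \<and> r <o |UNIV :: 'u set| \<and>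
       (\<exists>G. G \<subseteq> Obj C \<and> small G \<and>
         (\<forall>X \<in> G. preserves_colimits (card_filtered r :: ('u, 'u) cat \<Rightarrow> bool) C (Vect k) (hom_functor C X)) \<and>
         (\<forall>X \<in> Obj C. \<exists>(J :: ('u, 'u) cat) E \<iota>. small_category J \<and> card_filtered r J \<and>
            (\<forall>j \<in> Obj J. fobj E j \<in> G) \<and> is_colimit J C E X \<iota>)))"

definition presentable :: "'u ring \<Rightarrow> ('u, 'u, 'u) lincat \<Rightarrow> bool" where
  "presentable k C \<longleftrightarrow> linear_category k C \<and> locally_small C \<and> cocomplete C \<and> accessible k C"

text \<open>
  \<open>t : A \<times> B \<rightarrow> T\<close> exhibits \<open>T\<close> as the tensor product of \<open>A\<close> and \<open>B\<close> in \<open>Pr\<close>: for all \<open>C\<close> in \<open>Pr\<close>,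
  restriction along \<open>t\<close> is an equivalence from cocontinuous functors \<open>T \<rightarrow> C\<close> to functors
  \<open>A \<times> B \<rightarrow> C\<close> that are linear and cocontinuous in each variable. Accordingly, a 1-cell out of a
  (multiple) tensor product is given below as a functor of several variables of this kind.
\<close>

definition kelly_tensor ::
  "'u ring \<Rightarrow> ('u, 'u, 'u) lincat \<Rightarrow> ('u, 'u, 'u) lincat \<Rightarrow>
   ('u, 'u, 'u) lincat \<Rightarrow> ('u \<times> 'u, 'u \<times> 'u, 'u, 'u) functr \<Rightarrow> bool" where
  "kelly_tensor k A B T t \<longleftrightarrow>
     presentable k A \<and> presentable k B \<and> presentable k T \<and> bicocontinuous k A B T t \<and>
     (\<forall>C :: ('u, 'u, 'u) lincat. presentable k C \<longrightarrow>
        (\<forall>G. bicocontinuous k A B C G \<longrightarrow>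
           (\<exists>H \<beta>. cocontinuous k T C H \<and> nat_iso (prod_cat A B) C (comp_fun H t) G \<beta>)) \<and>
        (\<forall>H H' \<beta>. cocontinuous k T C H \<and> cocontinuous k T C H' \<and>
           nat_trans (prod_cat A B) C (comp_fun H t) (comp_fun H' t) \<beta> \<longrightarrow>
           (\<exists>\<alpha>. nat_trans T C H H' \<alpha> \<and> (\<forall>p \<in> Obj (prod_cat A B). \<alpha> (fobj t p) = \<beta> p) \<and>
              (\<forall>\<alpha>'. nat_trans T C H H' \<alpha>' \<and> (\<forall>p \<in> Obj (prod_cat A B). \<alpha>' (fobj t p) = \<beta> p) \<longrightarrow>
                 (\<forall>X \<in> Obj T. \<alpha>' X = \<alpha> X)))))"


section \<open>Compactness\<close>

definition compact_obj :: "'u ring \<Rightarrow> ('u, 'u, 'u) lincat \<Rightarrow> 'u \<Rightarrow> bool" where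
  "compact_obj k C X \<longleftrightarrow> X \<in> Obj C \<and> preserves_colimits (filtered :: ('u, 'u) cat \<Rightarrow> bool) C (Vect k) (hom_functor C X)"

definition compact_projective :: "'u ring \<Rightarrow> ('u, 'u, 'u) lincat \<Rightarrow> 'u \<Rightarrow> bool" where
  "compact_projective k C X \<longleftrightarrow> X \<in> Obj C \<and>
     preserves_colimits (\<lambda>J :: ('u, 'u) cat. True) C (Vect k) (hom_functor C X)"

definition enough_compact_projectives :: "'u ring \<Rightarrow> ('u, 'u, 'u) lincat \<Rightarrow> bool" where
  "enough_compact_projectives k C \<longleftrightarrow>
     (\<forall>X \<in> Obj C. \<exists>(J :: ('u, 'u) cat) E \<iota>. small_category J \<and>
        (\<forall>j \<in> Obj J. compact_projective k C (fobj E j)) \<and> is_colimit J C E X \<iota>)"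


section \<open>Framed \<open>E\<^sub>2\<close>-algebras\<close>

record 'u balanced_struct =
  tens :: "('u \<times> 'u, 'u \<times> 'u, 'u, 'u) functr"
  unt :: 'u
  assoc :: "'u \<Rightarrow> 'u \<Rightarrow> 'u \<Rightarrow> 'u"   \<comment> \<open>\<open>(X \<otimes> Y) \<otimes> Z \<rightarrow> X \<otimes> (Y \<otimes> Z)\<close>\<close>
  lunit :: "'u \<Rightarrow> 'u"   \<comment> \<open>\<open>I \<otimes> X \<rightarrow> X\<close>\<close>
  runit :: "'u \<Rightarrow> 'u"   \<comment> \<open>\<open>X \<otimes> I \<rightarrow> X\<close>\<close>
  braid :: "'u \<Rightarrow> 'u \<Rightarrow> 'u"
  twist :: "'u \<Rightarrow> 'u"

locale balanced_data =
  fixes A :: "('u, 'u, 'u) lincat" and M :: "'u balanced_struct"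
begin

abbreviation composite (infixr \<open>\<diamondop>\<close> 60) where "g \<diamondop> f \<equiv> Cmp A g f"
abbreviation tensor_obj (infixr \<open>\<star>\<close> 75) where "X \<star> Y \<equiv> fobj (tens M) (X, Y)"
abbreviation tensor_arr (infixr \<open>\<bullet>\<close> 75) where "f \<bullet> g \<equiv> farr (tens M) (f, g)"
abbreviation idt (\<open>\<iota>\<close>) where "\<iota> \<equiv> Idt A"
abbreviation inv_iso where "inv_iso f \<equiv> inv_arr A f"
abbreviation unit_obj (\<open>I\<close>) where "I \<equiv> unt M"
abbreviation \<a> where "\<a> \<equiv> assoc M"
abbreviation \<l> where "\<l> \<equiv> lunit M"
abbreviation \<r> where "\<r> \<equiv> runit M"
abbreviation \<c> where "\<c> \<equiv> braid M"
abbreviation \<theta> where "\<theta> \<equiv> twist M"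

definition monoidal_laws :: bool where
  "monoidal_laws \<longleftrightarrow> I \<in> Obj A \<and>
     (\<forall>X \<in> Obj A. \<forall>Y \<in> Obj A. \<forall>Z \<in> Obj A.
        \<a> X Y Z \<in> homs A ((X \<star> Y) \<star> Z) (X \<star> (Y \<star> Z)) \<and> is_iso A (\<a> X Y Z)) \<and>
     (\<forall>X \<in> Obj A. \<l> X \<in> homs A (I \<star> X) X \<and> is_iso A (\<l> X)) \<and>
     (\<forall>X \<in> Obj A. \<r> X \<in> homs A (X \<star> I) X \<and> is_iso A (\<r> X)) \<and>
     (\<forall>X \<in> Obj A. \<forall>X' \<in> Obj A. \<forall>Y \<in> Obj A. \<forall>Y' \<in> Obj A. \<forall>Z \<in> Obj A. \<forall>Z' \<in> Obj A.
        \<forall>f \<in> homs A X X'. \<forall>g \<in> homs A Y Y'. \<forall>h \<in> homs A Z Z'.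
        \<a> X' Y' Z' \<diamondop> (f \<bullet> g) \<bullet> h = f \<bullet> (g \<bullet> h) \<diamondop> \<a> X Y Z) \<and>
     (\<forall>X \<in> Obj A. \<forall>Y \<in> Obj A. \<forall>f \<in> homs A X Y.
        \<l> Y \<diamondop> \<iota> I \<bullet> f = f \<diamondop> \<l> X \<and> \<r> Y \<diamondop> f \<bullet> \<iota> I = f \<diamondop> \<r> X) \<and>
     (\<forall>W \<in> Obj A. \<forall>X \<in> Obj A. \<forall>Y \<in> Obj A. \<forall>Z \<in> Obj A.
        \<a> W X (Y \<star> Z) \<diamondop> \<a> (W \<star> X) Y Z =
          \<iota> W \<bullet> \<a> X Y Z \<diamondop> \<a> W (X \<star> Y) Z \<diamondop> \<a> W X Y \<bullet> \<iota> Z) \<and>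
     (\<forall>X \<in> Obj A. \<forall>Y \<in> Obj A. \<iota> X \<bullet> \<l> Y \<diamondop> \<a> X I Y = \<r> X \<bullet> \<iota> Y)"

definition braiding_laws :: bool where
  "braiding_laws \<longleftrightarrow>
     (\<forall>X \<in> Obj A. \<forall>Y \<in> Obj A. \<c> X Y \<in> homs A (X \<star> Y) (Y \<star> X) \<and> is_iso A (\<c> X Y)) \<and>
     (\<forall>X \<in> Obj A. \<forall>X' \<in> Obj A. \<forall>Y \<in> Obj A. \<forall>Y' \<in> Obj A. \<forall>f \<in> homs A X X'. \<forall>g \<in> homs A Y Y'.
        \<c> X' Y' \<diamondop> f \<bullet> g = g \<bullet> f \<diamondop> \<c> X Y) \<and>
     (\<forall>X \<in> Obj A. \<forall>Y \<in> Obj A. \<forall>Z \<in> Obj A.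
        \<a> Y Z X \<diamondop> \<c> X (Y \<star> Z) \<diamondop> \<a> X Y Z =
          \<iota> Y \<bullet> \<c> X Z \<diamondop> \<a> Y X Z \<diamondop> \<c> X Y \<bullet> \<iota> Z \<and>
        inv_iso (\<a> Z X Y) \<diamondop> \<c> (X \<star> Y) Z \<diamondop> inv_iso (\<a> X Y Z) =
          \<c> X Z \<bullet> \<iota> Y \<diamondop> inv_iso (\<a> X Z Y) \<diamondop> \<iota> X \<bullet> \<c> Y Z)"

definition balancing_laws :: bool where
  "balancing_laws \<longleftrightarrow>
     (\<forall>X \<in> Obj A. \<theta> X \<in> homs A X X \<and> is_iso A (\<theta> X)) \<and>
     (\<forall>X \<in> Obj A. \<forall>Y \<in> Obj A. \<forall>f \<in> homs A X Y. \<theta> Y \<diamondop> f = f \<diamondop> \<theta> X) \<and>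
     (\<forall>X \<in> Obj A. \<forall>Y \<in> Obj A. \<theta> (X \<star> Y) = \<c> Y X \<diamondop> \<c> X Y \<diamondop> \<theta> X \<bullet> \<theta> Y) \<and>
     \<theta> I = \<iota> I"

definition framed_E2_algebra :: "'u ring \<Rightarrow> bool" where
  "framed_E2_algebra k \<longleftrightarrow> presentable k A \<and> bicocontinuous k A A A (tens M) \<and>
     monoidal_laws \<and> braiding_laws \<and> balancing_laws"

text \<open>\<open>left_dual X X' e d\<close>: \<open>X'\<close> is a left dual of \<open>X\<close> with \<open>e : X' \<otimes> X \<rightarrow> I\<close> and \<open>d : I \<rightarrow> X \<otimes> X'\<close>;
  equivalently, \<open>X\<close> is a right dual of \<open>X'\<close>.\<close>

definition left_dual :: "'u \<Rightarrow> 'u \<Rightarrow> 'u \<Rightarrow> 'u \<Rightarrow> bool" where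
  "left_dual X X' e d \<longleftrightarrow> X \<in> Obj A \<and> X' \<in> Obj A \<and>
     e \<in> homs A (X' \<star> X) I \<and> d \<in> homs A I (X \<star> X') \<and>
     \<r> X \<diamondop> \<iota> X \<bullet> e \<diamondop> \<a> X X' X \<diamondop> d \<bullet> \<iota> X \<diamondop> inv_iso (\<l> X) = \<iota> X \<and>
     \<l> X' \<diamondop> e \<bullet> \<iota> X' \<diamondop> inv_iso (\<a> X' X X') \<diamondop> \<iota> X' \<bullet> d \<diamondop> inv_iso (\<r> X') = \<iota> X'"

definition dualizable :: "'u \<Rightarrow> bool" where
  "dualizable X \<longleftrightarrow> (\<exists>X' e d. left_dual X X' e d) \<and> (\<exists>X' e d. left_dual X' X e d)"

text \<open>The dual \<open>f\<^sup>\<or> : Y' \<rightarrow> X'\<close> of \<open>f : X \<rightarrow> Y\<close>, for left duals \<open>X'\<close> with coevaluation \<open>d\<close> of \<open>X\<close> and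
  \<open>Y'\<close> with evaluation \<open>e\<close> of \<open>Y\<close>\<close>

definition dual_arr :: "'u \<Rightarrow> 'u \<Rightarrow> 'u \<Rightarrow> 'u \<Rightarrow> 'u \<Rightarrow> 'u \<Rightarrow> 'u" where
  "dual_arr X' d Y Y' e f =
     \<l> X' \<diamondop> e \<bullet> \<iota> X' \<diamondop> inv_iso (\<a> Y' Y X') \<diamondop> \<iota> Y' \<bullet> (f \<bullet> \<iota> X') \<diamondop> \<iota> Y' \<bullet> d \<diamondop> inv_iso (\<r> Y')"

definition compact_rigid :: "'u ring \<Rightarrow> bool" where
  "compact_rigid k \<longleftrightarrow> (\<forall>X. compact_obj k A X \<longrightarrow> dualizable X)"

definition balancing_compatible_with_duals :: bool where
  "balancing_compatible_with_duals \<longleftrightarrow>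
     (\<forall>X X' e d. dualizable X \<and> left_dual X X' e d \<longrightarrow> dual_arr X' d X X' e (\<theta> X) = \<theta> X')"

end


section \<open>Cyclic framed \<open>E\<^sub>2\<close>-algebras\<close>

text \<open>The unit equivalence \<open>Vect \<boxtimes> A \<simeq> A\<close>\<close>

definition left_unitor ::
  "'u ring \<Rightarrow> ('u, 'u, 'u) lincat \<Rightarrow> ('u vs \<times> 'u, 'u vmap \<times> 'u, 'u, 'u) functr \<Rightarrow> bool" where
  "left_unitor k A U \<longleftrightarrow> bicocontinuous k (Vect k) A A U \<and>
     (\<exists>\<beta>. nat_iso A A (fix_left (Vect k) U (unit_space k)) id_fun \<beta>)"

text \<open>
  The snake relations for a pairing \<open>\<kappa>\<close> and a copairing \<open>\<Delta> : Vect \<rightarrow> A \<boxtimes> A\<close>, where \<open>T\<close> is \<open>A \<boxtimes> A\<close>.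
  In the first one, \<open>F\<close> is \<open>A \<boxtimes> (A \<boxtimes> A) \<simeq> (A \<boxtimes> A) \<boxtimes> A \<rightarrow> Vect \<boxtimes> A \<simeq> A\<close>, the middle arrow being
  \<open>\<kappa> \<boxtimes> id\<close>; by the universal property it is determined up to isomorphism by
  \<open>F(X, Y \<boxtimes> Z) \<cong> \<kappa>(X, Y) \<otimes> Z\<close>. Precomposing with \<open>A \<simeq> A \<boxtimes> Vect \<rightarrow> A \<boxtimes> (A \<boxtimes> A)\<close>, with the second
  arrow \<open>id \<boxtimes> \<Delta>\<close>, gives \<open>F(-, \<Delta>(k))\<close>. In the second one, \<open>F\<close> comes from \<open>id \<boxtimes> \<kappa>\<close>, with
  \<open>F(X \<boxtimes> Y, Z) \<cong> X \<otimes> \<kappa>(Y, Z)\<close>; the unit equivalence \<open>A \<boxtimes> Vect \<simeq> A\<close> is the left unitor after the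
  symmetry.
\<close>

definition snake_left ::
  "'u ring \<Rightarrow> ('u, 'u, 'u) lincat \<Rightarrow> ('u, 'u, 'u) lincat \<Rightarrow> ('u \<times> 'u, 'u \<times> 'u, 'u, 'u) functr \<Rightarrow>
   ('u \<times> 'u, 'u \<times> 'u, 'u vs, 'u vmap) functr \<Rightarrow> ('u vs, 'u vmap, 'u, 'u) functr \<Rightarrow> bool" where
  "snake_left k A T t \<kappa> \<Delta> \<longleftrightarrow>
     (\<exists>U F. left_unitor k A U \<and> bicocontinuous k A T A F \<and>
        (\<exists>\<beta>. nat_iso (prod_cat A (prod_cat A A)) A
               (comp_fun F (prod_fun id_fun t))
               (comp_fun U (comp_fun (prod_fun \<kappa> id_fun) rebracket)) \<beta>) \<and>
        (\<exists>\<beta>. nat_iso A A (fix_right T F (fobj \<Delta> (unit_space k))) id_fun \<beta>))"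

definition snake_right ::
  "'u ring \<Rightarrow> ('u, 'u, 'u) lincat \<Rightarrow> ('u, 'u, 'u) lincat \<Rightarrow> ('u \<times> 'u, 'u \<times> 'u, 'u, 'u) functr \<Rightarrow>
   ('u \<times> 'u, 'u \<times> 'u, 'u vs, 'u vmap) functr \<Rightarrow> ('u vs, 'u vmap, 'u, 'u) functr \<Rightarrow> bool" where
  "snake_right k A T t \<kappa> \<Delta> \<longleftrightarrow>
     (\<exists>U F. left_unitor k A U \<and> bicocontinuous k T A A F \<and>
        (\<exists>\<beta>. nat_iso (prod_cat A (prod_cat A A)) A
               (comp_fun F (comp_fun (prod_fun t id_fun) rebracket))
               (comp_fun U (comp_fun swap_fun (prod_fun id_fun \<kappa>))) \<beta>) \<and>
        (\<exists>\<beta>. nat_iso A A (fix_left T F (fobj \<Delta> (unit_space k))) id_fun \<beta>))"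

definition nondegenerate ::
  "'u ring \<Rightarrow> ('u, 'u, 'u) lincat \<Rightarrow> ('u, 'u, 'u) lincat \<Rightarrow> ('u \<times> 'u, 'u \<times> 'u, 'u, 'u) functr \<Rightarrow>
   ('u \<times> 'u, 'u \<times> 'u, 'u vs, 'u vmap) functr \<Rightarrow> bool" where
  "nondegenerate k A T t \<kappa> \<longleftrightarrow>
     (\<exists>\<Delta>. cocontinuous k (Vect k) T \<Delta> \<and> snake_left k A T t \<kappa> \<Delta> \<and> snake_right k A T t \<kappa> \<Delta>)"

text \<open>A cyclic framed \<open>E\<^sub>2\<close>-algebra, as a self-dual balanced braided algebra; \<open>\<gamma> (X, Y)\<close> is the
  component \<open>\<kappa>(X, Y) \<rightarrow> \<kappa>(I, X \<otimes> Y)\<close>.\<close>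

definition cyclic_framed_E2_algebra ::
  "'u ring \<Rightarrow> ('u, 'u, 'u) lincat \<Rightarrow> 'u balanced_struct \<Rightarrow>
   ('u, 'u, 'u) lincat \<Rightarrow> ('u \<times> 'u, 'u \<times> 'u, 'u, 'u) functr \<Rightarrow>
   ('u \<times> 'u, 'u \<times> 'u, 'u vs, 'u vmap) functr \<Rightarrow> ('u \<times> 'u \<Rightarrow> 'u vmap) \<Rightarrow> bool" where
  "cyclic_framed_E2_algebra k A M T t \<kappa> \<gamma> \<longleftrightarrow>
     balanced_data.framed_E2_algebra A M k \<and>
     bicocontinuous k A A (Vect k) \<kappa> \<and>
     nondegenerate k A T t \<kappa> \<and>
     nat_iso (prod_cat A A) (Vect k) \<kappa> (comp_fun (fix_left A \<kappa> (unt M)) (tens M)) \<gamma> \<and>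
     (\<forall>Y \<in> Obj A. \<gamma> (unt M, Y) = farr \<kappa> (Idt A (unt M), inv_arr A (lunit M Y))) \<and>
     (\<forall>X \<in> Obj A. \<forall>Y \<in> Obj A. farr \<kappa> (twist M X, Idt A Y) = farr \<kappa> (Idt A X, twist M Y))"

end

theory Submission
  imports Defs
begin

text \<open>
  By rigidity the class of compact projective objects is closed under tensor products and duals, and
  it has a small skeleton. The functor \<open>Hom(I, -)\<close> on compact projective objects extends to a
  cocontinuous functor \<open>\<phi> : A \<rightarrow> Vect\<close>, the coend of \<open>Hom(P, -) \<otimes> Hom(I, P)\<close>, and the pairing is
  \<open>\<kappa>(X, Y) = \<phi>(X \<otimes> Y)\<close>; the isomorphism \<open>\<gamma>\<close> comes from the unit isomorphism.

  For compact projective \<open>P\<close> and \<open>Q\<close>, an element of \<open>\<kappa>(P, Q) \<cong> Hom(I, P \<otimes> Q)\<close> is the mate of some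
  \<open>h : P\<^sup>\<or> \<rightarrow> Q\<close>. Compatibility of the balancing with duals moves \<open>\<theta>\<^sub>P\<close> to \<open>P\<^sup>\<or>\<close>, and naturality moves
  it along \<open>h\<close> to \<open>\<theta>\<^sub>Q\<close>. Both sides of (PB) are thus equal on compact projective objects, and by
  cocontinuity everywhere.

  The copairing is the coend of \<open>P\<^sup>\<or> \<boxtimes> P\<close>, here the colimit \<open>D\<close> over all pairs of mates
  \<open>f : R\<^sub>i \<rightarrow> R\<^sub>j\<close>, \<open>f' : L\<^sub>j \<rightarrow> L\<^sub>i\<close>, for a small family of dual pairs in which every compact projective object
  occurs on either side. This makes the right snake relation an instance of the left one, for the reversed
  tensor product, which exchanges \<open>L\<^sub>i\<close> and \<open>R\<^sub>i\<close>.
\<close>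

section \<open>Small sets\<close>

text \<open>The functor \<open>Hom(I, -)\<close> itself cannot serve as \<open>\<phi>\<close>: the
  unit is only assumed compact, so only filtered colimits are known to be preserved. Passing through
  compact projective objects repairs this. Every \<open>Hom(P, -)\<close> preserves all colimits,
  hence so does the coend, and on compact projective objects its values are still those of
  \<open>Hom(I, -)\<close>. Compactness of the unit enters through duals: it makes the duals of
  compact objects compact, so that rigidity can be applied to them a second time. The tensor product
  \<open>T\<close> is known only through its universal property. The copairing object is therefore a
  colimit formed inside \<open>T\<close>, the functors in the snake relations must be produced by
  extension along \<open>t\<close>, and their cocontinuity in the remaining variable requires an
  argument of its own.\<close>

lemma regular_universe_stable:
  assumes "regular_universe TYPE('u)"
  shows "stable |UNIV :: 'u set|"
  using assms unfolding regular_universe_def cinfinite_def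
  by (intro regularCard_stable) (auto simp: card_of_Card_order)

lemma infinite_universe:
  assumes "regular_universe TYPE('u)"
  shows "infinite (UNIV :: 'u set)"
  using assms by (simp add: regular_universe_def cinfinite_def Field_card_of)

lemma card_less_image:
  assumes "|S| <o r" shows "|f ` S| <o r"
  using assms card_of_image ordLeq_ordLess_trans by blast

lemma card_less_subset:
  assumes "|S| <o r" "S' \<subseteq> S" shows "|S'| <o r"
  using assms card_of_mono1 ordLeq_ordLess_trans by blast

lemma card_less_finite:
  assumes "regular_universe TYPE('u)" "finite S"
  shows "|S| <o |UNIV :: 'u set|"
  by (rule finite_ordLess_infinite)
    (use assms infinite_universe[OF assms(1)] card_of_Well_order in \<open>simp_all add: Field_card_of\<close>)

lemma card_less_Plus:
  assumes "regular_universe TYPE('u)" "|S| <o |UNIV :: 'u set|" "|S'| <o |UNIV :: 'u set|"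
  shows "|Sum_Type.Plus S S'| <o |UNIV :: 'u set|"
  using card_of_Plus_ordLess_infinite[OF infinite_universe[OF assms(1)] assms(2,3)] .

text \<open>This is where regularity of the universe is used; products and unions of small families
  are reduced to it.\<close>

lemma card_less_Sigma:
  fixes S :: "'s set" and F :: "'s \<Rightarrow> 'b set"
  assumes u: "regular_universe TYPE('u)" and S: "|S| <o |UNIV :: 'u set|"
    and F: "\<And>s. s \<in> S \<Longrightarrow> |F s| <o |UNIV :: 'u set|"
  shows "|Sigma S F| <o |UNIV :: 'u set|"
  using u S F
  by (intro stable_elim[OF regular_universe_stable]) auto

lemma card_less_Times:
  assumes "regular_universe TYPE('u)" "|S| <o |UNIV :: 'u set|" "|S'| <o |UNIV :: 'u set|"
  shows "|S \<times> S'| <o |UNIV :: 'u set|"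
  using assms by (intro card_less_Sigma)

lemma card_less_UNION:
  fixes S :: "'s set" and F :: "'s \<Rightarrow> 'b set"
  assumes "regular_universe TYPE('u)" "|S| <o |UNIV :: 'u set|"
    "\<And>s. s \<in> S \<Longrightarrow> |F s| <o |UNIV :: 'u set|"
  shows "|\<Union>s\<in>S. F s| <o |UNIV :: 'u set|"
proof -
  have "(\<Union>s\<in>S. F s) = snd ` Sigma S F" by force
  then show ?thesis using card_less_image[OF card_less_Sigma[OF assms]] by simp
qed

text \<open>Words of each fixed length form a small set by induction, but the union over all lengths
  is small only if the natural numbers are. Hence the universe has to be uncountable, which is later
  deduced from accessibility.\<close>

lemma card_less_lists:
  fixes S :: "'s set"
  assumes u: "regular_universe TYPE('u)" and S: "|S| <o |UNIV :: 'u set|"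
    and N: "natLeq <o |UNIV :: 'u set|"
  shows "|lists S| <o |UNIV :: 'u set|"
proof -
  have n: "|{xs \<in> lists S. length xs = n}| <o |UNIV :: 'u set|" for n
  proof (induction n)
    case 0
    have "finite {xs \<in> lists S. length xs = 0}" by (rule finite_subset[of _ "{[]}"]) auto
    then show ?case by (rule card_less_finite[OF u])
  next
    case (Suc n)
    have "{xs \<in> lists S. length xs = Suc n} \<subseteq> (\<lambda>(x, xs). x # xs) ` (S \<times> {xs \<in> lists S. length xs = n})"
      by (auto simp: length_Suc_conv image_iff)
    then show ?case using card_less_image[OF card_less_Times[OF u S Suc]] card_less_subset by blast
  qed
  have "|UNIV :: nat set| <o |UNIV :: 'u set|"
    using N card_of_nat ordIso_ordLess_trans by blast
  from card_less_UNION[OF u this n]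
  have "|\<Union>m. {xs \<in> lists S. length xs = m}| <o |UNIV :: 'u set|" by simp
  then show ?thesis by (rule card_less_subset) auto
qed

section \<open>Categories\<close>

lemma in_homs_iff: "f \<in> homs C X Y \<longleftrightarrow> f \<in> Arr C \<and> Dom C f = X \<and> Cod C f = Y"
  by (auto simp: homs_def)

lemma homsI: "f \<in> Arr C \<Longrightarrow> Dom C f = X \<Longrightarrow> Cod C f = Y \<Longrightarrow> f \<in> homs C X Y"
  by (simp add: in_homs_iff)

lemma homsD:
  assumes "f \<in> homs C X Y"
  shows "f \<in> Arr C" "Dom C f = X" "Cod C f = Y"
  using assms by (auto simp: in_homs_iff)

context
  fixes C :: "('o, 'a, 'z) cat_scheme"
  assumes C: "category C"
begin

lemma Obj_Dom [simp]: "f \<in> Arr C \<Longrightarrow> Dom C f \<in> Obj C"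
  using C by (auto simp: category_def)

lemma Obj_Cod [simp]: "f \<in> Arr C \<Longrightarrow> Cod C f \<in> Obj C"
  using C by (auto simp: category_def)

lemma Idt_simps [simp]:
  assumes "X \<in> Obj C"
  shows "Idt C X \<in> Arr C" "Dom C (Idt C X) = X" "Cod C (Idt C X) = X"
  using C assms by (auto simp: category_def in_homs_iff)

lemma Cmp_simps [simp]:
  assumes "f \<in> Arr C" "g \<in> Arr C" "Cod C f = Dom C g"
  shows "Cmp C g f \<in> Arr C" "Dom C (Cmp C g f) = Dom C f" "Cod C (Cmp C g f) = Cod C g"
proof -
  have "\<forall>X \<in> Obj C. \<forall>Y \<in> Obj C. \<forall>Z \<in> Obj C. \<forall>f \<in> homs C X Y. \<forall>g \<in> homs C Y Z. Cmp C g f \<in> homs C X Z"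
    using C unfolding category_def by (elim conjE)
  moreover have "Dom C f \<in> Obj C" "Dom C g \<in> Obj C" "Cod C g \<in> Obj C"
    using assms C by (auto simp: category_def)
  ultimately have "Cmp C g f \<in> homs C (Dom C f) (Cod C g)"
    by (metis assms homsI)
  then show "Cmp C g f \<in> Arr C" "Dom C (Cmp C g f) = Dom C f" "Cod C (Cmp C g f) = Cod C g"
    by (auto simp: in_homs_iff)
qed

lemma Cmp_Idt_right [simp]: "f \<in> Arr C \<Longrightarrow> Dom C f = X \<Longrightarrow> Cmp C f (Idt C X) = f"
  using C unfolding category_def by (metis (mono_tags, lifting) homsI)

lemma Cmp_Idt_left [simp]: "f \<in> Arr C \<Longrightarrow> Cod C f = X \<Longrightarrow> Cmp C (Idt C X) f = f"
  using C unfolding category_def by (metis (mono_tags, lifting) homsI)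

text \<open>Oriented so that simplification brackets composites to the right. The cancellation rules
  \<open>Cmp_cancel\<close> and \<open>inv_arr_cancel\<close>, and later \<open>Cmp_rewrite\<close>,
  are stated for this normal form, with a trailing factor \<open>h\<close>.\<close>

lemma Cmp_assoc [simp]:
  assumes "f \<in> Arr C" "g \<in> Arr C" "h \<in> Arr C" "Cod C f = Dom C g" "Cod C g = Dom C h"
  shows "Cmp C (Cmp C h g) f = Cmp C h (Cmp C g f)"
proof -
  have "f \<in> homs C (Dom C f) (Dom C g)" "g \<in> homs C (Dom C g) (Dom C h)" "h \<in> homs C (Dom C h) (Cod C h)"
    using assms by (auto simp: in_homs_iff)
  moreover have "Dom C f \<in> Obj C" "Dom C g \<in> Obj C" "Dom C h \<in> Obj C" "Cod C h \<in> Obj C"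
    using assms C by (auto simp: category_def)
  moreover have "\<forall>W \<in> Obj C. \<forall>X \<in> Obj C. \<forall>Y \<in> Obj C. \<forall>Z \<in> Obj C.
      \<forall>f \<in> homs C W X. \<forall>g \<in> homs C X Y. \<forall>h \<in> homs C Y Z. Cmp C h (Cmp C g f) = Cmp C (Cmp C h g) f"
    using C unfolding category_def by (elim conjE)
  ultimately show ?thesis by metis
qed

lemma Cmp_in_homs: "f \<in> homs C X Y \<Longrightarrow> g \<in> homs C Y Z \<Longrightarrow> Cmp C g f \<in> homs C X Z"
  by (simp add: in_homs_iff)

lemma Cmp_cancel:
  assumes "Cmp C g f = Idt C X" "f \<in> Arr C" "g \<in> Arr C" "Cod C f = Dom C g"
    "h \<in> Arr C" "Cod C h = Dom C f" "Dom C f = X"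
  shows "Cmp C g (Cmp C f h) = h"
  using assms by (metis Cmp_Idt_left Cmp_assoc)

lemma inverse_arrows_unique:
  assumes "inverse_arrows C f g" "inverse_arrows C f g'"
  shows "g = g'"
proof -
  have "Cmp C (Cmp C g f) g' = Cmp C g (Cmp C f g')"
    using assms C by (intro Cmp_assoc) (auto simp: inverse_arrows_def in_homs_iff)
  then show ?thesis
    using assms C by (auto simp: inverse_arrows_def in_homs_iff)
qed

lemma inv_arrI: "inverse_arrows C f g \<Longrightarrow> inv_arr C f = g"
  unfolding inv_arr_def using inverse_arrows_unique by blast

lemma inverse_arrowsI:
  assumes "f \<in> homs C X Y" "g \<in> homs C Y X" "Cmp C g f = Idt C X" "Cmp C f g = Idt C Y"
  shows "inverse_arrows C f g"
  using assms by (simp add: inverse_arrows_def in_homs_iff)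

lemma is_isoI:
  assumes "f \<in> homs C X Y" "g \<in> homs C Y X" "Cmp C g f = Idt C X" "Cmp C f g = Idt C Y"
  shows "is_iso C f"
  using inverse_arrowsI[OF assms] by (auto simp: is_iso_def)

lemma inverse_arrows_inv_arr: "is_iso C f \<Longrightarrow> inverse_arrows C f (inv_arr C f)"
  using inv_arrI by (metis is_iso_def)

lemma inv_arr_simps [simp]:
  assumes "is_iso C f"
  shows "inv_arr C f \<in> Arr C" "Dom C (inv_arr C f) = Cod C f" "Cod C (inv_arr C f) = Dom C f"
    "Cmp C (inv_arr C f) f = Idt C (Dom C f)" "Cmp C f (inv_arr C f) = Idt C (Cod C f)"
  using inverse_arrows_inv_arr[OF assms] by (auto simp: inverse_arrows_def in_homs_iff)

lemma is_iso_Arr: "is_iso C f \<Longrightarrow> f \<in> Arr C"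
  by (auto simp: is_iso_def inverse_arrows_def)

lemma inv_arr_cancel [simp]:
  assumes "is_iso C f" "h \<in> Arr C"
  shows "Cod C h = Dom C f \<Longrightarrow> Cmp C (inv_arr C f) (Cmp C f h) = h"
    "Cod C h = Cod C f \<Longrightarrow> Cmp C f (Cmp C (inv_arr C f) h) = h"
proof -
  have f: "f \<in> Arr C" using is_iso_Arr assms by blast
  show "Cod C h = Dom C f \<Longrightarrow> Cmp C (inv_arr C f) (Cmp C f h) = h"
    using Cmp_cancel[OF inv_arr_simps(4)[OF assms(1)]] f assms by simp
  show "Cod C h = Cod C f \<Longrightarrow> Cmp C f (Cmp C (inv_arr C f) h) = h"
    using Cmp_cancel[OF inv_arr_simps(5)[OF assms(1)]] f assms by simp
qed

lemma is_iso_inv_arr [simp]: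
  assumes "is_iso C f" shows "is_iso C (inv_arr C f)" "inv_arr C (inv_arr C f) = f"
proof -
  have "inverse_arrows C (inv_arr C f) f"
    using assms is_iso_Arr[OF assms] by (simp add: inverse_arrows_def in_homs_iff)
  then show "is_iso C (inv_arr C f)" "inv_arr C (inv_arr C f) = f"
    using inv_arrI by (auto simp: is_iso_def)
qed

lemma is_iso_Idt [simp]: "X \<in> Obj C \<Longrightarrow> is_iso C (Idt C X)"
  by (rule is_isoI[of _ X X "Idt C X"]) (auto simp: in_homs_iff)

lemma is_iso_Cmp:
  assumes "is_iso C f" "is_iso C g" "Cod C f = Dom C g"
  shows "is_iso C (Cmp C g f)"
  by (rule is_isoI[of _ "Dom C f" "Cod C g" "Cmp C (inv_arr C f) (inv_arr C g)"])
    (use assms is_iso_Arr[OF assms(1)] is_iso_Arr[OF assms(2)] in \<open>auto simp: in_homs_iff\<close>)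

lemma iso_mono:
  assumes "is_iso C g" "Cmp C g f = Cmp C g f'" "f \<in> Arr C" "f' \<in> Arr C" "Cod C f = Dom C g" "Cod C f' = Dom C g"
  shows "f = f'"
  using assms by (metis inv_arr_cancel(1))

lemma iso_epi:
  assumes g: "is_iso C g" and e: "Cmp C f g = Cmp C f' g"
    and f: "f \<in> Arr C" "f' \<in> Arr C" "Dom C f = Cod C g" "Dom C f' = Cod C g"
  shows "f = f'"
proof -
  have "Cmp C (Cmp C f g) (inv_arr C g) = Cmp C (Cmp C f' g) (inv_arr C g)" using e by simp
  then show ?thesis using is_iso_Arr[OF g] f g by simp
qed

end

section \<open>Functors, natural transformations and product categories\<close>

lemma is_functor_category: "is_functor C D F \<Longrightarrow> category C" "is_functor C D F \<Longrightarrow> category D"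
  by (auto simp: is_functor_def)

context
  fixes C :: "('o, 'a, 'y) cat_scheme" and D :: "('p, 'b, 'z) cat_scheme" and F
  assumes F: "is_functor C D F"
begin

lemma functor_Obj [simp]: "X \<in> Obj C \<Longrightarrow> fobj F X \<in> Obj D"
  using F by (auto simp: is_functor_def)

lemma functor_arr [simp]:
  assumes "f \<in> Arr C"
  shows "farr F f \<in> Arr D" "Dom D (farr F f) = fobj F (Dom C f)" "Cod D (farr F f) = fobj F (Cod C f)"
proof -
  have "Dom C f \<in> Obj C" "Cod C f \<in> Obj C" "f \<in> homs C (Dom C f) (Cod C f)"
    using is_functor_category(1)[OF F] assms by (auto simp: in_homs_iff)
  then have "farr F f \<in> homs D (fobj F (Dom C f)) (fobj F (Cod C f))"
    using F unfolding is_functor_def by blast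
  then show "farr F f \<in> Arr D" "Dom D (farr F f) = fobj F (Dom C f)" "Cod D (farr F f) = fobj F (Cod C f)"
    by (auto simp: in_homs_iff)
qed

lemma functor_Idt [simp]: "X \<in> Obj C \<Longrightarrow> farr F (Idt C X) = Idt D (fobj F X)"
  using F by (auto simp: is_functor_def)

lemma functor_Cmp:
  assumes "f \<in> Arr C" "g \<in> Arr C" "Cod C f = Dom C g"
  shows "farr F (Cmp C g f) = Cmp D (farr F g) (farr F f)"
proof -
  have C: "category C" using F by (rule is_functor_category)
  have "f \<in> homs C (Dom C f) (Dom C g)" "g \<in> homs C (Dom C g) (Cod C g)" using assms by (auto simp: in_homs_iff)
  moreover have "Dom C f \<in> Obj C" "Dom C g \<in> Obj C" "Cod C g \<in> Obj C" using assms C by auto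
  ultimately show ?thesis using F unfolding is_functor_def by blast
qed

lemma functor_homs: "f \<in> homs C X Y \<Longrightarrow> farr F f \<in> homs D (fobj F X) (fobj F Y)"
  by (simp add: in_homs_iff)

lemma functor_is_iso:
  assumes "is_iso C f"
  shows "is_iso D (farr F f)" "inv_arr D (farr F f) = farr F (inv_arr C f)"
proof -
  have C: "category C" and D: "category D" using F by (auto dest: is_functor_category)
  have f: "f \<in> Arr C" using is_iso_Arr[OF C assms] .
  have "inverse_arrows D (farr F f) (farr F (inv_arr C f))"
    using f assms C by (auto simp: inverse_arrows_def in_homs_iff functor_Cmp[symmetric])
  then show "is_iso D (farr F f)" "inv_arr D (farr F f) = farr F (inv_arr C f)"
    using inv_arrI[OF D] by (auto simp: is_iso_def)
qed

end

lemma is_functorI: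
  assumes "category C" "category D" "\<And>X. X \<in> Obj C \<Longrightarrow> fobj F X \<in> Obj D"
    "\<And>f. f \<in> Arr C \<Longrightarrow> farr F f \<in> homs D (fobj F (Dom C f)) (fobj F (Cod C f))"
    "\<And>X. X \<in> Obj C \<Longrightarrow> farr F (Idt C X) = Idt D (fobj F X)"
    "\<And>f g. f \<in> Arr C \<Longrightarrow> g \<in> Arr C \<Longrightarrow> Cod C f = Dom C g \<Longrightarrow> farr F (Cmp C g f) = Cmp D (farr F g) (farr F f)"
  shows "is_functor C D F"
  using assms unfolding is_functor_def by (auto simp: in_homs_iff)

lemma nat_transI:
  assumes "is_functor C D F" "is_functor C D G"
    "\<And>X. X \<in> Obj C \<Longrightarrow> \<tau> X \<in> homs D (fobj F X) (fobj G X)"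
    "\<And>f. f \<in> Arr C \<Longrightarrow> Cmp D (\<tau> (Cod C f)) (farr F f) = Cmp D (farr G f) (\<tau> (Dom C f))"
  shows "nat_trans C D F G \<tau>"
  using assms unfolding nat_trans_def by (auto simp: in_homs_iff)

lemma nat_trans_functor:
  assumes "nat_trans C D F G \<tau>" shows "is_functor C D F" "is_functor C D G"
  using assms by (auto simp: nat_trans_def)

lemma nat_trans_simps:
  assumes "nat_trans C D F G \<tau>" "X \<in> Obj C"
  shows "\<tau> X \<in> Arr D" "Dom D (\<tau> X) = fobj F X" "Cod D (\<tau> X) = fobj G X"
  using assms by (auto simp: nat_trans_def in_homs_iff)

lemma nat_trans_naturality:
  assumes "nat_trans C D F G \<tau>" "f \<in> Arr C"
  shows "Cmp D (\<tau> (Cod C f)) (farr F f) = Cmp D (farr G f) (\<tau> (Dom C f))"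
proof -
  have "category C" using assms(1) by (auto simp: nat_trans_def dest: is_functor_category)
  then have "Dom C f \<in> Obj C" "Cod C f \<in> Obj C" "f \<in> homs C (Dom C f) (Cod C f)"
    using assms by (auto simp: in_homs_iff)
  then show ?thesis using assms unfolding nat_trans_def by blast
qed

lemma nat_isoD:
  assumes "nat_iso C D F G \<tau>"
  shows "nat_trans C D F G \<tau>" "X \<in> Obj C \<Longrightarrow> is_iso D (\<tau> X)"
  using assms by (auto simp: nat_iso_def)

lemma comp_fun_simps [simp]:
  "fobj (comp_fun G F) X = fobj G (fobj F X)" "farr (comp_fun G F) f = farr G (farr F f)"
  by (auto simp: comp_fun_def)

lemma id_fun_simps [simp]: "fobj id_fun X = X" "farr id_fun f = f"
  by (auto simp: id_fun_def)

lemma fix_left_simps [simp]: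
  "fobj (fix_left C F X) Y = fobj F (X, Y)" "farr (fix_left C F X) g = farr F (Idt C X, g)"
  by (auto simp: fix_left_def)

lemma fix_right_simps [simp]:
  "fobj (fix_right C F Y) X = fobj F (X, Y)" "farr (fix_right C F Y) f = farr F (f, Idt C Y)"
  by (auto simp: fix_right_def)

lemma prod_fun_simps [simp]:
  "fobj (prod_fun F G) (X, Y) = (fobj F X, fobj G Y)" "farr (prod_fun F G) (f, g) = (farr F f, farr G g)"
  by (auto simp: prod_fun_def)

lemma swap_fun_simps [simp]:
  "fobj swap_fun (X, Y) = (Y, X)" "farr swap_fun (f, g) = (g, f)"
  by (auto simp: swap_fun_def)

lemma rebracket_simps [simp]:
  "fobj rebracket (X, Y, Z) = ((X, Y), Z)" "farr rebracket (f, g, h) = ((f, g), h)"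
  by (auto simp: rebracket_def)

lemma prod_cat_simps [simp]:
  "(X, Y) \<in> Obj (prod_cat C D) \<longleftrightarrow> X \<in> Obj C \<and> Y \<in> Obj D"
  "(f, g) \<in> Arr (prod_cat C D) \<longleftrightarrow> f \<in> Arr C \<and> g \<in> Arr D"
  "Dom (prod_cat C D) (f, g) = (Dom C f, Dom D g)"
  "Cod (prod_cat C D) (f, g) = (Cod C f, Cod D g)"
  "Cmp (prod_cat C D) (f, g) (f', g') = (Cmp C f f', Cmp D g g')"
  "Idt (prod_cat C D) (X, Y) = (Idt C X, Idt D Y)"
  by (auto simp: prod_cat_def)

lemma category_prod_cat [simp]:
  assumes "category C" "category D" shows "category (prod_cat C D)"
  using assms unfolding category_def[of "prod_cat C D"]
  by (auto simp: in_homs_iff)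

lemma is_functor_comp_fun:
  assumes F: "is_functor C D F" and G: "is_functor D E G" shows "is_functor C E (comp_fun G F)"
  by (rule is_functorI)
    (use is_functor_category(1)[OF F] is_functor_category(2)[OF G] in
      \<open>auto simp: in_homs_iff functor_Obj[OF F] functor_arr[OF F] functor_Idt[OF F] functor_Cmp[OF F]
        functor_Obj[OF G] functor_arr[OF G] functor_Idt[OF G] functor_Cmp[OF G]\<close>)

lemma is_functor_fix_left:
  assumes F: "is_functor (prod_cat C D) E F" and C: "category C" and D: "category D" and X: "X \<in> Obj C"
  shows "is_functor D E (fix_left C F X)"
proof (rule is_functorI)
  show "category D" "category E" using is_functor_category(2)[OF F] D by auto
qed (use functor_Obj[OF F] functor_arr[OF F] functor_Idt[OF F, of "(X, _)"] functor_Cmp[OF F, of "(Idt C X, _)" "(Idt C X, _)"] C D X in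
    \<open>auto simp: in_homs_iff\<close>)

lemma is_functor_fix_right:
  assumes F: "is_functor (prod_cat C D) E F" and C: "category C" and D: "category D" and Y: "Y \<in> Obj D"
  shows "is_functor C E (fix_right D F Y)"
proof (rule is_functorI)
  show "category C" "category E" using is_functor_category(2)[OF F] C by auto
qed (use functor_Obj[OF F] functor_arr[OF F] functor_Idt[OF F, of "(_, Y)"] functor_Cmp[OF F, of "(_, Idt D Y)" "(_, Idt D Y)"] C D Y in
    \<open>auto simp: in_homs_iff\<close>)

lemma is_functor_id_fun: "category C \<Longrightarrow> is_functor C C id_fun"
  by (rule is_functorI) (auto simp: in_homs_iff)

lemma is_functor_prod_fun:
  assumes F: "is_functor C D F" and G: "is_functor C' D' G"
  shows "is_functor (prod_cat C C') (prod_cat D D') (prod_fun F G)"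
  by (rule is_functorI)
    (use is_functor_category[OF F] is_functor_category[OF G] in
      \<open>auto simp: in_homs_iff functor_Obj[OF F] functor_arr[OF F] functor_Idt[OF F] functor_Cmp[OF F]
        functor_Obj[OF G] functor_arr[OF G] functor_Idt[OF G] functor_Cmp[OF G]\<close>)

lemma is_functor_swap_fun:
  assumes "category C" "category D"
  shows "is_functor (prod_cat C D) (prod_cat D C) swap_fun"
  by (rule is_functorI) (use assms in \<open>auto simp: in_homs_iff\<close>)

lemma is_functor_rebracket:
  assumes "category C" "category D" "category E"
  shows "is_functor (prod_cat C (prod_cat D E)) (prod_cat (prod_cat C D) E) rebracket"
  by (rule is_functorI) (use assms in \<open>auto simp: in_homs_iff\<close>)

text \<open>Together with \<open>functor_split_right\<close> this gives the interchange law of a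
  functor of two variables, which is how both are used.\<close>

lemma functor_split_left:
  assumes F: "is_functor (prod_cat C D) E F" and C: "category C" and D: "category D"
    and f: "f \<in> Arr C" and g: "g \<in> Arr D"
  shows "farr F (f, g) = Cmp E (farr F (f, Idt D (Cod D g))) (farr F (Idt C (Dom C f), g))"
  using functor_Cmp[OF F, of "(Idt C (Dom C f), g)" "(f, Idt D (Cod D g))"] C D f g by simp

lemma functor_split_right:
  assumes F: "is_functor (prod_cat C D) E F" and C: "category C" and D: "category D"
    and f: "f \<in> Arr C" and g: "g \<in> Arr D"
  shows "farr F (f, g) = Cmp E (farr F (Idt C (Cod C f), g)) (farr F (f, Idt D (Dom D g)))"
  using functor_Cmp[OF F, of "(f, Idt D (Dom D g))" "(Idt C (Cod C f), g)"] C D f g by simp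

section \<open>Colimits\<close>

lemma is_coconeI:
  assumes "is_functor J C E" "X \<in> Obj C"
    "\<And>j. j \<in> Obj J \<Longrightarrow> \<iota> j \<in> homs C (fobj E j) X"
    "\<And>u. u \<in> Arr J \<Longrightarrow> Cmp C (\<iota> (Cod J u)) (farr E u) = \<iota> (Dom J u)"
  shows "is_cocone J C E X \<iota>"
  using assms unfolding is_cocone_def by (auto simp: in_homs_iff)

lemma is_coconeD:
  assumes "is_cocone J C E X \<iota>"
  shows "is_functor J C E" "X \<in> Obj C"
    "j \<in> Obj J \<Longrightarrow> \<iota> j \<in> Arr C" "j \<in> Obj J \<Longrightarrow> Dom C (\<iota> j) = fobj E j" "j \<in> Obj J \<Longrightarrow> Cod C (\<iota> j) = X"
  using assms by (auto simp: is_cocone_def in_homs_iff)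

lemma is_cocone_Cmp:
  assumes "is_cocone J C E X \<iota>" "u \<in> Arr J"
  shows "Cmp C (\<iota> (Cod J u)) (farr E u) = \<iota> (Dom J u)"
proof -
  have "category J" using assms(1) by (auto simp: is_cocone_def dest: is_functor_category)
  then have "Dom J u \<in> Obj J" "Cod J u \<in> Obj J" "u \<in> homs J (Dom J u) (Cod J u)"
    using assms by (auto simp: in_homs_iff)
  then show ?thesis using assms(1) unfolding is_cocone_def by blast
qed

lemma is_colimit_cocone: "is_colimit J C E X \<iota> \<Longrightarrow> is_cocone J C E X \<iota>"
  by (simp add: is_colimit_def)

lemma is_colimit_factor:
  assumes "is_colimit J C E X \<iota>" "is_cocone J C E Y \<tau>"
  obtains h where "h \<in> homs C X Y" "\<And>j. j \<in> Obj J \<Longrightarrow> Cmp C h (\<iota> j) = \<tau> j"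
  using assms unfolding is_colimit_def by blast

text \<open>Colimit cocones are jointly epic: the composites with \<open>h'\<close> form a cocone,
  and both arrows are factorizations of it.\<close>

lemma is_colimit_eq:
  assumes "is_colimit J C E X \<iota>" and h: "h \<in> homs C X Y" "h' \<in> homs C X Y"
    and e: "\<And>j. j \<in> Obj J \<Longrightarrow> Cmp C h (\<iota> j) = Cmp C h' (\<iota> j)"
  shows "h = h'"
proof -
  have co: "is_cocone J C E X \<iota>" using assms by (simp add: is_colimit_def)
  have C: "category C" using is_functor_category(2)[OF is_coconeD(1)[OF co]] .
  have Y: "Y \<in> Obj C" using h C by (auto simp: in_homs_iff)
  have "is_cocone J C E Y (\<lambda>j. Cmp C h' (\<iota> j))"
    using is_coconeD[OF co] is_cocone_Cmp[OF co] h C Y is_functor_category(1)[OF is_coconeD(1)[OF co]]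
    by (intro is_coconeI) (auto simp: in_homs_iff functor_arr[OF is_coconeD(1)[OF co]])
  then have "\<exists>!h. h \<in> homs C X Y \<and> (\<forall>j\<in>Obj J. Cmp C h (\<iota> j) = Cmp C h' (\<iota> j))"
    using assms(1) unfolding is_colimit_def by blast
  then show ?thesis using h e by blast
qed

lemma is_colimitI:
  assumes "is_cocone J C E X \<iota>"
    "\<And>Y \<tau>. is_cocone J C E Y \<tau> \<Longrightarrow> \<exists>h. h \<in> homs C X Y \<and> (\<forall>j \<in> Obj J. Cmp C h (\<iota> j) = \<tau> j)"
    "\<And>Y h h'. h \<in> homs C X Y \<Longrightarrow> h' \<in> homs C X Y \<Longrightarrow> Y \<in> Obj C \<Longrightarrow>
      (\<And>j. j \<in> Obj J \<Longrightarrow> Cmp C h (\<iota> j) = Cmp C h' (\<iota> j)) \<Longrightarrow> h = h'"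
  shows "is_colimit J C E X \<iota>"
  unfolding is_colimit_def
proof (intro conjI allI impI)
  fix Y \<tau> assume \<tau>: "is_cocone J C E Y \<tau>"
  obtain h where h: "h \<in> homs C X Y" "\<forall>j \<in> Obj J. Cmp C h (\<iota> j) = \<tau> j" using assms(2)[OF \<tau>] by blast
  show "\<exists>!h. h \<in> homs C X Y \<and> (\<forall>j \<in> Obj J. Cmp C h (\<iota> j) = \<tau> j)"
  proof (rule ex1I[of _ h])
    fix h' assume "h' \<in> homs C X Y \<and> (\<forall>j \<in> Obj J. Cmp C h' (\<iota> j) = \<tau> j)"
    then show "h' = h" using assms(3)[of h' Y h] h is_coconeD(2)[OF \<tau>] by auto
  qed (use h in blast)
qed (fact assms(1))

section \<open>Transport of cocones and colimits along functors and natural transformations\<close>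

lemma is_cocone_comp_fun:
  assumes co: "is_cocone J C E X \<iota>" and F: "is_functor C D F"
  shows "is_cocone J D (comp_fun F E) (fobj F X) (\<lambda>j. farr F (\<iota> j))"
proof (rule is_coconeI)
  note E = is_coconeD(1)[OF co]
  show "is_functor J D (comp_fun F E)" using E F by (rule is_functor_comp_fun)
  show "fobj F X \<in> Obj D" using is_coconeD(2)[OF co] functor_Obj[OF F] by blast
  show "farr F (\<iota> j) \<in> homs D (fobj (comp_fun F E) j) (fobj F X)" if "j \<in> Obj J" for j
    using is_coconeD[OF co] that by (auto simp: in_homs_iff functor_arr[OF F])
  show "Cmp D (farr F (\<iota> (Cod J u))) (farr (comp_fun F E) u) = farr F (\<iota> (Dom J u))" if "u \<in> Arr J" for u
  proof -
    have "Cod J u \<in> Obj J" using is_functor_category(1)[OF E] that by simp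
    then show ?thesis
      using is_cocone_Cmp[OF co that] is_coconeD[OF co] that
      by (simp add: functor_Cmp[OF F, symmetric] functor_arr[OF E])
  qed
qed

lemma is_cocone_nat_trans:
  assumes co: "is_cocone J D (comp_fun G E) Y \<tau>" and s: "nat_trans C D F G s" and E: "is_functor J C E"
  shows "is_cocone J D (comp_fun F E) Y (\<lambda>j. Cmp D (\<tau> j) (s (fobj E j)))"
proof (rule is_coconeI)
  have F: "is_functor C D F" and G: "is_functor C D G" using nat_trans_functor[OF s] .
  have D: "category D" and J: "category J" and C: "category C"
    using is_functor_category F E by blast+
  show "is_functor J D (comp_fun F E)" using E F by (rule is_functor_comp_fun)
  show "Y \<in> Obj D" using is_coconeD(2)[OF co] .
  note [simp] = functor_Obj[OF E] functor_Obj[OF F] functor_Obj[OF G] nat_trans_simps[OF s] D J C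
    functor_arr[OF E] functor_arr[OF F] functor_arr[OF G]
  show "Cmp D (\<tau> j) (s (fobj E j)) \<in> homs D (fobj (comp_fun F E) j) Y" if "j \<in> Obj J" for j
    using is_coconeD[OF co] that by (auto simp: in_homs_iff)
  show "Cmp D (Cmp D (\<tau> (Cod J u)) (s (fobj E (Cod J u)))) (farr (comp_fun F E) u) =
      Cmp D (\<tau> (Dom J u)) (s (fobj E (Dom J u)))" if "u \<in> Arr J" for u
  proof -
    have a: "farr E u \<in> Arr C" using that by simp
    have "Cmp D (Cmp D (\<tau> (Cod J u)) (s (fobj E (Cod J u)))) (farr (comp_fun F E) u) =
      Cmp D (\<tau> (Cod J u)) (Cmp D (s (fobj E (Cod J u))) (farr F (farr E u)))"
      using that is_coconeD(3-5)[OF co] by simp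
    also have "\<dots> = Cmp D (\<tau> (Cod J u)) (Cmp D (farr G (farr E u)) (s (fobj E (Dom J u))))"
      using nat_trans_naturality[OF s a] that by simp
    also have "\<dots> = Cmp D (Cmp D (\<tau> (Cod J u)) (farr G (farr E u))) (s (fobj E (Dom J u)))"
      using that is_coconeD(3-5)[OF co] by simp
    also have "\<dots> = Cmp D (\<tau> (Dom J u)) (s (fobj E (Dom J u)))"
      using is_cocone_Cmp[OF co that] by simp
    finally show ?thesis .
  qed
qed

text \<open>A cocone on the image under \<open>F\<close> is pulled back along \<open>p\<close> to
  one on the image under \<open>G\<close>, factored there, and the result is restricted along
  \<open>s\<close>. Stated for retracts because Hom functors of retracts are needed; invariance
  under natural isomorphism is a special case.\<close>

lemma is_colimit_retract:
  assumes s: "nat_trans C D F G s" and p: "nat_trans C D G F p"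
    and ps: "\<And>X. X \<in> Obj C \<Longrightarrow> Cmp D (p X) (s X) = Idt D (fobj F X)"
    and co: "is_cocone J C E X \<iota>"
    and G: "is_colimit J D (comp_fun G E) (fobj G X) (\<lambda>j. farr G (\<iota> j))"
  shows "is_colimit J D (comp_fun F E) (fobj F X) (\<lambda>j. farr F (\<iota> j))"
proof (rule is_colimitI)
  note E = is_coconeD(1)[OF co] and X = is_coconeD(2)[OF co]
  note FF = nat_trans_functor(1)[OF s] and GF = nat_trans_functor(2)[OF s]
  have D: "category D" and J: "category J" and C: "category C"
    using is_functor_category FF E by blast+
  note [simp] = functor_Obj[OF E] functor_Obj[OF FF] functor_Obj[OF GF] nat_trans_simps[OF s] nat_trans_simps[OF p] D J C
    functor_arr[OF E] functor_arr[OF FF] functor_arr[OF GF] X is_coconeD(3-5)[OF co]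
  show "is_cocone J D (comp_fun F E) (fobj F X) (\<lambda>j. farr F (\<iota> j))"
    using is_cocone_comp_fun[OF co FF] .
  have nats: "Cmp D (s X) (farr F (\<iota> j)) = Cmp D (farr G (\<iota> j)) (s (fobj E j))" if "j \<in> Obj J" for j
    using nat_trans_naturality[OF s, of "\<iota> j"] that by simp
  have natp: "Cmp D (p X) (farr G (\<iota> j)) = Cmp D (farr F (\<iota> j)) (p (fobj E j))" if "j \<in> Obj J" for j
    using nat_trans_naturality[OF p, of "\<iota> j"] that by simp
  {
    fix Y \<tau> assume \<tau>: "is_cocone J D (comp_fun F E) Y \<tau>"
    note [simp] = is_coconeD(3-5)[OF \<tau>]
    obtain h where h: "h \<in> homs D (fobj G X) Y"
      "\<And>j. j \<in> Obj J \<Longrightarrow> Cmp D h (farr G (\<iota> j)) = Cmp D (\<tau> j) (p (fobj E j))"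
      using is_colimit_factor[OF G is_cocone_nat_trans[OF \<tau> p E]] by blast
    show "\<exists>h. h \<in> homs D (fobj F X) Y \<and> (\<forall>j \<in> Obj J. Cmp D h (farr F (\<iota> j)) = \<tau> j)"
    proof (intro exI[of _ "Cmp D h (s X)"] conjI ballI)
      show "Cmp D h (s X) \<in> homs D (fobj F X) Y" using h by (auto simp: in_homs_iff)
      fix j assume j: "j \<in> Obj J"
      have "Cmp D (Cmp D h (s X)) (farr F (\<iota> j)) = Cmp D h (Cmp D (farr G (\<iota> j)) (s (fobj E j)))"
        using h j nats[OF j] by (simp add: in_homs_iff)
      also have "\<dots> = Cmp D (Cmp D h (farr G (\<iota> j))) (s (fobj E j))"
        using h(1) j by (simp add: in_homs_iff)
      also have "\<dots> = Cmp D (\<tau> j) (Cmp D (p (fobj E j)) (s (fobj E j)))"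
        unfolding h(2)[OF j] using j by simp
      also have "\<dots> = \<tau> j" using j ps by simp
      finally show "Cmp D (Cmp D h (s X)) (farr F (\<iota> j)) = \<tau> j" .
    qed
  next
    fix Y h h' assume h: "h \<in> homs D (fobj F X) Y" "h' \<in> homs D (fobj F X) Y"
      and e: "\<And>j. j \<in> Obj J \<Longrightarrow> Cmp D h (farr F (\<iota> j)) = Cmp D h' (farr F (\<iota> j))"
    have "Cmp D h (p X) = Cmp D h' (p X)"
    proof (rule is_colimit_eq[OF G])
      show "Cmp D h (p X) \<in> homs D (fobj G X) Y" "Cmp D h' (p X) \<in> homs D (fobj G X) Y"
        using h by (auto simp: in_homs_iff)
      fix j assume j: "j \<in> Obj J"
      have k: "Cmp D (Cmp D k (p X)) (farr G (\<iota> j)) = Cmp D (Cmp D k (farr F (\<iota> j))) (p (fobj E j))"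
        if "k \<in> homs D (fobj F X) Y" for k
        using that natp[OF j] j by (simp add: in_homs_iff)
      show "Cmp D (Cmp D h (p X)) (farr G (\<iota> j)) = Cmp D (Cmp D h' (p X)) (farr G (\<iota> j))"
        using k h e[OF j] by simp
    qed
    then have "Cmp D (Cmp D h (p X)) (s X) = Cmp D (Cmp D h' (p X)) (s X)" by simp
    then show "h = h'" using h ps by (simp add: in_homs_iff)
  }
qed

lemma nat_iso_inverse:
  assumes "nat_iso C D F G \<tau>"
  shows "nat_iso C D G F (\<lambda>X. inv_arr D (\<tau> X))"
proof -
  note \<tau> = nat_isoD(1)[OF assms]
  note iso = nat_isoD(2)[OF assms]
  have F: "is_functor C D F" and G: "is_functor C D G" using nat_trans_functor[OF \<tau>] by auto
  have C: "category C" and D: "category D" using is_functor_category[OF F] .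
  have "nat_trans C D G F (\<lambda>X. inv_arr D (\<tau> X))"
  proof (rule nat_transI[OF G F])
    show "inv_arr D (\<tau> X) \<in> homs D (fobj G X) (fobj F X)" if "X \<in> Obj C" for X
      using iso that nat_trans_simps[OF \<tau>] D by (auto simp: in_homs_iff)
    fix f assume f: "f \<in> Arr C"
    show "Cmp D (inv_arr D (\<tau> (Cod C f))) (farr G f) = Cmp D (farr F f) (inv_arr D (\<tau> (Dom C f)))"
    proof (rule iso_epi[OF D])
      show "is_iso D (\<tau> (Dom C f))" using iso f C by simp
      have "Cmp D (Cmp D (inv_arr D (\<tau> (Cod C f))) (farr G f)) (\<tau> (Dom C f)) =
          Cmp D (inv_arr D (\<tau> (Cod C f))) (Cmp D (\<tau> (Cod C f)) (farr F f))"
        using nat_trans_naturality[OF \<tau> f] iso f C D nat_trans_simps[OF \<tau>] functor_arr[OF F] functor_arr[OF G]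
        by simp
      also have "\<dots> = farr F f"
        using iso f C D nat_trans_simps[OF \<tau>] functor_arr[OF F] by simp
      finally show "Cmp D (Cmp D (inv_arr D (\<tau> (Cod C f))) (farr G f)) (\<tau> (Dom C f)) =
          Cmp D (Cmp D (farr F f) (inv_arr D (\<tau> (Dom C f)))) (\<tau> (Dom C f))"
        using iso f C D nat_trans_simps[OF \<tau>] functor_arr[OF F] by simp
    qed (use iso f C D nat_trans_simps[OF \<tau>] functor_arr[OF F] functor_arr[OF G] in auto)
  qed
  then show ?thesis using iso D unfolding nat_iso_def by simp
qed

lemma nat_trans_Cmp:
  assumes s: "nat_trans C D F G \<sigma>" and t: "nat_trans C D G H \<tau>"
  shows "nat_trans C D F H (\<lambda>X. Cmp D (\<tau> X) (\<sigma> X))"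
proof (rule nat_transI)
  show F: "is_functor C D F" and H: "is_functor C D H" using nat_trans_functor s t by blast+
  have C: "category C" and D: "category D" using is_functor_category[OF F] .
  have G: "is_functor C D G" using nat_trans_functor s by blast
  note [simp] = C D functor_arr[OF F] functor_arr[OF H] functor_arr[OF G] nat_trans_simps[OF s] nat_trans_simps[OF t]
  show "Cmp D (\<tau> X) (\<sigma> X) \<in> homs D (fobj F X) (fobj H X)" if "X \<in> Obj C" for X
    using that by (simp add: in_homs_iff)
  show "Cmp D (Cmp D (\<tau> (Cod C f)) (\<sigma> (Cod C f))) (farr F f) = Cmp D (farr H f) (Cmp D (\<tau> (Dom C f)) (\<sigma> (Dom C f)))"
    if f: "f \<in> Arr C" for f
  proof -
    have "Cmp D (Cmp D (\<tau> (Cod C f)) (\<sigma> (Cod C f))) (farr F f) =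
      Cmp D (\<tau> (Cod C f)) (Cmp D (farr G f) (\<sigma> (Dom C f)))"
      using f nat_trans_naturality[OF s f] by simp
    also have "\<dots> = Cmp D (Cmp D (\<tau> (Cod C f)) (farr G f)) (\<sigma> (Dom C f))"
      using f by simp
    finally show ?thesis using f nat_trans_naturality[OF t f] by simp
  qed
qed

lemma nat_iso_Cmp:
  assumes "nat_iso C D F G \<sigma>" "nat_iso C D G H \<tau>"
  shows "nat_iso C D F H (\<lambda>X. Cmp D (\<tau> X) (\<sigma> X))"
proof -
  note s = nat_isoD(1)[OF assms(1)] and t = nat_isoD(1)[OF assms(2)]
  have "category D" using is_functor_category(2)[OF nat_trans_functor(1)[OF s]] .
  then show ?thesis
    using nat_trans_Cmp[OF s t] assms nat_trans_simps[OF s] nat_trans_simps[OF t]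
    by (auto simp: nat_iso_def intro!: is_iso_Cmp)
qed

lemma is_colimit_nat_iso:
  assumes i: "nat_iso C D F G \<tau>" and co: "is_cocone J C E X \<iota>"
    and F: "is_colimit J D (comp_fun F E) (fobj F X) (\<lambda>j. farr F (\<iota> j))"
  shows "is_colimit J D (comp_fun G E) (fobj G X) (\<lambda>j. farr G (\<iota> j))"
proof (rule is_colimit_retract[OF nat_isoD(1)[OF nat_iso_inverse[OF i]] nat_isoD(1)[OF i] _ co F])
  fix X assume X: "X \<in> Obj C"
  have "category D" using is_functor_category(2)[OF nat_trans_functor(1)[OF nat_isoD(1)[OF i]]] .
  then show "Cmp D (\<tau> X) (inv_arr D (\<tau> X)) = Idt D (fobj G X)"
    using nat_isoD(2)[OF i X] nat_trans_simps[OF nat_isoD(1)[OF i] X] by simp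
qed

lemma preserves_colimitsD:
  assumes "preserves_colimits P C D F" "small_category J" "P J" "is_colimit J C E X \<iota>"
  shows "is_colimit J D (comp_fun F E) (fobj F X) (\<lambda>j. farr F (\<iota> j))"
  using assms unfolding preserves_colimits_def by blast

lemma preserves_colimits_retract:
  assumes "nat_trans C D F G s" "nat_trans C D G F p"
    and "\<And>X. X \<in> Obj C \<Longrightarrow> Cmp D (p X) (s X) = Idt D (fobj F X)"
    and "preserves_colimits P C D G"
  shows "preserves_colimits P C D F"
  unfolding preserves_colimits_def
  using is_colimit_retract[OF assms(1-3) is_colimit_cocone preserves_colimitsD[OF assms(4)]] by blast

lemma comp_fun_assoc: "comp_fun (comp_fun H G) F = comp_fun H (comp_fun G F)"
  by (simp add: comp_fun_def comp_assoc)

lemma preserves_colimits_comp_fun: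
  assumes F: "preserves_colimits P C D F" and G: "preserves_colimits P D E G"
  shows "preserves_colimits P C E (comp_fun G F)"
  unfolding preserves_colimits_def
proof (intro allI impI, elim conjE)
  fix J E' X \<iota> assume J: "small_category J" "P J" "is_colimit J C E' X \<iota>"
  from preserves_colimitsD[OF G J(1,2) preserves_colimitsD[OF F J]]
  show "is_colimit J E (comp_fun (comp_fun G F) E') (fobj (comp_fun G F) X) (\<lambda>j. farr (comp_fun G F) (\<iota> j))"
    by (simp add: comp_fun_assoc)
qed

lemma is_functor_cong:
  assumes "is_functor C D F" "\<And>X. X \<in> Obj C \<Longrightarrow> fobj G X = fobj F X" "\<And>f. f \<in> Arr C \<Longrightarrow> farr G f = farr F f"
  shows "is_functor C D G"
  using is_functor_category[OF assms(1)] functor_arr[OF assms(1)] functor_Cmp[OF assms(1)] functor_Obj[OF assms(1)]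
    functor_Idt[OF assms(1)]
  by (intro is_functorI) (auto simp: assms(2,3) in_homs_iff)

lemma nat_iso_cong:
  assumes F: "is_functor C D F" "\<And>X. X \<in> Obj C \<Longrightarrow> fobj G X = fobj F X" "\<And>f. f \<in> Arr C \<Longrightarrow> farr G f = farr F f"
  shows "nat_iso C D F G (\<lambda>X. Idt D (fobj F X))"
proof -
  have C: "category C" and D: "category D" using is_functor_category[OF F(1)] .
  have "nat_trans C D F G (\<lambda>X. Idt D (fobj F X))"
    by (intro nat_transI F(1) is_functor_cong[OF F])
      (use C D functor_arr[OF F(1)] functor_Obj[OF F(1)] in \<open>auto simp: in_homs_iff F(2,3)\<close>)
  then show ?thesis using D functor_Obj[OF F(1)] by (auto simp: nat_iso_def)
qed

lemma preserves_colimits_nat_iso: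
  assumes "nat_iso C D F G \<tau>" "preserves_colimits P C D F"
  shows "preserves_colimits P C D G"
  using is_colimit_nat_iso[OF assms(1) is_colimit_cocone preserves_colimitsD[OF assms(2)]]
  unfolding preserves_colimits_def by blast

text \<open>The componentwise inverses, followed by the legs, form a cocone, and the arrow it
  induces is the inverse at the vertex. This is the step from compact projective objects to
  arbitrary ones in the snake relation.\<close>

lemma is_iso_at_colimit:
  assumes \<alpha>: "nat_trans C D F G \<alpha>" and co: "is_cocone J C E X \<iota>"
    and F: "is_colimit J D (comp_fun F E) (fobj F X) (\<lambda>j. farr F (\<iota> j))"
    and G: "is_colimit J D (comp_fun G E) (fobj G X) (\<lambda>j. farr G (\<iota> j))"
    and i: "\<And>j. j \<in> Obj J \<Longrightarrow> is_iso D (\<alpha> (fobj E j))"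
  shows "is_iso D (\<alpha> X)"
proof -
  note E = is_coconeD(1)[OF co] and X = is_coconeD(2)[OF co]
  note FF = nat_trans_functor(1)[OF \<alpha>] and GF = nat_trans_functor(2)[OF \<alpha>]
  have D: "category D" and J: "category J" and C: "category C"
    using is_functor_category FF E by blast+
  note [simp] = functor_Obj[OF E] functor_Obj[OF FF] functor_Obj[OF GF] nat_trans_simps[OF \<alpha>] D J C
    functor_arr[OF E] functor_arr[OF FF] functor_arr[OF GF] X is_coconeD(3-5)[OF co] i
  have nat: "Cmp D (\<alpha> X) (farr F (\<iota> j)) = Cmp D (farr G (\<iota> j)) (\<alpha> (fobj E j))" if "j \<in> Obj J" for j
    using nat_trans_naturality[OF \<alpha>, of "\<iota> j"] that by simp
  let ?\<tau> = "\<lambda>j. Cmp D (farr F (\<iota> j)) (inv_arr D (\<alpha> (fobj E j)))"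
  have co': "is_cocone J D (comp_fun G E) (fobj F X) ?\<tau>"
  proof (rule is_coconeI)
    show "is_functor J D (comp_fun G E)" using E GF by (rule is_functor_comp_fun)
    show "fobj F X \<in> Obj D" by simp
    show "?\<tau> j \<in> homs D (fobj (comp_fun G E) j) (fobj F X)" if "j \<in> Obj J" for j
      using that by (simp add: in_homs_iff)
    fix u assume u: "u \<in> Arr J"
    show "Cmp D (?\<tau> (Cod J u)) (farr (comp_fun G E) u) = ?\<tau> (Dom J u)"
    proof (rule iso_epi[OF D])
      show "is_iso D (\<alpha> (fobj E (Dom J u)))" using u by simp
      have "Cmp D (Cmp D (?\<tau> (Cod J u)) (farr (comp_fun G E) u)) (\<alpha> (fobj E (Dom J u))) =
         Cmp D (farr F (\<iota> (Cod J u))) (Cmp D (inv_arr D (\<alpha> (fobj E (Cod J u))))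
           (Cmp D (farr G (farr E u)) (\<alpha> (fobj E (Dom J u)))))"
        using u by simp
      also have "Cmp D (farr G (farr E u)) (\<alpha> (fobj E (Dom J u))) = Cmp D (\<alpha> (fobj E (Cod J u))) (farr F (farr E u))"
        using u nat_trans_naturality[OF \<alpha>, of "farr E u"] by simp
      also have "Cmp D (farr F (\<iota> (Cod J u))) (Cmp D (inv_arr D (\<alpha> (fobj E (Cod J u)))) \<dots>) =
          farr F (\<iota> (Dom J u))"
        using u is_cocone_Cmp[OF co u] by (simp add: functor_Cmp[OF FF, symmetric])
      also have "\<dots> = Cmp D (?\<tau> (Dom J u)) (\<alpha> (fobj E (Dom J u)))"
        using u by simp
      finally show "Cmp D (Cmp D (?\<tau> (Cod J u)) (farr (comp_fun G E) u)) (\<alpha> (fobj E (Dom J u))) =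
        Cmp D (?\<tau> (Dom J u)) (\<alpha> (fobj E (Dom J u)))" .
    qed (use u in simp_all)
  qed
  obtain g where g: "g \<in> homs D (fobj G X) (fobj F X)" "\<And>j. j \<in> Obj J \<Longrightarrow> Cmp D g (farr G (\<iota> j)) = ?\<tau> j"
    using is_colimit_factor[OF G co'] by blast
  have "Cmp D g (\<alpha> X) = Idt D (fobj F X)"
  proof (rule is_colimit_eq[OF F])
    show "Cmp D g (\<alpha> X) \<in> homs D (fobj F X) (fobj F X)" "Idt D (fobj F X) \<in> homs D (fobj F X) (fobj F X)"
      using g by (auto simp: in_homs_iff)
    fix j assume j: "j \<in> Obj J"
    have "Cmp D (Cmp D g (\<alpha> X)) (farr F (\<iota> j)) = Cmp D (Cmp D g (farr G (\<iota> j))) (\<alpha> (fobj E j))"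
      using j g(1) nat[OF j] by (simp add: in_homs_iff)
    then show "Cmp D (Cmp D g (\<alpha> X)) (farr F (\<iota> j)) = Cmp D (Idt D (fobj F X)) (farr F (\<iota> j))"
      using j g(2)[OF j] by simp
  qed
  moreover have "Cmp D (\<alpha> X) g = Idt D (fobj G X)"
  proof (rule is_colimit_eq[OF G])
    show "Cmp D (\<alpha> X) g \<in> homs D (fobj G X) (fobj G X)" "Idt D (fobj G X) \<in> homs D (fobj G X) (fobj G X)"
      using g by (auto simp: in_homs_iff)
    fix j assume j: "j \<in> Obj J"
    have "Cmp D (Cmp D (\<alpha> X) g) (farr G (\<iota> j)) = Cmp D (Cmp D (\<alpha> X) (farr F (\<iota> j))) (inv_arr D (\<alpha> (fobj E j)))"
      using j g by (simp add: in_homs_iff)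
    then show "Cmp D (Cmp D (\<alpha> X) g) (farr G (\<iota> j)) = Cmp D (Idt D (fobj G X)) (farr G (\<iota> j))"
      using j nat[OF j] by simp
  qed
  ultimately show ?thesis
    using g by (intro is_isoI[OF D, of _ "fobj F X" "fobj G X" g]) (auto simp: in_homs_iff)
qed

section \<open>Glueings\<close>

text \<open>\<open>glueing\<close> is the colimit of a bipartite diagram: every \<open>r \<in> R\<close> identifies, along a pair of
  arrows \<open>p r\<close> and \<open>q r\<close> with the same domain, the objects \<open>X (src r)\<close> and \<open>X (tgt r)\<close>.\<close>

definition glue_cocone ::
  "('o, 'a, 'z) cat_scheme \<Rightarrow> 's set \<Rightarrow> 'r set \<Rightarrow> ('r \<Rightarrow> 's) \<Rightarrow> ('r \<Rightarrow> 's) \<Rightarrow> ('s \<Rightarrow> 'o) \<Rightarrow>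
   ('r \<Rightarrow> 'a) \<Rightarrow> ('r \<Rightarrow> 'a) \<Rightarrow> 'o \<Rightarrow> ('s \<Rightarrow> 'a) \<Rightarrow> bool" where
  "glue_cocone C S R src tgt X p q W i \<longleftrightarrow> W \<in> Obj C \<and> (\<forall>s\<in>S. i s \<in> homs C (X s) W) \<and>
     (\<forall>r\<in>R. Cmp C (i (src r)) (p r) = Cmp C (i (tgt r)) (q r))"

definition glueing ::
  "('o, 'a, 'z) cat_scheme \<Rightarrow> 's set \<Rightarrow> 'r set \<Rightarrow> ('r \<Rightarrow> 's) \<Rightarrow> ('r \<Rightarrow> 's) \<Rightarrow> ('s \<Rightarrow> 'o) \<Rightarrow>
   ('r \<Rightarrow> 'a) \<Rightarrow> ('r \<Rightarrow> 'a) \<Rightarrow> 'o \<Rightarrow> ('s \<Rightarrow> 'a) \<Rightarrow> bool" where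
  "glueing C S R src tgt X p q W i \<longleftrightarrow> glue_cocone C S R src tgt X p q W i \<and>
     (\<forall>Y j. glue_cocone C S R src tgt X p q Y j \<longrightarrow> (\<exists>!h. h \<in> homs C W Y \<and> (\<forall>s\<in>S. Cmp C h (i s) = j s)))"

text \<open>The index category has \<open>S + R\<close> as objects and two nonidentity arrows out of
  each relation. Diagrams are indexed by categories over the universe, so all of these are named by
  elements of \<open>'u\<close> through the injection \<open>e\<close>.\<close>

locale glue_shape =
  fixes S :: "'s set" and R :: "'r set" and src tgt :: "'r \<Rightarrow> 's"
    and e :: "('s + 'r) + ('r + 'r) \<Rightarrow> 'u"
  assumes inj: "inj_on e (Sum_Type.Plus (Sum_Type.Plus S R) (Sum_Type.Plus R R))"
    and src: "r \<in> R \<Longrightarrow> src r \<in> S" and tgt: "r \<in> R \<Longrightarrow> tgt r \<in> S"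
begin

abbreviation N where "N \<equiv> Sum_Type.Plus (Sum_Type.Plus S R) (Sum_Type.Plus R R)"

definition d where "d = inv_into N e"

lemma d_e [simp]:
  "s \<in> S \<Longrightarrow> d (e (Inl (Inl s))) = Inl (Inl s)"
  "r \<in> R \<Longrightarrow> d (e (Inl (Inr r))) = Inl (Inr r)"
  "r \<in> R \<Longrightarrow> d (e (Inr (Inl r))) = Inr (Inl r)"
  "r \<in> R \<Longrightarrow> d (e (Inr (Inr r))) = Inr (Inr r)"
  unfolding d_def by (auto intro!: inv_into_f_f[OF inj])

text \<open>An object serves as its own identity arrow. Nonidentity arrows lead from relations to
  elements of \<open>S\<close>, so no two of them are composable, and a composite is whichever
  factor is not an identity.\<close>

definition shape :: "('u, 'u) cat" where
  "shape = \<lparr>Obj = (e \<circ> Inl) ` Sum_Type.Plus S R, Arr = e ` N,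
     Dom = (\<lambda>u. case d u of Inl x \<Rightarrow> u | Inr (Inl r) \<Rightarrow> e (Inl (Inr r)) | Inr (Inr r) \<Rightarrow> e (Inl (Inr r))),
     Cod = (\<lambda>u. case d u of Inl x \<Rightarrow> u | Inr (Inl r) \<Rightarrow> e (Inl (Inl (src r))) | Inr (Inr r) \<Rightarrow> e (Inl (Inl (tgt r)))),
     Cmp = (\<lambda>g f. case d g of Inl x \<Rightarrow> f | Inr x \<Rightarrow> g),
     Idt = id\<rparr>"

lemma Obj_shape: "u \<in> Obj shape \<longleftrightarrow> (\<exists>s\<in>S. u = e (Inl (Inl s))) \<or> (\<exists>r\<in>R. u = e (Inl (Inr r)))"
  by (auto simp: shape_def Plus_def)

lemma Arr_shape:
  "u \<in> Arr shape \<longleftrightarrow> (\<exists>s\<in>S. u = e (Inl (Inl s))) \<or> (\<exists>r\<in>R. u = e (Inl (Inr r))) \<or>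
     (\<exists>r\<in>R. u = e (Inr (Inl r))) \<or> (\<exists>r\<in>R. u = e (Inr (Inr r)))"
  by (auto simp: shape_def Plus_def)

lemma shape_simps [simp]:
  "s \<in> S \<Longrightarrow> Dom shape (e (Inl (Inl s))) = e (Inl (Inl s))"
  "s \<in> S \<Longrightarrow> Cod shape (e (Inl (Inl s))) = e (Inl (Inl s))"
  "r \<in> R \<Longrightarrow> Dom shape (e (Inl (Inr r))) = e (Inl (Inr r))"
  "r \<in> R \<Longrightarrow> Cod shape (e (Inl (Inr r))) = e (Inl (Inr r))"
  "r \<in> R \<Longrightarrow> Dom shape (e (Inr (Inl r))) = e (Inl (Inr r))"
  "r \<in> R \<Longrightarrow> Dom shape (e (Inr (Inr r))) = e (Inl (Inr r))"
  "r \<in> R \<Longrightarrow> Cod shape (e (Inr (Inl r))) = e (Inl (Inl (src r)))"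
  "r \<in> R \<Longrightarrow> Cod shape (e (Inr (Inr r))) = e (Inl (Inl (tgt r)))"
  "s \<in> S \<Longrightarrow> Cmp shape (e (Inl (Inl s))) f = f"
  "r \<in> R \<Longrightarrow> Cmp shape (e (Inl (Inr r))) f = f"
  "r \<in> R \<Longrightarrow> Cmp shape (e (Inr (Inl r))) f = e (Inr (Inl r))"
  "r \<in> R \<Longrightarrow> Cmp shape (e (Inr (Inr r))) f = e (Inr (Inr r))"
  "Idt shape x = x"
  by (auto simp: shape_def)

lemma e_eq_iff:
  "s \<in> S \<Longrightarrow> s' \<in> S \<Longrightarrow> e (Inl (Inl s)) = e (Inl (Inl s')) \<longleftrightarrow> s = s'"
  "r \<in> R \<Longrightarrow> r' \<in> R \<Longrightarrow> e (Inl (Inr r)) = e (Inl (Inr r')) \<longleftrightarrow> r = r'"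
  "s \<in> S \<Longrightarrow> r \<in> R \<Longrightarrow> e (Inl (Inl s)) \<noteq> e (Inl (Inr r))"
  "s \<in> S \<Longrightarrow> r \<in> R \<Longrightarrow> e (Inl (Inr r)) \<noteq> e (Inl (Inl s))"
  using d_e by (metis sum.inject sum.distinct)+

lemma category_shape: "category shape"
  unfolding category_def
proof (intro conjI ballI)
  fix X Y Z f g
  assume "f \<in> homs shape X Y" "g \<in> homs shape Y Z"
  then show "Cmp shape g f \<in> homs shape X Z"
    by (auto simp: in_homs_iff Arr_shape src tgt e_eq_iff)
next
  fix W X Y Z f g h
  assume "f \<in> homs shape W X" "g \<in> homs shape X Y" "h \<in> homs shape Y Z"
  then show "Cmp shape h (Cmp shape g f) = Cmp shape (Cmp shape h g) f"
    by (auto simp: in_homs_iff Arr_shape src tgt e_eq_iff)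
qed (auto simp: in_homs_iff Arr_shape Obj_shape src tgt e_eq_iff)

definition diagram ::
  "('o, 'a, 'z) cat_scheme \<Rightarrow> ('s \<Rightarrow> 'o) \<Rightarrow> ('r \<Rightarrow> 'a) \<Rightarrow> ('r \<Rightarrow> 'a) \<Rightarrow> ('u, 'u, 'o, 'a) functr" where
  "diagram C X p q = \<lparr>
     fobj = (\<lambda>u. case d u of Inl (Inl s) \<Rightarrow> X s | Inl (Inr r) \<Rightarrow> Dom C (p r)),
     farr = (\<lambda>u. case d u of Inl (Inl s) \<Rightarrow> Idt C (X s) | Inl (Inr r) \<Rightarrow> Idt C (Dom C (p r)) |
       Inr (Inl r) \<Rightarrow> p r | Inr (Inr r) \<Rightarrow> q r)\<rparr>"

lemma diagram_simps [simp]: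
  "s \<in> S \<Longrightarrow> fobj (diagram C X p q) (e (Inl (Inl s))) = X s"
  "r \<in> R \<Longrightarrow> fobj (diagram C X p q) (e (Inl (Inr r))) = Dom C (p r)"
  "s \<in> S \<Longrightarrow> farr (diagram C X p q) (e (Inl (Inl s))) = Idt C (X s)"
  "r \<in> R \<Longrightarrow> farr (diagram C X p q) (e (Inl (Inr r))) = Idt C (Dom C (p r))"
  "r \<in> R \<Longrightarrow> farr (diagram C X p q) (e (Inr (Inl r))) = p r"
  "r \<in> R \<Longrightarrow> farr (diagram C X p q) (e (Inr (Inr r))) = q r"
  by (auto simp: diagram_def)

lemma is_functor_diagram:
  assumes C: "category C" and X: "\<And>s. s \<in> S \<Longrightarrow> X s \<in> Obj C"
    and p: "\<And>r. r \<in> R \<Longrightarrow> p r \<in> homs C (Z r) (X (src r))" "\<And>r. r \<in> R \<Longrightarrow> q r \<in> homs C (Z r) (X (tgt r))"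
  shows "is_functor shape C (diagram C X p q)"
proof (rule is_functorI[OF category_shape C])
  note [simp] = C X homsD[OF p(1)] homsD[OF p(2)] src tgt
  show "fobj (diagram C X p q) u \<in> Obj C" if "u \<in> Obj shape" for u
    using that Obj_Dom[OF C homsD(1)[OF p(1)]] by (auto simp: Obj_shape)
  have ZC: "Z r \<in> Obj C" if "r \<in> R" for r
    using that Obj_Dom[OF C homsD(1)[OF p(1)]] by auto
  show "farr (diagram C X p q) u \<in> homs C (fobj (diagram C X p q) (Dom shape u)) (fobj (diagram C X p q) (Cod shape u))"
    if "u \<in> Arr shape" for u
    using that ZC by (auto simp: Arr_shape in_homs_iff)
  show "farr (diagram C X p q) (Idt shape u) = Idt C (fobj (diagram C X p q) u)" if "u \<in> Obj shape" for u
    using that by (auto simp: Obj_shape)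
  show "farr (diagram C X p q) (Cmp shape g f) = Cmp C (farr (diagram C X p q) g) (farr (diagram C X p q) f)"
    if "f \<in> Arr shape" "g \<in> Arr shape" "Cod shape f = Dom shape g" for f g
    using that ZC by (auto simp: Arr_shape e_eq_iff)
qed

text \<open>The shape of the statement covers both a diagram and its image under a functor.\<close>

lemma is_colimit_shape_imp_glueing:
  assumes l: "is_colimit shape C E W \<iota>"
    and X: "\<And>s. s \<in> S \<Longrightarrow> fobj E (e (Inl (Inl s))) = X s"
    and p: "\<And>r. r \<in> R \<Longrightarrow> farr E (e (Inr (Inl r))) = p r" "\<And>r. r \<in> R \<Longrightarrow> farr E (e (Inr (Inr r))) = q r"
  shows "glueing C S R src tgt X p q W (\<lambda>s. \<iota> (e (Inl (Inl s))))"
proof -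
  note co = is_colimit_cocone[OF l]
  note E = is_coconeD(1)[OF co]
  have C: "category C" using is_functor_category(2)[OF E] .
  have oS: "e (Inl (Inl s)) \<in> Obj shape" if "s \<in> S" for s using that by (auto simp: Obj_shape)
  have oR: "e (Inl (Inr r)) \<in> Obj shape" if "r \<in> R" for r using that by (auto simp: Obj_shape)
  have aR: "e (Inr (Inl r)) \<in> Arr shape" "e (Inr (Inr r)) \<in> Arr shape" if "r \<in> R" for r
    using that by (auto simp: Arr_shape)
  have pr: "p r \<in> Arr C" "q r \<in> Arr C" "Dom C (p r) = fobj E (e (Inl (Inr r)))" "Dom C (q r) = fobj E (e (Inl (Inr r)))"
    "Cod C (p r) = X (src r)" "Cod C (q r) = X (tgt r)" if "r \<in> R" for r
    using functor_arr[OF E aR(1)[OF that]] functor_arr[OF E aR(2)[OF that]] that p X src tgt by auto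
  have "glue_cocone C S R src tgt X p q W (\<lambda>s. \<iota> (e (Inl (Inl s))))"
    unfolding glue_cocone_def
  proof (intro conjI ballI)
    show "W \<in> Obj C" using is_coconeD(2)[OF co] .
    show "\<iota> (e (Inl (Inl s))) \<in> homs C (X s) W" if "s \<in> S" for s
      using is_coconeD(3-5)[OF co oS[OF that]] X[OF that] by (simp add: in_homs_iff)
    show "Cmp C (\<iota> (e (Inl (Inl (src r))))) (p r) = Cmp C (\<iota> (e (Inl (Inl (tgt r))))) (q r)" if "r \<in> R" for r
      using is_cocone_Cmp[OF co aR(1)[OF that]] is_cocone_Cmp[OF co aR(2)[OF that]] that p by simp
  qed
  moreover have "\<exists>!h. h \<in> homs C W Y \<and> (\<forall>s\<in>S. Cmp C h (\<iota> (e (Inl (Inl s)))) = j s)"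
    if g: "glue_cocone C S R src tgt X p q Y j" for Y j
  proof -
    have Y: "Y \<in> Obj C" and j: "\<And>s. s \<in> S \<Longrightarrow> j s \<in> homs C (X s) Y"
      and eq: "\<And>r. r \<in> R \<Longrightarrow> Cmp C (j (src r)) (p r) = Cmp C (j (tgt r)) (q r)"
      using g by (auto simp: glue_cocone_def)
    \<comment> \<open>The component at a relation is forced by the cocone law; by \<open>eq\<close>
      its two legs prescribe the same arrow.\<close>
    define \<tau> where "\<tau> u = (case d u of Inl (Inl s) \<Rightarrow> j s | Inl (Inr r) \<Rightarrow> Cmp C (j (src r)) (p r))" for u
    have \<tau>: "s \<in> S \<Longrightarrow> \<tau> (e (Inl (Inl s))) = j s" "r \<in> R \<Longrightarrow> \<tau> (e (Inl (Inr r))) = Cmp C (j (src r)) (p r)" for s r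
      by (auto simp: \<tau>_def)
    have eid: "u \<in> Obj shape \<Longrightarrow> farr E u = Idt C (fobj E u)" for u
      using functor_Idt[OF E, of u] by simp
    have "is_cocone shape C E Y \<tau>"
    proof (rule is_coconeI[OF E Y])
      show "\<tau> u \<in> homs C (fobj E u) Y" if "u \<in> Obj shape" for u
        using that j X pr C src homsD[OF j] by (auto simp: Obj_shape \<tau> in_homs_iff)
      show "Cmp C (\<tau> (Cod shape u)) (farr E u) = \<tau> (Dom shape u)" if "u \<in> Arr shape" for u
        using that pr C src tgt X homsD[OF j] eq eid[OF oS] eid[OF oR] functor_Obj[OF E oR]
        by (auto simp: Arr_shape \<tau> p)
    qed
    then obtain h where h: "h \<in> homs C W Y" "\<And>u. u \<in> Obj shape \<Longrightarrow> Cmp C h (\<iota> u) = \<tau> u"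
      using is_colimit_factor[OF l] by blast
    show ?thesis
    proof (rule ex1I[of _ h])
      show "h \<in> homs C W Y \<and> (\<forall>s\<in>S. Cmp C h (\<iota> (e (Inl (Inl s)))) = j s)"
        using h oS \<tau> by simp
      fix h' assume h': "h' \<in> homs C W Y \<and> (\<forall>s\<in>S. Cmp C h' (\<iota> (e (Inl (Inl s)))) = j s)"
      show "h' = h"
      proof (rule is_colimit_eq[OF l])
        show "h' \<in> homs C W Y" "h \<in> homs C W Y" using h h' by auto
        fix u assume u: "u \<in> Obj shape"
        show "Cmp C h' (\<iota> u) = Cmp C h (\<iota> u)"
        proof (cases "\<exists>s\<in>S. u = e (Inl (Inl s))")
          case True then show ?thesis using h h' oS \<tau> by auto
        next
          case False
          then obtain r where r: "r \<in> R" and u: "u = e (Inl (Inr r))" using u by (auto simp: Obj_shape)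
          have \<iota>: "\<iota> u = Cmp C (\<iota> (e (Inl (Inl (src r))))) (p r)"
            using is_cocone_Cmp[OF co aR(1)[OF r]] r p u by simp
          have *: "Cmp C k (\<iota> u) = Cmp C (Cmp C k (\<iota> (e (Inl (Inl (src r)))))) (p r)" if "k \<in> homs C W Y" for k
            unfolding \<iota> using that C pr[OF r] is_coconeD(3-5)[OF co oS[OF src[OF r]]] X src r by (simp add: in_homs_iff)
          show ?thesis using * h h' src[OF r] oS \<tau> by metis
        qed
      qed
    qed
  qed
  ultimately show ?thesis unfolding glueing_def by blast
qed

end

text \<open>Preservation is asserted together with existence: cocontinuity speaks of colimits over
  index categories, and a glueing no longer remembers the one it came from.\<close>

lemma exists_glueing:
  fixes C :: "('u, 'u, 'u) lincat" and S :: "'s set" and R :: "'r set"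
  assumes u: "regular_universe TYPE('u)" and cC: "cocomplete C" and C: "category C"
    and S: "|S| <o |UNIV :: 'u set|" and R: "|R| <o |UNIV :: 'u set|"
    and st: "\<And>r. r \<in> R \<Longrightarrow> src r \<in> S" "\<And>r. r \<in> R \<Longrightarrow> tgt r \<in> S"
    and X: "\<And>s. s \<in> S \<Longrightarrow> X s \<in> Obj C"
    and p: "\<And>r. r \<in> R \<Longrightarrow> p r \<in> homs C (Z r) (X (src r))" "\<And>r. r \<in> R \<Longrightarrow> q r \<in> homs C (Z r) (X (tgt r))"
  obtains W i where "glueing C S R src tgt X p q W i"
    and "\<And>(D :: ('p, 'b, 'y) cat_scheme) H. preserves_colimits (\<lambda>J :: ('u, 'u) cat. True) C D H \<Longrightarrow>
      glueing D S R src tgt (\<lambda>s. fobj H (X s)) (\<lambda>r. farr H (p r)) (\<lambda>r. farr H (q r)) (fobj H W) (\<lambda>s. farr H (i s))"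
proof -
  let ?N = "Sum_Type.Plus (Sum_Type.Plus S R) (Sum_Type.Plus R R)"
  have N: "|?N| <o |UNIV :: 'u set|"
    by (intro card_less_Plus u S R)
  then obtain e :: "('s + 'r) + ('r + 'r) \<Rightarrow> 'u" where e: "inj_on e ?N"
    using card_of_ordLeq[of ?N "UNIV :: 'u set"] ordLess_imp_ordLeq by blast
  interpret glue_shape S R src tgt e by unfold_locales (fact e st)+
  have sm: "small_category shape"
    unfolding small_category_def small_def
  proof (intro conjI category_shape)
    show a: "|Arr shape| <o |UNIV :: 'u set|"
      using card_less_image[OF N] by (simp add: shape_def)
    have "Obj shape \<subseteq> Arr shape" by (auto simp: Obj_shape Arr_shape)
    then show "|Obj shape| <o |UNIV :: 'u set|" using card_less_subset a by blast
  qed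
  have "is_functor shape C (diagram C X p q)" using C X p by (rule is_functor_diagram)
  then obtain W \<iota> where l: "is_colimit shape C (diagram C X p q) W \<iota>"
    using cC sm unfolding cocomplete_def by blast
  show thesis
  proof (rule that)
    show "glueing C S R src tgt X p q W (\<lambda>s. \<iota> (e (Inl (Inl s))))"
      using l by (rule is_colimit_shape_imp_glueing) simp_all
    fix D :: "('p, 'b, 'y) cat_scheme" and H assume "preserves_colimits (\<lambda>J :: ('u, 'u) cat. True) C D H"
    from preserves_colimitsD[OF this sm TrueI l]
    show "glueing D S R src tgt (\<lambda>s. fobj H (X s)) (\<lambda>r. farr H (p r)) (\<lambda>r. farr H (q r)) (fobj H W)
        (\<lambda>s. farr H (\<iota> (e (Inl (Inl s)))))"
      by (rule is_colimit_shape_imp_glueing) simp_all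
  qed
qed

lemma glueing_factor:
  assumes "glueing C S R src tgt X p q W i" "Y \<in> Obj C" "\<And>s. s \<in> S \<Longrightarrow> j s \<in> homs C (X s) Y"
    "\<And>r. r \<in> R \<Longrightarrow> Cmp C (j (src r)) (p r) = Cmp C (j (tgt r)) (q r)"
  obtains h where "h \<in> homs C W Y" "\<And>s. s \<in> S \<Longrightarrow> Cmp C h (i s) = j s"
  using assms unfolding glueing_def glue_cocone_def by blast

lemma glueing_eq:
  assumes g: "glueing C S R src tgt X p q W i" and C: "category C"
    and st: "\<And>r. r \<in> R \<Longrightarrow> src r \<in> S" "\<And>r. r \<in> R \<Longrightarrow> tgt r \<in> S"
    and p: "\<And>r. r \<in> R \<Longrightarrow> p r \<in> homs C (Z r) (X (src r))" "\<And>r. r \<in> R \<Longrightarrow> q r \<in> homs C (Z r) (X (tgt r))"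
    and h: "h \<in> homs C W Y" "h' \<in> homs C W Y" and e: "\<And>s. s \<in> S \<Longrightarrow> Cmp C h (i s) = Cmp C h' (i s)"
  shows "h = h'"
proof -
  have W: "W \<in> Obj C" "\<And>s. s \<in> S \<Longrightarrow> i s \<in> homs C (X s) W"
    "\<And>r. r \<in> R \<Longrightarrow> Cmp C (i (src r)) (p r) = Cmp C (i (tgt r)) (q r)"
    using g by (auto simp: glueing_def glue_cocone_def)
  have a: "Cmp C (Cmp C h' (i (src r))) (p r) = Cmp C (Cmp C h' (i (tgt r))) (q r)" if "r \<in> R" for r
    using W(3)[OF that] homsD[OF W(2)[OF st(1)[OF that]]] homsD[OF W(2)[OF st(2)[OF that]]]
      homsD[OF p(1)[OF that]] homsD[OF p(2)[OF that]] C homsD[OF h(2)] by simp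
  have "glue_cocone C S R src tgt X p q Y (\<lambda>s. Cmp C h' (i s))"
    unfolding glue_cocone_def using W h C a by (auto simp: in_homs_iff)
  then have "\<exists>!h. h \<in> homs C W Y \<and> (\<forall>s\<in>S. Cmp C h (i s) = Cmp C h' (i s))"
    using g unfolding glueing_def by blast
  then show ?thesis using h e by blast
qed

section \<open>Linear categories\<close>

lemma hom_space_simps [simp]:
  "carrier (hom_space C X Y) = homs C X Y"
  "zero (hom_space C X Y) = HZero C X Y"
  "add (hom_space C X Y) = HAdd C"
  "smult (hom_space C X Y) = HScale C"
  by (auto simp: hom_space_def)

lemma linear_category_category: "linear_category k C \<Longrightarrow> category C"
  by (simp add: linear_category_def)

context
  fixes k :: "'s ring" and C :: "('o, 'a, 's) lincat"
  assumes L: "linear_category k C"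
begin

lemma hom_space_module: "X \<in> Obj C \<Longrightarrow> Y \<in> Obj C \<Longrightarrow> module k (hom_space C X Y)"
  using L by (auto simp: linear_category_def)

lemma HAdd_homs:
  assumes "f \<in> homs C X Y" "g \<in> homs C X Y" shows "HAdd C f g \<in> homs C X Y"
proof -
  have "X \<in> Obj C" "Y \<in> Obj C" using assms linear_category_category[OF L] by (auto simp: in_homs_iff)
  then interpret module k "hom_space C X Y" by (rule hom_space_module)
  show ?thesis using M.add.m_closed[of f g] assms by simp
qed

lemma HScale_homs:
  assumes "f \<in> homs C X Y" "a \<in> carrier k" shows "HScale C a f \<in> homs C X Y"
proof -
  have "X \<in> Obj C" "Y \<in> Obj C" using assms linear_category_category[OF L] by (auto simp: in_homs_iff)
  then interpret module k "hom_space C X Y" by (rule hom_space_module)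
  show ?thesis using smult_closed[of a f] assms by simp
qed

lemma HZero_homs:
  assumes "X \<in> Obj C" "Y \<in> Obj C" shows "HZero C X Y \<in> homs C X Y"
proof -
  interpret module k "hom_space C X Y" using assms by (rule hom_space_module)
  show ?thesis using M.zero_closed by simp
qed

lemma HAdd_arr [simp]:
  assumes "f \<in> Arr C" "g \<in> Arr C" "Dom C f = Dom C g" "Cod C f = Cod C g"
  shows "HAdd C f g \<in> Arr C" "Dom C (HAdd C f g) = Dom C g" "Cod C (HAdd C f g) = Cod C g"
  using HAdd_homs[of f "Dom C g" "Cod C g" g] assms by (auto simp: in_homs_iff)

lemma HScale_arr [simp]:
  assumes "f \<in> Arr C" "a \<in> carrier k"
  shows "HScale C a f \<in> Arr C" "Dom C (HScale C a f) = Dom C f" "Cod C (HScale C a f) = Cod C f"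
  using HScale_homs[of f "Dom C f" "Cod C f" a] assms by (auto simp: in_homs_iff)

lemma Cmp_HAdd_right:
  assumes "f \<in> Arr C" "f' \<in> Arr C" "g \<in> Arr C" "Dom C f = Dom C f'" "Cod C f = Dom C g" "Cod C f' = Dom C g"
  shows "Cmp C g (HAdd C f f') = HAdd C (Cmp C g f) (Cmp C g f')"
proof -
  have "Dom C f \<in> Obj C" "Dom C g \<in> Obj C" "Cod C g \<in> Obj C" "f \<in> homs C (Dom C f) (Dom C g)"
    "f' \<in> homs C (Dom C f) (Dom C g)" "g \<in> homs C (Dom C g) (Cod C g)"
    using assms linear_category_category[OF L] by (auto simp: in_homs_iff)
  then show ?thesis using L unfolding linear_category_def by blast
qed

lemma Cmp_HAdd_left:
  assumes "f \<in> Arr C" "g' \<in> Arr C" "g \<in> Arr C" "Dom C g' = Dom C g" "Cod C g' = Cod C g" "Cod C f = Dom C g"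
  shows "Cmp C (HAdd C g g') f = HAdd C (Cmp C g f) (Cmp C g' f)"
proof -
  have "Dom C f \<in> Obj C" "Dom C g \<in> Obj C" "Cod C g \<in> Obj C" "f \<in> homs C (Dom C f) (Dom C g)"
    "g' \<in> homs C (Dom C g) (Cod C g)" "g \<in> homs C (Dom C g) (Cod C g)"
    using assms linear_category_category[OF L] by (auto simp: in_homs_iff)
  then show ?thesis using L unfolding linear_category_def by blast
qed

lemma Cmp_HScale:
  assumes "f \<in> Arr C" "g \<in> Arr C" "Cod C f = Dom C g" "a \<in> carrier k"
  shows "Cmp C g (HScale C a f) = HScale C a (Cmp C g f)" "Cmp C (HScale C a g) f = HScale C a (Cmp C g f)"
proof -
  have "Dom C f \<in> Obj C" "Dom C g \<in> Obj C" "Cod C g \<in> Obj C" "f \<in> homs C (Dom C f) (Dom C g)"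
    "g \<in> homs C (Dom C g) (Cod C g)"
    using assms linear_category_category[OF L] by (auto simp: in_homs_iff)
  then show "Cmp C g (HScale C a f) = HScale C a (Cmp C g f)" "Cmp C (HScale C a g) f = HScale C a (Cmp C g f)"
    using assms L unfolding linear_category_def by blast+
qed

end

lemma linear_functorD:
  assumes "linear_functor k C D F"
  shows "linear_category k C" "linear_category k D" "is_functor C D F"
    "f \<in> Arr C \<Longrightarrow> g \<in> Arr C \<Longrightarrow> Dom C f = Dom C g \<Longrightarrow> Cod C f = Cod C g \<Longrightarrow> farr F (HAdd C f g) = HAdd D (farr F f) (farr F g)"
    "f \<in> Arr C \<Longrightarrow> a \<in> carrier k \<Longrightarrow> farr F (HScale C a f) = HScale D a (farr F f)"
proof -
  show L: "linear_category k C" "linear_category k D" "is_functor C D F"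
    using assms by (auto simp: linear_functor_def)
  have C: "category C" using linear_category_category L by blast
  show "farr F (HAdd C f g) = HAdd D (farr F f) (farr F g)"
    if "f \<in> Arr C" "g \<in> Arr C" "Dom C f = Dom C g" "Cod C f = Cod C g"
  proof -
    have "Dom C g \<in> Obj C" "Cod C g \<in> Obj C" "f \<in> homs C (Dom C g) (Cod C g)" "g \<in> homs C (Dom C g) (Cod C g)"
      using that C by (auto simp: in_homs_iff)
    then show ?thesis using assms unfolding linear_functor_def by blast
  qed
  show "farr F (HScale C a f) = HScale D a (farr F f)" if "f \<in> Arr C" "a \<in> carrier k"
  proof -
    have "Dom C f \<in> Obj C" "Cod C f \<in> Obj C" "f \<in> homs C (Dom C f) (Cod C f)"
      using that C by (auto simp: in_homs_iff)
    then show ?thesis using assms that unfolding linear_functor_def by blast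
  qed
qed

lemma linear_functorI:
  assumes "linear_category k C" "linear_category k D" "is_functor C D F"
    "\<And>f g. f \<in> Arr C \<Longrightarrow> g \<in> Arr C \<Longrightarrow> Dom C f = Dom C g \<Longrightarrow> Cod C f = Cod C g \<Longrightarrow> farr F (HAdd C f g) = HAdd D (farr F f) (farr F g)"
    "\<And>f a. f \<in> Arr C \<Longrightarrow> a \<in> carrier k \<Longrightarrow> farr F (HScale C a f) = HScale D a (farr F f)"
  shows "linear_functor k C D F"
  using assms unfolding linear_functor_def by (auto simp: in_homs_iff)

lemma linear_functor_comp_fun:
  assumes F: "linear_functor k C D F" and G: "linear_functor k D E G"
  shows "linear_functor k C E (comp_fun G F)"
proof (rule linear_functorI)
  show "linear_category k C" "linear_category k E" using linear_functorD F G by blast+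
  note FF = linear_functorD(3)[OF F]
  show "is_functor C E (comp_fun G F)" using FF linear_functorD(3)[OF G] by (rule is_functor_comp_fun)
qed (use linear_functorD(4,5)[OF F] linear_functorD(4,5)[OF G] functor_arr[OF linear_functorD(3)[OF F]] in auto)

lemma linear_functor_cong:
  assumes F: "linear_functor k C D F" "\<And>X. X \<in> Obj C \<Longrightarrow> fobj G X = fobj F X" "\<And>f. f \<in> Arr C \<Longrightarrow> farr G f = farr F f"
  shows "linear_functor k C D G"
  using linear_functorD[OF F(1)] is_functor_cong[OF _ F(2,3)] F(3)
  by (intro linear_functorI) auto

lemma cocontinuousD:
  assumes "cocontinuous k C D F"
  shows "linear_functor k C D F" "linear_category k C" "linear_category k D" "is_functor C D F" "category C" "category D"
  using assms linear_functorD[of k C D F] linear_category_category by (auto simp: cocontinuous_def)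

lemma cocontinuous_colimit:
  fixes C :: "('o, 'a, 'u) lincat" and J :: "('u, 'u) cat"
  assumes "cocontinuous k C D F" "small_category J" "is_colimit J C E X \<iota>"
  shows "is_colimit J D (comp_fun F E) (fobj F X) (\<lambda>j. farr F (\<iota> j))"
  using assms preserves_colimitsD[where P = "\<lambda>_. True"] by (auto simp: cocontinuous_def)

lemma cocontinuousI:
  fixes C :: "('o, 'a, 'u) lincat"
  assumes "linear_functor k C D F"
    and "\<And>(J :: ('u, 'u) cat) E X \<iota>. small_category J \<Longrightarrow> is_colimit J C E X \<iota> \<Longrightarrow>
      is_colimit J D (comp_fun F E) (fobj F X) (\<lambda>j. farr F (\<iota> j))"
  shows "cocontinuous k C D F"
  using assms by (auto simp: cocontinuous_def preserves_colimits_def)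

lemma cocontinuous_comp_fun:
  assumes F: "cocontinuous k C D F" and G: "cocontinuous k D E G"
  shows "cocontinuous k C E (comp_fun G F)"
  using F G linear_functor_comp_fun preserves_colimits_comp_fun by (auto simp: cocontinuous_def)

lemma cocontinuous_cong:
  assumes F: "cocontinuous k C D F" "\<And>X. X \<in> Obj C \<Longrightarrow> fobj G X = fobj F X" "\<And>f. f \<in> Arr C \<Longrightarrow> farr G f = farr F f"
  shows "cocontinuous k C D G"
  using F linear_functor_cong[OF _ F(2,3)] preserves_colimits_nat_iso[OF nat_iso_cong[OF _ F(2,3)]] cocontinuousD(4)
  unfolding cocontinuous_def by blast

lemma bicocontinuousD:
  assumes "bicocontinuous k C D E F"
  shows "is_functor (prod_cat C D) E F" "X \<in> Obj C \<Longrightarrow> cocontinuous k D E (fix_left C F X)"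
    "Y \<in> Obj D \<Longrightarrow> cocontinuous k C E (fix_right D F Y)"
  using assms by (auto simp: bicocontinuous_def)

section \<open>Vector spaces\<close>

definition ap :: "'u vmap \<Rightarrow> 'u \<Rightarrow> 'u" where "ap f = snd (snd f)"

definition lin :: "'u ring \<Rightarrow> 'u vs \<Rightarrow> 'u vs \<Rightarrow> ('u \<Rightarrow> 'u) \<Rightarrow> bool" where
  "lin k V W f \<longleftrightarrow> (\<forall>x\<in>carrier V. f x \<in> carrier W) \<and>
     (\<forall>x\<in>carrier V. \<forall>y\<in>carrier V. f (x \<oplus>\<^bsub>V\<^esub> y) = f x \<oplus>\<^bsub>W\<^esub> f y) \<and>
     (\<forall>a\<in>carrier k. \<forall>x\<in>carrier V. f (a \<odot>\<^bsub>V\<^esub> x) = a \<odot>\<^bsub>W\<^esub> f x)"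

definition vmk :: "'u vs \<Rightarrow> 'u vs \<Rightarrow> ('u \<Rightarrow> 'u) \<Rightarrow> 'u vmap" where
  "vmk V W f = (V, W, restrict f (carrier V))"

lemma linI:
  assumes "\<And>x. x \<in> carrier V \<Longrightarrow> f x \<in> carrier W"
    "\<And>x y. x \<in> carrier V \<Longrightarrow> y \<in> carrier V \<Longrightarrow> f (x \<oplus>\<^bsub>V\<^esub> y) = f x \<oplus>\<^bsub>W\<^esub> f y"
    "\<And>a x. a \<in> carrier k \<Longrightarrow> x \<in> carrier V \<Longrightarrow> f (a \<odot>\<^bsub>V\<^esub> x) = a \<odot>\<^bsub>W\<^esub> f x"
  shows "lin k V W f"
  using assms by (auto simp: lin_def)

lemma linD:
  assumes "lin k V W f"
  shows "x \<in> carrier V \<Longrightarrow> f x \<in> carrier W"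
    "x \<in> carrier V \<Longrightarrow> y \<in> carrier V \<Longrightarrow> f (x \<oplus>\<^bsub>V\<^esub> y) = f x \<oplus>\<^bsub>W\<^esub> f y"
    "a \<in> carrier k \<Longrightarrow> x \<in> carrier V \<Longrightarrow> f (a \<odot>\<^bsub>V\<^esub> x) = a \<odot>\<^bsub>W\<^esub> f x"
  using assms by (auto simp: lin_def)

lemma Obj_Vect: "V \<in> Obj (Vect k) \<longleftrightarrow> module k V \<and> small (carrier V)"
  by (simp add: Vect_def)

lemma module_Vect: "V \<in> Obj (Vect k) \<Longrightarrow> module k V"
  by (simp add: Obj_Vect)

lemma module_add_closed:
  assumes "module k V" "x \<in> carrier V" "y \<in> carrier V" shows "x \<oplus>\<^bsub>V\<^esub> y \<in> carrier V"
proof -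
  interpret module k V by fact
  show ?thesis using assms by simp
qed

lemma module_smult_closed:
  assumes "module k V" "a \<in> carrier k" "x \<in> carrier V" shows "a \<odot>\<^bsub>V\<^esub> x \<in> carrier V"
  using assms module.smult_closed by metis

lemma Vect_closed [simp]:
  assumes "V \<in> Obj (Vect k)" "x \<in> carrier V"
  shows "y \<in> carrier V \<Longrightarrow> x \<oplus>\<^bsub>V\<^esub> y \<in> carrier V" "a \<in> carrier k \<Longrightarrow> a \<odot>\<^bsub>V\<^esub> x \<in> carrier V"
  using assms module_Vect module_add_closed module_smult_closed by metis+

lemma lin_zero:
  assumes V: "module k V" "module k W" and f: "lin k V W f"
  shows "f \<zero>\<^bsub>V\<^esub> = \<zero>\<^bsub>W\<^esub>"
proof -
  interpret V: module k V by fact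
  interpret W: module k W by fact
  have "f \<zero>\<^bsub>V\<^esub> = f (\<zero>\<^bsub>k\<^esub> \<odot>\<^bsub>V\<^esub> \<zero>\<^bsub>V\<^esub>)" by (subst V.smult_l_null) auto
  also have "\<dots> = \<zero>\<^bsub>k\<^esub> \<odot>\<^bsub>W\<^esub> f \<zero>\<^bsub>V\<^esub>" by (rule linD(3)[OF f]) auto
  also have "\<dots> = \<zero>\<^bsub>W\<^esub>" using linD(1)[OF f, of "\<zero>\<^bsub>V\<^esub>"] by simp
  finally show ?thesis .
qed

lemma Vect_homs_iff:
  "F \<in> homs (Vect k) V W \<longleftrightarrow> V \<in> Obj (Vect k) \<and> W \<in> Obj (Vect k) \<and>
     fst F = V \<and> fst (snd F) = W \<and> lin k V W (ap F) \<and> ap F \<in> extensional (carrier V)"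
  by (auto simp: homs_def Vect_def linear_maps_def lin_def ap_def PiE_def Pi_def split: prod.splits)

lemma Vect_homsD:
  assumes "F \<in> homs (Vect k) V W"
  shows "V \<in> Obj (Vect k)" "W \<in> Obj (Vect k)" "lin k V W (ap F)"
  using assms by (auto simp: Vect_homs_iff)

lemma vmk_homs: "V \<in> Obj (Vect k) \<Longrightarrow> W \<in> Obj (Vect k) \<Longrightarrow> lin k V W f \<Longrightarrow> vmk V W f \<in> homs (Vect k) V W"
  by (auto simp: Vect_homs_iff vmk_def ap_def lin_def module_add_closed module_smult_closed Obj_Vect)

lemma ap_vmk [simp]: "x \<in> carrier V \<Longrightarrow> ap (vmk V W f) x = f x"
  by (simp add: ap_def vmk_def)

lemma Vect_arr_eqI:
  assumes "F \<in> homs (Vect k) V W" "G \<in> homs (Vect k) V W" "\<And>x. x \<in> carrier V \<Longrightarrow> ap F x = ap G x"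
  shows "F = G"
proof -
  have "ap F = ap G" using assms by (intro extensionalityI[of _ "carrier V"]) (auto simp: Vect_homs_iff)
  then show ?thesis using assms(1,2) by (auto simp: Vect_homs_iff ap_def prod_eq_iff)
qed

lemma Cmp_Vect: "Cmp (Vect k) G F = vmk (fst F) (fst (snd G)) (\<lambda>x. ap G (ap F x))"
  by (auto simp: Vect_def vmk_def ap_def split: prod.splits)

lemma Idt_Vect: "Idt (Vect k) V = vmk V V (\<lambda>x. x)"
  by (auto simp: Vect_def vmk_def)

lemma HAdd_Vect: "HAdd (Vect k) F G = vmk (fst F) (fst (snd F)) (\<lambda>x. ap F x \<oplus>\<^bsub>fst (snd F)\<^esub> ap G x)"
  by (auto simp: Vect_def vmk_def ap_def split: prod.splits)

lemma HScale_Vect: "HScale (Vect k) a F = vmk (fst F) (fst (snd F)) (\<lambda>x. a \<odot>\<^bsub>fst (snd F)\<^esub> ap F x)"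
  by (auto simp: Vect_def vmk_def ap_def split: prod.splits)

lemma HZero_Vect: "HZero (Vect k) V W = vmk V W (\<lambda>x. \<zero>\<^bsub>W\<^esub>)"
  by (auto simp: Vect_def vmk_def)

lemma Dom_Vect [simp]: "Dom (Vect k) F = fst F" "Cod (Vect k) F = fst (snd F)"
  by (auto simp: Vect_def split: prod.splits)

lemma fst_vmk [simp]: "fst (vmk V W f) = V" "fst (snd (vmk V W f)) = W"
  by (auto simp: vmk_def)

lemma Arr_Vect_iff: "F \<in> Arr (Vect k) \<longleftrightarrow> F \<in> homs (Vect k) (fst F) (fst (snd F))"
  by (auto simp: in_homs_iff)

lemma lin_comp: "lin k U V f \<Longrightarrow> lin k V W g \<Longrightarrow> lin k U W (\<lambda>x. g (f x))"
  by (auto simp: lin_def)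

lemma lin_id: "lin k V V (\<lambda>x. x)"
  by (auto simp: lin_def)

lemma lin_add:
  assumes "module k W" "lin k V W f" "lin k V W g"
  shows "lin k V W (\<lambda>x. f x \<oplus>\<^bsub>W\<^esub> g x)"
proof -
  interpret W: module k W by fact
  show ?thesis using linD[OF assms(2)] linD[OF assms(3)]
    by (intro linI) (auto simp: W.smult_r_distr W.M.a_ac)
qed

lemma lin_smult:
  assumes "module k W" "lin k V W f" "a \<in> carrier k"
  shows "lin k V W (\<lambda>x. a \<odot>\<^bsub>W\<^esub> f x)"
proof -
  interpret W: module k W by fact
  show ?thesis using linD[OF assms(2)] assms(3)
    by (intro linI) (auto simp: W.smult_r_distr W.smult_assoc1[symmetric] W.R.m_comm)
qed

lemma Cmp_Vect_homs:
  assumes "F \<in> homs (Vect k) U V" "G \<in> homs (Vect k) V W"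
  shows "Cmp (Vect k) G F \<in> homs (Vect k) U W" "x \<in> carrier U \<Longrightarrow> ap (Cmp (Vect k) G F) x = ap G (ap F x)"
  using assms lin_comp[of k U V "ap F" W "ap G"] unfolding Cmp_Vect
  by (auto simp: Vect_homs_iff[of F] Vect_homs_iff[of G] intro!: vmk_homs)

lemma Idt_Vect_homs: "V \<in> Obj (Vect k) \<Longrightarrow> Idt (Vect k) V \<in> homs (Vect k) V V"
  unfolding Idt_Vect by (intro vmk_homs lin_id)

lemma Cmp_Vect_Idt:
  assumes F: "F \<in> homs (Vect k) V W"
  shows "Cmp (Vect k) F (Idt (Vect k) V) = F" "Cmp (Vect k) (Idt (Vect k) W) F = F"
proof -
  note I = Idt_Vect_homs[OF Vect_homsD(1)[OF F]] Idt_Vect_homs[OF Vect_homsD(2)[OF F]]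
  have cl: "ap F x \<in> carrier W" if "x \<in> carrier V" for x using linD(1)[OF Vect_homsD(3)[OF F]] that .
  show "Cmp (Vect k) F (Idt (Vect k) V) = F"
    by (rule Vect_arr_eqI[OF Cmp_Vect_homs(1)[OF I(1) F] F]) (simp add: Cmp_Vect_homs(2)[OF I(1) F], simp add: Idt_Vect)
  show "Cmp (Vect k) (Idt (Vect k) W) F = F"
    by (rule Vect_arr_eqI[OF Cmp_Vect_homs(1)[OF F I(2)] F]) (simp add: Cmp_Vect_homs(2)[OF F I(2)], simp add: Idt_Vect cl)
qed

lemma Cmp_Vect_assoc:
  assumes F: "F \<in> homs (Vect k) U V" and G: "G \<in> homs (Vect k) V W" and H: "H \<in> homs (Vect k) W Z"
  shows "Cmp (Vect k) H (Cmp (Vect k) G F) = Cmp (Vect k) (Cmp (Vect k) H G) F"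
proof (rule Vect_arr_eqI)
  note GF = Cmp_Vect_homs[OF F G] and HG = Cmp_Vect_homs[OF G H]
  show "Cmp (Vect k) H (Cmp (Vect k) G F) \<in> homs (Vect k) U Z" "Cmp (Vect k) (Cmp (Vect k) H G) F \<in> homs (Vect k) U Z"
    using Cmp_Vect_homs(1)[OF GF(1) H] Cmp_Vect_homs(1)[OF F HG(1)] .
  show "ap (Cmp (Vect k) H (Cmp (Vect k) G F)) x = ap (Cmp (Vect k) (Cmp (Vect k) H G) F) x" if "x \<in> carrier U" for x
    using that GF HG Cmp_Vect_homs(2)[OF GF(1) H] Cmp_Vect_homs(2)[OF F HG(1)] linD(1)[OF Vect_homsD(3)[OF F]]
    by simp
qed

lemma category_Vect: "category (Vect k)"
  unfolding category_def
proof (intro conjI ballI)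
  fix F assume "F \<in> Arr (Vect k)"
  then have "F \<in> homs (Vect k) (Dom (Vect k) F) (Cod (Vect k) F)" by (auto simp: in_homs_iff)
  then show "Dom (Vect k) F \<in> Obj (Vect k)" "Cod (Vect k) F \<in> Obj (Vect k)"
    using Vect_homsD by blast+
qed (rule Idt_Vect_homs Cmp_Vect_homs(1) Cmp_Vect_Idt Cmp_Vect_assoc; assumption)+

lemma Vect_arr [simp]:
  assumes "F \<in> Arr (Vect k)"
  shows "x \<in> carrier (fst F) \<Longrightarrow> ap F x \<in> carrier (fst (snd F))"
    "x \<in> carrier (fst F) \<Longrightarrow> y \<in> carrier (fst F) \<Longrightarrow> ap F (x \<oplus>\<^bsub>fst F\<^esub> y) = ap F x \<oplus>\<^bsub>fst (snd F)\<^esub> ap F y"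
    "a \<in> carrier k \<Longrightarrow> x \<in> carrier (fst F) \<Longrightarrow> ap F (a \<odot>\<^bsub>fst F\<^esub> x) = a \<odot>\<^bsub>fst (snd F)\<^esub> ap F x"
    "fst F \<in> Obj (Vect k)" "fst (snd F) \<in> Obj (Vect k)"
  using assms by (auto simp: Arr_Vect_iff Vect_homs_iff lin_def)

lemma ap_Cmp [simp]:
  "x \<in> carrier (fst F) \<Longrightarrow> ap (Cmp (Vect k) G F) x = ap G (ap F x)"
  by (simp add: Cmp_Vect)

lemma ap_Idt [simp]: "x \<in> carrier V \<Longrightarrow> ap (Idt (Vect k) V) x = x"
  by (simp add: Idt_Vect)

lemma linear_category_Vect:
  assumes k: "field k" shows "linear_category k (Vect k)"
proof -
  have modules: "module k (hom_space (Vect k) V W)" if V: "V \<in> Obj (Vect k)" and W: "W \<in> Obj (Vect k)" for V W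
  proof -
    interpret W: module k W using module_Vect[OF W] .
    have add: "HAdd (Vect k) F G \<in> homs (Vect k) V W" "x \<in> carrier V \<Longrightarrow> ap (HAdd (Vect k) F G) x = ap F x \<oplus>\<^bsub>W\<^esub> ap G x"
      if "F \<in> homs (Vect k) V W" "G \<in> homs (Vect k) V W" for F G x
      using that lin_add[OF module_Vect[OF W], of V "ap F" "ap G"] unfolding HAdd_Vect
      by (auto simp: Vect_homs_iff[of F] Vect_homs_iff[of G] intro!: vmk_homs)
    have sc: "HScale (Vect k) a F \<in> homs (Vect k) V W" "x \<in> carrier V \<Longrightarrow> ap (HScale (Vect k) a F) x = a \<odot>\<^bsub>W\<^esub> ap F x"
      if "F \<in> homs (Vect k) V W" "a \<in> carrier k" for F a x
      using that lin_smult[OF module_Vect[OF W], of V "ap F" a] unfolding HScale_Vect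
      by (auto simp: Vect_homs_iff[of F] intro!: vmk_homs)
    have z: "HZero (Vect k) V W \<in> homs (Vect k) V W" "x \<in> carrier V \<Longrightarrow> ap (HZero (Vect k) V W) x = \<zero>\<^bsub>W\<^esub>" for x
      unfolding HZero_Vect using V W by (auto intro!: vmk_homs simp: lin_def)
    have cl: "ap F x \<in> carrier W" if "F \<in> homs (Vect k) V W" "x \<in> carrier V" for F x
      using that by (auto simp: Vect_homs_iff lin_def)
    \<comment> \<open>The additive inverse is the multiple by the scalar -1, since the records for
      vector spaces have no field for negation.\<close>
    have inv: "\<exists>G\<in>homs (Vect k) V W. HAdd (Vect k) G F = HZero (Vect k) V W" if F: "F \<in> homs (Vect k) V W" for F
    proof -
      have m: "\<ominus>\<^bsub>k\<^esub> \<one>\<^bsub>k\<^esub> \<in> carrier k" by simp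
      let ?G = "HScale (Vect k) (\<ominus>\<^bsub>k\<^esub> \<one>\<^bsub>k\<^esub>) F"
      have "HAdd (Vect k) ?G F = HZero (Vect k) V W"
        using F m by (intro Vect_arr_eqI[OF add(1) z(1)] sc)
          (auto simp: add sc z cl W.smult_l_minus W.M.l_neg)
      then show ?thesis using sc(1)[OF F m] by blast
    qed
    show ?thesis
    proof (rule moduleI)
      show "abelian_group (hom_space (Vect k) V W)"
        by (rule abelian_groupI)
          (auto simp: add z cl W.M.a_ac inv intro!: Vect_arr_eqI[of _ k V W])
    qed (auto simp: W.R.is_cring add sc cl W.smult_l_distr W.smult_r_distr W.smult_assoc1 intro!: Vect_arr_eqI[of _ k V W])
  qed
  have dist: "Cmp (Vect k) G (HAdd (Vect k) F F') = HAdd (Vect k) (Cmp (Vect k) G F) (Cmp (Vect k) G F')"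
    if "F \<in> homs (Vect k) U V" "F' \<in> homs (Vect k) U V" "G \<in> homs (Vect k) V W" for F F' G U V W
    using that unfolding Cmp_Vect HAdd_Vect
    by (auto simp: Vect_homs_iff lin_def vmk_def ap_def intro!: restrict_ext)
  have dist': "Cmp (Vect k) (HAdd (Vect k) G G') F = HAdd (Vect k) (Cmp (Vect k) G F) (Cmp (Vect k) G' F)"
    if "F \<in> homs (Vect k) U V" "G \<in> homs (Vect k) V W" "G' \<in> homs (Vect k) V W" for F G G' U V W
    using that unfolding Cmp_Vect HAdd_Vect
    by (auto simp: Vect_homs_iff lin_def vmk_def ap_def intro!: restrict_ext)
  have sc: "Cmp (Vect k) G (HScale (Vect k) a F) = HScale (Vect k) a (Cmp (Vect k) G F)"
    "Cmp (Vect k) (HScale (Vect k) a G) F = HScale (Vect k) a (Cmp (Vect k) G F)"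
    if "F \<in> homs (Vect k) U V" "G \<in> homs (Vect k) V W" "a \<in> carrier k" for F G U V W a
    using that unfolding Cmp_Vect HScale_Vect
    by (auto simp: Vect_homs_iff lin_def vmk_def ap_def intro!: restrict_ext)
  show ?thesis unfolding linear_category_def
    by (intro conjI ballI k category_Vect modules; (rule dist dist' sc)?; assumption)
qed

lemma unit_space_Obj:
  assumes "field k" "small (carrier k)" shows "unit_space k \<in> Obj (Vect k)"
proof -
  interpret field k by fact
  have "module k (unit_space k)"
  proof (rule moduleI)
    show "abelian_group (unit_space k)"
    proof (rule abelian_groupI)
      show "\<exists>y\<in>carrier (unit_space k). y \<oplus>\<^bsub>unit_space k\<^esub> x = \<zero>\<^bsub>unit_space k\<^esub>"
        if "x \<in> carrier (unit_space k)" for x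
        using that l_neg[of x] a_inv_closed[of x] by (auto simp: unit_space_def)
    qed (auto simp: unit_space_def a_ac)
  qed (auto simp: unit_space_def is_cring l_distr r_distr m_assoc)
  then show ?thesis using assms by (simp add: Obj_Vect unit_space_def)
qed

lemma hom_space_Obj:
  "linear_category k C \<Longrightarrow> locally_small C \<Longrightarrow> X \<in> Obj C \<Longrightarrow> Y \<in> Obj C \<Longrightarrow> hom_space C X Y \<in> Obj (Vect k)"
  by (auto simp: Obj_Vect hom_space_module locally_small_def)

text \<open>With \<open>Vect_colimit_eq\<close> and \<open>Vect_is_colimitI\<close>, this allows
  cocones in \<open>Vect\<close> to be treated as compatible families of linear functions on
  elements.\<close>

lemma Vect_colimit_factor:
  assumes l: "is_colimit J (Vect k) E V \<iota>" and W: "W \<in> Obj (Vect k)"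
    and t: "\<And>j. j \<in> Obj J \<Longrightarrow> lin k (fobj E j) W (t j)"
    and c: "\<And>u x. u \<in> Arr J \<Longrightarrow> x \<in> carrier (fobj E (Dom J u)) \<Longrightarrow> t (Cod J u) (ap (farr E u) x) = t (Dom J u) x"
  obtains h where "lin k V W h" "\<And>j x. j \<in> Obj J \<Longrightarrow> x \<in> carrier (fobj E j) \<Longrightarrow> h (ap (\<iota> j) x) = t j x"
proof -
  note co = is_colimit_cocone[OF l]
  note E = is_coconeD(1)[OF co]
  have J: "category J" using is_functor_category(1)[OF E] .
  have co': "is_cocone J (Vect k) E W (\<lambda>j. vmk (fobj E j) W (t j))"
  proof (rule is_coconeI[OF E W])
    show v: "vmk (fobj E j) W (t j) \<in> homs (Vect k) (fobj E j) W" if "j \<in> Obj J" for j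
      using that functor_Obj[OF E] W t by (intro vmk_homs)
    fix u assume u: "u \<in> Arr J"
    have a: "farr E u \<in> homs (Vect k) (fobj E (Dom J u)) (fobj E (Cod J u))"
      using functor_arr[OF E u] by (simp add: in_homs_iff)
    show "Cmp (Vect k) (vmk (fobj E (Cod J u)) W (t (Cod J u))) (farr E u) = vmk (fobj E (Dom J u)) W (t (Dom J u))"
    proof (rule Vect_arr_eqI)
      show "Cmp (Vect k) (vmk (fobj E (Cod J u)) W (t (Cod J u))) (farr E u) \<in> homs (Vect k) (fobj E (Dom J u)) W"
        using Cmp_Vect_homs(1)[OF a v] J u by simp
      show "vmk (fobj E (Dom J u)) W (t (Dom J u)) \<in> homs (Vect k) (fobj E (Dom J u)) W"
        using v J u by simp
    qed (use a c[OF u] linD(1)[OF Vect_homsD(3)[OF a]] in \<open>auto simp: Vect_homs_iff\<close>)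
  qed
  obtain h where h: "h \<in> homs (Vect k) V W" "\<And>j. j \<in> Obj J \<Longrightarrow> Cmp (Vect k) h (\<iota> j) = vmk (fobj E j) W (t j)"
    using is_colimit_factor[OF l co'] by blast
  show thesis
  proof (rule that[of "ap h"])
    show "lin k V W (ap h)" using Vect_homsD(3)[OF h(1)] .
    fix j x assume j: "j \<in> Obj J" and x: "x \<in> carrier (fobj E j)"
    have "ap h (ap (\<iota> j) x) = ap (Cmp (Vect k) h (\<iota> j)) x"
      using is_coconeD(4)[OF co j] x by simp
    then show "ap h (ap (\<iota> j) x) = t j x" using h(2)[OF j] x by simp
  qed
qed

lemma Vect_colimit_eq:
  assumes l: "is_colimit J (Vect k) E V \<iota>" and h: "lin k V W h" "lin k V W h'" and W: "W \<in> Obj (Vect k)"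
    and e: "\<And>j x. j \<in> Obj J \<Longrightarrow> x \<in> carrier (fobj E j) \<Longrightarrow> h (ap (\<iota> j) x) = h' (ap (\<iota> j) x)"
    and x: "x \<in> carrier V"
  shows "h x = h' x"
proof -
  note co = is_colimit_cocone[OF l]
  have V: "V \<in> Obj (Vect k)" using is_coconeD(2)[OF co] .
  have "vmk V W h = vmk V W h'"
  proof (rule is_colimit_eq[OF l])
    show vh: "vmk V W h \<in> homs (Vect k) V W" "vmk V W h' \<in> homs (Vect k) V W" using V W h by (auto intro: vmk_homs)
    fix j assume j: "j \<in> Obj J"
    have i: "\<iota> j \<in> homs (Vect k) (fobj E j) V" using is_coconeD(3-5)[OF co j] by (simp add: in_homs_iff)
    show "Cmp (Vect k) (vmk V W h) (\<iota> j) = Cmp (Vect k) (vmk V W h') (\<iota> j)"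
      by (rule Vect_arr_eqI[OF Cmp_Vect_homs(1)[OF i vh(1)] Cmp_Vect_homs(1)[OF i vh(2)]])
        (use i e[OF j] linD(1)[OF Vect_homsD(3)[OF i]] in \<open>simp add: Vect_homs_iff\<close>)
  qed
  then show ?thesis using x by (metis ap_vmk)
qed

lemma Vect_is_colimitI:
  assumes co: "is_cocone J (Vect k) E V \<iota>"
    and f: "\<And>W t. W \<in> Obj (Vect k) \<Longrightarrow> (\<And>j. j \<in> Obj J \<Longrightarrow> lin k (fobj E j) W (t j)) \<Longrightarrow>
      (\<And>u x. u \<in> Arr J \<Longrightarrow> x \<in> carrier (fobj E (Dom J u)) \<Longrightarrow> t (Cod J u) (ap (farr E u) x) = t (Dom J u) x) \<Longrightarrow>
      \<exists>h. lin k V W h \<and> (\<forall>j\<in>Obj J. \<forall>x\<in>carrier (fobj E j). h (ap (\<iota> j) x) = t j x)"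
    and e: "\<And>W h h' x. W \<in> Obj (Vect k) \<Longrightarrow> lin k V W h \<Longrightarrow> lin k V W h' \<Longrightarrow>
      (\<And>j x. j \<in> Obj J \<Longrightarrow> x \<in> carrier (fobj E j) \<Longrightarrow> h (ap (\<iota> j) x) = h' (ap (\<iota> j) x)) \<Longrightarrow> x \<in> carrier V \<Longrightarrow> h x = h' x"
  shows "is_colimit J (Vect k) E V \<iota>"
proof (rule is_colimitI[OF co])
  have V: "V \<in> Obj (Vect k)" using is_coconeD(2)[OF co] .
  have i: "\<iota> j \<in> homs (Vect k) (fobj E j) V" if "j \<in> Obj J" for j
    using is_coconeD(3-5)[OF co that] by (simp add: in_homs_iff)
  have ic: "fst (\<iota> j) = fobj E j" if "j \<in> Obj J" for j using i[OF that] by (simp add: Vect_homs_iff)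
  {
    fix W \<tau> assume \<tau>: "is_cocone J (Vect k) E W \<tau>"
    note W = is_coconeD(2)[OF \<tau>]
    have t: "\<tau> j \<in> homs (Vect k) (fobj E j) W" if "j \<in> Obj J" for j
      using is_coconeD(3-5)[OF \<tau> that] by (simp add: in_homs_iff)
    have c: "ap (\<tau> (Cod J u)) (ap (farr E u) x) = ap (\<tau> (Dom J u)) x" if "u \<in> Arr J" "x \<in> carrier (fobj E (Dom J u))" for u x
      using is_cocone_Cmp[OF \<tau> that(1)] that functor_arr[OF is_coconeD(1)[OF \<tau>] that(1)] ap_Cmp[of x "farr E u" k "\<tau> (Cod J u)"]
      by simp
    have "\<exists>h. lin k V W h \<and> (\<forall>j\<in>Obj J. \<forall>x\<in>carrier (fobj E j). h (ap (\<iota> j) x) = ap (\<tau> j) x)"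
      by (rule f[OF W]) (use Vect_homsD(3)[OF t] c in auto)
    then obtain h where h: "lin k V W h" "\<And>j x. j \<in> Obj J \<Longrightarrow> x \<in> carrier (fobj E j) \<Longrightarrow> h (ap (\<iota> j) x) = ap (\<tau> j) x"
      by blast
    show "\<exists>h. h \<in> homs (Vect k) V W \<and> (\<forall>j\<in>Obj J. Cmp (Vect k) h (\<iota> j) = \<tau> j)"
    proof (intro exI[of _ "vmk V W h"] conjI ballI)
      show vh: "vmk V W h \<in> homs (Vect k) V W" using V W h by (intro vmk_homs)
      fix j assume j: "j \<in> Obj J"
      show "Cmp (Vect k) (vmk V W h) (\<iota> j) = \<tau> j"
        by (rule Vect_arr_eqI[OF Cmp_Vect_homs(1)[OF i[OF j] vh] t[OF j]])
          (use ic[OF j] h(2)[OF j] linD(1)[OF Vect_homsD(3)[OF i[OF j]]] in simp)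
    qed
  next
    fix W h h' assume h: "h \<in> homs (Vect k) V W" "h' \<in> homs (Vect k) V W" and W: "W \<in> Obj (Vect k)"
      and eq: "\<And>j. j \<in> Obj J \<Longrightarrow> Cmp (Vect k) h (\<iota> j) = Cmp (Vect k) h' (\<iota> j)"
    show "h = h'"
    proof (rule Vect_arr_eqI[OF h], rule e[OF W Vect_homsD(3)[OF h(1)] Vect_homsD(3)[OF h(2)]])
      fix j x assume "j \<in> Obj J" "x \<in> carrier (fobj E j)"
      then show "ap h (ap (\<iota> j) x) = ap h' (ap (\<iota> j) x)"
        using eq[of j] ic[of j] by (metis ap_Cmp)
    qed
  }
qed

lemma hom_functor_simps [simp]:
  "fobj (hom_functor C X) Y = hom_space C X Y"
  "farr (hom_functor C X) g = vmk (hom_space C X (Dom C g)) (hom_space C X (Cod C g)) (\<lambda>f. Cmp C g f)"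
  by (auto simp: hom_functor_def vmk_def)

lemma lin_Cmp_right:
  assumes L: "linear_category k C" and g: "g \<in> homs C Y Z"
  shows "lin k (hom_space C X Y) (hom_space C X Z) (\<lambda>f. Cmp C g f)"
  using linear_category_category[OF L] g
  by (intro linI) (auto simp: in_homs_iff Cmp_HAdd_right[OF L] Cmp_HScale[OF L])

lemma lin_Cmp_left:
  assumes L: "linear_category k C" and g: "g \<in> homs C X Y"
  shows "lin k (hom_space C Y Z) (hom_space C X Z) (\<lambda>f. Cmp C f g)"
  using linear_category_category[OF L] g
  by (intro linI) (auto simp: in_homs_iff Cmp_HAdd_left[OF L] Cmp_HScale[OF L])

lemma is_functor_hom_functor:
  assumes L: "linear_category k C" and ls: "locally_small C" and X: "X \<in> Obj C"
  shows "is_functor C (Vect k) (hom_functor C X)"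
proof (rule is_functorI)
  show C: "category C" using linear_category_category[OF L] .
  show "category (Vect k)" by (rule category_Vect)
  show o: "fobj (hom_functor C X) Y \<in> Obj (Vect k)" if "Y \<in> Obj C" for Y
    using hom_space_Obj[OF L ls X that] by simp
  show a: "farr (hom_functor C X) g \<in> homs (Vect k) (fobj (hom_functor C X) (Dom C g)) (fobj (hom_functor C X) (Cod C g))"
    if "g \<in> Arr C" for g
    unfolding hom_functor_simps
    using that C o[of "Dom C g"] o[of "Cod C g"] lin_Cmp_right[OF L, of g "Dom C g" "Cod C g" X]
    by (intro vmk_homs) (simp_all add: in_homs_iff)
  show "farr (hom_functor C X) (Idt C Y) = Idt (Vect k) (fobj (hom_functor C X) Y)" if Y: "Y \<in> Obj C" for Y
    using a[of "Idt C Y"] Idt_simps[OF C Y] Y C Idt_simps[OF category_Vect o[OF Y]]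
    by (intro Vect_arr_eqI[of _ k "hom_space C X Y" "hom_space C X Y"]) (auto simp: in_homs_iff)
  show "farr (hom_functor C X) (Cmp C g f) = Cmp (Vect k) (farr (hom_functor C X) g) (farr (hom_functor C X) f)"
    if f: "f \<in> Arr C" "g \<in> Arr C" "Cod C f = Dom C g" for f g
  proof (rule Vect_arr_eqI)
    show "farr (hom_functor C X) (Cmp C g f) \<in> homs (Vect k) (hom_space C X (Dom C f)) (hom_space C X (Cod C g))"
      using a[of "Cmp C g f"] f C by simp
    show "Cmp (Vect k) (farr (hom_functor C X) g) (farr (hom_functor C X) f) \<in> homs (Vect k) (hom_space C X (Dom C f)) (hom_space C X (Cod C g))"
      using Cmp_Vect_homs(1)[OF a[OF f(1)]] a[OF f(2)] f by simp
  qed (use f C in \<open>simp add: in_homs_iff\<close>)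
qed

section \<open>Copowers\<close>

text \<open>\<open>W\<close> represents the functor that sends \<open>Y\<close> to the linear maps
  from \<open>V\<close> to \<open>Hom(X, Y)\<close>, and \<open>\<eta>\<close> is the universal such
  map. It is the object \<open>V \<otimes> X\<close> of the module structure of a cocomplete linear
  category over \<open>Vect\<close>.\<close>

definition is_copower :: "'u ring \<Rightarrow> ('u, 'u, 'u) lincat \<Rightarrow> 'u vs \<Rightarrow> 'u \<Rightarrow> 'u \<Rightarrow> ('u \<Rightarrow> 'u) \<Rightarrow> bool" where
  "is_copower k C V X W \<eta> \<longleftrightarrow> W \<in> Obj C \<and> lin k V (hom_space C X W) \<eta> \<and>
     (\<forall>Y m. Y \<in> Obj C \<and> lin k V (hom_space C X Y) m \<longrightarrow>
        (\<exists>h\<in>homs C W Y. \<forall>v\<in>carrier V. Cmp C h (\<eta> v) = m v)) \<and>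
     (\<forall>Y h h'. h \<in> homs C W Y \<and> h' \<in> homs C W Y \<and> (\<forall>v\<in>carrier V. Cmp C h (\<eta> v) = Cmp C h' (\<eta> v)) \<longrightarrow> h = h')"

locale linear_cocomplete =
  fixes k :: "'u ring" and C :: "('u, 'u, 'u) lincat"
  assumes universe: "regular_universe TYPE('u)" and small_k: "small (carrier k)"
    and linear: "linear_category k C" and cocomplete: "cocomplete C" and locally_small: "locally_small C"
begin

lemma field_k: "field k" using linear by (simp add: linear_category_def)

lemma category_C [simp]: "category C" using linear by (rule linear_category_category)

text \<open>Two glueings: the coproduct of copies of \<open>X\<close> indexed by the elements of
  \<open>V\<close>, and then the quotient that makes the family of injections linear. The second
  needs the first, because the sum of two injections is an arrow into the coproduct.\<close>

lemma exists_copower: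
  assumes V: "V \<in> Obj (Vect k)" and X: "X \<in> Obj C"
  obtains W \<eta> where "is_copower k C V X W \<eta>"
proof -
  have sV: "|carrier V| <o |UNIV :: 'u set|" and sk: "|carrier k| <o |UNIV :: 'u set|"
    using V small_k by (auto simp: Obj_Vect small_def)
  have mV: "module k V" using V by (simp add: Obj_Vect)
  \<comment> \<open>Without relations a glueing is a coproduct, and the undefined legs are never
    consulted.\<close>
  obtain S i where g: "glueing C (carrier V) ({} :: unit set) (\<lambda>_. undefined) (\<lambda>_. undefined) (\<lambda>_. X)
      (\<lambda>_. undefined) (\<lambda>_. undefined) S i"
    by (rule exists_glueing[OF universe cocomplete category_C sV card_less_finite[OF universe finite.emptyI],
      where src = "\<lambda>_. undefined" and tgt = "\<lambda>_. undefined" and X = "\<lambda>_. X" and p = "\<lambda>_. undefined" and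
       q = "\<lambda>_. undefined" and Z = "\<lambda>_. undefined"]) (use X in auto)
  have S: "S \<in> Obj C" and i: "v \<in> carrier V \<Longrightarrow> i v \<in> homs C X S" for v
    using g by (auto simp: glueing_def glue_cocone_def)
  have iA [simp]: "v \<in> carrier V \<Longrightarrow> i v \<in> Arr C" "v \<in> carrier V \<Longrightarrow> Dom C (i v) = X" "v \<in> carrier V \<Longrightarrow> Cod C (i v) = S" for v
    using i by (auto simp: in_homs_iff)
  note [simp] = V module_add_closed[OF mV] module_smult_closed[OF mV]
  define R where "R = Sum_Type.Plus (carrier V \<times> carrier V) (carrier k \<times> carrier V)"
  define p where "p r = (case r of Inl (v, w) \<Rightarrow> i (v \<oplus>\<^bsub>V\<^esub> w) | Inr (a, v) \<Rightarrow> i (a \<odot>\<^bsub>V\<^esub> v))" for r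
  define q where "q r = (case r of Inl (v, w) \<Rightarrow> HAdd C (i v) (i w) | Inr (a, v) \<Rightarrow> HScale C a (i v))" for r
  have R: "|R| <o |UNIV :: 'u set|"
    unfolding R_def by (intro card_less_Plus card_less_Times universe sV sk)
  have pq: "p r \<in> homs C X S" "q r \<in> homs C X S" if "r \<in> R" for r
    using that linear by (auto simp: R_def p_def q_def in_homs_iff)
  \<comment> \<open>With a single object the glueing is a simultaneous coequalizer of all pairs
    \<open>p r\<close>, \<open>q r\<close>.\<close>
  obtain W j where w: "glueing C {()} R (\<lambda>_. ()) (\<lambda>_. ()) (\<lambda>_. S) p q W j"
    by (rule exists_glueing[OF universe cocomplete category_C card_less_finite[OF universe] R,
      where src = "\<lambda>_. ()" and tgt = "\<lambda>_. ()" and X = "\<lambda>_. S" and p = p and q = q and Z = "\<lambda>_. X"]) (use S pq in auto)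
  define \<pi> where "\<pi> = j ()"
  have W: "W \<in> Obj C" and pi: "\<pi> \<in> homs C S W" and rel: "r \<in> R \<Longrightarrow> Cmp C \<pi> (p r) = Cmp C \<pi> (q r)" for r
    using w by (auto simp: glueing_def glue_cocone_def \<pi>_def)
  have piA [simp]: "\<pi> \<in> Arr C" "Dom C \<pi> = S" "Cod C \<pi> = W" using pi by (auto simp: in_homs_iff)
  have "is_copower k C V X W (\<lambda>v. Cmp C \<pi> (i v))"
    unfolding is_copower_def
  proof (intro conjI allI impI)
    show "W \<in> Obj C" by fact
    show "lin k V (hom_space C X W) (\<lambda>v. Cmp C \<pi> (i v))"
    proof (rule linI)
      show "Cmp C \<pi> (i (v \<oplus>\<^bsub>V\<^esub> w)) = Cmp C \<pi> (i v) \<oplus>\<^bsub>hom_space C X W\<^esub> Cmp C \<pi> (i w)" if "v \<in> carrier V" "w \<in> carrier V" for v w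
        using rel[of "Inl (v, w)"] that Cmp_HAdd_right[OF linear] by (auto simp: R_def p_def q_def)
      show "Cmp C \<pi> (i (a \<odot>\<^bsub>V\<^esub> v)) = a \<odot>\<^bsub>hom_space C X W\<^esub> Cmp C \<pi> (i v)" if "a \<in> carrier k" "v \<in> carrier V" for a v
        using rel[of "Inr (a, v)"] that Cmp_HScale[OF linear] by (auto simp: R_def p_def q_def)
    qed (simp add: in_homs_iff)
  next
    fix Y m assume Ym: "Y \<in> Obj C \<and> lin k V (hom_space C X Y) m"
    then have Y: "Y \<in> Obj C" and m: "\<And>v. v \<in> carrier V \<Longrightarrow> m v \<in> homs C X Y"
      and ma: "\<And>v w. v \<in> carrier V \<Longrightarrow> w \<in> carrier V \<Longrightarrow> m (v \<oplus>\<^bsub>V\<^esub> w) = HAdd C (m v) (m w)"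
      and ms: "\<And>a v. a \<in> carrier k \<Longrightarrow> v \<in> carrier V \<Longrightarrow> m (a \<odot>\<^bsub>V\<^esub> v) = HScale C a (m v)"
      by (auto simp: lin_def)
    obtain h0 where h0: "h0 \<in> homs C S Y" "\<And>v. v \<in> carrier V \<Longrightarrow> Cmp C h0 (i v) = m v"
      using glueing_factor[OF g Y, of m] m by auto
    have h0A: "h0 \<in> Arr C" "Dom C h0 = S" "Cod C h0 = Y" using h0 by (auto simp: in_homs_iff)
    have "Cmp C h0 (p r) = Cmp C h0 (q r)" if "r \<in> R" for r
      using that h0(2) h0A ma ms Cmp_HAdd_right[OF linear] Cmp_HScale[OF linear] by (auto simp: R_def p_def q_def)
    then obtain h where h: "h \<in> homs C W Y" "Cmp C h \<pi> = h0"
      using glueing_factor[OF w Y, of "\<lambda>_. h0"] h0 by (auto simp: \<pi>_def)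
    show "\<exists>h\<in>homs C W Y. \<forall>v\<in>carrier V. Cmp C h (Cmp C \<pi> (i v)) = m v"
    proof (intro bexI[OF _ h(1)] ballI)
      fix v assume v: "v \<in> carrier V"
      have "Cmp C h (Cmp C \<pi> (i v)) = Cmp C (Cmp C h \<pi>) (i v)" using v h(1) by (simp add: in_homs_iff)
      then show "Cmp C h (Cmp C \<pi> (i v)) = m v" using h(2) h0(2)[OF v] by simp
    qed
  next
    fix Y h h' assume a: "h \<in> homs C W Y \<and> h' \<in> homs C W Y \<and> (\<forall>v\<in>carrier V. Cmp C h (Cmp C \<pi> (i v)) = Cmp C h' (Cmp C \<pi> (i v)))"
    then have hA: "h \<in> Arr C" "Dom C h = W" "Cod C h = Y" "h' \<in> Arr C" "Dom C h' = W" "Cod C h' = Y"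
      by (auto simp: in_homs_iff)
    have eq: "Cmp C h \<pi> = Cmp C h' \<pi>"
      by (rule glueing_eq[OF g category_C]) (use a hA in \<open>auto simp: in_homs_iff\<close>)
    show "h = h'"
      by (rule glueing_eq[OF w category_C, where Z = "\<lambda>_. X"]) (use a pq eq in \<open>auto simp: \<pi>_def\<close>)
  qed
  then show thesis by (rule that)
qed

text \<open>\<open>cpo\<close> and \<open>cpi\<close> project the same choice term, so that the
  object and the universal family belong together.\<close>

definition cpo :: "'u vs \<Rightarrow> 'u \<Rightarrow> 'u" where
  "cpo V X = fst (SOME (W, \<eta>). is_copower k C V X W \<eta>)"

definition cpi :: "'u vs \<Rightarrow> 'u \<Rightarrow> 'u \<Rightarrow> 'u" where
  "cpi V X = snd (SOME (W, \<eta>). is_copower k C V X W \<eta>)"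

lemma is_copower_cpo:
  assumes "V \<in> Obj (Vect k)" "X \<in> Obj C"
  shows "is_copower k C V X (cpo V X) (cpi V X)"
proof -
  have "\<exists>x. case x of (W, \<eta>) \<Rightarrow> is_copower k C V X W \<eta>"
    using exists_copower[OF assms] by (metis case_prod_conv)
  from someI_ex[OF this] show ?thesis by (simp add: cpo_def cpi_def case_prod_unfold)
qed

context
  fixes V X assumes V: "V \<in> Obj (Vect k)" and X: "X \<in> Obj C"
begin

lemma cpo_Obj [simp]: "cpo V X \<in> Obj C"
  using is_copower_cpo[OF V X] by (simp add: is_copower_def)

lemma lin_cpi: "lin k V (hom_space C X (cpo V X)) (cpi V X)"
  using is_copower_cpo[OF V X] by (simp add: is_copower_def)

lemma cpi_arr [simp]:
  assumes "v \<in> carrier V"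
  shows "cpi V X v \<in> Arr C" "Dom C (cpi V X v) = X" "Cod C (cpi V X v) = cpo V X"
  using linD(1)[OF lin_cpi assms] by (auto simp: in_homs_iff)

lemma cpi_add: "v \<in> carrier V \<Longrightarrow> w \<in> carrier V \<Longrightarrow> cpi V X (v \<oplus>\<^bsub>V\<^esub> w) = HAdd C (cpi V X v) (cpi V X w)"
  using linD(2)[OF lin_cpi] by simp

lemma cpi_smult: "a \<in> carrier k \<Longrightarrow> v \<in> carrier V \<Longrightarrow> cpi V X (a \<odot>\<^bsub>V\<^esub> v) = HScale C a (cpi V X v)"
  using linD(3)[OF lin_cpi] by simp

lemma cpo_factor:
  assumes "Y \<in> Obj C" "lin k V (hom_space C X Y) m"
  obtains h where "h \<in> homs C (cpo V X) Y" "\<And>v. v \<in> carrier V \<Longrightarrow> Cmp C h (cpi V X v) = m v"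
  using is_copower_cpo[OF V X] assms unfolding is_copower_def by blast

lemma cpo_eq:
  assumes "h \<in> homs C (cpo V X) Y" "h' \<in> homs C (cpo V X) Y"
    "\<And>v. v \<in> carrier V \<Longrightarrow> Cmp C h (cpi V X v) = Cmp C h' (cpi V X v)"
  shows "h = h'"
  using is_copower_cpo[OF V X] assms unfolding is_copower_def by blast

end

section \<open>The copower as a cocontinuous functor of two variables, and the unit
  equivalence\<close>

definition copower :: "('u vs \<times> 'u, 'u vmap \<times> 'u, 'u, 'u) functr" where
  "copower = \<lparr>fobj = (\<lambda>(V, X). cpo V X),
     farr = (\<lambda>(F, f). SOME h. h \<in> homs C (cpo (fst F) (Dom C f)) (cpo (fst (snd F)) (Cod C f)) \<and>
       (\<forall>v\<in>carrier (fst F). Cmp C h (cpi (fst F) (Dom C f) v) = Cmp C (cpi (fst (snd F)) (Cod C f) (ap F v)) f))\<rparr>"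

lemma copower_obj [simp]: "fobj copower (V, X) = cpo V X"
  by (simp add: copower_def)

lemma copower_arr:
  assumes F: "F \<in> Arr (Vect k)" and f: "f \<in> Arr C"
  shows "farr copower (F, f) \<in> homs C (cpo (fst F) (Dom C f)) (cpo (fst (snd F)) (Cod C f))"
    "v \<in> carrier (fst F) \<Longrightarrow> Cmp C (farr copower (F, f)) (cpi (fst F) (Dom C f) v) = Cmp C (cpi (fst (snd F)) (Cod C f) (ap F v)) f"
proof -
  have l: "lin k (fst F) (hom_space C (Dom C f) (cpo (fst (snd F)) (Cod C f))) (\<lambda>v. Cmp C (cpi (fst (snd F)) (Cod C f) (ap F v)) f)"
    using F f by (intro linI) (simp_all add: in_homs_iff cpi_add cpi_smult Cmp_HAdd_left[OF linear] Cmp_HScale[OF linear])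
  have "\<exists>h. h \<in> homs C (cpo (fst F) (Dom C f)) (cpo (fst (snd F)) (Cod C f)) \<and>
       (\<forall>v\<in>carrier (fst F). Cmp C h (cpi (fst F) (Dom C f) v) = Cmp C (cpi (fst (snd F)) (Cod C f) (ap F v)) f)"
    by (rule cpo_factor[OF _ _ _ l]) (use F f in auto)
  from someI_ex[OF this]
  show "farr copower (F, f) \<in> homs C (cpo (fst F) (Dom C f)) (cpo (fst (snd F)) (Cod C f))"
    "v \<in> carrier (fst F) \<Longrightarrow> Cmp C (farr copower (F, f)) (cpi (fst F) (Dom C f) v) = Cmp C (cpi (fst (snd F)) (Cod C f) (ap F v)) f"
    by (auto simp: copower_def)
qed

lemma copower_arr_simps [simp]:
  assumes "F \<in> Arr (Vect k)" "f \<in> Arr C"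
  shows "farr copower (F, f) \<in> Arr C" "Dom C (farr copower (F, f)) = cpo (fst F) (Dom C f)"
    "Cod C (farr copower (F, f)) = cpo (fst (snd F)) (Cod C f)"
  using copower_arr(1)[OF assms] by (auto simp: in_homs_iff)

lemma copower_cpi:
  assumes "F \<in> Arr (Vect k)" "f \<in> Arr C" "v \<in> carrier (fst F)" "fst F = V" "Dom C f = X" "fst (snd F) = W" "Cod C f = Y"
  shows "Cmp C (farr copower (F, f)) (cpi V X v) = Cmp C (cpi W Y (ap F v)) f"
  using copower_arr(2)[OF assms(1-3)] assms(4-) by simp

lemma fst_Idt_Vect [simp]: "fst (Idt (Vect k) V) = V" "fst (snd (Idt (Vect k) V)) = V"
  by (auto simp: Idt_Vect)

lemma fst_Cmp_Vect [simp]: "fst (Cmp (Vect k) G F) = fst F" "fst (snd (Cmp (Vect k) G F)) = fst (snd G)"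
  by (auto simp: Cmp_Vect)

lemma Idt_Vect_Arr [simp]: "V \<in> Obj (Vect k) \<Longrightarrow> Idt (Vect k) V \<in> Arr (Vect k)"
  using Idt_Vect_homs by (auto simp: in_homs_iff)

lemma Cmp_Vect_Arr [simp]: "F \<in> Arr (Vect k) \<Longrightarrow> G \<in> Arr (Vect k) \<Longrightarrow> fst (snd F) = fst G \<Longrightarrow> Cmp (Vect k) G F \<in> Arr (Vect k)"
  using Cmp_simps[OF category_Vect] by simp

lemma is_functor_copower: "is_functor (prod_cat (Vect k) C) C copower"
proof (rule is_functorI)
  show "category (prod_cat (Vect k) C)" by (simp add: category_Vect)
  show "category C" by simp
  show "fobj copower P \<in> Obj C" if "P \<in> Obj (prod_cat (Vect k) C)" for P
    using that by (cases P) simp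
  show "farr copower P \<in> homs C (fobj copower (Dom (prod_cat (Vect k) C) P)) (fobj copower (Cod (prod_cat (Vect k) C) P))"
    if "P \<in> Arr (prod_cat (Vect k) C)" for P
    using that by (cases P) (simp add: in_homs_iff)
  show "farr copower (Idt (prod_cat (Vect k) C) P) = Idt C (fobj copower P)" if "P \<in> Obj (prod_cat (Vect k) C)" for P
  proof (cases P)
    case (Pair V X)
    then have VX: "V \<in> Obj (Vect k)" "X \<in> Obj C" using that by auto
    have "farr copower (Idt (Vect k) V, Idt C X) = Idt C (cpo V X)"
      by (rule cpo_eq[OF VX]) (use VX in \<open>auto simp: in_homs_iff copower_cpi\<close>)
    then show ?thesis using Pair by simp
  qed
  show "farr copower (Cmp (prod_cat (Vect k) C) Q P) = Cmp C (farr copower Q) (farr copower P)"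
    if "P \<in> Arr (prod_cat (Vect k) C)" "Q \<in> Arr (prod_cat (Vect k) C)" "Cod (prod_cat (Vect k) C) P = Dom (prod_cat (Vect k) C) Q" for P Q
  proof (cases P; cases Q)
    fix F f G g assume PQ: "P = (F, f)" "Q = (G, g)"
    have [simp]: "F \<in> Arr (Vect k)" "G \<in> Arr (Vect k)" "f \<in> Arr C" "g \<in> Arr C" "Cod C f = Dom C g" and FG [simp]: "fst (snd F) = fst G"
      using that PQ by auto
    have [simp]: "ap F v \<in> carrier (fst G)" if "v \<in> carrier (fst F)" for v
      using Vect_arr(1)[of F k v] that by simp
    have [simp]: "ap G v \<in> carrier (fst (snd G))" if "v \<in> carrier (fst G)" for v
      using Vect_arr(1)[of G k v] that by simp
    have o: "fst F \<in> Obj (Vect k)" "Dom C f \<in> Obj C" by auto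
    have "farr copower (Cmp (Vect k) G F, Cmp C g f) = Cmp C (farr copower (G, g)) (farr copower (F, f))"
    proof (rule cpo_eq[OF o])
      fix v assume v: "v \<in> carrier (fst F)"
      have "Cmp C (farr copower (Cmp (Vect k) G F, Cmp C g f)) (cpi (fst F) (Dom C f) v)
          = Cmp C (cpi (fst (snd G)) (Cod C g) (ap G (ap F v))) (Cmp C g f)"
        using v by (subst copower_cpi) auto
      also have "\<dots> = Cmp C (Cmp C (farr copower (G, g)) (cpi (fst G) (Dom C g) (ap F v))) f"
        using v by (subst copower_cpi) auto
      also have "\<dots> = Cmp C (farr copower (G, g)) (Cmp C (cpi (fst G) (Dom C g) (ap F v)) f)"
        using v by simp
      also have "Cmp C (cpi (fst G) (Dom C g) (ap F v)) f = Cmp C (farr copower (F, f)) (cpi (fst F) (Dom C f) v)"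
        using v by (subst copower_cpi) auto
      finally show "Cmp C (farr copower (Cmp (Vect k) G F, Cmp C g f)) (cpi (fst F) (Dom C f) v) =
          Cmp C (Cmp C (farr copower (G, g)) (farr copower (F, f))) (cpi (fst F) (Dom C f) v)"
        using v by simp
    qed (auto simp: in_homs_iff)
    then show ?thesis using PQ by simp
  qed
qed

text \<open>The functor is left adjoint to \<open>Hom(X, -)\<close>: a cocone under the copowers of
  the \<open>E j\<close> amounts to a cocone of linear maps from the \<open>E j\<close> to
  \<open>Hom(X, Y)\<close>, and that one factors through the colimit in \<open>Vect\<close>.\<close>

lemma cocontinuous_copower_right:
  assumes X: "X \<in> Obj C"
  shows "cocontinuous k (Vect k) C (fix_right C copower X)"
proof (rule cocontinuousI)
  note F = is_functor_fix_right[OF is_functor_copower category_Vect category_C X]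
  show "linear_functor k (Vect k) C (fix_right C copower X)"
  proof (rule linear_functorI[OF linear_category_Vect[OF field_k] linear F])
    note LV = linear_category_Vect[OF field_k]
    show "farr (fix_right C copower X) (HAdd (Vect k) f g) = HAdd C (farr (fix_right C copower X) f) (farr (fix_right C copower X) g)"
      if f: "f \<in> Arr (Vect k)" "g \<in> Arr (Vect k)" "Dom (Vect k) f = Dom (Vect k) g" "Cod (Vect k) f = Cod (Vect k) g" for f g
    proof -
      have s: "HAdd (Vect k) f g \<in> Arr (Vect k)" using HAdd_arr(1)[OF LV] f by simp
      have [simp]: "fst (HAdd (Vect k) f g) = fst g" "fst (snd (HAdd (Vect k) f g)) = fst (snd g)" using f by (auto simp: HAdd_Vect)
      have fx: "ap f v \<in> carrier (fst (snd g))" "ap g v \<in> carrier (fst (snd g))" if "v \<in> carrier (fst g)" for v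
        using Vect_arr(1)[OF f(1)] Vect_arr(1)[OF f(2)] f(3,4) that by auto
      have "farr copower (HAdd (Vect k) f g, Idt C X) = HAdd C (farr copower (f, Idt C X)) (farr copower (g, Idt C X))"
      proof (rule cpo_eq[of "fst g" X])
        fix v assume v: "v \<in> carrier (fst g)"
        have "Cmp C (farr copower (HAdd (Vect k) f g, Idt C X)) (cpi (fst g) X v) = cpi (fst (snd g)) X (ap f v \<oplus>\<^bsub>fst (snd g)\<^esub> ap g v)"
          using f s v fx X module_add_closed[OF module_Vect[OF Vect_arr(5)[OF f(2)]]]
          by (subst copower_cpi) (auto simp: HAdd_Vect)
        also have "\<dots> = HAdd C (cpi (fst (snd g)) X (ap f v)) (cpi (fst (snd g)) X (ap g v))"
          using f fx v X by (intro cpi_add) auto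
        also have "\<dots> = Cmp C (HAdd C (farr copower (f, Idt C X)) (farr copower (g, Idt C X))) (cpi (fst g) X v)"
          using f fx v X by (subst Cmp_HAdd_left[OF linear]) (auto simp: copower_cpi)
        finally show "Cmp C (farr copower (HAdd (Vect k) f g, Idt C X)) (cpi (fst g) X v) =
          Cmp C (HAdd C (farr copower (f, Idt C X)) (farr copower (g, Idt C X))) (cpi (fst g) X v)" .
      qed (use f s X linear in \<open>auto simp: in_homs_iff\<close>)
      then show ?thesis by simp
    qed
    show "farr (fix_right C copower X) (HScale (Vect k) a f) = HScale C a (farr (fix_right C copower X) f)"
      if f: "f \<in> Arr (Vect k)" and a: "a \<in> carrier k" for f a
    proof -
      have s: "HScale (Vect k) a f \<in> Arr (Vect k)" using HScale_arr(1)[OF LV] f a by simp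
      have [simp]: "fst (HScale (Vect k) a f) = fst f" "fst (snd (HScale (Vect k) a f)) = fst (snd f)" by (auto simp: HScale_Vect)
      have fx: "ap f v \<in> carrier (fst (snd f))" if "v \<in> carrier (fst f)" for v
        using Vect_arr(1)[OF f(1)] that by auto
      have "farr copower (HScale (Vect k) a f, Idt C X) = HScale C a (farr copower (f, Idt C X))"
      proof (rule cpo_eq[of "fst f" X])
        fix v assume v: "v \<in> carrier (fst f)"
        have "Cmp C (farr copower (HScale (Vect k) a f, Idt C X)) (cpi (fst f) X v) = cpi (fst (snd f)) X (a \<odot>\<^bsub>fst (snd f)\<^esub> ap f v)"
          using f a s v fx X module_smult_closed[OF module_Vect[OF Vect_arr(5)[OF f]]]
          by (subst copower_cpi) (auto simp: HScale_Vect)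
        also have "\<dots> = HScale C a (cpi (fst (snd f)) X (ap f v))"
          using f a fx v X by (intro cpi_smult) auto
        also have "\<dots> = Cmp C (HScale C a (farr copower (f, Idt C X))) (cpi (fst f) X v)"
          using f a fx v X by (subst Cmp_HScale(2)[OF linear]) (auto simp: copower_cpi)
        finally show "Cmp C (farr copower (HScale (Vect k) a f, Idt C X)) (cpi (fst f) X v) =
          Cmp C (HScale C a (farr copower (f, Idt C X))) (cpi (fst f) X v)" .
      qed (use f a s X linear in \<open>auto simp: in_homs_iff\<close>)
      then show ?thesis by simp
    qed
  qed
  fix J :: "('u, 'u) cat" and E V \<iota>
  assume l: "is_colimit J (Vect k) E V \<iota>"
  note co = is_colimit_cocone[OF l]
  note E = is_coconeD(1)[OF co] and V = is_coconeD(2)[OF co]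
  have J: "category J" using is_functor_category(1)[OF E] .
  have EO [simp]: "fobj E j \<in> Obj (Vect k)" if "j \<in> Obj J" for j using functor_Obj[OF E that] .
  have i [simp]: "\<iota> j \<in> Arr (Vect k)" "fst (\<iota> j) = fobj E j" "fst (snd (\<iota> j)) = V" if "j \<in> Obj J" for j
    using is_coconeD(3-5)[OF co that] by auto
  have ix [simp]: "ap (\<iota> j) x \<in> carrier V" if "j \<in> Obj J" "x \<in> carrier (fobj E j)" for j x
    using Vect_arr(1)[OF i(1)[OF that(1)]] that by simp
  have Ea [simp]: "farr E u \<in> Arr (Vect k)" "fst (farr E u) = fobj E (Dom J u)" "fst (snd (farr E u)) = fobj E (Cod J u)" if "u \<in> Arr J" for u
    using functor_arr[OF E that] by auto
  have Ex [simp]: "ap (farr E u) x \<in> carrier (fobj E (Cod J u))" if "u \<in> Arr J" "x \<in> carrier (fobj E (Dom J u))" for u x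
    using Vect_arr(1)[OF Ea(1)[OF that(1)]] that by simp
  note [simp] = X V J
  show "is_colimit J C (comp_fun (fix_right C copower X) E) (fobj (fix_right C copower X) V) (\<lambda>j. farr (fix_right C copower X) (\<iota> j))"
  proof (rule is_colimitI[OF is_cocone_comp_fun[OF co F]])
    fix Y \<tau> assume \<tau>: "is_cocone J C (comp_fun (fix_right C copower X) E) Y \<tau>"
    have tA [simp]: "\<tau> j \<in> Arr C" "Dom C (\<tau> j) = cpo (fobj E j) X" "Cod C (\<tau> j) = Y" if "j \<in> Obj J" for j
      using is_coconeD(3-5)[OF \<tau> that] by auto
    have Y: "Y \<in> Obj C" using is_coconeD(2)[OF \<tau>] .
    have "lin k (fobj E j) (hom_space C X Y) (\<lambda>v. Cmp C (\<tau> j) (cpi (fobj E j) X v))" if j: "j \<in> Obj J" for j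
      using lin_comp[OF lin_cpi[OF EO[OF j] X] lin_Cmp_right[OF linear, of "\<tau> j" "cpo (fobj E j) X" Y X]] j by (simp add: in_homs_iff)
    moreover have "Cmp C (\<tau> (Cod J u)) (cpi (fobj E (Cod J u)) X (ap (farr E u) x)) = Cmp C (\<tau> (Dom J u)) (cpi (fobj E (Dom J u)) X x)"
      if u: "u \<in> Arr J" and x: "x \<in> carrier (fobj E (Dom J u))" for u x
    proof -
      have "Cmp C (\<tau> (Dom J u)) (cpi (fobj E (Dom J u)) X x) =
          Cmp C (Cmp C (\<tau> (Cod J u)) (farr copower (farr E u, Idt C X))) (cpi (fobj E (Dom J u)) X x)"
        using is_cocone_Cmp[OF \<tau> u] by simp
      also have "\<dots> = Cmp C (\<tau> (Cod J u)) (Cmp C (farr copower (farr E u, Idt C X)) (cpi (fobj E (Dom J u)) X x))"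
        using u x by simp
      also have "Cmp C (farr copower (farr E u, Idt C X)) (cpi (fobj E (Dom J u)) X x) = cpi (fobj E (Cod J u)) X (ap (farr E u) x)"
        using u x by (subst copower_cpi) auto
      finally show ?thesis by simp
    qed
    ultimately obtain m where m: "lin k V (hom_space C X Y) m"
      "\<And>j x. j \<in> Obj J \<Longrightarrow> x \<in> carrier (fobj E j) \<Longrightarrow> m (ap (\<iota> j) x) = Cmp C (\<tau> j) (cpi (fobj E j) X x)"
      using Vect_colimit_factor[OF l hom_space_Obj[OF linear locally_small X Y], of "\<lambda>j v. Cmp C (\<tau> j) (cpi (fobj E j) X v)"] by blast
    obtain h where h: "h \<in> homs C (cpo V X) Y" "\<And>v. v \<in> carrier V \<Longrightarrow> Cmp C h (cpi V X v) = m v"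
      using cpo_factor[OF V X Y m(1)] by blast
    have hA: "h \<in> Arr C" "Dom C h = cpo V X" "Cod C h = Y" using h(1) by (auto simp: in_homs_iff)
    have "Cmp C h (farr copower (\<iota> j, Idt C X)) = \<tau> j" if j: "j \<in> Obj J" for j
    proof (rule cpo_eq[OF EO[OF j] X])
      fix x assume x: "x \<in> carrier (fobj E j)"
      show "Cmp C (Cmp C h (farr copower (\<iota> j, Idt C X))) (cpi (fobj E j) X x) = Cmp C (\<tau> j) (cpi (fobj E j) X x)"
        using hA j x h(2) m(2) by (simp add: copower_cpi)
    qed (use hA j in \<open>auto simp: in_homs_iff\<close>)
    then show "\<exists>h. h \<in> homs C (fobj (fix_right C copower X) V) Y \<and> (\<forall>j\<in>Obj J. Cmp C h (farr (fix_right C copower X) (\<iota> j)) = \<tau> j)"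
      using h(1) by (auto intro!: exI[of _ h])
  next
    fix Y h h' assume "h \<in> homs C (fobj (fix_right C copower X) V) Y" "h' \<in> homs C (fobj (fix_right C copower X) V) Y"
      and Y: "Y \<in> Obj C" and eq: "\<And>j. j \<in> Obj J \<Longrightarrow> Cmp C h (farr (fix_right C copower X) (\<iota> j)) = Cmp C h' (farr (fix_right C copower X) (\<iota> j))"
    then have h: "h \<in> homs C (cpo V X) Y" "h' \<in> homs C (cpo V X) Y" by auto
    show "h = h'"
    proof (rule cpo_eq[OF V X h], rule Vect_colimit_eq[OF l, where h = "\<lambda>v. Cmp C h (cpi V X v)" and h' = "\<lambda>v. Cmp C h' (cpi V X v)" and W = "hom_space C X Y"])
      show "hom_space C X Y \<in> Obj (Vect k)" using hom_space_Obj[OF linear locally_small X Y] .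
      show "lin k V (hom_space C X Y) (\<lambda>v. Cmp C h (cpi V X v))" "lin k V (hom_space C X Y) (\<lambda>v. Cmp C h' (cpi V X v))"
        using h by (auto intro!: lin_comp[OF lin_cpi lin_Cmp_right[OF linear]])
      fix j x assume j: "j \<in> Obj J" and x: "x \<in> carrier (fobj E j)"
      have *: "Cmp C g (cpi V X (ap (\<iota> j) x)) = Cmp C (Cmp C g (farr copower (\<iota> j, Idt C X))) (cpi (fobj E j) X x)"
        if "g \<in> homs C (cpo V X) Y" for g
        using that j x by (simp add: copower_cpi in_homs_iff)
      show "Cmp C h (cpi V X (ap (\<iota> j) x)) = Cmp C h' (cpi V X (ap (\<iota> j) x))"
        using eq[OF j] *[OF h(1)] *[OF h(2)] by simp
    qed
  qed
qed

text \<open>Restricting a cocone along the injections at a fixed \<open>v\<close> gives a cocone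
  under the original diagram, hence an arrow \<open>m v\<close> out of its colimit. By uniqueness
  \<open>m\<close> is linear in \<open>v\<close>, so it defines an arrow out of the copower.\<close>

lemma cocontinuous_copower_left:
  assumes V: "V \<in> Obj (Vect k)"
  shows "cocontinuous k C C (fix_left (Vect k) copower V)"
proof (rule cocontinuousI)
  note F = is_functor_fix_left[OF is_functor_copower category_Vect category_C V]
  show "linear_functor k C C (fix_left (Vect k) copower V)"
  proof (rule linear_functorI[OF linear linear F])
    fix f g assume f: "f \<in> Arr C" "g \<in> Arr C" "Dom C f = Dom C g" "Cod C f = Cod C g"
    have "farr copower (Idt (Vect k) V, HAdd C f g) = HAdd C (farr copower (Idt (Vect k) V, f)) (farr copower (Idt (Vect k) V, g))"
      by (rule cpo_eq[of V "Dom C g"])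
        (use f V linear in \<open>auto simp: in_homs_iff copower_cpi Cmp_HAdd_left[OF linear] Cmp_HAdd_right[OF linear]\<close>)
    then show "farr (fix_left (Vect k) copower V) (HAdd C f g) = HAdd C (farr (fix_left (Vect k) copower V) f) (farr (fix_left (Vect k) copower V) g)"
      by simp
  next
    fix f a assume f: "f \<in> Arr C" "a \<in> carrier k"
    have "farr copower (Idt (Vect k) V, HScale C a f) = HScale C a (farr copower (Idt (Vect k) V, f))"
      by (rule cpo_eq[of V "Dom C f"])
        (use f V linear in \<open>auto simp: in_homs_iff copower_cpi Cmp_HScale[OF linear]\<close>)
    then show "farr (fix_left (Vect k) copower V) (HScale C a f) = HScale C a (farr (fix_left (Vect k) copower V) f)"
      by simp
  qed
  fix J :: "('u, 'u) cat" and E X \<iota>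
  assume l: "is_colimit J C E X \<iota>"
  note co = is_colimit_cocone[OF l]
  note E = is_coconeD(1)[OF co] and X = is_coconeD(2)[OF co]
  have J: "category J" using is_functor_category(1)[OF E] .
  note [simp] = V X J functor_Obj[OF E] functor_arr[OF E] is_coconeD(3-5)[OF co]
    module_add_closed[OF module_Vect[OF V]] module_smult_closed[OF module_Vect[OF V]]
  show "is_colimit J C (comp_fun (fix_left (Vect k) copower V) E) (fobj (fix_left (Vect k) copower V) X) (\<lambda>j. farr (fix_left (Vect k) copower V) (\<iota> j))"
  proof (rule is_colimitI[OF is_cocone_comp_fun[OF co F]])
    fix Y \<tau> assume \<tau>: "is_cocone J C (comp_fun (fix_left (Vect k) copower V) E) Y \<tau>"
    have tA [simp]: "\<tau> j \<in> Arr C" "Dom C (\<tau> j) = cpo V (fobj E j)" "Cod C (\<tau> j) = Y" if "j \<in> Obj J" for j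
      using is_coconeD(3-5)[OF \<tau> that] by auto
    have Y: "Y \<in> Obj C" using is_coconeD(2)[OF \<tau>] .
    have "\<exists>m. m \<in> homs C X Y \<and> (\<forall>j\<in>Obj J. Cmp C m (\<iota> j) = Cmp C (\<tau> j) (cpi V (fobj E j) v))" if v: "v \<in> carrier V" for v
    proof -
      have "is_cocone J C E Y (\<lambda>j. Cmp C (\<tau> j) (cpi V (fobj E j) v))"
      proof (rule is_coconeI[OF E Y])
        fix u assume u: "u \<in> Arr J"
        have "Cmp C (Cmp C (\<tau> (Cod J u)) (cpi V (fobj E (Cod J u)) v)) (farr E u) =
            Cmp C (Cmp C (\<tau> (Cod J u)) (farr copower (Idt (Vect k) V, farr E u))) (cpi V (fobj E (Dom J u)) v)"
          using u v by (simp add: copower_cpi)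
        then show "Cmp C (Cmp C (\<tau> (Cod J u)) (cpi V (fobj E (Cod J u)) v)) (farr E u) = Cmp C (\<tau> (Dom J u)) (cpi V (fobj E (Dom J u)) v)"
          using is_cocone_Cmp[OF \<tau> u] by simp
      qed (use v in \<open>simp add: in_homs_iff\<close>)
      then show ?thesis by (rule is_colimit_factor[OF l]) blast
    qed
    then obtain m where m: "\<And>v. v \<in> carrier V \<Longrightarrow> m v \<in> homs C X Y"
      "\<And>v j. v \<in> carrier V \<Longrightarrow> j \<in> Obj J \<Longrightarrow> Cmp C (m v) (\<iota> j) = Cmp C (\<tau> j) (cpi V (fobj E j) v)"
      by metis
    have mA [simp]: "v \<in> carrier V \<Longrightarrow> m v \<in> Arr C" "v \<in> carrier V \<Longrightarrow> Dom C (m v) = X" "v \<in> carrier V \<Longrightarrow> Cod C (m v) = Y" for v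
      using m(1) by (auto simp: in_homs_iff)
    have "lin k V (hom_space C X Y) m"
    proof (rule linI)
      fix v w assume v: "v \<in> carrier V" "w \<in> carrier V"
      have "m (v \<oplus>\<^bsub>V\<^esub> w) = HAdd C (m v) (m w)"
        by (rule is_colimit_eq[OF l]) (use v linear in \<open>auto simp: in_homs_iff m(2) Cmp_HAdd_left[OF linear] Cmp_HAdd_right[OF linear] cpi_add\<close>)
      then show "m (v \<oplus>\<^bsub>V\<^esub> w) = m v \<oplus>\<^bsub>hom_space C X Y\<^esub> m w" by simp
    next
      fix a v assume v: "a \<in> carrier k" "v \<in> carrier V"
      have "m (a \<odot>\<^bsub>V\<^esub> v) = HScale C a (m v)"
        by (rule is_colimit_eq[OF l]) (use v linear in \<open>auto simp: in_homs_iff m(2) Cmp_HScale[OF linear] cpi_smult\<close>)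
      then show "m (a \<odot>\<^bsub>V\<^esub> v) = a \<odot>\<^bsub>hom_space C X Y\<^esub> m v" by simp
    qed (use m in auto)
    then obtain h where h: "h \<in> homs C (cpo V X) Y" "\<And>v. v \<in> carrier V \<Longrightarrow> Cmp C h (cpi V X v) = m v"
      using cpo_factor[OF V X Y] by blast
    have hA: "h \<in> Arr C" "Dom C h = cpo V X" "Cod C h = Y" using h(1) by (auto simp: in_homs_iff)
    have "Cmp C h (farr copower (Idt (Vect k) V, \<iota> j)) = \<tau> j" if j: "j \<in> Obj J" for j
    proof (rule cpo_eq[OF V functor_Obj[OF E j]])
      fix v assume v: "v \<in> carrier V"
      have "Cmp C (Cmp C h (farr copower (Idt (Vect k) V, \<iota> j))) (cpi V (fobj E j) v) = Cmp C (Cmp C h (cpi V X v)) (\<iota> j)"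
        using hA j v by (simp add: copower_cpi)
      then show "Cmp C (Cmp C h (farr copower (Idt (Vect k) V, \<iota> j))) (cpi V (fobj E j) v) = Cmp C (\<tau> j) (cpi V (fobj E j) v)"
        using j v h(2) m(2) by simp
    qed (use hA j in \<open>auto simp: in_homs_iff\<close>)
    then show "\<exists>h. h \<in> homs C (fobj (fix_left (Vect k) copower V) X) Y \<and> (\<forall>j\<in>Obj J. Cmp C h (farr (fix_left (Vect k) copower V) (\<iota> j)) = \<tau> j)"
      using h(1) by (auto intro!: exI[of _ h])
  next
    fix Y h h' assume "h \<in> homs C (fobj (fix_left (Vect k) copower V) X) Y" "h' \<in> homs C (fobj (fix_left (Vect k) copower V) X) Y"
      and Y: "Y \<in> Obj C" and eq: "\<And>j. j \<in> Obj J \<Longrightarrow> Cmp C h (farr (fix_left (Vect k) copower V) (\<iota> j)) = Cmp C h' (farr (fix_left (Vect k) copower V) (\<iota> j))"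
    then have h: "h \<in> homs C (cpo V X) Y" "h' \<in> homs C (cpo V X) Y" by auto
    show "h = h'"
    proof (rule cpo_eq[OF V X h], rule is_colimit_eq[OF l])
      fix v assume v: "v \<in> carrier V"
      show "Cmp C h (cpi V X v) \<in> homs C X Y" "Cmp C h' (cpi V X v) \<in> homs C X Y" using h v by (auto simp: in_homs_iff)
      fix j assume j: "j \<in> Obj J"
      have *: "Cmp C (Cmp C g (cpi V X v)) (\<iota> j) = Cmp C (Cmp C g (farr copower (Idt (Vect k) V, \<iota> j))) (cpi V (fobj E j) v)"
        if "g \<in> homs C (cpo V X) Y" for g
        using that j v by (simp add: copower_cpi in_homs_iff)
      show "Cmp C (Cmp C h (cpi V X v)) (\<iota> j) = Cmp C (Cmp C h' (cpi V X v)) (\<iota> j)"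
        using eq[OF j] *[OF h(1)] *[OF h(2)] by simp
    qed
  qed
qed

lemma bicocontinuous_copower: "bicocontinuous k (Vect k) C C copower"
  unfolding bicocontinuous_def
  using is_functor_copower cocontinuous_copower_left cocontinuous_copower_right by blast

lemma unit_space_simps:
  "carrier (unit_space k) = carrier k" "x \<oplus>\<^bsub>unit_space k\<^esub> y = x \<oplus>\<^bsub>k\<^esub> y" "a \<odot>\<^bsub>unit_space k\<^esub> x = a \<otimes>\<^bsub>k\<^esub> x"
  by (auto simp: unit_space_def)

text \<open>The arrow from the copower by the unit space to \<open>X\<close> is induced by sending a
  scalar \<open>a\<close> to \<open>a\<close> times the identity; its inverse is the injection at
  the element 1.\<close>

lemma left_unitor_copower: "left_unitor k C copower"
proof -
  interpret k: field k by (rule field_k)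
  have K: "unit_space k \<in> Obj (Vect k)" using unit_space_Obj[OF field_k small_k] .
  note [simp] = K
  note F = is_functor_fix_left[OF is_functor_copower category_Vect category_C K]
  have "\<exists>h. h \<in> homs C (cpo (unit_space k) X) X \<and> (\<forall>a\<in>carrier k. Cmp C h (cpi (unit_space k) X a) = HScale C a (Idt C X))"
    if X: "X \<in> Obj C" for X
  proof -
    interpret H: module k "hom_space C X X" using hom_space_module[OF linear X X] .
    have "lin k (unit_space k) (hom_space C X X) (\<lambda>a. HScale C a (Idt C X))"
      using H.smult_l_distr[of _ _ "Idt C X"] H.smult_assoc1[of _ _ "Idt C X"] H.smult_closed[of _ "Idt C X"] X
      by (intro linI) (auto simp: unit_space_simps in_homs_iff)
    then show ?thesis using cpo_factor[OF K X X] unit_space_simps by metis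
  qed
  then obtain \<beta> where b: "\<And>X. X \<in> Obj C \<Longrightarrow> \<beta> X \<in> homs C (cpo (unit_space k) X) X"
    "\<And>X a. X \<in> Obj C \<Longrightarrow> a \<in> carrier k \<Longrightarrow> Cmp C (\<beta> X) (cpi (unit_space k) X a) = HScale C a (Idt C X)"
    by metis
  have bA [simp]: "X \<in> Obj C \<Longrightarrow> \<beta> X \<in> Arr C" "X \<in> Obj C \<Longrightarrow> Dom C (\<beta> X) = cpo (unit_space k) X" "X \<in> Obj C \<Longrightarrow> Cod C (\<beta> X) = X" for X
    using b(1) by (auto simp: in_homs_iff)
  have one: "HScale C \<one>\<^bsub>k\<^esub> f = f" if "f \<in> Arr C" for f
  proof -
    interpret H: module k "hom_space C (Dom C f) (Cod C f)" using that by (intro hom_space_module[OF linear]) auto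
    show ?thesis using H.smult_one[of f] that by (simp add: in_homs_iff)
  qed
  have "nat_trans C C (fix_left (Vect k) copower (unit_space k)) id_fun \<beta>"
  proof (rule nat_transI[OF F is_functor_id_fun])
    fix f assume f: "f \<in> Arr C"
    have "Cmp C (\<beta> (Cod C f)) (farr copower (Idt (Vect k) (unit_space k), f)) = Cmp C f (\<beta> (Dom C f))"
    proof (rule cpo_eq[OF K])
      fix a assume a: "a \<in> carrier (unit_space k)"
      then have a': "a \<in> carrier k" by (simp add: unit_space_simps)
      have "Cmp C (Cmp C (\<beta> (Cod C f)) (farr copower (Idt (Vect k) (unit_space k), f))) (cpi (unit_space k) (Dom C f) a) =
        Cmp C (Cmp C (\<beta> (Cod C f)) (cpi (unit_space k) (Cod C f) a)) f"
        using f a by (simp add: copower_cpi)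
      also have "\<dots> = HScale C a f" using f a' b(2) by (simp add: Cmp_HScale[OF linear])
      also have "\<dots> = Cmp C (Cmp C f (\<beta> (Dom C f))) (cpi (unit_space k) (Dom C f) a)"
        using f a a' b(2) by (simp add: Cmp_HScale[OF linear])
      finally show "Cmp C (Cmp C (\<beta> (Cod C f)) (farr copower (Idt (Vect k) (unit_space k), f))) (cpi (unit_space k) (Dom C f) a) =
        Cmp C (Cmp C f (\<beta> (Dom C f))) (cpi (unit_space k) (Dom C f) a)" .
    qed (use f in \<open>auto simp: in_homs_iff\<close>)
    then show "Cmp C (\<beta> (Cod C f)) (farr (fix_left (Vect k) copower (unit_space k)) f) = Cmp C (farr id_fun f) (\<beta> (Dom C f))"
      by simp
  qed (auto simp: in_homs_iff)
  moreover have "is_iso C (\<beta> X)" if X: "X \<in> Obj C" for X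
  proof (rule is_isoI[OF category_C b(1)[OF X]])
    have oneK: "\<one>\<^bsub>k\<^esub> \<in> carrier (unit_space k)" by (simp add: unit_space_simps)
    show "cpi (unit_space k) X \<one>\<^bsub>k\<^esub> \<in> homs C X (cpo (unit_space k) X)"
      using X oneK by (simp add: in_homs_iff)
    show "Cmp C (\<beta> X) (cpi (unit_space k) X \<one>\<^bsub>k\<^esub>) = Idt C X"
      using b(2)[OF X] one X by simp
    show "Cmp C (cpi (unit_space k) X \<one>\<^bsub>k\<^esub>) (\<beta> X) = Idt C (cpo (unit_space k) X)"
    proof (rule cpo_eq[OF K X])
      fix a assume a: "a \<in> carrier (unit_space k)"
      then have a': "a \<in> carrier k" by (simp add: unit_space_simps)
      have "Cmp C (Cmp C (cpi (unit_space k) X \<one>\<^bsub>k\<^esub>) (\<beta> X)) (cpi (unit_space k) X a) = HScale C a (cpi (unit_space k) X \<one>\<^bsub>k\<^esub>)"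
        using X a a' oneK b(2)[OF X a'] by (simp add: Cmp_HScale[OF linear])
      also have "\<dots> = cpi (unit_space k) X (a \<odot>\<^bsub>unit_space k\<^esub> \<one>\<^bsub>k\<^esub>)" using cpi_smult[OF K X a' oneK] by simp
      finally show "Cmp C (Cmp C (cpi (unit_space k) X \<one>\<^bsub>k\<^esub>) (\<beta> X)) (cpi (unit_space k) X a) = Cmp C (Idt C (cpo (unit_space k) X)) (cpi (unit_space k) X a)"
        using a a' X by (simp add: unit_space_simps)
    qed (use X oneK in \<open>auto simp: in_homs_iff\<close>)
  qed
  ultimately have "nat_iso C C (fix_left (Vect k) copower (unit_space k)) id_fun \<beta>" by (simp add: nat_iso_def)
  then show ?thesis unfolding left_unitor_def using bicocontinuous_copower by blast
qed

end

section \<open>Extension along the tensor product\<close>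

lemma nat_trans_whisker:
  assumes \<alpha>: "nat_trans T C H H' \<alpha>" and t: "is_functor B T t"
  shows "nat_trans B C (comp_fun H t) (comp_fun H' t) (\<lambda>p. \<alpha> (fobj t p))"
proof (rule nat_transI)
  note H = nat_trans_functor[OF \<alpha>]
  show "is_functor B C (comp_fun H t)" "is_functor B C (comp_fun H' t)"
    using is_functor_comp_fun[OF t] H by auto
  show "\<alpha> (fobj t p) \<in> homs C (fobj (comp_fun H t) p) (fobj (comp_fun H' t) p)" if "p \<in> Obj B" for p
    using nat_trans_simps[OF \<alpha>] functor_Obj[OF t that] by (simp add: in_homs_iff)
  show "Cmp C (\<alpha> (fobj t (Cod B f))) (farr (comp_fun H t) f) = Cmp C (farr (comp_fun H' t) f) (\<alpha> (fobj t (Dom B f)))"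
    if "f \<in> Arr B" for f
    using nat_trans_naturality[OF \<alpha>, of "farr t f"] functor_arr[OF t that] by simp
qed

lemma nat_trans_Idt:
  assumes F: "is_functor C D F"
  shows "nat_trans C D F F (\<lambda>X. Idt D (fobj F X))"
  by (intro nat_transI F) (use is_functor_category[OF F] functor_Obj[OF F] functor_arr[OF F] in \<open>auto simp: in_homs_iff\<close>)

lemma nat_trans_HAdd:
  assumes L: "linear_category k D" and \<alpha>: "nat_trans C D F G \<alpha>" and \<beta>: "nat_trans C D F G \<beta>"
  shows "nat_trans C D F G (\<lambda>X. HAdd D (\<alpha> X) (\<beta> X))"
proof (rule nat_transI)
  show F: "is_functor C D F" and G: "is_functor C D G" using nat_trans_functor[OF \<alpha>] .
  note [simp] = nat_trans_simps[OF \<alpha>] nat_trans_simps[OF \<beta>] functor_arr[OF F] functor_arr[OF G]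
    is_functor_category[OF F]
  show "HAdd D (\<alpha> X) (\<beta> X) \<in> homs D (fobj F X) (fobj G X)" if "X \<in> Obj C" for X
    using that L by (simp add: in_homs_iff)
  show "Cmp D (HAdd D (\<alpha> (Cod C f)) (\<beta> (Cod C f))) (farr F f) = Cmp D (farr G f) (HAdd D (\<alpha> (Dom C f)) (\<beta> (Dom C f)))"
    if "f \<in> Arr C" for f
    using that nat_trans_naturality[OF \<alpha> that] nat_trans_naturality[OF \<beta> that]
    by (simp add: Cmp_HAdd_left[OF L] Cmp_HAdd_right[OF L])
qed

lemma nat_trans_HScale:
  assumes L: "linear_category k D" and \<alpha>: "nat_trans C D F G \<alpha>" and a: "a \<in> carrier k"
  shows "nat_trans C D F G (\<lambda>X. HScale D a (\<alpha> X))"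
proof (rule nat_transI)
  show F: "is_functor C D F" and G: "is_functor C D G" using nat_trans_functor[OF \<alpha>] .
  note [simp] = nat_trans_simps[OF \<alpha>] functor_arr[OF F] functor_arr[OF G] is_functor_category[OF F] a
  show "HScale D a (\<alpha> X) \<in> homs D (fobj F X) (fobj G X)" if "X \<in> Obj C" for X
    using that L by (simp add: in_homs_iff)
  show "Cmp D (HScale D a (\<alpha> (Cod C f))) (farr F f) = Cmp D (farr G f) (HScale D a (\<alpha> (Dom C f)))"
    if "f \<in> Arr C" for f
    using that nat_trans_naturality[OF \<alpha> that] by (simp add: Cmp_HScale[OF L])
qed

lemma is_colimit_unique:
  assumes l: "is_colimit J C E X \<iota>" and l': "is_colimit J C E X' \<iota>'"
    and h: "h \<in> homs C X X'" "\<And>j. j \<in> Obj J \<Longrightarrow> Cmp C h (\<iota> j) = \<iota>' j"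
  shows "is_iso C h"
proof -
  note co = is_colimit_cocone[OF l] and co' = is_colimit_cocone[OF l']
  have C: "category C" using is_functor_category(2)[OF is_coconeD(1)[OF co]] .
  note [simp] = C is_coconeD(2-5)[OF co] is_coconeD(2-5)[OF co'] homsD[OF h(1)]
  obtain g where g: "g \<in> homs C X' X" "\<And>j. j \<in> Obj J \<Longrightarrow> Cmp C g (\<iota>' j) = \<iota> j"
    using is_colimit_factor[OF l' co] by blast
  note [simp] = homsD[OF g(1)]
  have "Cmp C g h = Idt C X"
    by (rule is_colimit_eq[OF l]) (auto simp: in_homs_iff h(2) g(2))
  moreover have "Cmp C h g = Idt C X'"
    by (rule is_colimit_eq[OF l']) (auto simp: in_homs_iff h(2) g(2))
  ultimately show ?thesis using is_isoI[OF C h(1) g(1)] by simp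
qed

lemma is_colimit_iso_vertex:
  assumes l: "is_colimit J C E X \<iota>" and h: "is_iso C h" "Dom C h = X" "Cod C h = Y"
    and j: "\<And>j. j \<in> Obj J \<Longrightarrow> \<iota>' j = Cmp C h (\<iota> j)"
  shows "is_colimit J C E Y \<iota>'"
proof -
  note co = is_colimit_cocone[OF l]
  note E = is_coconeD(1)[OF co]
  have C: "category C" and J: "category J" using is_functor_category[OF E] by auto
  have hA: "h \<in> Arr C" using is_iso_Arr[OF C h(1)] .
  note [simp] = C J is_coconeD(2-5)[OF co] hA h functor_arr[OF E] functor_Obj[OF E]
  show ?thesis
  proof (rule is_colimitI)
    show "is_cocone J C E Y \<iota>'"
    proof (rule is_coconeI[OF E])
      show "Y \<in> Obj C" using Obj_Cod[OF C hA] by simp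
      show "\<iota>' j \<in> homs C (fobj E j) Y" if "j \<in> Obj J" for j using that j by (simp add: in_homs_iff)
      show "Cmp C (\<iota>' (Cod J u)) (farr E u) = \<iota>' (Dom J u)" if "u \<in> Arr J" for u
        using that is_cocone_Cmp[OF co that] j by simp
    qed
    fix Z \<tau> assume "is_cocone J C E Z \<tau>"
    then obtain g where g: "g \<in> homs C X Z" "\<And>j. j \<in> Obj J \<Longrightarrow> Cmp C g (\<iota> j) = \<tau> j"
      using is_colimit_factor[OF l] by blast
    then show "\<exists>g. g \<in> homs C Y Z \<and> (\<forall>j\<in>Obj J. Cmp C g (\<iota>' j) = \<tau> j)"
      using j by (intro exI[of _ "Cmp C g (inv_arr C h)"]) (auto simp: in_homs_iff)
  next
    fix Z g g' assume g: "g \<in> homs C Y Z" "g' \<in> homs C Y Z" and eq: "\<And>j. j \<in> Obj J \<Longrightarrow> Cmp C g (\<iota>' j) = Cmp C g' (\<iota>' j)"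
    note [simp] = homsD[OF g(1)] homsD[OF g(2)]
    have gh: "Cmp C g h = Cmp C g' h"
      by (rule is_colimit_eq[OF l]) (use eq j in \<open>auto simp: in_homs_iff\<close>)
    show "g = g'" by (rule iso_epi[OF C h(1) gh]) auto
  qed
qed

text \<open>Colimits commute with colimits.\<close>

lemma pointwise_colimit:
  fixes F :: "('u \<times> 'u, 'u \<times> 'u, 'u, 'u) functr" and J :: "('u, 'u) cat"
  assumes J: "small_category J" and F: "is_functor (prod_cat J T) C F"
    and Fj: "\<And>j. j \<in> Obj J \<Longrightarrow> cocontinuous k T C (fix_left J F j)"
    and cC: "cocomplete C" and LT: "linear_category k T" and LC: "linear_category k C"
  obtains K \<kappa> where "cocontinuous k T C K"
    "\<And>W. W \<in> Obj T \<Longrightarrow> is_colimit J C (fix_right T F W) (fobj K W) (\<kappa> W)"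
    "\<And>w j. w \<in> Arr T \<Longrightarrow> j \<in> Obj J \<Longrightarrow> Cmp C (farr K w) (\<kappa> (Dom T w) j) = Cmp C (\<kappa> (Cod T w) j) (farr F (Idt J j, w))"
proof -
  have catJ: "category J" using J by (simp add: small_category_def)
  have catT: "category T" and catC: "category C" using LT LC by (auto dest: linear_category_category)
  note [simp] = catJ catT catC
  have FO [simp]: "fobj F (j, W) \<in> Obj C" if "j \<in> Obj J" "W \<in> Obj T" for j W
    using functor_Obj[OF F, of "(j, W)"] that by simp
  have FA [simp]: "farr F (u, w) \<in> Arr C" "Dom C (farr F (u, w)) = fobj F (Dom J u, Dom T w)" "Cod C (farr F (u, w)) = fobj F (Cod J u, Cod T w)"
    if "u \<in> Arr J" "w \<in> Arr T" for u w
    using functor_arr[OF F, of "(u, w)"] that by simp_all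
  have comm: "Cmp C (farr F (Idt J (Cod J u), w)) (farr F (u, Idt T (Dom T w))) = Cmp C (farr F (u, Idt T (Cod T w))) (farr F (Idt J (Dom J u), w))"
    if "u \<in> Arr J" "w \<in> Arr T" for u w
    using functor_split_left[OF F catJ catT that] functor_split_right[OF F catJ catT that] by simp
  have FC: "farr F (Idt J j, Cmp T w' w) = Cmp C (farr F (Idt J j, w')) (farr F (Idt J j, w))"
    if "j \<in> Obj J" "w \<in> Arr T" "w' \<in> Arr T" "Cod T w = Dom T w'" for j w w'
    using functor_Cmp[OF F, of "(Idt J j, w)" "(Idt J j, w')"] that by simp
  have "\<exists>X \<iota>. is_colimit J C (fix_right T F W) X \<iota>" if "W \<in> Obj T" for W
    using cC J is_functor_fix_right[OF F catJ catT that] unfolding cocomplete_def by blast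
  then obtain K0 \<kappa> where l: "\<And>W. W \<in> Obj T \<Longrightarrow> is_colimit J C (fix_right T F W) (K0 W) (\<kappa> W)"
    by metis
  note co = is_colimit_cocone[OF l]
  have \<kappa> [simp]: "\<kappa> W j \<in> Arr C" "Dom C (\<kappa> W j) = fobj F (j, W)" "Cod C (\<kappa> W j) = K0 W" if "W \<in> Obj T" "j \<in> Obj J" for W j
    using is_coconeD(3-5)[OF co[OF that(1)] that(2)] by simp_all
  have K0 [simp]: "K0 W \<in> Obj C" if "W \<in> Obj T" for W using is_coconeD(2)[OF co[OF that]] .
  have \<kappa>u: "Cmp C (\<kappa> W (Cod J u)) (farr F (u, Idt T W)) = \<kappa> W (Dom J u)" if "W \<in> Obj T" "u \<in> Arr J" for W u
    using is_cocone_Cmp[OF co[OF that(1)] that(2)] by simp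
  have "\<exists>h. h \<in> homs C (K0 (Dom T w)) (K0 (Cod T w)) \<and>
      (\<forall>j\<in>Obj J. Cmp C h (\<kappa> (Dom T w) j) = Cmp C (\<kappa> (Cod T w) j) (farr F (Idt J j, w)))" if w: "w \<in> Arr T" for w
  proof -
    have "is_cocone J C (fix_right T F (Dom T w)) (K0 (Cod T w)) (\<lambda>j. Cmp C (\<kappa> (Cod T w) j) (farr F (Idt J j, w)))"
    proof (rule is_coconeI)
      show "is_functor J C (fix_right T F (Dom T w))" using w by (intro is_functor_fix_right[OF F]) auto
      fix u assume u: "u \<in> Arr J"
      have "Cmp C (Cmp C (\<kappa> (Cod T w) (Cod J u)) (farr F (Idt J (Cod J u), w))) (farr (fix_right T F (Dom T w)) u)
        = Cmp C (\<kappa> (Cod T w) (Cod J u)) (Cmp C (farr F (Idt J (Cod J u), w)) (farr F (u, Idt T (Dom T w))))"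
        using u w by simp
      also have "\<dots> = Cmp C (Cmp C (\<kappa> (Cod T w) (Cod J u)) (farr F (u, Idt T (Cod T w)))) (farr F (Idt J (Dom J u), w))"
        unfolding comm[OF u w] using u w by simp
      also have "\<dots> = Cmp C (\<kappa> (Cod T w) (Dom J u)) (farr F (Idt J (Dom J u), w))"
        using \<kappa>u u w by simp
      finally show "Cmp C (Cmp C (\<kappa> (Cod T w) (Cod J u)) (farr F (Idt J (Cod J u), w))) (farr (fix_right T F (Dom T w)) u) =
        Cmp C (\<kappa> (Cod T w) (Dom J u)) (farr F (Idt J (Dom J u), w))" .
    qed (use w in \<open>auto simp: in_homs_iff\<close>)
    then show ?thesis using is_colimit_factor[OF l[OF Obj_Dom[OF catT w]]] by (metis (no_types, lifting))
  qed
  then obtain K1 where K1: "\<And>w. w \<in> Arr T \<Longrightarrow> K1 w \<in> homs C (K0 (Dom T w)) (K0 (Cod T w))"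
    "\<And>w j. w \<in> Arr T \<Longrightarrow> j \<in> Obj J \<Longrightarrow> Cmp C (K1 w) (\<kappa> (Dom T w) j) = Cmp C (\<kappa> (Cod T w) j) (farr F (Idt J j, w))"
    by metis
  have K1A [simp]: "K1 w \<in> Arr C" "Dom C (K1 w) = K0 (Dom T w)" "Cod C (K1 w) = K0 (Cod T w)" if "w \<in> Arr T" for w
    using K1(1)[OF that] by (auto simp: in_homs_iff)
  define K where "K = \<lparr>fobj = K0, farr = K1\<rparr>"
  have [simp]: "fobj K = K0" "farr K = K1" by (auto simp: K_def)
  have FI: "farr F (Idt J j, Idt T W) = Idt C (fobj F (j, W))" if "j \<in> Obj J" "W \<in> Obj T" for j W
    using functor_Idt[OF F, of "(j, W)"] that by simp
  have Kf: "is_functor T C K"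
  proof (rule is_functorI)
    show "farr K (Idt T W) = Idt C (fobj K W)" if W: "W \<in> Obj T" for W
    proof -
      have "K1 (Idt T W) = Idt C (K0 W)"
      proof (rule is_colimit_eq[OF l[OF W]])
        fix j assume "j \<in> Obj J"
        then show "Cmp C (K1 (Idt T W)) (\<kappa> W j) = Cmp C (Idt C (K0 W)) (\<kappa> W j)"
          using W K1(2)[of "Idt T W" j] FI by simp
      qed (use W in \<open>auto simp: in_homs_iff\<close>)
      then show ?thesis by simp
    qed
    show "farr K (Cmp T g f) = Cmp C (farr K g) (farr K f)" if f: "f \<in> Arr T" "g \<in> Arr T" "Cod T f = Dom T g" for f g
    proof -
      have "K1 (Cmp T g f) = Cmp C (K1 g) (K1 f)"
      proof (rule is_colimit_eq[OF l[OF Obj_Dom[OF catT f(1)]]])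
        fix j assume j: "j \<in> Obj J"
        have "Cmp C (K1 (Cmp T g f)) (\<kappa> (Dom T f) j) = Cmp C (\<kappa> (Cod T g) j) (Cmp C (farr F (Idt J j, g)) (farr F (Idt J j, f)))"
          using f j K1(2)[of "Cmp T g f" j] FC by simp
        also have "\<dots> = Cmp C (Cmp C (K1 g) (\<kappa> (Dom T g) j)) (farr F (Idt J j, f))"
          using f j K1(2)[of g j] by simp
        also have "\<dots> = Cmp C (K1 g) (Cmp C (K1 f) (\<kappa> (Dom T f) j))"
          using f j K1(2)[of f j] by simp
        finally show "Cmp C (K1 (Cmp T g f)) (\<kappa> (Dom T f) j) = Cmp C (Cmp C (K1 g) (K1 f)) (\<kappa> (Dom T f) j)"
          using f j by simp
      qed (use f in \<open>auto simp: in_homs_iff\<close>)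
      then show ?thesis by simp
    qed
  qed (auto simp: in_homs_iff)
  have FL: "farr F (Idt J j, HAdd T f g) = HAdd C (farr F (Idt J j, f)) (farr F (Idt J j, g))"
    if "j \<in> Obj J" "f \<in> Arr T" "g \<in> Arr T" "Dom T f = Dom T g" "Cod T f = Cod T g" for j f g
    using linear_functorD(4)[OF cocontinuousD(1)[OF Fj[OF that(1)]] that(2-)] by simp
  have FS: "farr F (Idt J j, HScale T a f) = HScale C a (farr F (Idt J j, f))"
    if "j \<in> Obj J" "f \<in> Arr T" "a \<in> carrier k" for j f a
    using linear_functorD(5)[OF cocontinuousD(1)[OF Fj[OF that(1)]] that(2-)] by simp
  have "cocontinuous k T C K"
  proof (rule cocontinuousI)
    show "linear_functor k T C K"
    proof (rule linear_functorI[OF LT LC Kf])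
      fix f g assume f: "f \<in> Arr T" "g \<in> Arr T" "Dom T f = Dom T g" "Cod T f = Cod T g"
      have "K1 (HAdd T f g) = HAdd C (K1 f) (K1 g)"
      proof (rule is_colimit_eq[OF l[OF Obj_Dom[OF catT f(2)]]])
        fix j assume j: "j \<in> Obj J"
        show "Cmp C (K1 (HAdd T f g)) (\<kappa> (Dom T g) j) = Cmp C (HAdd C (K1 f) (K1 g)) (\<kappa> (Dom T g) j)"
          using j f LT K1(2)[of "HAdd T f g" j] K1(2)[of f j] K1(2)[of g j]
          by (simp add: FL Cmp_HAdd_left[OF LC] Cmp_HAdd_right[OF LC])
      qed (use f LT LC in \<open>auto simp: in_homs_iff\<close>)
      then show "farr K (HAdd T f g) = HAdd C (farr K f) (farr K g)" by simp
    next
      fix f a assume f: "f \<in> Arr T" "a \<in> carrier k"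
      have "K1 (HScale T a f) = HScale C a (K1 f)"
      proof (rule is_colimit_eq[OF l[OF Obj_Dom[OF catT f(1)]]])
        fix j assume j: "j \<in> Obj J"
        show "Cmp C (K1 (HScale T a f)) (\<kappa> (Dom T f) j) = Cmp C (HScale C a (K1 f)) (\<kappa> (Dom T f) j)"
          using j f LT K1(2)[of "HScale T a f" j] K1(2)[of f j]
          by (simp add: FS Cmp_HScale[OF LC])
      qed (use f LT LC in \<open>auto simp: in_homs_iff\<close>)
      then show "farr K (HScale T a f) = HScale C a (farr K f)" by simp
    qed
    fix J' :: "('u, 'u) cat" and E' W \<iota>'
    assume J': "small_category J'" and l': "is_colimit J' T E' W \<iota>'"
    note co' = is_colimit_cocone[OF l']
    note E' = is_coconeD(1)[OF co']
    have catJ': "category J'" using is_functor_category(1)[OF E'] .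
    note [simp] = catJ' functor_Obj[OF E'] functor_arr[OF E'] is_coconeD(2-5)[OF co']
    have lj: "is_colimit J' C (comp_fun (fix_left J F j) E') (fobj F (j, W)) (\<lambda>i. farr F (Idt J j, \<iota>' i))" if "j \<in> Obj J" for j
      using cocontinuous_colimit[OF Fj[OF that] J' l'] by simp
    show "is_colimit J' C (comp_fun K E') (fobj K W) (\<lambda>i. farr K (\<iota>' i))"
    proof (rule is_colimitI[OF is_cocone_comp_fun[OF co' Kf]])
      fix Y \<tau> assume \<tau>: "is_cocone J' C (comp_fun K E') Y \<tau>"
      note [simp] = is_coconeD(2)[OF \<tau>]
      have \<tau>A [simp]: "\<tau> i \<in> Arr C" "Dom C (\<tau> i) = K0 (fobj E' i)" "Cod C (\<tau> i) = Y" if "i \<in> Obj J'" for i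
        using is_coconeD(3-5)[OF \<tau> that] by auto
      \<comment> \<open>For fixed \<open>j\<close>, cocontinuity of \<open>F(j, -)\<close> turns
        \<open>\<tau>\<close> into an arrow \<open>m j\<close>. These arrows form a cocone in
        \<open>j\<close>, which then factors through \<open>K(W)\<close>.\<close>
      have "\<exists>m. m \<in> homs C (fobj F (j, W)) Y \<and> (\<forall>i\<in>Obj J'. Cmp C m (farr F (Idt J j, \<iota>' i)) = Cmp C (\<tau> i) (\<kappa> (fobj E' i) j))"
        if j: "j \<in> Obj J" for j
      proof -
        have "is_cocone J' C (comp_fun (fix_left J F j) E') Y (\<lambda>i. Cmp C (\<tau> i) (\<kappa> (fobj E' i) j))"
        proof (rule is_coconeI[OF is_coconeD(1)[OF is_colimit_cocone[OF lj[OF j]]]])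
          fix u assume u: "u \<in> Arr J'"
          have "Cmp C (Cmp C (\<tau> (Cod J' u)) (\<kappa> (fobj E' (Cod J' u)) j)) (farr (comp_fun (fix_left J F j) E') u) =
              Cmp C (Cmp C (\<tau> (Cod J' u)) (K1 (farr E' u))) (\<kappa> (fobj E' (Dom J' u)) j)"
            using u j K1(2)[of "farr E' u" j] by simp
          then show "Cmp C (Cmp C (\<tau> (Cod J' u)) (\<kappa> (fobj E' (Cod J' u)) j)) (farr (comp_fun (fix_left J F j) E') u) =
              Cmp C (\<tau> (Dom J' u)) (\<kappa> (fobj E' (Dom J' u)) j)"
            using is_cocone_Cmp[OF \<tau> u] by simp
        qed (use j in \<open>auto simp: in_homs_iff\<close>)
        then show ?thesis by (rule is_colimit_factor[OF lj[OF j]]) blast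
      qed
      then obtain m where m: "\<And>j. j \<in> Obj J \<Longrightarrow> m j \<in> homs C (fobj F (j, W)) Y"
        "\<And>j i. j \<in> Obj J \<Longrightarrow> i \<in> Obj J' \<Longrightarrow> Cmp C (m j) (farr F (Idt J j, \<iota>' i)) = Cmp C (\<tau> i) (\<kappa> (fobj E' i) j)"
        by metis
      have mA [simp]: "m j \<in> Arr C" "Dom C (m j) = fobj F (j, W)" "Cod C (m j) = Y" if "j \<in> Obj J" for j
        using m(1)[OF that] by (auto simp: in_homs_iff)
      have "is_cocone J C (fix_right T F W) Y m"
      proof (rule is_coconeI[OF is_functor_fix_right[OF F catJ catT]])
        fix u assume u: "u \<in> Arr J"
        have "Cmp C (m (Cod J u)) (farr F (u, Idt T W)) = m (Dom J u)"
        proof (rule is_colimit_eq[OF lj[OF Obj_Dom[OF catJ u]]])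
          fix i assume i: "i \<in> Obj J'"
          have "Cmp C (Cmp C (m (Cod J u)) (farr F (u, Idt T W))) (farr F (Idt J (Dom J u), \<iota>' i))
            = Cmp C (m (Cod J u)) (Cmp C (farr F (u, Idt T W)) (farr F (Idt J (Dom J u), \<iota>' i)))"
            using u i by simp
          also have "\<dots> = Cmp C (m (Cod J u)) (Cmp C (farr F (Idt J (Cod J u), \<iota>' i)) (farr F (u, Idt T (fobj E' i))))"
            using comm[of u "\<iota>' i"] u i by simp
          also have "\<dots> = Cmp C (Cmp C (m (Cod J u)) (farr F (Idt J (Cod J u), \<iota>' i))) (farr F (u, Idt T (fobj E' i)))"
            using u i by simp
          also have "\<dots> = Cmp C (Cmp C (\<tau> i) (\<kappa> (fobj E' i) (Cod J u))) (farr F (u, Idt T (fobj E' i)))"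
            using u i m(2) by simp
          also have "\<dots> = Cmp C (\<tau> i) (\<kappa> (fobj E' i) (Dom J u))"
            using u i \<kappa>u by simp
          finally show "Cmp C (Cmp C (m (Cod J u)) (farr F (u, Idt T W))) (farr F (Idt J (Dom J u), \<iota>' i)) =
            Cmp C (m (Dom J u)) (farr F (Idt J (Dom J u), \<iota>' i))" using m(2) u i by simp
        qed (use u in \<open>auto simp: in_homs_iff\<close>)
        then show "Cmp C (m (Cod J u)) (farr (fix_right T F W) u) = m (Dom J u)" by simp
      qed (auto simp: in_homs_iff)
      then obtain h where h: "h \<in> homs C (K0 W) Y" "\<And>j. j \<in> Obj J \<Longrightarrow> Cmp C h (\<kappa> W j) = m j"
        using is_colimit_factor[OF l[OF is_coconeD(2)[OF co']]] by blast
      note [simp] = homsD[OF h(1)]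
      have "Cmp C h (K1 (\<iota>' i)) = \<tau> i" if i: "i \<in> Obj J'" for i
      proof (rule is_colimit_eq[OF l[OF functor_Obj[OF E' i]]])
        fix j assume j: "j \<in> Obj J"
        have "Cmp C (Cmp C h (K1 (\<iota>' i))) (\<kappa> (fobj E' i) j) = Cmp C (Cmp C h (\<kappa> W j)) (farr F (Idt J j, \<iota>' i))"
          using i j K1(2)[of "\<iota>' i" j] by simp
        then show "Cmp C (Cmp C h (K1 (\<iota>' i))) (\<kappa> (fobj E' i) j) = Cmp C (\<tau> i) (\<kappa> (fobj E' i) j)"
          using h(2)[OF j] m(2)[OF j i] by simp
      qed (use i in \<open>auto simp: in_homs_iff\<close>)
      then show "\<exists>h. h \<in> homs C (fobj K W) Y \<and> (\<forall>i\<in>Obj J'. Cmp C h (farr K (\<iota>' i)) = \<tau> i)"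
        using h(1) by auto
    next
      fix Y h h' assume h: "h \<in> homs C (fobj K W) Y" "h' \<in> homs C (fobj K W) Y" and Y: "Y \<in> Obj C"
        and eq: "\<And>i. i \<in> Obj J' \<Longrightarrow> Cmp C h (farr K (\<iota>' i)) = Cmp C h' (farr K (\<iota>' i))"
      note [simp] = homsD[OF h(1), simplified] homsD[OF h(2), simplified]
      show "h = h'"
      proof (rule is_colimit_eq[OF l[OF is_coconeD(2)[OF co']]])
        show "h \<in> homs C (K0 W) Y" "h' \<in> homs C (K0 W) Y" using h by auto
        fix j assume j: "j \<in> Obj J"
        show "Cmp C h (\<kappa> W j) = Cmp C h' (\<kappa> W j)"
        proof (rule is_colimit_eq[OF lj[OF j]])
          fix i assume i: "i \<in> Obj J'"
          have *: "Cmp C (Cmp C g (\<kappa> W j)) (farr F (Idt J j, \<iota>' i)) = Cmp C (Cmp C g (K1 (\<iota>' i))) (\<kappa> (fobj E' i) j)"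
            if "g \<in> homs C (K0 W) Y" for g
            using that i j K1(2)[of "\<iota>' i" j] by (simp add: in_homs_iff)
          show "Cmp C (Cmp C h (\<kappa> W j)) (farr F (Idt J j, \<iota>' i)) = Cmp C (Cmp C h' (\<kappa> W j)) (farr F (Idt J j, \<iota>' i))"
            using *[of h] *[of h'] h eq[OF i] by simp
        qed (use j in \<open>auto simp: in_homs_iff\<close>)
      qed
    qed
  qed
  then show thesis by (rule that) (use l K1(2) in auto)
qed

section \<open>The universal property of the tensor product, with a parameter\<close>

lemma kelly_tensor_lift:
  assumes "kelly_tensor k A B T t" "presentable k C" "cocontinuous k T C H" "cocontinuous k T C H'"
    "nat_trans (prod_cat A B) C (comp_fun H t) (comp_fun H' t) \<beta>"
  obtains \<alpha> where "nat_trans T C H H' \<alpha>" "\<And>p. p \<in> Obj (prod_cat A B) \<Longrightarrow> \<alpha> (fobj t p) = \<beta> p"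
  using assms unfolding kelly_tensor_def by blast

lemma kelly_tensor_eq:
  assumes kt: "kelly_tensor k A B T t" and C: "presentable k C" and H: "cocontinuous k T C H" "cocontinuous k T C H'"
    and \<alpha>: "nat_trans T C H H' \<alpha>" "nat_trans T C H H' \<alpha>'"
    and eq: "\<And>p. p \<in> Obj (prod_cat A B) \<Longrightarrow> \<alpha> (fobj t p) = \<alpha>' (fobj t p)" and X: "X \<in> Obj T"
  shows "\<alpha> X = \<alpha>' X"
proof -
  have t: "is_functor (prod_cat A B) T t" using kt by (auto simp: kelly_tensor_def bicocontinuous_def)
  have "\<exists>\<alpha>0. nat_trans T C H H' \<alpha>0 \<and> (\<forall>p\<in>Obj (prod_cat A B). \<alpha>0 (fobj t p) = \<alpha> (fobj t p)) \<and>
      (\<forall>\<alpha>'. nat_trans T C H H' \<alpha>' \<and> (\<forall>p\<in>Obj (prod_cat A B). \<alpha>' (fobj t p) = \<alpha> (fobj t p)) \<longrightarrow>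
        (\<forall>X\<in>Obj T. \<alpha>' X = \<alpha>0 X))"
    using kt C H nat_trans_whisker[OF \<alpha>(1) t] unfolding kelly_tensor_def by blast
  then obtain \<alpha>0 where "\<And>\<alpha>'. nat_trans T C H H' \<alpha>' \<Longrightarrow> \<forall>p\<in>Obj (prod_cat A B). \<alpha>' (fobj t p) = \<alpha> (fobj t p) \<Longrightarrow> \<forall>X\<in>Obj T. \<alpha>' X = \<alpha>0 X"
    by blast
  then show ?thesis using \<alpha> eq X by metis
qed

lemma presentableD:
  assumes "presentable k C"
  shows "linear_category k C" "locally_small C" "cocomplete C" "accessible k C" "category C"
  using assms linear_category_category by (auto simp: presentable_def)

text \<open>For each \<open>X\<close> the universal property extends \<open>G(X, -)\<close> to a
  functor \<open>H X\<close> on \<open>T\<close>, and its lifting property for transformations makes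
  \<open>H\<close> functorial in \<open>X\<close>. What remains is cocontinuity in \<open>X\<close>,
  about which the universal property says nothing directly. The pointwise colimit of the
  \<open>F(E j, -)\<close> is again cocontinuous on \<open>T\<close>, and it agrees with
  \<open>F(X, -)\<close> on the objects \<open>t(p)\<close>, because there \<open>G(-, p)\<close> is
  cocontinuous; the universal property spreads this agreement over \<open>T\<close>. No internal Hom
  of \<open>Pr\<close> is involved.\<close>

lemma exists_kelly_extension:
  fixes A B T C A' :: "('u, 'u, 'u) lincat"
  assumes kt: "kelly_tensor k A B T t" and pC: "presentable k C" and LA': "linear_category k A'"
    and G: "is_functor (prod_cat A' (prod_cat A B)) C G"
    and G1: "\<And>X. X \<in> Obj A' \<Longrightarrow> bicocontinuous k A B C (fix_left A' G X)"
    and G2: "\<And>p. p \<in> Obj (prod_cat A B) \<Longrightarrow> cocontinuous k A' C (fix_right (prod_cat A B) G p)"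
  obtains F \<beta> where "bicocontinuous k A' T C F"
    "nat_iso (prod_cat A' (prod_cat A B)) C (comp_fun F (prod_fun id_fun t)) G \<beta>"
proof -
  let ?P = "prod_cat A B"
  have pT: "presentable k T" and pA: "presentable k A" and pB: "presentable k B" and t: "is_functor ?P T t"
    using kt by (auto simp: kelly_tensor_def bicocontinuous_def)
  have LC: "linear_category k C" and cC: "cocomplete C" and [simp]: "category C" using presentableD[OF pC] by auto
  have LT: "linear_category k T" and [simp]: "category T" using presentableD[OF pT] by auto
  have [simp]: "category A" "category B" using presentableD[OF pA] presentableD[OF pB] by auto
  have [simp]: "category A'" using linear_category_category[OF LA'] .
  have catP [simp]: "category ?P" by simp
  note Gs [simp] = functor_Obj[OF G] functor_arr[OF G]
  have GO [simp]: "fobj G (X, p) \<in> Obj C" if "X \<in> Obj A'" "p \<in> Obj ?P" for X p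
    using functor_Obj[OF G, of "(X, p)"] that by simp
  have GA [simp]: "farr G (f, g) \<in> Arr C" "Dom C (farr G (f, g)) = fobj G (Dom A' f, Dom ?P g)"
    "Cod C (farr G (f, g)) = fobj G (Cod A' f, Cod ?P g)" if "f \<in> Arr A'" "g \<in> Arr ?P" for f g
    using functor_arr[OF G, of "(f, g)"] that by simp_all
  have tO [simp]: "fobj t p \<in> Obj T" if "p \<in> Obj ?P" for p using functor_Obj[OF t that] .
  have tA [simp]: "farr t g \<in> Arr T" "Dom T (farr t g) = fobj t (Dom ?P g)" "Cod T (farr t g) = fobj t (Cod ?P g)" if "g \<in> Arr ?P" for g
    using functor_arr[OF t that] .
  have "\<exists>H \<beta>. cocontinuous k T C H \<and> nat_iso ?P C (comp_fun H t) (fix_left A' G X) \<beta>" if "X \<in> Obj A'" for X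
    using kt pC G1[OF that] unfolding kelly_tensor_def by blast
  then obtain H b where H: "\<And>X. X \<in> Obj A' \<Longrightarrow> cocontinuous k T C (H X)"
    and b: "\<And>X. X \<in> Obj A' \<Longrightarrow> nat_iso ?P C (comp_fun (H X) t) (fix_left A' G X) (b X)" by metis
  note Hf = cocontinuousD(4)[OF H]
  have HO [simp]: "fobj (H X) W \<in> Obj C" if "X \<in> Obj A'" "W \<in> Obj T" for X W
    using functor_Obj[OF Hf] that by blast
  have HA [simp]: "farr (H X) w \<in> Arr C" "Dom C (farr (H X) w) = fobj (H X) (Dom T w)" "Cod C (farr (H X) w) = fobj (H X) (Cod T w)"
    if "X \<in> Obj A'" "w \<in> Arr T" for X w
    using functor_arr[OF Hf] that by auto
  have bA [simp]: "b X p \<in> Arr C" "Dom C (b X p) = fobj (H X) (fobj t p)" "Cod C (b X p) = fobj G (X, p)" "is_iso C (b X p)"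
    if "X \<in> Obj A'" "p \<in> Obj ?P" for X p
    using nat_trans_simps[OF nat_isoD(1)[OF b]] nat_isoD(2)[OF b] that by auto
  have bn: "Cmp C (b X (Cod ?P g)) (farr (H X) (farr t g)) = Cmp C (farr G (Idt A' X, g)) (b X (Dom ?P g))"
    if "X \<in> Obj A'" "g \<in> Arr ?P" for X g
    using nat_trans_naturality[OF nat_isoD(1)[OF b]] that by simp
  have comm: "Cmp C (farr G (Idt A' (Cod A' f), g)) (farr G (f, Idt ?P (Dom ?P g))) = Cmp C (farr G (f, Idt ?P (Cod ?P g))) (farr G (Idt A' (Dom A' f), g))"
    if "f \<in> Arr A'" "g \<in> Arr ?P" for f g
    using functor_split_left[OF G _ _ that] functor_split_right[OF G _ _ that] by simp
  have GC: "farr G (Cmp A' f' f, Idt ?P p) = Cmp C (farr G (f', Idt ?P p)) (farr G (f, Idt ?P p))"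
    if "p \<in> Obj ?P" "f \<in> Arr A'" "f' \<in> Arr A'" "Cod A' f = Dom A' f'" for p f f'
  proof -
    have "Cmp ?P (Idt ?P p) (Idt ?P p) = Idt ?P p"
      using Idt_simps[OF catP that(1)] Cmp_Idt_left[OF catP] by blast
    moreover have "farr G (Cmp (prod_cat A' ?P) (f', Idt ?P p) (f, Idt ?P p)) = Cmp C (farr G (f', Idt ?P p)) (farr G (f, Idt ?P p))"
      using Idt_simps[OF catP that(1)] that by (intro functor_Cmp[OF G]) auto
    ultimately show ?thesis by simp
  qed
  have GI: "farr G (Idt A' X, Idt ?P p) = Idt C (fobj G (X, p))" if "X \<in> Obj A'" "p \<in> Obj ?P" for X p
    using functor_Idt[OF G, of "(X, p)"] that by simp
  note Ip [simp] = Idt_simps[OF catP]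

  \<comment> \<open>This is \<open>G(f, -)\<close> transported along the isomorphisms
    \<open>b\<close>. It lives on the objects \<open>t(p)\<close> and lifts to a transformation
    \<open>\<alpha> f\<close> on all of \<open>T\<close>.\<close>
  define \<beta> where "\<beta> f p = Cmp C (inv_arr C (b (Cod A' f) p)) (Cmp C (farr G (f, Idt ?P p)) (b (Dom A' f) p))" for f p
  have \<beta>A [simp]: "\<beta> f p \<in> Arr C" "Dom C (\<beta> f p) = fobj (H (Dom A' f)) (fobj t p)" "Cod C (\<beta> f p) = fobj (H (Cod A' f)) (fobj t p)"
    if "f \<in> Arr A'" "p \<in> Obj ?P" for f p
    using that by (auto simp: \<beta>_def)
  have \<beta>b: "Cmp C (b (Cod A' f) p) (\<beta> f p) = Cmp C (farr G (f, Idt ?P p)) (b (Dom A' f) p)"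
    if "f \<in> Arr A'" "p \<in> Obj ?P" for f p
    using that by (simp add: \<beta>_def)
  have Hc: "farr (H X) (Cmp T g f) = Cmp C (farr (H X) g) (farr (H X) f)" if "X \<in> Obj A'" "f \<in> Arr T" "g \<in> Arr T" "Cod T f = Dom T g" for X f g
    using functor_Cmp[OF Hf] that by blast
  have Hi [simp]: "farr (H X) (Idt T W) = Idt C (fobj (H X) W)" if "X \<in> Obj A'" "W \<in> Obj T" for X W
    using functor_Idt[OF Hf] that by blast
  have \<beta>nat: "nat_trans ?P C (comp_fun (H (Dom A' f)) t) (comp_fun (H (Cod A' f)) t) (\<beta> f)" if f: "f \<in> Arr A'" for f
  proof (rule nat_transI)
    show "is_functor ?P C (comp_fun (H (Dom A' f)) t)" "is_functor ?P C (comp_fun (H (Cod A' f)) t)"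
      using f by (auto intro!: is_functor_comp_fun[OF t] Hf)
    show "\<beta> f p \<in> homs C (fobj (comp_fun (H (Dom A' f)) t) p) (fobj (comp_fun (H (Cod A' f)) t) p)" if "p \<in> Obj ?P" for p
      using f that by (simp add: in_homs_iff)
    fix g assume g: "g \<in> Arr ?P"
    note [simp] = Obj_Dom[OF catP g] Obj_Cod[OF catP g]
    have "Cmp C (\<beta> f (Cod ?P g)) (farr (H (Dom A' f)) (farr t g)) = Cmp C (farr (H (Cod A' f)) (farr t g)) (\<beta> f (Dom ?P g))"
    proof (rule iso_mono[of C "b (Cod A' f) (Cod ?P g)"])
      have "Cmp C (b (Cod A' f) (Cod ?P g)) (Cmp C (\<beta> f (Cod ?P g)) (farr (H (Dom A' f)) (farr t g)))
        = Cmp C (Cmp C (b (Cod A' f) (Cod ?P g)) (\<beta> f (Cod ?P g))) (farr (H (Dom A' f)) (farr t g))"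
        using f g by simp
      also have "\<dots> = Cmp C (farr G (f, Idt ?P (Cod ?P g))) (Cmp C (b (Dom A' f) (Cod ?P g)) (farr (H (Dom A' f)) (farr t g)))"
        using f g \<beta>b by simp
      also have "\<dots> = Cmp C (Cmp C (farr G (f, Idt ?P (Cod ?P g))) (farr G (Idt A' (Dom A' f), g))) (b (Dom A' f) (Dom ?P g))"
        using f g bn by simp
      also have "\<dots> = Cmp C (farr G (Idt A' (Cod A' f), g)) (Cmp C (farr G (f, Idt ?P (Dom ?P g))) (b (Dom A' f) (Dom ?P g)))"
        using f g comm[OF f g, symmetric] by simp
      also have "\<dots> = Cmp C (Cmp C (farr G (Idt A' (Cod A' f), g)) (b (Cod A' f) (Dom ?P g))) (\<beta> f (Dom ?P g))"
        using f g \<beta>b[symmetric] by simp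
      also have "\<dots> = Cmp C (b (Cod A' f) (Cod ?P g)) (Cmp C (farr (H (Cod A' f)) (farr t g)) (\<beta> f (Dom ?P g)))"
        using f g bn[symmetric] by simp
      finally show "Cmp C (b (Cod A' f) (Cod ?P g)) (Cmp C (\<beta> f (Cod ?P g)) (farr (H (Dom A' f)) (farr t g))) =
        Cmp C (b (Cod A' f) (Cod ?P g)) (Cmp C (farr (H (Cod A' f)) (farr t g)) (\<beta> f (Dom ?P g)))" .
    qed (use f g in auto)
    then show "Cmp C (\<beta> f (Cod ?P g)) (farr (comp_fun (H (Dom A' f)) t) g) = Cmp C (farr (comp_fun (H (Cod A' f)) t) g) (\<beta> f (Dom ?P g))"
      by simp
  qed
  have "\<exists>\<alpha>. nat_trans T C (H (Dom A' f)) (H (Cod A' f)) \<alpha> \<and> (\<forall>p\<in>Obj ?P. \<alpha> (fobj t p) = \<beta> f p)" if f: "f \<in> Arr A'" for f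
    by (rule kelly_tensor_lift[OF kt pC H H \<beta>nat[OF f]]) (use f in auto)
  then obtain \<alpha> where \<alpha>: "\<And>f. f \<in> Arr A' \<Longrightarrow> nat_trans T C (H (Dom A' f)) (H (Cod A' f)) (\<alpha> f)"
    "\<And>f p. f \<in> Arr A' \<Longrightarrow> p \<in> Obj ?P \<Longrightarrow> \<alpha> f (fobj t p) = \<beta> f p" by metis
  have \<alpha>A [simp]: "\<alpha> f W \<in> Arr C" "Dom C (\<alpha> f W) = fobj (H (Dom A' f)) W" "Cod C (\<alpha> f W) = fobj (H (Cod A' f)) W"
    if "f \<in> Arr A'" "W \<in> Obj T" for f W
    using nat_trans_simps[OF \<alpha>(1)] that by auto
  have \<alpha>n: "Cmp C (\<alpha> f (Cod T w)) (farr (H (Dom A' f)) w) = Cmp C (farr (H (Cod A' f)) w) (\<alpha> f (Dom T w))"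
    if "f \<in> Arr A'" "w \<in> Arr T" for f w
    using nat_trans_naturality[OF \<alpha>(1)] that by blast
  have eq: "\<alpha>1 W = \<alpha>2 W" if "nat_trans T C (H X) (H Y) \<alpha>1" "nat_trans T C (H X) (H Y) \<alpha>2" "X \<in> Obj A'" "Y \<in> Obj A'"
    "\<And>p. p \<in> Obj ?P \<Longrightarrow> \<alpha>1 (fobj t p) = \<alpha>2 (fobj t p)" "W \<in> Obj T" for \<alpha>1 \<alpha>2 X Y W
    using kelly_tensor_eq[OF kt pC H H that(1,2)] that by blast
  have \<alpha>I: "\<alpha> (Idt A' X) W = Idt C (fobj (H X) W)" if X: "X \<in> Obj A'" and W: "W \<in> Obj T" for X W
  proof (rule eq[OF _ nat_trans_Idt[OF Hf[OF X]] X X _ W])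
    show "nat_trans T C (H X) (H X) (\<alpha> (Idt A' X))" using \<alpha>(1)[of "Idt A' X"] X by simp
    show "\<alpha> (Idt A' X) (fobj t p) = Idt C (fobj (H X) (fobj t p))" if "p \<in> Obj ?P" for p
      using X that by (simp add: \<alpha>(2) \<beta>_def GI)
  qed
  have \<alpha>C: "\<alpha> (Cmp A' g f) W = Cmp C (\<alpha> g W) (\<alpha> f W)"
    if f: "f \<in> Arr A'" "g \<in> Arr A'" "Cod A' f = Dom A' g" and W: "W \<in> Obj T" for f g W
  proof (rule eq[OF _ nat_trans_Cmp[OF \<alpha>(1)[OF f(1)] \<alpha>(1)[OF f(2), folded f(3)]] _ _ _ W])
    show "nat_trans T C (H (Dom A' f)) (H (Cod A' g)) (\<alpha> (Cmp A' g f))" using \<alpha>(1)[of "Cmp A' g f"] f by simp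
    fix p assume p: "p \<in> Obj ?P"
    have "\<beta> (Cmp A' g f) p = Cmp C (\<beta> g p) (\<beta> f p)"
      using f p by (simp add: \<beta>_def GC)
    then show "\<alpha> (Cmp A' g f) (fobj t p) = Cmp C (\<alpha> g (fobj t p)) (\<alpha> f (fobj t p))"
      using f p by (simp add: \<alpha>(2))
  qed (use f in auto)
  \<comment> \<open>By naturality of \<open>\<alpha> f\<close> the two factors could equally be
    composed in the other order.\<close>
  define F where "F = \<lparr>fobj = (\<lambda>(X, W). fobj (H X) W), farr = (\<lambda>(f, w). Cmp C (farr (H (Cod A' f)) w) (\<alpha> f (Dom T w)))\<rparr>"
  have Fs [simp]: "fobj F (X, W) = fobj (H X) W" "farr F (f, w) = Cmp C (farr (H (Cod A' f)) w) (\<alpha> f (Dom T w))" for X W f w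
    by (auto simp: F_def)
  have Ff: "is_functor (prod_cat A' T) C F"
  proof (rule is_functorI)
    show "fobj F P \<in> Obj C" if "P \<in> Obj (prod_cat A' T)" for P using that by (cases P) simp
    show "farr F P \<in> homs C (fobj F (Dom (prod_cat A' T) P)) (fobj F (Cod (prod_cat A' T) P))" if "P \<in> Arr (prod_cat A' T)" for P
      using that by (cases P) (simp add: in_homs_iff)
    show "farr F (Idt (prod_cat A' T) P) = Idt C (fobj F P)" if "P \<in> Obj (prod_cat A' T)" for P
      using that by (cases P) (simp add: \<alpha>I)
    show "farr F (Cmp (prod_cat A' T) Q P) = Cmp C (farr F Q) (farr F P)"
      if "P \<in> Arr (prod_cat A' T)" "Q \<in> Arr (prod_cat A' T)" "Cod (prod_cat A' T) P = Dom (prod_cat A' T) Q" for P Q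
    proof (cases P; cases Q)
      fix f v g w assume PQ: "P = (f, v)" "Q = (g, w)"
      then have a: "f \<in> Arr A'" "g \<in> Arr A'" "v \<in> Arr T" "w \<in> Arr T" "Cod A' f = Dom A' g" "Cod T v = Dom T w" using that by auto
      have "Cmp C (Cmp C (farr (H (Cod A' g)) w) (\<alpha> g (Dom T w))) (Cmp C (farr (H (Cod A' f)) v) (\<alpha> f (Dom T v)))
        = Cmp C (farr (H (Cod A' g)) w) (Cmp C (Cmp C (\<alpha> g (Dom T w)) (farr (H (Cod A' f)) v)) (\<alpha> f (Dom T v)))"
        using a by simp
      also have "\<dots> = Cmp C (farr (H (Cod A' g)) w) (Cmp C (farr (H (Cod A' g)) v) (Cmp C (\<alpha> g (Dom T v)) (\<alpha> f (Dom T v))))"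
        using a \<alpha>n[of g v] by simp
      finally show ?thesis using PQ a by (simp add: Hc \<alpha>C)
    qed
  qed simp_all
  have left: "cocontinuous k T C (fix_left A' F X)" if X: "X \<in> Obj A'" for X
    by (rule cocontinuous_cong[OF H[OF X]]) (use X in \<open>auto simp: \<alpha>I\<close>)
  have right: "cocontinuous k A' C (fix_right T F W)" if W: "W \<in> Obj T" for W
  proof (rule cocontinuousI)
    note FW = is_functor_fix_right[OF Ff \<open>category A'\<close> \<open>category T\<close>]
    have Fa: "farr (fix_right T F W') f = \<alpha> f W'" if "f \<in> Arr A'" "W' \<in> Obj T" for f W'
      using that by simp
    show "linear_functor k A' C (fix_right T F W)"
    proof (rule linear_functorI[OF LA' LC FW[OF W]])
      fix f g assume f: "f \<in> Arr A'" "g \<in> Arr A'" "Dom A' f = Dom A' g" "Cod A' f = Cod A' g"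
      have s: "HAdd A' f g \<in> Arr A'" "Dom A' (HAdd A' f g) = Dom A' g" "Cod A' (HAdd A' f g) = Cod A' g"
        using f LA' by auto
      have "\<alpha> (HAdd A' f g) W = HAdd C (\<alpha> f W) (\<alpha> g W)"
      proof (rule eq[OF _ nat_trans_HAdd[OF LC \<alpha>(1)[OF f(1), unfolded f(3,4)] \<alpha>(1)[OF f(2)]] _ _ _ W])
        show "nat_trans T C (H (Dom A' g)) (H (Cod A' g)) (\<alpha> (HAdd A' f g))" using \<alpha>(1)[OF s(1)] s by simp
        fix p assume p: "p \<in> Obj ?P"
        have "farr G (HAdd A' f g, Idt ?P p) = HAdd C (farr G (f, Idt ?P p)) (farr G (g, Idt ?P p))"
          using linear_functorD(4)[OF cocontinuousD(1)[OF G2[OF p]] f] by simp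
        then have "\<beta> (HAdd A' f g) p = HAdd C (\<beta> f p) (\<beta> g p)"
          using f p s LC by (simp add: \<beta>_def Cmp_HAdd_left[OF LC] Cmp_HAdd_right[OF LC])
        then show "\<alpha> (HAdd A' f g) (fobj t p) = HAdd C (\<alpha> f (fobj t p)) (\<alpha> g (fobj t p))"
          using f p s by (simp add: \<alpha>(2))
      qed (use f in auto)
      then show "farr (fix_right T F W) (HAdd A' f g) = HAdd C (farr (fix_right T F W) f) (farr (fix_right T F W) g)"
        using f s W Fa by metis
    next
      fix f a assume f: "f \<in> Arr A'" "a \<in> carrier k"
      have s: "HScale A' a f \<in> Arr A'" "Dom A' (HScale A' a f) = Dom A' f" "Cod A' (HScale A' a f) = Cod A' f"
        using f LA' by auto
      have "\<alpha> (HScale A' a f) W = HScale C a (\<alpha> f W)"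
      proof (rule eq[OF _ nat_trans_HScale[OF LC \<alpha>(1)[OF f(1)] f(2)] _ _ _ W])
        show "nat_trans T C (H (Dom A' f)) (H (Cod A' f)) (\<alpha> (HScale A' a f))" using \<alpha>(1)[OF s(1)] s by simp
        fix p assume p: "p \<in> Obj ?P"
        have "farr G (HScale A' a f, Idt ?P p) = HScale C a (farr G (f, Idt ?P p))"
          using linear_functorD(5)[OF cocontinuousD(1)[OF G2[OF p]] f] by simp
        then have "\<beta> (HScale A' a f) p = HScale C a (\<beta> f p)"
          using f p s LC by (simp add: \<beta>_def Cmp_HScale[OF LC])
        then show "\<alpha> (HScale A' a f) (fobj t p) = HScale C a (\<alpha> f (fobj t p))"
          using f p s by (simp add: \<alpha>(2))
      qed (use f in auto)
      then show "farr (fix_right T F W) (HScale A' a f) = HScale C a (farr (fix_right T F W) f)"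
        using f s W Fa by metis
    qed
    fix J :: "('u, 'u) cat" and E X \<iota>
    assume J: "small_category J" and l: "is_colimit J A' E X \<iota>"
    note co = is_colimit_cocone[OF l]
    note E = is_coconeD(1)[OF co]
    have catJ: "category J" using is_functor_category(1)[OF E] .
    note [simp] = catJ functor_Obj[OF E] functor_arr[OF E] is_coconeD(2-5)[OF co]
    have co': "is_cocone J C (comp_fun (fix_right T F W') E) (fobj (H X) W') (\<lambda>j. \<alpha> (\<iota> j) W')" if W': "W' \<in> Obj T" for W'
    proof -
      have "is_cocone J C (comp_fun (fix_right T F W') E) (fobj (fix_right T F W') X) (\<lambda>j. farr (fix_right T F W') (\<iota> j))"
        using is_cocone_comp_fun[OF co FW[OF W']] .
      then show ?thesis using W' unfolding is_cocone_def by (auto simp: in_homs_iff)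
    qed
    \<comment> \<open>\<open>K(W)\<close> will be the colimit of the objects
      \<open>F(E j, W)\<close>, and \<open>\<zeta>\<close> its comparison with
      \<open>F(X, W)\<close>. The aim is to show that \<open>\<zeta>\<close> is invertible; at
      \<open>W = t(p)\<close> this is cocontinuity of \<open>G(-, p)\<close>.\<close>
    let ?F = "comp_fun F (prod_fun E id_fun)"
    have F': "is_functor (prod_cat J T) C ?F"
      by (intro is_functor_comp_fun[OF is_functor_prod_fun[OF E is_functor_id_fun] Ff]) simp
    have Fj: "cocontinuous k T C (fix_left J ?F j)" if j: "j \<in> Obj J" for j
      by (rule cocontinuous_cong[OF left[of "fobj E j"]]) (use j functor_Idt[OF E] in auto)
    obtain K \<kappa> where K: "cocontinuous k T C K"
      and \<kappa>: "\<And>W. W \<in> Obj T \<Longrightarrow> is_colimit J C (fix_right T ?F W) (fobj K W) (\<kappa> W)"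
      and \<kappa>n: "\<And>w j. w \<in> Arr T \<Longrightarrow> j \<in> Obj J \<Longrightarrow> Cmp C (farr K w) (\<kappa> (Dom T w) j) = Cmp C (\<kappa> (Cod T w) j) (farr ?F (Idt J j, w))"
      using pointwise_colimit[OF J F' Fj cC LT LC] by blast
    have Kf: "is_functor T C K" using cocontinuousD(4)[OF K] .
    have Feq: "fix_right T ?F W' = comp_fun (fix_right T F W') E" for W'
      by (simp add: fix_right_def comp_fun_def prod_fun_def id_fun_def comp_def)
    note \<kappa>' = \<kappa>[unfolded Feq]
    note [simp] = functor_Obj[OF Kf] functor_arr[OF Kf]
    have \<kappa>A [simp]: "\<kappa> W j \<in> Arr C" "Dom C (\<kappa> W j) = fobj (H (fobj E j)) W" "Cod C (\<kappa> W j) = fobj K W" if "W \<in> Obj T" "j \<in> Obj J" for W j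
      using is_coconeD(3-5)[OF is_colimit_cocone[OF \<kappa>'[OF that(1)]] that(2)] by auto
    have "\<exists>h. h \<in> homs C (fobj K W') (fobj (H X) W') \<and> (\<forall>j\<in>Obj J. Cmp C h (\<kappa> W' j) = \<alpha> (\<iota> j) W')" if "W' \<in> Obj T" for W'
      by (rule is_colimit_factor[OF \<kappa>'[OF that] co'[OF that]]) blast
    then obtain \<zeta> where \<zeta>: "\<And>W'. W' \<in> Obj T \<Longrightarrow> \<zeta> W' \<in> homs C (fobj K W') (fobj (H X) W')"
      "\<And>W' j. W' \<in> Obj T \<Longrightarrow> j \<in> Obj J \<Longrightarrow> Cmp C (\<zeta> W') (\<kappa> W' j) = \<alpha> (\<iota> j) W'"
      by metis
    have \<zeta>A [simp]: "\<zeta> W' \<in> Arr C" "Dom C (\<zeta> W') = fobj K W'" "Cod C (\<zeta> W') = fobj (H X) W'" if "W' \<in> Obj T" for W'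
      using \<zeta>(1)[OF that] by (auto simp: in_homs_iff)
    have X: "X \<in> Obj A'" by simp
    have \<zeta>n: "nat_trans T C K (H X) \<zeta>"
    proof (rule nat_transI[OF Kf Hf[OF X] \<zeta>(1)])
      fix w assume w: "w \<in> Arr T"
      show "Cmp C (\<zeta> (Cod T w)) (farr K w) = Cmp C (farr (H X) w) (\<zeta> (Dom T w))"
      proof (rule is_colimit_eq[OF \<kappa>'[OF Obj_Dom[OF \<open>category T\<close> w]]])
        fix j assume j: "j \<in> Obj J"
        have "Cmp C (Cmp C (\<zeta> (Cod T w)) (farr K w)) (\<kappa> (Dom T w) j) = Cmp C (Cmp C (\<zeta> (Cod T w)) (\<kappa> (Cod T w) j)) (farr (H (fobj E j)) w)"
          using w j \<kappa>n[OF w j] functor_Idt[OF E j] by (simp add: \<alpha>I)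
        also have "\<dots> = Cmp C (farr (H X) w) (\<alpha> (\<iota> j) (Dom T w))"
          using w j \<zeta>(2) \<alpha>n[of "\<iota> j" w] by simp
        also have "\<dots> = Cmp C (Cmp C (farr (H X) w) (\<zeta> (Dom T w))) (\<kappa> (Dom T w) j)"
          using w j \<zeta>(2) by simp
        finally show "Cmp C (Cmp C (\<zeta> (Cod T w)) (farr K w)) (\<kappa> (Dom T w) j) = Cmp C (Cmp C (farr (H X) w) (\<zeta> (Dom T w))) (\<kappa> (Dom T w) j)" .
      qed (use w in \<open>auto simp: in_homs_iff\<close>)
    qed simp
    have \<zeta>t: "is_iso C (\<zeta> (fobj t p))" if p: "p \<in> Obj ?P" for p
    proof (rule is_colimit_unique[OF \<kappa>'[OF tO[OF p]] _ \<zeta>(1)[OF tO[OF p]] \<zeta>(2)[OF tO[OF p]]])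
      have i: "nat_iso A' C (fix_right T F (fobj t p)) (fix_right ?P G p) (\<lambda>X. b X p)"
      proof -
        have "nat_trans A' C (fix_right T F (fobj t p)) (fix_right ?P G p) (\<lambda>X. b X p)"
        proof (rule nat_transI[OF FW[OF tO[OF p]] is_functor_fix_right[OF G _ _ p]])
          fix f assume f: "f \<in> Arr A'"
          show "Cmp C (b (Cod A' f) p) (farr (fix_right T F (fobj t p)) f) = Cmp C (farr (fix_right ?P G p) f) (b (Dom A' f) p)"
            using Fa[OF f tO[OF p]] \<beta>b[OF f p] \<alpha>(2)[OF f p] by simp
        qed (use p in \<open>auto simp: in_homs_iff\<close>)
        then show ?thesis using p by (simp add: nat_iso_def)
      qed
      have "is_colimit J C (comp_fun (fix_right T F (fobj t p)) E) (fobj (fix_right T F (fobj t p)) X) (\<lambda>j. farr (fix_right T F (fobj t p)) (\<iota> j))"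
        by (rule is_colimit_nat_iso[OF nat_iso_inverse[OF i] co cocontinuous_colimit[OF G2[OF p] J l]])
      then show "is_colimit J C (comp_fun (fix_right T F (fobj t p)) E) (fobj (H X) (fobj t p)) (\<lambda>j. \<alpha> (\<iota> j) (fobj t p))"
        using is_colimit_iso_vertex[of J C _ _ _ "Idt C (fobj (H X) (fobj t p))" _ "\<lambda>j. \<alpha> (\<iota> j) (fobj t p)"] p by auto
    qed
    have "nat_iso ?P C (comp_fun K t) (comp_fun (H X) t) (\<lambda>p. \<zeta> (fobj t p))"
      using nat_trans_whisker[OF \<zeta>n t] \<zeta>t by (simp add: nat_iso_def)
    \<comment> \<open>So far \<open>\<zeta>\<close> has an inverse only at the objects
      \<open>t(p)\<close>. Lifting it gives a transformation \<open>\<xi>\<close> on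
      \<open>T\<close>, and the uniqueness of lifts shows that \<open>\<xi>\<close> and
      \<open>\<zeta>\<close> are inverse to each other.\<close>
    note inv = nat_isoD(1)[OF nat_iso_inverse[OF this]]
    obtain \<xi> where \<xi>: "nat_trans T C (H X) K \<xi>" "\<And>p. p \<in> Obj ?P \<Longrightarrow> \<xi> (fobj t p) = inv_arr C (\<zeta> (fobj t p))"
      using kelly_tensor_lift[OF kt pC H[OF X] K inv] by blast
    note [simp] = nat_trans_simps[OF \<xi>(1)]
    have 1: "Cmp C (\<xi> W) (\<zeta> W) = Idt C (fobj K W)"
      by (rule kelly_tensor_eq[OF kt pC K K nat_trans_Cmp[OF \<zeta>n \<xi>(1)] nat_trans_Idt[OF Kf] _ W]) (simp add: \<xi>(2) \<zeta>t)
    have 2: "Cmp C (\<zeta> W) (\<xi> W) = Idt C (fobj (H X) W)"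
      by (rule kelly_tensor_eq[OF kt pC H[OF X] H[OF X] nat_trans_Cmp[OF \<xi>(1) \<zeta>n] nat_trans_Idt[OF Hf[OF X]] _ W]) (simp add: \<xi>(2) \<zeta>t)
    have "is_iso C (\<zeta> W)"
      by (rule is_isoI[OF \<open>category C\<close> \<zeta>(1)[OF W] _ 1 2]) (use W in \<open>simp add: in_homs_iff\<close>)
    then have "is_colimit J C (comp_fun (fix_right T F W) E) (fobj (H X) W) (\<lambda>j. farr (fix_right T F W) (\<iota> j))"
      by (rule is_colimit_iso_vertex[OF \<kappa>'[OF W]]) (use W in \<open>auto simp: \<zeta>(2)\<close>)
    then show "is_colimit J C (comp_fun (fix_right T F W) E) (fobj (fix_right T F W) X) (\<lambda>j. farr (fix_right T F W) (\<iota> j))"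
      by simp
  qed
  have "nat_trans (prod_cat A' ?P) C (comp_fun F (prod_fun id_fun t)) G (\<lambda>(X, p). b X p)"
  proof (rule nat_transI)
    show "is_functor (prod_cat A' ?P) C (comp_fun F (prod_fun id_fun t))"
      by (rule is_functor_comp_fun[OF is_functor_prod_fun[OF is_functor_id_fun t] Ff]) simp
    show "is_functor (prod_cat A' ?P) C G" by fact
    show "(case P of (X, p) \<Rightarrow> b X p) \<in> homs C (fobj (comp_fun F (prod_fun id_fun t)) P) (fobj G P)" if "P \<in> Obj (prod_cat A' ?P)" for P
    proof (cases P rule: prod.exhaust[case_names Pair])
      case (Pair X p)
      then have "X \<in> Obj A'" "p \<in> Obj ?P" using that by (auto simp del: prod_cat_simps simp add: prod_cat_simps(1)[of _ _ A' ?P])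
      then show ?thesis using Pair by (simp add: in_homs_iff)
    qed
    show "Cmp C (case Cod (prod_cat A' ?P) Q of (X, p) \<Rightarrow> b X p) (farr (comp_fun F (prod_fun id_fun t)) Q) =
        Cmp C (farr G Q) (case Dom (prod_cat A' ?P) Q of (X, p) \<Rightarrow> b X p)" if "Q \<in> Arr (prod_cat A' ?P)" for Q
    proof (cases Q rule: prod.exhaust[case_names Pair])
      case (Pair f g)
      then have f: "f \<in> Arr A'" and g: "g \<in> Arr ?P" using that prod_cat_simps(2)[of f g A' ?P] by auto
      note [simp] = Obj_Dom[OF catP g] Obj_Cod[OF catP g]
      have "Cmp C (b (Cod A' f) (Cod ?P g)) (Cmp C (farr (H (Cod A' f)) (farr t g)) (\<beta> f (Dom ?P g)))
        = Cmp C (Cmp C (b (Cod A' f) (Cod ?P g)) (farr (H (Cod A' f)) (farr t g))) (\<beta> f (Dom ?P g))"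
        using f g by simp
      also have "\<dots> = Cmp C (farr G (Idt A' (Cod A' f), g)) (Cmp C (b (Cod A' f) (Dom ?P g)) (\<beta> f (Dom ?P g)))"
        using f g bn by simp
      also have "\<dots> = Cmp C (Cmp C (farr G (Idt A' (Cod A' f), g)) (farr G (f, Idt ?P (Dom ?P g)))) (b (Dom A' f) (Dom ?P g))"
        using f g \<beta>b by simp
      also have "\<dots> = Cmp C (farr G (f, g)) (b (Dom A' f) (Dom ?P g))"
        using functor_split_right[OF G _ _ f g] by simp
      finally show ?thesis using Pair f g \<alpha>(2) prod_cat_simps(3,4)[of A' ?P f g] by simp
    qed
  qed
  then have "nat_iso (prod_cat A' ?P) C (comp_fun F (prod_fun id_fun t)) G (\<lambda>(X, p). b X p)"
    unfolding nat_iso_def by (auto simp: prod_cat_simps(1)[of _ _ A' ?P])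
  moreover have "bicocontinuous k A' T C F"
    unfolding bicocontinuous_def using Ff left right by blast
  ultimately show thesis by (rule that[rotated])
qed

section \<open>Functors of two variables: composition, symmetry and change of an argument\<close>

lemma bicocontinuous_comp_fun:
  assumes F: "bicocontinuous k C D E F" and G: "cocontinuous k E E' G"
  shows "bicocontinuous k C D E' (comp_fun G F)"
proof -
  have "fix_left C (comp_fun G F) X = comp_fun G (fix_left C F X)" "fix_right D (comp_fun G F) Y = comp_fun G (fix_right D F Y)" for X Y
    by (simp_all add: fix_left_def fix_right_def comp_fun_def comp_def)
  then show ?thesis
    using bicocontinuousD[OF F] cocontinuous_comp_fun[OF _ G] is_functor_comp_fun[OF _ cocontinuousD(4)[OF G]]
    unfolding bicocontinuous_def by metis
qed

lemma bicocontinuous_swap: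
  assumes C: "category C" "category D" and F: "bicocontinuous k C D E F"
  shows "bicocontinuous k D C E (comp_fun F swap_fun)"
proof -
  have "fix_left D (comp_fun F swap_fun) Y = fix_right D F Y" "fix_right C (comp_fun F swap_fun) X = fix_left C F X" for X Y
    by (simp_all add: fix_left_def fix_right_def)
  then show ?thesis
    using bicocontinuousD[OF F] is_functor_comp_fun[OF is_functor_swap_fun[OF C(2,1)]] unfolding bicocontinuous_def by simp
qed

lemma nat_iso_whisker:
  assumes "nat_iso T C H H' \<alpha>" and t: "is_functor B T t"
  shows "nat_iso B C (comp_fun H t) (comp_fun H' t) (\<lambda>p. \<alpha> (fobj t p))"
  using assms nat_trans_whisker[OF _ t] functor_Obj[OF t] by (auto simp: nat_iso_def)

lemma comp_fun_swap_swap [simp]: "comp_fun (comp_fun F swap_fun) swap_fun = F"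
  by (simp add: comp_fun_def swap_fun_def comp_def)

lemma swap_fun_obj: "fobj swap_fun p = prod.swap p"
  by (simp add: swap_fun_def)

text \<open>Functors and transformations on one product category are whiskered with the swap to the
  other and back. The right snake relation is proved for \<open>t\<close> after the swap.\<close>

lemma kelly_tensor_swap:
  assumes kt: "kelly_tensor k A B T t"
  shows "kelly_tensor k B A T (comp_fun t swap_fun)"
proof -
  have p: "presentable k A" "presentable k B" "presentable k T" and t: "bicocontinuous k A B T t"
    using kt by (auto simp: kelly_tensor_def)
  have C: "category A" "category B" "category T" using p presentableD(5) by auto
  have s: "is_functor (prod_cat A B) (prod_cat B A) swap_fun" "is_functor (prod_cat B A) (prod_cat A B) swap_fun"
    using is_functor_swap_fun C by auto
  have "\<exists>H \<beta>. cocontinuous k T E H \<and> nat_iso (prod_cat B A) E (comp_fun H (comp_fun t swap_fun)) G \<beta>"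
    if E: "presentable k E" and G: "bicocontinuous k B A E G" for E :: "('a, 'a, 'a) lincat" and G
  proof -
    obtain H \<beta> where H: "cocontinuous k T E H" "nat_iso (prod_cat A B) E (comp_fun H t) (comp_fun G swap_fun) \<beta>"
      using kt E bicocontinuous_swap[OF C(2,1) G] unfolding kelly_tensor_def by blast
    show ?thesis using H(1) nat_iso_whisker[OF H(2) s(2)] unfolding comp_fun_swap_swap comp_fun_assoc[of H t] by blast
  qed
  moreover have "\<exists>\<alpha>. nat_trans T E H H' \<alpha> \<and> (\<forall>p\<in>Obj (prod_cat B A). \<alpha> (fobj (comp_fun t swap_fun) p) = \<beta> p) \<and>
      (\<forall>\<alpha>'. nat_trans T E H H' \<alpha>' \<and> (\<forall>p\<in>Obj (prod_cat B A). \<alpha>' (fobj (comp_fun t swap_fun) p) = \<beta> p) \<longrightarrow> (\<forall>X\<in>Obj T. \<alpha>' X = \<alpha> X))"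
    if E: "presentable k E" and H: "cocontinuous k T E H" "cocontinuous k T E H'"
      and \<beta>: "nat_trans (prod_cat B A) E (comp_fun H (comp_fun t swap_fun)) (comp_fun H' (comp_fun t swap_fun)) \<beta>"
    for E :: "('a, 'a, 'a) lincat" and H H' \<beta>
  proof -
    have e: "comp_fun (comp_fun K (comp_fun t swap_fun)) swap_fun = comp_fun K t" for K :: "('a, 'a, 'a, 'a) functr"
      by (simp add: comp_fun_assoc[symmetric])
    have "nat_trans (prod_cat A B) E (comp_fun H t) (comp_fun H' t) (\<lambda>p. \<beta> (prod.swap p))"
      using nat_trans_whisker[OF \<beta> s(1)] unfolding e swap_fun_obj .
    from kelly_tensor_lift[OF kt E H this] obtain \<alpha> where \<alpha>: "nat_trans T E H H' \<alpha>"
      "\<And>p. p \<in> Obj (prod_cat A B) \<Longrightarrow> \<alpha> (fobj t p) = \<beta> (prod.swap p)" by blast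
    have "\<alpha> (fobj (comp_fun t swap_fun) p) = \<beta> p" if "p \<in> Obj (prod_cat B A)" for p
      using \<alpha>(2)[of "prod.swap p"] that by (cases p) (simp add: swap_fun_obj)
    moreover have "\<alpha>' X = \<alpha> X" if \<alpha>': "nat_trans T E H H' \<alpha>'"
      "\<forall>p\<in>Obj (prod_cat B A). \<alpha>' (fobj (comp_fun t swap_fun) p) = \<beta> p" and X: "X \<in> Obj T" for \<alpha>' X
    proof (rule kelly_tensor_eq[OF kt E H \<alpha>'(1) \<alpha>(1) _ X])
      show "\<alpha>' (fobj t p) = \<alpha> (fobj t p)" if "p \<in> Obj (prod_cat A B)" for p
        using \<alpha>(2)[OF that] bspec[OF \<alpha>'(2), of "prod.swap p"] that by (cases p) (simp add: swap_fun_obj)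
    qed
    ultimately show ?thesis using \<alpha>(1) by blast
  qed
  ultimately show ?thesis
    unfolding kelly_tensor_def using p bicocontinuous_swap[OF C(1,2) t] by blast
qed

text \<open>These are the hypotheses of \<open>exists_kelly_extension\<close> for the functor
  \<open>\<kappa>(X, Y) \<otimes> Z\<close> of three variables, whose extension is the functor
  \<open>F\<close> of the left snake relation. In each variable \<open>G\<close> is a composite of
  cocontinuous functors.\<close>

lemma (in linear_cocomplete) copower_pairing:
  assumes \<kappa>: "bicocontinuous k C C (Vect k) \<kappa>"
  defines "G \<equiv> comp_fun copower (comp_fun (prod_fun \<kappa> id_fun) rebracket)"
  shows "is_functor (prod_cat C (prod_cat C C)) C G" "X \<in> Obj C \<Longrightarrow> bicocontinuous k C C C (fix_left C G X)"
    "p \<in> Obj (prod_cat C C) \<Longrightarrow> cocontinuous k C C (fix_right (prod_cat C C) G p)"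
proof -
  note \<kappa>f = bicocontinuousD(1)[OF \<kappa>]
  note U = bicocontinuousD[OF bicocontinuous_copower]
  have \<kappa>O: "fobj \<kappa> (X, Y) \<in> Obj (Vect k)" if "X \<in> Obj C" "Y \<in> Obj C" for X Y
    using functor_Obj[OF \<kappa>f, of "(X, Y)"] that by simp
  show G: "is_functor (prod_cat C (prod_cat C C)) C G"
    unfolding G_def
    by (intro is_functor_comp_fun[OF _ U(1)] is_functor_comp_fun[OF is_functor_rebracket] is_functor_prod_fun[OF \<kappa>f] is_functor_id_fun) simp_all
  show "bicocontinuous k C C C (fix_left C G X)" if X: "X \<in> Obj C" for X
  proof -
    have "fix_left C (fix_left C G X) Y = fix_left (Vect k) copower (fobj \<kappa> (X, Y))" if "Y \<in> Obj C" for Y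
      using functor_Idt[OF \<kappa>f, of "(X, Y)"] X that by (simp add: G_def fix_left_def comp_fun_def comp_def prod_fun_def rebracket_def id_fun_def)
    moreover have "fix_right C (fix_left C G X) Z = comp_fun (fix_right C copower Z) (fix_left C \<kappa> X)" for Z
      by (simp add: G_def fix_left_def fix_right_def comp_fun_def comp_def prod_fun_def rebracket_def id_fun_def)
    ultimately show ?thesis
      unfolding bicocontinuous_def using is_functor_fix_left[OF G] X U(2) \<kappa>O
        cocontinuous_comp_fun[OF bicocontinuousD(2)[OF \<kappa> X] U(3)] by simp
  qed
  show "cocontinuous k C C (fix_right (prod_cat C C) G p)" if "p \<in> Obj (prod_cat C C)"
  proof (cases p)
    case (Pair Y Z)
    then have "fix_right (prod_cat C C) G p = comp_fun (fix_right C copower Z) (fix_right C \<kappa> Y)"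
      by (simp add: G_def fix_left_def fix_right_def comp_fun_def comp_def prod_fun_def rebracket_def id_fun_def)
    then show ?thesis using cocontinuous_comp_fun[OF bicocontinuousD(3)[OF \<kappa>] U(3)] that Pair by simp
  qed
qed

text \<open>Serves to pass, in the snake relations, between \<open>\<Delta>(k)\<close> and the
  object \<open>D\<close> from which \<open>\<Delta>\<close> is built.\<close>

lemma fix_right_iso:
  assumes C: "category C" and T: "category T" and F: "is_functor (prod_cat C T) D F" and w: "w \<in> homs T W W'" "is_iso T w"
  shows "nat_iso C D (fix_right T F W) (fix_right T F W') (\<lambda>X. farr F (Idt C X, w))"
proof -
  note [simp] = C T homsD[OF w(1)] w(2)
  have W [simp]: "W \<in> Obj T" "W' \<in> Obj T" using Obj_Dom[OF T, of w] Obj_Cod[OF T, of w] by simp_all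
  have i: "is_iso (prod_cat C T) (Idt C X, w)" if "X \<in> Obj C" for X
    using that by (intro is_isoI[of _ _ "(X, W)" "(X, W')" "(Idt C X, inv_arr T w)"]) (auto simp: in_homs_iff)
  have "nat_trans C D (fix_right T F W) (fix_right T F W') (\<lambda>X. farr F (Idt C X, w))"
  proof (rule nat_transI)
    show "is_functor C D (fix_right T F W)" "is_functor C D (fix_right T F W')"
      using is_functor_fix_right[OF F C T] by simp_all
    show "farr F (Idt C X, w) \<in> homs D (fobj (fix_right T F W) X) (fobj (fix_right T F W') X)" if "X \<in> Obj C" for X
      using functor_arr[OF F, of "(Idt C X, w)"] that by (simp add: in_homs_iff)
    show "Cmp D (farr F (Idt C (Cod C f), w)) (farr (fix_right T F W) f) = Cmp D (farr (fix_right T F W') f) (farr F (Idt C (Dom C f), w))"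
      if "f \<in> Arr C" for f
      using functor_split_left[OF F C T, of f w] functor_split_right[OF F C T, of f w] that by simp
  qed
  then show ?thesis using functor_is_iso(1)[OF F i] by (simp add: nat_iso_def)
qed

text \<open>The two legs of a relation enter symmetrically. In the right snake relation the same
  object \<open>D\<close> appears with the legs of its presentation exchanged.\<close>

lemma glueing_flip:
  assumes "glueing C S R src tgt X p q W i" and e: "bij_betw e R' R"
    and "\<And>r. r \<in> R' \<Longrightarrow> src' r = tgt (e r) \<and> tgt' r = src (e r) \<and> p' r = q (e r) \<and> q' r = p (e r)"
  shows "glueing C S R' src' tgt' X p' q' W i"
proof -
  have "glue_cocone C S R' src' tgt' X p' q' Y j \<longleftrightarrow> glue_cocone C S R src tgt X p q Y j" for Y j
    using assms(3) unfolding glue_cocone_def bij_betw_imp_surj_on[OF e, symmetric] by auto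
  then show ?thesis using assms(1) by (simp add: glueing_def)
qed

section \<open>Vector spaces by generators and relations\<close>

text \<open>Formal linear combinations are words of coefficients and generators, possibly with
  repetitions; \<open>card_less_lists\<close> keeps the set of these words small.\<close>

fun lsum :: "'u vs \<Rightarrow> ('s \<Rightarrow> 'u) \<Rightarrow> ('u \<times> 's) list \<Rightarrow> 'u" where
  "lsum W \<tau> [] = \<zero>\<^bsub>W\<^esub>"
| "lsum W \<tau> ((a, s) # l) = a \<odot>\<^bsub>W\<^esub> \<tau> s \<oplus>\<^bsub>W\<^esub> lsum W \<tau> l"

lemma lsum_closed:
  assumes "module k V" "\<And>s. s \<in> S \<Longrightarrow> \<tau> s \<in> carrier V" "l \<in> lists (carrier k \<times> S)"
  shows "lsum V \<tau> l \<in> carrier V"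
proof -
  interpret V: module k V by fact
  show ?thesis using assms(3) by induction (use assms in auto)
qed

lemma lsum_lin:
  assumes "module k V" "module k W" "lin k V W h" "\<And>s. s \<in> S \<Longrightarrow> \<tau> s \<in> carrier V" "l \<in> lists (carrier k \<times> S)"
  shows "h (lsum V \<tau> l) = lsum W (\<lambda>s. h (\<tau> s)) l"
proof -
  interpret V: module k V by fact
  have c: "lsum V \<tau> l \<in> carrier V" if "\<forall>x\<in>set l. x \<in> carrier k \<times> S" for l
    using lsum_closed[of k V S \<tau> l] assms(1,4) that by auto
  show ?thesis using assms(5)
    by induction (use assms lin_zero[OF assms(1-3)] linD[OF assms(3)] c in \<open>auto\<close>)
qed

lemma lsum_append:
  assumes V: "module k V" "\<And>s. s \<in> S \<Longrightarrow> \<tau> s \<in> carrier V" "l \<in> lists (carrier k \<times> S)" "l' \<in> lists (carrier k \<times> S)"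
  shows "lsum V \<tau> (l @ l') = lsum V \<tau> l \<oplus>\<^bsub>V\<^esub> lsum V \<tau> l'"
proof -
  interpret V: module k V by fact
  have c: "lsum V \<tau> l \<in> carrier V" if "\<forall>x\<in>set l. x \<in> carrier k \<times> S" for l
    using lsum_closed[of k V S \<tau> l] V(1,2) that by auto
  show ?thesis using V(3)
    by induction (use V c in \<open>auto simp: V.M.a_assoc\<close>)
qed

lemma lsum_scale:
  assumes V: "module k V" "\<And>s. s \<in> S \<Longrightarrow> \<tau> s \<in> carrier V" "l \<in> lists (carrier k \<times> S)" "a \<in> carrier k"
  shows "lsum V \<tau> (map (\<lambda>(b, s). (a \<otimes>\<^bsub>k\<^esub> b, s)) l) = a \<odot>\<^bsub>V\<^esub> lsum V \<tau> l"
proof -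
  interpret V: module k V by fact
  have c: "lsum V \<tau> l \<in> carrier V" if "\<forall>x\<in>set l. x \<in> carrier k \<times> S" for l
    using lsum_closed[of k V S \<tau> l] V(1,2) that by auto
  show ?thesis using V(3)
    by induction (use V c in \<open>auto simp: V.smult_r_distr V.smult_assoc1\<close>)
qed

text \<open>Two formal linear combinations are identified if they agree in every small vector space in
  which the relations hold; the vector space axioms then hold in the quotient because they hold in
  all these spaces.\<close>

lemma exists_universal_space:
  fixes S :: "'s set" and k :: "'u ring"
  assumes u: "regular_universe TYPE('u)" and N: "natLeq <o |UNIV :: 'u set|" and k: "field k" "small (carrier k)"
    and S: "|S| <o |UNIV :: 'u set|" and Rel: "Rel \<subseteq> lists (carrier k \<times> S) \<times> lists (carrier k \<times> S)"
  obtains V \<eta> where "V \<in> Obj (Vect k)" "\<And>s. s \<in> S \<Longrightarrow> \<eta> s \<in> carrier V"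
    "\<And>l l'. (l, l') \<in> Rel \<Longrightarrow> lsum V \<eta> l = lsum V \<eta> l'"
    "\<And>W \<tau>. W \<in> Obj (Vect k) \<Longrightarrow> (\<And>s. s \<in> S \<Longrightarrow> \<tau> s \<in> carrier W) \<Longrightarrow> (\<And>l l'. (l, l') \<in> Rel \<Longrightarrow> lsum W \<tau> l = lsum W \<tau> l') \<Longrightarrow>
      \<exists>h. lin k V W h \<and> (\<forall>s\<in>S. h (\<eta> s) = \<tau> s)"
    "\<And>W h h' x. W \<in> Obj (Vect k) \<Longrightarrow> lin k V W h \<Longrightarrow> lin k V W h' \<Longrightarrow> (\<And>s. s \<in> S \<Longrightarrow> h (\<eta> s) = h' (\<eta> s)) \<Longrightarrow>
      x \<in> carrier V \<Longrightarrow> h x = h' x"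
proof -
  interpret k: field k by fact
  define L where "L = lists (carrier k \<times> S)"
  have cL: "|L| <o |UNIV :: 'u set|"
    unfolding L_def using k(2) by (intro card_less_lists card_less_Times u N S) (simp add: small_def)
  then obtain e :: "('u \<times> 's) list \<Rightarrow> 'u" where e: "inj_on e L"
    using card_of_ordLeq[of L "UNIV :: 'u set"] ordLess_imp_ordLeq by blast
  define test where "test W \<tau> \<longleftrightarrow> W \<in> Obj (Vect k) \<and> (\<forall>s\<in>S. \<tau> s \<in> carrier W) \<and> (\<forall>(l, l')\<in>Rel. lsum W \<tau> l = lsum W \<tau> l')" for W \<tau>
  define eqv where "eqv l l' \<longleftrightarrow> (\<forall>W \<tau>. test W \<tau> \<longrightarrow> lsum W \<tau> l = lsum W \<tau> l')" for l l'
  \<comment> \<open>Equivalent words define the same predicate \<open>eqv l\<close>, hence the same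
    chosen representative; this is what makes \<open>cls\<close> constant on classes. The injection
    \<open>e\<close> then names classes by elements of the universe, and \<open>w\<close> reads a
    representative back.\<close>
  define rep where "rep l = (SOME l'. l' \<in> L \<and> eqv l l')" for l
  have rep: "rep l \<in> L \<and> eqv l (rep l)" if "l \<in> L" for l
    unfolding rep_def by (rule someI[of _ l]) (use that in \<open>simp add: eqv_def\<close>)
  define cls where "cls l = e (rep l)" for l
  define w where "w x = inv_into L e x" for x
  have w: "w (cls l) \<in> L" "eqv (w (cls l)) l" if "l \<in> L" for l
    using rep[OF that] inv_into_f_f[OF e, of "rep l"] by (auto simp: cls_def w_def eqv_def)
  have cls_eq: "cls l = cls l'" if "eqv l l'" for l l'
  proof -
    have "eqv l = eqv l'" using that by (auto simp: eqv_def fun_eq_iff)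
    then show ?thesis by (simp add: cls_def rep_def)
  qed
  define V where "V = \<lparr>carrier = cls ` L, monoid.mult = (\<lambda>_ _. cls []), one = cls [], zero = cls [],
    add = (\<lambda>x y. cls (w x @ w y)), smult = (\<lambda>a x. cls (map (\<lambda>(b, s). (a \<otimes>\<^bsub>k\<^esub> b, s)) (w x)))\<rparr>"
  have Vs: "carrier V = cls ` L" "\<zero>\<^bsub>V\<^esub> = cls []" "x \<oplus>\<^bsub>V\<^esub> y = cls (w x @ w y)"
    "a \<odot>\<^bsub>V\<^esub> x = cls (map (\<lambda>(b, s). (a \<otimes>\<^bsub>k\<^esub> b, s)) (w x))" for x y a
    by (auto simp: V_def)
  have L: "[] \<in> L" "l \<in> L \<Longrightarrow> l' \<in> L \<Longrightarrow> l @ l' \<in> L" "a \<in> carrier k \<Longrightarrow> l \<in> L \<Longrightarrow> map (\<lambda>(b, s). (a \<otimes>\<^bsub>k\<^esub> b, s)) l \<in> L"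
    "s \<in> S \<Longrightarrow> a \<in> carrier k \<Longrightarrow> [(a, s)] \<in> L" for l l' a s
    by (fastforce simp: L_def)+
  have wL: "w x \<in> L" if "x \<in> carrier V" for x using that w by (auto simp: Vs)
  define val where "val W \<tau> x = lsum W \<tau> (w x)" for W \<tau> x
  have val_cls: "val W \<tau> (cls l) = lsum W \<tau> l" if "l \<in> L" "test W \<tau>" for W \<tau> l
    using w[OF that(1)] that by (auto simp: val_def eqv_def)
  have tm: "module k W" "s \<in> S \<Longrightarrow> \<tau> s \<in> carrier W" if "test W \<tau>" for W \<tau> s
    using that by (auto simp: test_def Obj_Vect)
  have val_closed: "val W \<tau> x \<in> carrier W" if "test W \<tau>" "x \<in> carrier V" for W \<tau> x
    using lsum_closed[of k W S \<tau> "w x", OF tm(1)[OF that(1)] tm(2)[OF that(1)]] wL[OF that(2)] by (simp add: val_def L_def)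
  have val_add: "val W \<tau> (x \<oplus>\<^bsub>V\<^esub> y) = val W \<tau> x \<oplus>\<^bsub>W\<^esub> val W \<tau> y" if "test W \<tau>" "x \<in> carrier V" "y \<in> carrier V" for W \<tau> x y
  proof -
    have "val W \<tau> (x \<oplus>\<^bsub>V\<^esub> y) = lsum W \<tau> (w x @ w y)"
      unfolding Vs(3) using val_cls[OF L(2)[OF wL[OF that(2)] wL[OF that(3)]] that(1)] .
    then show ?thesis
      using lsum_append[of k W S \<tau> "w x" "w y", OF tm(1)[OF that(1)] tm(2)[OF that(1)]] wL[OF that(2)] wL[OF that(3)]
      by (simp add: val_def L_def)
  qed
  have val_smult: "val W \<tau> (a \<odot>\<^bsub>V\<^esub> x) = a \<odot>\<^bsub>W\<^esub> val W \<tau> x" if "test W \<tau>" "x \<in> carrier V" "a \<in> carrier k" for W \<tau> x a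
  proof -
    have "val W \<tau> (a \<odot>\<^bsub>V\<^esub> x) = lsum W \<tau> (map (\<lambda>(b, s). (a \<otimes>\<^bsub>k\<^esub> b, s)) (w x))"
      unfolding Vs(4) using val_cls[OF L(3)[OF that(3) wL[OF that(2)]] that(1)] .
    then show ?thesis
      using lsum_scale[of k W S \<tau> "w x" a, OF tm(1)[OF that(1)] tm(2)[OF that(1)]] wL[OF that(2)] that(3)
      by (simp add: val_def L_def)
  qed
  have val_zero: "val W \<tau> \<zero>\<^bsub>V\<^esub> = \<zero>\<^bsub>W\<^esub>" if "test W \<tau>" for W \<tau>
    using val_cls[OF L(1) that] by (simp add: Vs)
  have ext: "x = y" if "x \<in> carrier V" "y \<in> carrier V" "\<And>W \<tau>. test W \<tau> \<Longrightarrow> val W \<tau> x = val W \<tau> y" for x y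
    using that val_cls cls_eq by (auto simp: Vs eqv_def)
  have cl: "\<And>x y. x \<in> carrier V \<Longrightarrow> y \<in> carrier V \<Longrightarrow> x \<oplus>\<^bsub>V\<^esub> y \<in> carrier V"
    "\<And>x a. x \<in> carrier V \<Longrightarrow> a \<in> carrier k \<Longrightarrow> a \<odot>\<^bsub>V\<^esub> x \<in> carrier V"
    using wL L by (auto simp: Vs)
  have z: "\<zero>\<^bsub>V\<^esub> \<in> carrier V" using L by (auto simp: Vs)
  have VO: "V \<in> Obj (Vect k)"
    unfolding Obj_Vect
  proof
    show "small (carrier V)" using card_less_image[OF cL] by (simp add: small_def Vs)
    show "module k V"
    proof (rule moduleI)
      show "abelian_group V"
      proof (rule abelian_groupI)
        fix x y z assume x: "x \<in> carrier V" "y \<in> carrier V" "z \<in> carrier V"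
        show "x \<oplus>\<^bsub>V\<^esub> y \<in> carrier V" using cl x by blast
        show "x \<oplus>\<^bsub>V\<^esub> y \<oplus>\<^bsub>V\<^esub> z = x \<oplus>\<^bsub>V\<^esub> (y \<oplus>\<^bsub>V\<^esub> z)"
        proof (rule ext)
          fix W \<tau> assume t: "test W \<tau>"
          interpret W: module k W using tm[OF t] by blast
          show "val W \<tau> (x \<oplus>\<^bsub>V\<^esub> y \<oplus>\<^bsub>V\<^esub> z) = val W \<tau> (x \<oplus>\<^bsub>V\<^esub> (y \<oplus>\<^bsub>V\<^esub> z))"
            using x t by (simp add: val_add cl(1) val_closed W.M.a_assoc)
        qed (use cl(1) x in auto)
        show "x \<oplus>\<^bsub>V\<^esub> y = y \<oplus>\<^bsub>V\<^esub> x"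
        proof (rule ext)
          fix W \<tau> assume t: "test W \<tau>"
          interpret W: module k W using tm[OF t] by blast
          show "val W \<tau> (x \<oplus>\<^bsub>V\<^esub> y) = val W \<tau> (y \<oplus>\<^bsub>V\<^esub> x)"
            using x t by (simp add: val_add val_closed W.M.a_comm)
        qed (use cl(1) x in auto)
        show "\<zero>\<^bsub>V\<^esub> \<oplus>\<^bsub>V\<^esub> x = x"
        proof (rule ext)
          fix W \<tau> assume t: "test W \<tau>"
          interpret W: module k W using tm[OF t] by blast
          show "val W \<tau> (\<zero>\<^bsub>V\<^esub> \<oplus>\<^bsub>V\<^esub> x) = val W \<tau> x"
            using x t z by (simp add: val_add val_zero val_closed)
        qed (use cl(1) z x in auto)
        have m: "\<ominus>\<^bsub>k\<^esub> \<one>\<^bsub>k\<^esub> \<in> carrier k" by simp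
        have "(\<ominus>\<^bsub>k\<^esub> \<one>\<^bsub>k\<^esub>) \<odot>\<^bsub>V\<^esub> x \<oplus>\<^bsub>V\<^esub> x = \<zero>\<^bsub>V\<^esub>"
        proof (rule ext)
          fix W \<tau> assume t: "test W \<tau>"
          interpret W: module k W using tm[OF t] by blast
          show "val W \<tau> ((\<ominus>\<^bsub>k\<^esub> \<one>\<^bsub>k\<^esub>) \<odot>\<^bsub>V\<^esub> x \<oplus>\<^bsub>V\<^esub> x) = val W \<tau> \<zero>\<^bsub>V\<^esub>"
            using x t z m cl(2)[OF x(1) m] by (simp add: val_add val_zero val_closed val_smult W.smult_l_minus W.M.l_neg)
        qed (use cl m z x in auto)
        then show "\<exists>y\<in>carrier V. y \<oplus>\<^bsub>V\<^esub> x = \<zero>\<^bsub>V\<^esub>" using cl(2)[OF x(1) m] by blast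
      qed (fact z)
      fix a b x y assume a: "a \<in> carrier k" "b \<in> carrier k" "x \<in> carrier V" "y \<in> carrier V"
      show "a \<odot>\<^bsub>V\<^esub> x \<in> carrier V" using cl a by blast
      show "(a \<oplus>\<^bsub>k\<^esub> b) \<odot>\<^bsub>V\<^esub> x = a \<odot>\<^bsub>V\<^esub> x \<oplus>\<^bsub>V\<^esub> b \<odot>\<^bsub>V\<^esub> x"
      proof (rule ext)
        fix W \<tau> assume t: "test W \<tau>"
        interpret W: module k W using tm[OF t] by blast
        show "val W \<tau> ((a \<oplus>\<^bsub>k\<^esub> b) \<odot>\<^bsub>V\<^esub> x) = val W \<tau> (a \<odot>\<^bsub>V\<^esub> x \<oplus>\<^bsub>V\<^esub> b \<odot>\<^bsub>V\<^esub> x)"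
          using a t cl(2) by (simp add: val_add val_closed val_smult W.smult_l_distr)
      qed (use cl a k.add.m_closed in auto)
      show "a \<odot>\<^bsub>V\<^esub> (x \<oplus>\<^bsub>V\<^esub> y) = a \<odot>\<^bsub>V\<^esub> x \<oplus>\<^bsub>V\<^esub> a \<odot>\<^bsub>V\<^esub> y"
      proof (rule ext)
        fix W \<tau> assume t: "test W \<tau>"
        interpret W: module k W using tm[OF t] by blast
        show "val W \<tau> (a \<odot>\<^bsub>V\<^esub> (x \<oplus>\<^bsub>V\<^esub> y)) = val W \<tau> (a \<odot>\<^bsub>V\<^esub> x \<oplus>\<^bsub>V\<^esub> a \<odot>\<^bsub>V\<^esub> y)"
          using a t cl by (simp add: val_add val_closed val_smult W.smult_r_distr)
      qed (use cl a in auto)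
      show "(a \<otimes>\<^bsub>k\<^esub> b) \<odot>\<^bsub>V\<^esub> x = a \<odot>\<^bsub>V\<^esub> (b \<odot>\<^bsub>V\<^esub> x)"
      proof (rule ext)
        fix W \<tau> assume t: "test W \<tau>"
        interpret W: module k W using tm[OF t] by blast
        show "val W \<tau> ((a \<otimes>\<^bsub>k\<^esub> b) \<odot>\<^bsub>V\<^esub> x) = val W \<tau> (a \<odot>\<^bsub>V\<^esub> (b \<odot>\<^bsub>V\<^esub> x))"
          using a t cl by (simp add: val_closed val_smult W.smult_assoc1)
      qed (use cl a k.m_closed in auto)
    next
      fix x assume a: "x \<in> carrier V"
      show "\<one>\<^bsub>k\<^esub> \<odot>\<^bsub>V\<^esub> x = x"
      proof (rule ext)
        fix W \<tau> assume t: "test W \<tau>"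
        interpret W: module k W using tm[OF t] by blast
        show "val W \<tau> (\<one>\<^bsub>k\<^esub> \<odot>\<^bsub>V\<^esub> x) = val W \<tau> x"
          using a t by (simp add: val_closed val_smult)
      qed (use cl a k.one_closed in auto)
    qed (fact k.is_cring)
  qed
  have mV: "module k V" using VO by (simp add: Obj_Vect)
  define \<eta> where "\<eta> s = cls [(\<one>\<^bsub>k\<^esub>, s)]" for s
  have \<eta>: "\<eta> s \<in> carrier V" if "s \<in> S" for s using L(4)[OF that] by (auto simp: \<eta>_def Vs)
  have val_\<eta>: "val W \<tau> (\<eta> s) = \<tau> s" if "s \<in> S" "test W \<tau>" for W \<tau> s
  proof -
    interpret W: module k W using tm[OF that(2)] by blast
    show ?thesis using val_cls[OF L(4)[OF that(1) k.one_closed] that(2)] tm(2)[OF that(2,1)] by (simp add: \<eta>_def)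
  qed
  have lin_val: "lin k V W (val W \<tau>)" if "test W \<tau>" for W \<tau>
    using that by (intro linI) (auto simp: val_closed val_add val_smult)
  have val_lsum: "val W \<tau> (lsum V \<eta> l) = lsum W \<tau> l" if "l \<in> L" "test W \<tau>" for W \<tau> l
  proof -
    have "val W \<tau> (lsum V \<eta> l) = lsum W (\<lambda>s. val W \<tau> (\<eta> s)) l"
      using lsum_lin[of k V W "val W \<tau>" S \<eta> l, OF mV tm(1)[OF that(2)] lin_val[OF that(2)] \<eta>] that(1) by (auto simp: L_def)
    also have "\<dots> = lsum W \<tau> l"
      using that(1) unfolding L_def by (induction l) (auto simp: val_\<eta> that(2))
    finally show ?thesis .
  qed
  have \<eta>L: "lsum V \<eta> l \<in> carrier V" if "l \<in> L" for l
    using lsum_closed[of k V S \<eta> l, OF mV \<eta>] that by (auto simp: L_def)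
  \<comment> \<open>Every element of \<open>V\<close> is thus the value of a word at the generators
    \<open>\<eta>\<close>, which yields the uniqueness claim.\<close>
  have lsum_cls: "lsum V \<eta> l = cls l" if "l \<in> L" for l
    by (rule ext) (use that \<eta>L val_lsum val_cls in \<open>auto simp: Vs\<close>)
  show thesis
  proof (rule that[OF VO \<eta>])
    fix l l' assume r: "(l, l') \<in> Rel"
    then have l: "l \<in> L" "l' \<in> L" using Rel by (auto simp: L_def)
    show "lsum V \<eta> l = lsum V \<eta> l'"
      by (rule ext) (use l r \<eta>L val_lsum in \<open>auto simp: test_def\<close>)
  next
    fix W \<tau> assume "W \<in> Obj (Vect k)" "\<And>s. s \<in> S \<Longrightarrow> \<tau> s \<in> carrier W" "\<And>l l'. (l, l') \<in> Rel \<Longrightarrow> lsum W \<tau> l = lsum W \<tau> l'"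
    then have "test W \<tau>" by (auto simp: test_def)
    then show "\<exists>h. lin k V W h \<and> (\<forall>s\<in>S. h (\<eta> s) = \<tau> s)" using lin_val val_\<eta> by blast
  next
    fix W h h' x
    assume W: "W \<in> Obj (Vect k)" and h: "lin k V W h" "lin k V W h'" and eq: "\<And>s. s \<in> S \<Longrightarrow> h (\<eta> s) = h' (\<eta> s)" and x: "x \<in> carrier V"
    obtain l where l: "l \<in> L" "x = lsum V \<eta> l" using x lsum_cls by (auto simp: Vs)
    have "h x = lsum W (\<lambda>s. h (\<eta> s)) l" "h' x = lsum W (\<lambda>s. h' (\<eta> s)) l"
      using lsum_lin[of k V W h S \<eta> l, OF mV module_Vect[OF W] h(1) \<eta>] lsum_lin[of k V W h' S \<eta> l, OF mV module_Vect[OF W] h(2) \<eta>] l by (auto simp: L_def)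
    moreover have "lsum W (\<lambda>s. h (\<eta> s)) l = lsum W (\<lambda>s. h' (\<eta> s)) l"
      using l(1) unfolding L_def by (induction l) (auto simp: eq)
    ultimately show "h x = h' x" by simp
  qed
qed

section \<open>Compact projective objects form an essentially small class\<close>

text \<open>Accessibility supplies an infinite cardinal strictly below that of the universe, which
  rules out a countable universe.\<close>

lemma accessible_natLeq:
  fixes C :: "('u, 'u, 'u) lincat"
  assumes "accessible k C" shows "natLeq <o |UNIV :: 'u set|"
proof -
  obtain r :: "'u rel" where r: "Card_order r" "cinfinite r" "r <o |UNIV :: 'u set|"
    using assms unfolding accessible_def by blast
  then show ?thesis using natLeq_ordLeq_cinfinite ordLeq_ordLess_trans by blast
qed

text \<open>Filteredness is applied to the discrete category on \<open>S\<close>, which lies over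
  the universe as test diagrams must. The empty set gives an object of \<open>J\<close>, a
  two-element set a common bound.\<close>

lemma card_filtered_bound:
  fixes J :: "('u, 'u) cat"
  assumes J: "card_filtered r J" and r: "Card_order r" "cinfinite r" and S: "finite S" "\<And>s. s \<in> S \<Longrightarrow> d s \<in> Obj J"
  obtains m a where "m \<in> Obj J" "\<And>s. s \<in> (S :: 'u set) \<Longrightarrow> a s \<in> homs J (d s) m"
proof -
  define I :: "('u, 'u) cat" where
    "I = \<lparr>Obj = S, Arr = S, Dom = id, Cod = id, Cmp = (\<lambda>g f. g), Idt = id\<rparr>"
  define E where "E = \<lparr>fobj = d, farr = (\<lambda>s. Idt J (d s))\<rparr>"
  have catJ: "category J" using J by (simp add: card_filtered_def)
  have I: "category I" by (auto simp: category_def I_def homs_def)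
  have "is_functor I J E"
    by (rule is_functorI[OF I catJ]) (use S catJ in \<open>auto simp: I_def E_def in_homs_iff\<close>)
  moreover have "|Arr I| <o r"
    unfolding I_def using S(1) r
    by (auto intro!: finite_ordLess_infinite simp: Field_card_of card_of_well_order_on card_order_on_well_order_on cinfinite_def)
  ultimately obtain m \<iota> where "is_cocone I J E m \<iota>" using J I unfolding card_filtered_def by blast
  from is_coconeD(2-5)[OF this] show thesis
    by (intro that[of m \<iota>]) (auto simp: I_def E_def in_homs_iff)
qed

text \<open>The images of the arrows that factor through the diagram form a subspace with the universal
  property of the colimit.\<close>

lemma compact_projective_factor:
  fixes C :: "('u, 'u, 'u) lincat" and J :: "('u, 'u) cat"
  assumes L: "linear_category k C" and ls: "locally_small C" and P: "compact_projective k C P"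
    and J: "small_category J" "card_filtered r J" and r: "Card_order r" "cinfinite r"
    and l: "is_colimit J C E X \<iota>" and x: "x \<in> homs C P X"
  obtains j f where "j \<in> Obj J" "f \<in> homs C P (fobj E j)" "x = Cmp C (\<iota> j) f"
proof -
  note co = is_colimit_cocone[OF l]
  note E = is_coconeD(1)[OF co]
  have catC: "category C" and catJ: "category J" using is_functor_category[OF E] by auto
  note [simp] = catC catJ is_coconeD(2-5)[OF co] functor_Obj[OF E] functor_arr[OF E]
  have PO [simp]: "P \<in> Obj C" using P by (simp add: compact_projective_def)
  note pr = P[unfolded compact_projective_def, THEN conjunct2]
  have l': "is_colimit J (Vect k) (comp_fun (hom_functor C P) E) (hom_space C P X) (\<lambda>j. farr (hom_functor C P) (\<iota> j))"
    using preserves_colimitsD[where P = "\<lambda>_. True", OF pr J(1) TrueI l] unfolding hom_functor_simps(1) .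
  define U where "U = {x. \<exists>j\<in>Obj J. \<exists>f\<in>homs C P (fobj E j). x = Cmp C (\<iota> j) f}"
  define V where "V = hom_space C P X"
  have VO: "V \<in> Obj (Vect k)" unfolding V_def using hom_space_Obj[OF L ls] by simp
  interpret V: module k V using module_Vect[OF VO] .
  have UV: "U \<subseteq> carrier V" by (auto simp: U_def V_def in_homs_iff)
  have U_smult: "a \<odot>\<^bsub>V\<^esub> x \<in> U" if "a \<in> carrier k" "x \<in> U" for a x
  proof -
    obtain j f where jf: "j \<in> Obj J" "f \<in> homs C P (fobj E j)" "x = Cmp C (\<iota> j) f" using \<open>x \<in> U\<close> by (auto simp: U_def)
    then have "a \<odot>\<^bsub>V\<^esub> x = Cmp C (\<iota> j) (HScale C a f)" using that by (simp add: V_def Cmp_HScale[OF L] in_homs_iff)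
    then show ?thesis using jf(1) HScale_homs[OF L jf(2) that(1)] unfolding U_def by blast
  qed
  \<comment> \<open>Filteredness brings two arrows to a common stage \<open>m\<close> of the
    diagram, where they can be added.\<close>
  have U_add: "x \<oplus>\<^bsub>V\<^esub> y \<in> U" if "x \<in> U" "y \<in> U" for x y
  proof -
    obtain i f where i: "i \<in> Obj J" "f \<in> homs C P (fobj E i)" "x = Cmp C (\<iota> i) f" using \<open>x \<in> U\<close> by (auto simp: U_def)
    obtain j g where j: "j \<in> Obj J" "g \<in> homs C P (fobj E j)" "y = Cmp C (\<iota> j) g" using \<open>y \<in> U\<close> by (auto simp: U_def)
    obtain m a where m: "m \<in> Obj J" "\<And>s. s \<in> {i, j} \<Longrightarrow> a s \<in> homs J s m"
      using card_filtered_bound[OF J(2) r, of "{i, j}" "\<lambda>s. s"] i(1) j(1) by auto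
    have a: "a i \<in> homs J i m" "a j \<in> homs J j m" using m(2) by auto
    have 1: "x = Cmp C (\<iota> m) (Cmp C (farr E (a i)) f)"
      using is_cocone_Cmp[OF co homsD(1)[OF a(1)]] homsD[OF a(1)] i m(1) Cmp_assoc[OF catC, of f "farr E (a i)" "\<iota> m"]
      by (simp add: in_homs_iff)
    have 2: "y = Cmp C (\<iota> m) (Cmp C (farr E (a j)) g)"
      using is_cocone_Cmp[OF co homsD(1)[OF a(2)]] homsD[OF a(2)] j m(1) Cmp_assoc[OF catC, of g "farr E (a j)" "\<iota> m"]
      by (simp add: in_homs_iff)
    let ?h = "HAdd C (Cmp C (farr E (a i)) f) (Cmp C (farr E (a j)) g)"
    have "?h \<in> homs C P (fobj E m)" using i j homsD[OF a(1)] homsD[OF a(2)] L by (simp add: in_homs_iff)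
    moreover have "x \<oplus>\<^bsub>V\<^esub> y = Cmp C (\<iota> m) ?h"
      unfolding 1 2 using i j m(1) homsD[OF a(1)] homsD[OF a(2)] by (simp add: V_def Cmp_HAdd_right[OF L] in_homs_iff)
    ultimately show ?thesis using m(1) by (auto simp: U_def)
  qed
  have U_zero: "\<zero>\<^bsub>V\<^esub> \<in> U"
  proof -
    obtain m where m: "m \<in> Obj J" using card_filtered_bound[OF J(2) r, of "{}"] by auto
    have "Cmp C (\<iota> m) (HZero C P (fobj E m)) \<in> U"
      using m HZero_homs[OF L PO functor_Obj[OF E m]] unfolding U_def by blast
    then have "\<zero>\<^bsub>k\<^esub> \<odot>\<^bsub>V\<^esub> Cmp C (\<iota> m) (HZero C P (fobj E m)) \<in> U" by (intro U_smult) auto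
    then show ?thesis using UV \<open>Cmp C (\<iota> m) (HZero C P (fobj E m)) \<in> U\<close> by auto
  qed
  define V0 where "V0 = V\<lparr>carrier := U\<rparr>"
  have V0s: "carrier V0 = U" "zero V0 = zero V" "add V0 = add V" "smult V0 = smult V" by (auto simp: V0_def)
  have sub: "x \<in> U \<Longrightarrow> x \<in> carrier V" for x using UV by blast
  have "module k V0"
  proof (rule moduleI)
    show "abelian_group V0"
    proof (rule abelian_groupI)
      fix x assume "x \<in> carrier V0"
      then have x: "x \<in> U" by (simp add: V0s)
      have m: "\<ominus>\<^bsub>k\<^esub> \<one>\<^bsub>k\<^esub> \<in> carrier k" by simp
      have "(\<ominus>\<^bsub>k\<^esub> \<one>\<^bsub>k\<^esub>) \<odot>\<^bsub>V\<^esub> x \<oplus>\<^bsub>V\<^esub> x = \<zero>\<^bsub>V\<^esub>"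
        using sub[OF x] by (simp add: V.smult_l_minus V.M.l_neg)
      then show "\<exists>y\<in>carrier V0. y \<oplus>\<^bsub>V0\<^esub> x = \<zero>\<^bsub>V0\<^esub>" using U_smult[OF m x] by (auto simp: V0s)
    qed (auto simp: V0s U_add U_zero sub V.M.a_ac)
  qed (auto simp: V0s V.R.is_cring U_smult sub V.smult_l_distr V.smult_r_distr V.smult_assoc1)
  moreover have "small (carrier V0)"
    using VO card_less_subset[OF _ UV] by (auto simp: V0s Obj_Vect small_def)
  ultimately have V0O: "V0 \<in> Obj (Vect k)" by (simp add: Obj_Vect)
  have lin: "lin k (hom_space C P (fobj E j)) V0 (\<lambda>f. Cmp C (\<iota> j) f)" if j: "j \<in> Obj J" for j
  proof -
    have "lin k (hom_space C P (fobj E j)) V (\<lambda>f. Cmp C (\<iota> j) f)"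
      unfolding V_def using j by (intro lin_Cmp_right[OF L]) (simp add: in_homs_iff)
    then show ?thesis using j unfolding lin_def by (auto simp: V0s U_def)
  qed
  obtain h where h: "lin k V V0 h" "\<And>j f. j \<in> Obj J \<Longrightarrow> f \<in> homs C P (fobj E j) \<Longrightarrow> h (Cmp C (\<iota> j) f) = Cmp C (\<iota> j) f"
  proof -
    have c: "Cmp C (\<iota> (Cod J u)) (ap (farr (comp_fun (hom_functor C P) E) u) f) = Cmp C (\<iota> (Dom J u)) f"
      if "u \<in> Arr J" "f \<in> carrier (fobj (comp_fun (hom_functor C P) E) (Dom J u))" for u f
      using that is_cocone_Cmp[OF co that(1)] Cmp_assoc[OF catC, of f "farr E u" "\<iota> (Cod J u)"] by (simp add: in_homs_iff)
    show thesis
      by (rule Vect_colimit_factor[OF l' V0O, of "\<lambda>j f. Cmp C (\<iota> j) f"])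
        (use lin c in \<open>auto simp: V_def in_homs_iff intro!: that\<close>)
  qed
  \<comment> \<open>Followed by the inclusion of the subspace, \<open>h\<close> fixes the image of
    every stage, so it is the identity of \<open>V\<close> by uniqueness. Hence each
    \<open>x\<close> equals \<open>h x\<close> and lies in \<open>U\<close>.\<close>
  have h': "lin k V V h" using h(1) sub unfolding lin_def by (auto simp: V0s)
  have "h x = x"
    by (rule Vect_colimit_eq[OF l' _ _ VO, of h "\<lambda>x. x"])
      (use h' h(2) lin_id x in \<open>auto simp: V_def in_homs_iff\<close>)
  moreover have "h x \<in> U" using linD(1)[OF h(1), of x] x by (simp add: V0s V_def)
  ultimately show thesis using that by (auto simp: U_def)
qed

text \<open>Accessibility writes a compact projective object as an \<open>r\<close>-filtered colimit
  of objects of a small set \<open>G\<close>. Its identity factors through a stage, so it is a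
  retract of an object of \<open>G\<close>. A retract is determined up to isomorphism by its
  idempotent, and by local smallness the endomorphisms of objects of \<open>G\<close> form a small
  set.\<close>

lemma exists_small_compact_projectives:
  fixes C :: "('u, 'u, 'u) lincat"
  assumes u: "regular_universe TYPE('u)" and C: "presentable k C"
  obtains PP where "|PP| <o |UNIV :: 'u set|" "\<And>P. P \<in> PP \<Longrightarrow> compact_projective k C P"
    "\<And>Q. compact_projective k C Q \<Longrightarrow> \<exists>P\<in>PP. \<exists>f\<in>homs C Q P. is_iso C f"
proof -
  note C = presentableD[OF C]
  obtain r :: "'u rel" and G where r: "Card_order r" "cinfinite r" and G: "G \<subseteq> Obj C" "small G"
    and GX: "\<And>X. X \<in> Obj C \<Longrightarrow> \<exists>(J :: ('u, 'u) cat) E \<iota>. small_category J \<and> card_filtered r J \<and>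
            (\<forall>j \<in> Obj J. fobj E j \<in> G) \<and> is_colimit J C E X \<iota>"
    using C(4) unfolding accessible_def by blast
  have retract: "\<exists>X\<in>G. \<exists>s\<in>homs C P X. \<exists>p\<in>homs C X P. Cmp C p s = Idt C P" if P: "compact_projective k C P" for P
  proof -
    have PO: "P \<in> Obj C" using P by (simp add: compact_projective_def)
    obtain J :: "('u, 'u) cat" and E \<iota> where J: "small_category J" "card_filtered r J" "\<And>j. j \<in> Obj J \<Longrightarrow> fobj E j \<in> G"
      and l: "is_colimit J C E P \<iota>" using GX[OF PO] by blast
    obtain j f where j: "j \<in> Obj J" "f \<in> homs C P (fobj E j)" "Idt C P = Cmp C (\<iota> j) f"
      by (rule compact_projective_factor[OF C(1,2) P J(1,2) r l, of "Idt C P"]) (use PO C(5) in \<open>auto simp: in_homs_iff\<close>)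
    have "\<iota> j \<in> homs C (fobj E j) P" using is_coconeD(3-5)[OF is_colimit_cocone[OF l] j(1)] by (simp add: in_homs_iff)
    then show ?thesis using j J(3) by metis
  qed
  define ok where "ok P x \<longleftrightarrow> fst x \<in> G \<and> fst (snd x) \<in> homs C P (fst x) \<and> snd (snd x) \<in> homs C (fst x) P \<and>
    Cmp C (snd (snd x)) (fst (snd x)) = Idt C P" for P x
  define sp where "sp P = (SOME x. ok P x)" for P
  have sp: "ok P (sp P)" if P: "compact_projective k C P" for P
  proof -
    obtain X s p where "X \<in> G" "s \<in> homs C P X" "p \<in> homs C X P" "Cmp C p s = Idt C P" using retract[OF P] by blast
    then have "ok P (X, s, p)" by (simp add: ok_def)
    then show ?thesis unfolding sp_def by (rule someI)
  qed
  \<comment> \<open>The idempotent that splits through \<open>P\<close>, together with the object on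
    which it acts.\<close>
  define code where "code P = (fst (sp P), Cmp C (fst (snd (sp P))) (snd (snd (sp P))))" for P
  define cp where "cp = {P. compact_projective k C P}"
  \<comment> \<open>One compact projective object for every idempotent that occurs as a
    code.\<close>
  define PP where "PP = inv_into cp code ` (code ` cp)"
  have "code ` cp \<subseteq> Sigma G (\<lambda>X. homs C X X)"
  proof
    fix x assume "x \<in> code ` cp"
    then obtain P where P: "compact_projective k C P" "x = code P" by (auto simp: cp_def)
    then show "x \<in> Sigma G (\<lambda>X. homs C X X)"
      using sp[OF P(1)] Cmp_in_homs[OF C(5), of "snd (snd (sp P))" _ P "fst (snd (sp P))"] by (simp add: code_def ok_def)
  qed
  moreover have "|Sigma G (\<lambda>X. homs C X X)| <o |UNIV :: 'u set|"
    using G C(2) by (intro card_less_Sigma[OF u]) (auto simp: small_def locally_small_def)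
  ultimately have "|code ` cp| <o |UNIV :: 'u set|" using card_less_subset by blast
  then have "|PP| <o |UNIV :: 'u set|" unfolding PP_def by (rule card_less_image)
  moreover have PPcp: "compact_projective k C P" if "P \<in> PP" for P
    using that inv_into_into[of _ code cp] by (auto simp: PP_def cp_def)
  moreover have "\<exists>P\<in>PP. \<exists>f\<in>homs C Q P. is_iso C f" if Q: "compact_projective k C Q" for Q
  proof -
    define P where "P = inv_into cp code (code Q)"
    have Qc: "code Q \<in> code ` cp" using Q by (auto simp: cp_def)
    have P: "P \<in> PP" using Qc by (auto simp: P_def PP_def)
    have eq: "code P = code Q" using f_inv_into_f[OF Qc] by (simp add: P_def)
    obtain X s p where X: "sp P = (X, s, p)" by (cases "sp P") auto
    obtain Y s' p' where Y: "sp Q = (Y, s', p')" by (cases "sp Q") auto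
    have XY: "Y = X" "Cmp C s p = Cmp C s' p'" using eq by (auto simp: code_def X Y)
    have 1: "s \<in> homs C P X" "p \<in> homs C X P" "Cmp C p s = Idt C P" using sp[OF PPcp[OF P]] X by (auto simp: ok_def)
    have 2: "s' \<in> homs C Q X" "p' \<in> homs C X Q" "Cmp C p' s' = Idt C Q" using sp[OF Q] Y XY by (auto simp: ok_def)
    note [simp] = C(5) homsD[OF 1(1)] homsD[OF 1(2)] homsD[OF 2(1)] homsD[OF 2(2)]
    have O: "P \<in> Obj C" "Q \<in> Obj C" using PPcp[OF P] Q by (auto simp: compact_projective_def)
    \<comment> \<open>The arrows \<open>p s'\<close> and \<open>p' s\<close> between the two
      retracts are mutually inverse because \<open>s p\<close> and \<open>s' p'\<close> are the same
      idempotent.\<close>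
    have "Cmp C (Cmp C p' s) (Cmp C p s') = Cmp C p' (Cmp C (Cmp C s p) s')" by simp
    also have "\<dots> = Cmp C (Cmp C p' s') (Cmp C p' s')" unfolding XY(2) by simp
    finally have a: "Cmp C (Cmp C p' s) (Cmp C p s') = Idt C Q" using 2 O by simp
    have "Cmp C (Cmp C p s') (Cmp C p' s) = Cmp C p (Cmp C (Cmp C s' p') s)" by simp
    also have "\<dots> = Cmp C (Cmp C p s) (Cmp C p s)" unfolding XY(2)[symmetric] by simp
    finally have b: "Cmp C (Cmp C p s') (Cmp C p' s) = Idt C P" using 1 O by simp
    have "Cmp C p s' \<in> homs C Q P" "Cmp C p' s \<in> homs C P Q" by (simp_all add: in_homs_iff)
    then show ?thesis using P is_isoI[OF C(5) _ _ a b] by blast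
  qed
  ultimately show thesis by (rule that)
qed

section \<open>The cocontinuous extension of \<open>Hom(I, -)\<close> from compact projective objects\<close>

locale projective_extension = linear_cocomplete k C for k :: "'u ring" and C :: "('u, 'u, 'u) lincat" +
  fixes I :: 'u and PP :: "'u set"
  assumes I: "I \<in> Obj C" and natLeq: "natLeq <o |UNIV :: 'u set|"
    and small_PP: "|PP| <o |UNIV :: 'u set|" and PP: "P \<in> PP \<Longrightarrow> compact_projective k C P"
    and PP_all: "compact_projective k C Q \<Longrightarrow> \<exists>P\<in>PP. \<exists>f\<in>homs C Q P. is_iso C f"
begin

lemma PP_Obj: "P \<in> PP \<Longrightarrow> P \<in> Obj C"
  using PP by (simp add: compact_projective_def)

text \<open>A pair stands for the class of the tensor of \<open>f\<close> and \<open>g\<close> in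
  the coend. The object \<open>P\<close> is not recorded, as it is the domain of
  \<open>f\<close>.\<close>

definition gens :: "'u \<Rightarrow> ('u \<times> 'u) set" where
  "gens Z = {(f, g). \<exists>P\<in>PP. f \<in> homs C P Z \<and> g \<in> homs C I P}"

text \<open>The families of arrows out of the coend of \<open>Hom(P, Z) \<otimes> Hom(I, P)\<close> over \<open>P\<close>\<close>

definition dinatural :: "'u \<Rightarrow> 'u vs \<Rightarrow> ('u \<times> 'u \<Rightarrow> 'u) \<Rightarrow> bool" where
  "dinatural Z W \<tau> \<longleftrightarrow> (\<forall>s\<in>gens Z. \<tau> s \<in> carrier W) \<and>
     (\<forall>P\<in>PP. \<forall>f\<in>homs C P Z. \<forall>f'\<in>homs C P Z. \<forall>g\<in>homs C I P. \<tau> (HAdd C f f', g) = \<tau> (f, g) \<oplus>\<^bsub>W\<^esub> \<tau> (f', g)) \<and>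
     (\<forall>P\<in>PP. \<forall>f\<in>homs C P Z. \<forall>g\<in>homs C I P. \<forall>g'\<in>homs C I P. \<tau> (f, HAdd C g g') = \<tau> (f, g) \<oplus>\<^bsub>W\<^esub> \<tau> (f, g')) \<and>
     (\<forall>P\<in>PP. \<forall>f\<in>homs C P Z. \<forall>g\<in>homs C I P. \<forall>a\<in>carrier k. \<tau> (HScale C a f, g) = a \<odot>\<^bsub>W\<^esub> \<tau> (f, g)) \<and>
     (\<forall>P\<in>PP. \<forall>f\<in>homs C P Z. \<forall>g\<in>homs C I P. \<forall>a\<in>carrier k. \<tau> (f, HScale C a g) = a \<odot>\<^bsub>W\<^esub> \<tau> (f, g)) \<and>
     (\<forall>P\<in>PP. \<forall>Q\<in>PP. \<forall>f\<in>homs C Q Z. \<forall>v\<in>homs C P Q. \<forall>g\<in>homs C I P. \<tau> (Cmp C f v, g) = \<tau> (f, Cmp C v g))"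

lemma gensI: "P \<in> PP \<Longrightarrow> f \<in> homs C P Z \<Longrightarrow> g \<in> homs C I P \<Longrightarrow> (f, g) \<in> gens Z"
  by (auto simp: gens_def)

lemma dinaturalI:
  assumes "\<And>P f g. P \<in> PP \<Longrightarrow> f \<in> homs C P Z \<Longrightarrow> g \<in> homs C I P \<Longrightarrow> \<tau> (f, g) \<in> carrier W"
    "\<And>P f f' g. P \<in> PP \<Longrightarrow> f \<in> homs C P Z \<Longrightarrow> f' \<in> homs C P Z \<Longrightarrow> g \<in> homs C I P \<Longrightarrow> \<tau> (HAdd C f f', g) = \<tau> (f, g) \<oplus>\<^bsub>W\<^esub> \<tau> (f', g)"
    "\<And>P f g g'. P \<in> PP \<Longrightarrow> f \<in> homs C P Z \<Longrightarrow> g \<in> homs C I P \<Longrightarrow> g' \<in> homs C I P \<Longrightarrow> \<tau> (f, HAdd C g g') = \<tau> (f, g) \<oplus>\<^bsub>W\<^esub> \<tau> (f, g')"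
    "\<And>P f g a. P \<in> PP \<Longrightarrow> f \<in> homs C P Z \<Longrightarrow> g \<in> homs C I P \<Longrightarrow> a \<in> carrier k \<Longrightarrow> \<tau> (HScale C a f, g) = a \<odot>\<^bsub>W\<^esub> \<tau> (f, g)"
    "\<And>P f g a. P \<in> PP \<Longrightarrow> f \<in> homs C P Z \<Longrightarrow> g \<in> homs C I P \<Longrightarrow> a \<in> carrier k \<Longrightarrow> \<tau> (f, HScale C a g) = a \<odot>\<^bsub>W\<^esub> \<tau> (f, g)"
    "\<And>P Q f v g. P \<in> PP \<Longrightarrow> Q \<in> PP \<Longrightarrow> f \<in> homs C Q Z \<Longrightarrow> v \<in> homs C P Q \<Longrightarrow> g \<in> homs C I P \<Longrightarrow> \<tau> (Cmp C f v, g) = \<tau> (f, Cmp C v g)"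
  shows "dinatural Z W \<tau>"
  using assms unfolding dinatural_def gens_def by (intro conjI ballI) auto

lemma dinaturalD:
  assumes "dinatural Z W \<tau>" "P \<in> PP" "f \<in> homs C P Z" "g \<in> homs C I P"
  shows "\<tau> (f, g) \<in> carrier W"
    "f' \<in> homs C P Z \<Longrightarrow> \<tau> (HAdd C f f', g) = \<tau> (f, g) \<oplus>\<^bsub>W\<^esub> \<tau> (f', g)"
    "g' \<in> homs C I P \<Longrightarrow> \<tau> (f, HAdd C g g') = \<tau> (f, g) \<oplus>\<^bsub>W\<^esub> \<tau> (f, g')"
    "a \<in> carrier k \<Longrightarrow> \<tau> (HScale C a f, g) = a \<odot>\<^bsub>W\<^esub> \<tau> (f, g)"
    "a \<in> carrier k \<Longrightarrow> \<tau> (f, HScale C a g) = a \<odot>\<^bsub>W\<^esub> \<tau> (f, g)"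
    "Q \<in> PP \<Longrightarrow> v \<in> homs C Q P \<Longrightarrow> h \<in> homs C I Q \<Longrightarrow> \<tau> (Cmp C f v, h) = \<tau> (f, Cmp C v h)"
proof -
  note d = assms(1)[unfolded dinatural_def]
  show "\<tau> (f, g) \<in> carrier W" using d[THEN conjunct1] gensI[OF assms(2-4)] by (rule bspec)
  show "f' \<in> homs C P Z \<Longrightarrow> \<tau> (HAdd C f f', g) = \<tau> (f, g) \<oplus>\<^bsub>W\<^esub> \<tau> (f', g)"
    using d[THEN conjunct2, THEN conjunct1] assms(2-) by blast
  show "g' \<in> homs C I P \<Longrightarrow> \<tau> (f, HAdd C g g') = \<tau> (f, g) \<oplus>\<^bsub>W\<^esub> \<tau> (f, g')"
    using d[THEN conjunct2, THEN conjunct2, THEN conjunct1] assms(2-) by blast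
  show "a \<in> carrier k \<Longrightarrow> \<tau> (HScale C a f, g) = a \<odot>\<^bsub>W\<^esub> \<tau> (f, g)"
    using d[THEN conjunct2, THEN conjunct2, THEN conjunct2, THEN conjunct1] assms(2-) by blast
  show "a \<in> carrier k \<Longrightarrow> \<tau> (f, HScale C a g) = a \<odot>\<^bsub>W\<^esub> \<tau> (f, g)"
    using d[THEN conjunct2, THEN conjunct2, THEN conjunct2, THEN conjunct2, THEN conjunct1] assms(2-) by blast
  show "Q \<in> PP \<Longrightarrow> v \<in> homs C Q P \<Longrightarrow> h \<in> homs C I Q \<Longrightarrow> \<tau> (Cmp C f v, h) = \<tau> (f, Cmp C v h)"
    using d[THEN conjunct2, THEN conjunct2, THEN conjunct2, THEN conjunct2, THEN conjunct2] assms(2-) by blast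
qed

definition is_coend :: "'u \<Rightarrow> 'u vs \<Rightarrow> ('u \<times> 'u \<Rightarrow> 'u) \<Rightarrow> bool" where
  "is_coend Z V \<eta> \<longleftrightarrow> V \<in> Obj (Vect k) \<and> dinatural Z V \<eta> \<and>
     (\<forall>W \<tau>. W \<in> Obj (Vect k) \<and> dinatural Z W \<tau> \<longrightarrow> (\<exists>h. lin k V W h \<and> (\<forall>s\<in>gens Z. h (\<eta> s) = \<tau> s))) \<and>
     (\<forall>W h h'. W \<in> Obj (Vect k) \<and> lin k V W h \<and> lin k V W h' \<and> (\<forall>s\<in>gens Z. h (\<eta> s) = h' (\<eta> s)) \<longrightarrow>
        (\<forall>x\<in>carrier V. h x = h' x))"

lemma exists_coend:
  assumes Z: "Z \<in> Obj C"
  obtains V \<eta> where "is_coend Z V \<eta>"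
proof -
  interpret k: field k by (rule field_k)
  have "gens Z \<subseteq> (\<Union>P\<in>PP. homs C P Z \<times> homs C I P)" by (auto simp: gens_def)
  moreover have "|\<Union>P\<in>PP. homs C P Z \<times> homs C I P| <o |UNIV :: 'u set|"
    using locally_small Z I PP_Obj
    by (intro card_less_UNION card_less_Times universe small_PP) (auto simp: locally_small_def small_def)
  ultimately have S: "|gens Z| <o |UNIV :: 'u set|" using card_less_subset by blast
  \<comment> \<open>\<open>R1\<close> to \<open>R4\<close> impose bilinearity and \<open>R5\<close>
    dinaturality; each relation is a pair of words that are to take the same value.\<close>
  define R1 where "R1 = {([(\<one>\<^bsub>k\<^esub>, (HAdd C f f', g))], [(\<one>\<^bsub>k\<^esub>, (f, g)), (\<one>\<^bsub>k\<^esub>, (f', g))]) | P f f' g.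
    P \<in> PP \<and> f \<in> homs C P Z \<and> f' \<in> homs C P Z \<and> g \<in> homs C I P}"
  define R2 where "R2 = {([(\<one>\<^bsub>k\<^esub>, (f, HAdd C g g'))], [(\<one>\<^bsub>k\<^esub>, (f, g)), (\<one>\<^bsub>k\<^esub>, (f, g'))]) | P f g g'.
    P \<in> PP \<and> f \<in> homs C P Z \<and> g \<in> homs C I P \<and> g' \<in> homs C I P}"
  define R3 where "R3 = {([(\<one>\<^bsub>k\<^esub>, (HScale C a f, g))], [(a, (f, g))]) | P f g a.
    P \<in> PP \<and> f \<in> homs C P Z \<and> g \<in> homs C I P \<and> a \<in> carrier k}"
  define R4 where "R4 = {([(\<one>\<^bsub>k\<^esub>, (f, HScale C a g))], [(a, (f, g))]) | P f g a.
    P \<in> PP \<and> f \<in> homs C P Z \<and> g \<in> homs C I P \<and> a \<in> carrier k}"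
  define R5 where "R5 = {([(\<one>\<^bsub>k\<^esub>, (Cmp C f v, g))], [(\<one>\<^bsub>k\<^esub>, (f, Cmp C v g))]) | P Q f v g.
    P \<in> PP \<and> Q \<in> PP \<and> f \<in> homs C Q Z \<and> v \<in> homs C P Q \<and> g \<in> homs C I P}"
  define R where "R = R1 \<union> R2 \<union> R3 \<union> R4 \<union> R5"
  have R: "R \<subseteq> lists (carrier k \<times> gens Z) \<times> lists (carrier k \<times> gens Z)"
  proof -
    have "R1 \<union> R2 \<union> R3 \<union> R4 \<subseteq> lists (carrier k \<times> gens Z) \<times> lists (carrier k \<times> gens Z)"
      unfolding R1_def R2_def R3_def R4_def
      by (auto intro!: gensI intro: HAdd_homs[OF linear] HScale_homs[OF linear])
    moreover have "(Cmp C f v, g) \<in> gens Z \<and> (f, Cmp C v g) \<in> gens Z"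
      if "P \<in> PP" "Q \<in> PP" "f \<in> homs C Q Z" "v \<in> homs C P Q" "g \<in> homs C I P" for P Q f v g
      using that gensI Cmp_in_homs[OF category_C] by metis
    then have "R5 \<subseteq> lists (carrier k \<times> gens Z) \<times> lists (carrier k \<times> gens Z)"
      unfolding R5_def by auto
    ultimately show ?thesis unfolding R_def by blast
  qed
  have eq1: "dinatural Z W \<tau>"
    if W: "W \<in> Obj (Vect k)" and c: "\<And>s. s \<in> gens Z \<Longrightarrow> \<tau> s \<in> carrier W" and r: "\<And>l l'. (l, l') \<in> R \<Longrightarrow> lsum W \<tau> l = lsum W \<tau> l'" for W \<tau>
  proof -
    interpret W: module k W using module_Vect[OF W] .
    note c' = c[OF gensI]
    show ?thesis
    proof (rule dinaturalI)
      fix P f g assume P: "P \<in> PP" and f: "f \<in> homs C P Z" and g: "g \<in> homs C I P"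
      show "\<tau> (f, g) \<in> carrier W" using c'[OF P f g] .
      note fg = c'[OF P f g]
      {
        fix f' assume f': "f' \<in> homs C P Z"
        have "([(\<one>\<^bsub>k\<^esub>, (HAdd C f f', g))], [(\<one>\<^bsub>k\<^esub>, (f, g)), (\<one>\<^bsub>k\<^esub>, (f', g))]) \<in> R"
          unfolding R_def R1_def using P f f' g by blast
        from r[OF this] show "\<tau> (HAdd C f f', g) = \<tau> (f, g) \<oplus>\<^bsub>W\<^esub> \<tau> (f', g)"
          using fg c'[OF P f' g] c'[OF P HAdd_homs[OF linear f f'] g] by simp
      next
        fix g' assume g': "g' \<in> homs C I P"
        have "([(\<one>\<^bsub>k\<^esub>, (f, HAdd C g g'))], [(\<one>\<^bsub>k\<^esub>, (f, g)), (\<one>\<^bsub>k\<^esub>, (f, g'))]) \<in> R"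
          unfolding R_def R2_def using P f g' g by blast
        from r[OF this] show "\<tau> (f, HAdd C g g') = \<tau> (f, g) \<oplus>\<^bsub>W\<^esub> \<tau> (f, g')"
          using fg c'[OF P f g'] c'[OF P f HAdd_homs[OF linear g g']] by simp
      next
        fix a assume a: "a \<in> carrier k"
        have "([(\<one>\<^bsub>k\<^esub>, (HScale C a f, g))], [(a, (f, g))]) \<in> R"
          unfolding R_def R3_def using P f g a by blast
        from r[OF this] show "\<tau> (HScale C a f, g) = a \<odot>\<^bsub>W\<^esub> \<tau> (f, g)"
          using fg a c'[OF P HScale_homs[OF linear f a] g] by simp
        have "([(\<one>\<^bsub>k\<^esub>, (f, HScale C a g))], [(a, (f, g))]) \<in> R"
          unfolding R_def R4_def using P f g a by blast
        from r[OF this] show "\<tau> (f, HScale C a g) = a \<odot>\<^bsub>W\<^esub> \<tau> (f, g)"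
          using fg a c'[OF P f HScale_homs[OF linear g a]] by simp
      }
    next
      fix P Q f v g assume P: "P \<in> PP" "Q \<in> PP" and f: "f \<in> homs C Q Z" "v \<in> homs C P Q" "g \<in> homs C I P"
      have "([(\<one>\<^bsub>k\<^esub>, (Cmp C f v, g))], [(\<one>\<^bsub>k\<^esub>, (f, Cmp C v g))]) \<in> R"
        unfolding R_def R5_def using P f by blast
      from r[OF this] show "\<tau> (Cmp C f v, g) = \<tau> (f, Cmp C v g)"
        using c'[OF P(1) Cmp_in_homs[OF category_C f(2,1)] f(3)] c'[OF P(2) f(1) Cmp_in_homs[OF category_C f(3,2)]] by simp
    qed
  qed
  have eq2: "lsum W \<tau> l = lsum W \<tau> l'" if W: "W \<in> Obj (Vect k)" and d: "dinatural Z W \<tau>" and l: "(l, l') \<in> R" for W \<tau> l l'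
  proof -
    interpret W: module k W using module_Vect[OF W] .
    note D = dinaturalD[OF d]
    consider "(l, l') \<in> R1" | "(l, l') \<in> R2" | "(l, l') \<in> R3" | "(l, l') \<in> R4" | "(l, l') \<in> R5"
      using l unfolding R_def by blast
    then show ?thesis
    proof cases
      case 1
      then obtain P f f' g where P: "P \<in> PP" "f \<in> homs C P Z" "f' \<in> homs C P Z" "g \<in> homs C I P"
        "l = [(\<one>\<^bsub>k\<^esub>, (HAdd C f f', g))]" "l' = [(\<one>\<^bsub>k\<^esub>, (f, g)), (\<one>\<^bsub>k\<^esub>, (f', g))]" unfolding R1_def by blast
      show ?thesis using D(1)[OF P(1,2,4)] D(1)[OF P(1,3,4)] D(2)[OF P(1,2,4,3)] P(5,6) by simp
    next
      case 2
      then obtain P f g g' where P: "P \<in> PP" "f \<in> homs C P Z" "g \<in> homs C I P" "g' \<in> homs C I P"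
        "l = [(\<one>\<^bsub>k\<^esub>, (f, HAdd C g g'))]" "l' = [(\<one>\<^bsub>k\<^esub>, (f, g)), (\<one>\<^bsub>k\<^esub>, (f, g'))]" unfolding R2_def by blast
      show ?thesis using D(1)[OF P(1,2,3)] D(1)[OF P(1,2,4)] D(3)[OF P(1,2,3,4)] P(5,6) by simp
    next
      case 3
      then obtain P f g a where P: "P \<in> PP" "f \<in> homs C P Z" "g \<in> homs C I P" "a \<in> carrier k"
        "l = [(\<one>\<^bsub>k\<^esub>, (HScale C a f, g))]" "l' = [(a, (f, g))]" unfolding R3_def by blast
      show ?thesis using D(1)[OF P(1,2,3)] D(4)[OF P(1,2,3,4)] P(4,5,6) by simp
    next
      case 4
      then obtain P f g a where P: "P \<in> PP" "f \<in> homs C P Z" "g \<in> homs C I P" "a \<in> carrier k"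
        "l = [(\<one>\<^bsub>k\<^esub>, (f, HScale C a g))]" "l' = [(a, (f, g))]" unfolding R4_def by blast
      show ?thesis using D(1)[OF P(1,2,3)] D(5)[OF P(1,2,3,4)] P(4,5,6) by simp
    next
      case 5
      then obtain P Q f v g where P: "P \<in> PP" "Q \<in> PP" "f \<in> homs C Q Z" "v \<in> homs C P Q" "g \<in> homs C I P"
        "l = [(\<one>\<^bsub>k\<^esub>, (Cmp C f v, g))]" "l' = [(\<one>\<^bsub>k\<^esub>, (f, Cmp C v g))]" unfolding R5_def by blast
      show ?thesis using D(6)[OF P(2,3) Cmp_in_homs[OF category_C P(5,4)] P(1,4,5)] P(6,7) by simp
    qed
  qed
  show thesis
  proof (rule exists_universal_space[OF universe natLeq field_k small_k S R])
  fix V \<eta> assume V: "V \<in> Obj (Vect k)" "\<And>s. s \<in> gens Z \<Longrightarrow> \<eta> s \<in> carrier V"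
    "\<And>l l'. (l, l') \<in> R \<Longrightarrow> lsum V \<eta> l = lsum V \<eta> l'"
    and f: "\<And>W \<tau>. W \<in> Obj (Vect k) \<Longrightarrow> (\<And>s. s \<in> gens Z \<Longrightarrow> \<tau> s \<in> carrier W) \<Longrightarrow> (\<And>l l'. (l, l') \<in> R \<Longrightarrow> lsum W \<tau> l = lsum W \<tau> l') \<Longrightarrow>
      \<exists>h. lin k V W h \<and> (\<forall>s\<in>gens Z. h (\<eta> s) = \<tau> s)"
    and e: "\<And>W h h' x. W \<in> Obj (Vect k) \<Longrightarrow> lin k V W h \<Longrightarrow> lin k V W h' \<Longrightarrow> (\<And>s. s \<in> gens Z \<Longrightarrow> h (\<eta> s) = h' (\<eta> s)) \<Longrightarrow>
      x \<in> carrier V \<Longrightarrow> h x = h' x"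
  have "is_coend Z V \<eta>"
    unfolding is_coend_def
  proof (intro conjI allI impI ballI)
    show "V \<in> Obj (Vect k)" by fact
    show "dinatural Z V \<eta>" using eq1[OF V] .
    show "\<exists>h. lin k V W h \<and> (\<forall>s\<in>gens Z. h (\<eta> s) = \<tau> s)" if "W \<in> Obj (Vect k) \<and> dinatural Z W \<tau>" for W \<tau>
    proof (rule f)
      show "W \<in> Obj (Vect k)" using that by blast
      show "\<tau> s \<in> carrier W" if "s \<in> gens Z" for s using that \<open>W \<in> Obj (Vect k) \<and> dinatural Z W \<tau>\<close> by (auto simp: dinatural_def)
      show "lsum W \<tau> l = lsum W \<tau> l'" if "(l, l') \<in> R" for l l' using eq2 that \<open>W \<in> Obj (Vect k) \<and> dinatural Z W \<tau>\<close> by blast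
    qed
  qed (use e in blast)
  then show thesis by (rule that)
  qed
qed

end

section \<open>The functor \<open>\<phi>\<close> and its comparison with
  \<open>Hom(I, -)\<close>\<close>

context projective_extension
begin

definition pobj :: "'u \<Rightarrow> 'u vs" where
  "pobj Z = fst (SOME (V, \<eta>). is_coend Z V \<eta>)"

definition pelt :: "'u \<Rightarrow> 'u \<times> 'u \<Rightarrow> 'u" where
  "pelt Z = snd (SOME (V, \<eta>). is_coend Z V \<eta>)"

lemma is_coend_pobj:
  assumes "Z \<in> Obj C" shows "is_coend Z (pobj Z) (pelt Z)"
proof -
  have "\<exists>x. case x of (V, \<eta>) \<Rightarrow> is_coend Z V \<eta>"
    using exists_coend[OF assms] by (metis case_prod_conv)
  from someI_ex[OF this] show ?thesis by (simp add: pobj_def pelt_def case_prod_unfold)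
qed

context
  fixes Z assumes Z: "Z \<in> Obj C"
begin

lemma pobj_Obj: "pobj Z \<in> Obj (Vect k)"
  using is_coend_pobj[OF Z] by (simp add: is_coend_def)

lemma dinatural_pelt: "dinatural Z (pobj Z) (pelt Z)"
  using is_coend_pobj[OF Z] by (simp add: is_coend_def)

lemma pobj_factor:
  assumes "W \<in> Obj (Vect k)" "dinatural Z W \<tau>"
  obtains h where "lin k (pobj Z) W h" "\<And>f g. (f, g) \<in> gens Z \<Longrightarrow> h (pelt Z (f, g)) = \<tau> (f, g)"
  using is_coend_pobj[OF Z] assms unfolding is_coend_def by blast

lemma pobj_eq:
  assumes "W \<in> Obj (Vect k)" "lin k (pobj Z) W h" "lin k (pobj Z) W h'"
    "\<And>f g. (f, g) \<in> gens Z \<Longrightarrow> h (pelt Z (f, g)) = h' (pelt Z (f, g))" "x \<in> carrier (pobj Z)"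
  shows "h x = h' x"
  using is_coend_pobj[OF Z] assms unfolding is_coend_def by fast

end

lemma gensE:
  assumes "(f, g) \<in> gens Z"
  obtains P where "P \<in> PP" "f \<in> homs C P Z" "g \<in> homs C I P"
  using assms by (auto simp: gens_def)

lemma pelt_closed: "Z \<in> Obj C \<Longrightarrow> s \<in> gens Z \<Longrightarrow> pelt Z s \<in> carrier (pobj Z)"
  using dinatural_pelt by (simp add: dinatural_def)

lemma dinatural_lin:
  assumes d: "dinatural Z V \<tau>" and h: "lin k V W h"
  shows "dinatural Z W (\<lambda>s. h (\<tau> s))"
proof (rule dinaturalI)
  fix P Q f v g assume P: "P \<in> PP" "Q \<in> PP" and f: "f \<in> homs C Q Z" "v \<in> homs C P Q" "g \<in> homs C I P"
  show "h (\<tau> (Cmp C f v, g)) = h (\<tau> (f, Cmp C v g))"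
    using dinaturalD(6)[OF d P(2) f(1) Cmp_in_homs[OF category_C f(3,2)] P(1) f(2,3)] by simp
qed (simp_all add: dinaturalD(1-5)[OF d] linD[OF h])

lemma dinatural_comp:
  assumes d: "dinatural Z V \<tau>" and u: "u \<in> homs C Y Z"
  shows "dinatural Y V (\<lambda>(f, g). \<tau> (Cmp C u f, g))"
proof (rule dinaturalI)
  note uf = Cmp_in_homs[OF category_C _ u]
  note [simp] = homsD[OF u]
  fix P f g assume P: "P \<in> PP" and f: "f \<in> homs C P Y" and g: "g \<in> homs C I P"
  note D = dinaturalD[OF d P uf[OF f] g]
  show "(case (f, g) of (f, g) \<Rightarrow> \<tau> (Cmp C u f, g)) \<in> carrier V" using D(1) by simp
  {
    fix f' assume f': "f' \<in> homs C P Y"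
    have "Cmp C u (HAdd C f f') = HAdd C (Cmp C u f) (Cmp C u f')"
      using f f' by (simp add: in_homs_iff Cmp_HAdd_right[OF linear])
    then show "(case (HAdd C f f', g) of (f, g) \<Rightarrow> \<tau> (Cmp C u f, g)) =
      (case (f, g) of (f, g) \<Rightarrow> \<tau> (Cmp C u f, g)) \<oplus>\<^bsub>V\<^esub> (case (f', g) of (f, g) \<Rightarrow> \<tau> (Cmp C u f, g))"
      using D(2)[OF uf[OF f']] by simp
  next
    fix g' assume "g' \<in> homs C I P"
    then show "(case (f, HAdd C g g') of (f, g) \<Rightarrow> \<tau> (Cmp C u f, g)) =
      (case (f, g) of (f, g) \<Rightarrow> \<tau> (Cmp C u f, g)) \<oplus>\<^bsub>V\<^esub> (case (f, g') of (f, g) \<Rightarrow> \<tau> (Cmp C u f, g))"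
      using D(3) by simp
  next
    fix a assume a: "a \<in> carrier k"
    have "Cmp C u (HScale C a f) = HScale C a (Cmp C u f)"
      using f a by (simp add: in_homs_iff Cmp_HScale[OF linear])
    then show "(case (HScale C a f, g) of (f, g) \<Rightarrow> \<tau> (Cmp C u f, g)) = a \<odot>\<^bsub>V\<^esub> (case (f, g) of (f, g) \<Rightarrow> \<tau> (Cmp C u f, g))"
      using D(4)[OF a] by simp
    show "(case (f, HScale C a g) of (f, g) \<Rightarrow> \<tau> (Cmp C u f, g)) = a \<odot>\<^bsub>V\<^esub> (case (f, g) of (f, g) \<Rightarrow> \<tau> (Cmp C u f, g))"
      using D(5)[OF a] by simp
  }
next
  note uf = Cmp_in_homs[OF category_C _ u]
  fix P Q f v g assume P: "P \<in> PP" "Q \<in> PP" and f: "f \<in> homs C Q Y" "v \<in> homs C P Q" "g \<in> homs C I P"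
  have "Cmp C u (Cmp C f v) = Cmp C (Cmp C u f) v" using f u by (simp add: in_homs_iff)
  then show "(case (Cmp C f v, g) of (f, g) \<Rightarrow> \<tau> (Cmp C u f, g)) = (case (f, Cmp C v g) of (f, g) \<Rightarrow> \<tau> (Cmp C u f, g))"
    using dinaturalD(6)[OF d P(2) uf[OF f(1)] Cmp_in_homs[OF category_C f(3,2)] P(1) f(2,3)] by simp
qed

lemma gens_comp: "(f, g) \<in> gens Y \<Longrightarrow> u \<in> homs C Y Z \<Longrightarrow> (Cmp C u f, g) \<in> gens Z"
  using Cmp_in_homs[OF category_C] unfolding gens_def by blast

text \<open>The functor \<open>\<phi>\<close> of the overview, a left Kan extension of
  \<open>Hom(I, -)\<close> from the objects in \<open>PP\<close>. An arrow acts by composition on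
  the first entry of a generator.\<close>

definition pfun :: "('u, 'u, 'u vs, 'u vmap) functr" where
  "pfun = \<lparr>fobj = pobj, farr = (\<lambda>u. vmk (pobj (Dom C u)) (pobj (Cod C u))
     (SOME h. lin k (pobj (Dom C u)) (pobj (Cod C u)) h \<and>
        (\<forall>f g. (f, g) \<in> gens (Dom C u) \<longrightarrow> h (pelt (Dom C u) (f, g)) = pelt (Cod C u) (Cmp C u f, g))))\<rparr>"

lemma pfun_obj [simp]: "fobj pfun Z = pobj Z"
  by (simp add: pfun_def)

lemma pfun_arr:
  assumes u: "u \<in> homs C Y Z"
  shows "farr pfun u \<in> homs (Vect k) (pobj Y) (pobj Z)"
    "(f, g) \<in> gens Y \<Longrightarrow> ap (farr pfun u) (pelt Y (f, g)) = pelt Z (Cmp C u f, g)"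
proof -
  note U = homsD[OF u]
  have Y: "Y \<in> Obj C" and Z: "Z \<in> Obj C" using Obj_Dom[OF category_C U(1)] Obj_Cod[OF category_C U(1)] U by auto
  have "\<exists>h. lin k (pobj Y) (pobj Z) h \<and> (\<forall>f g. (f, g) \<in> gens Y \<longrightarrow> h (pelt Y (f, g)) = pelt Z (Cmp C u f, g))"
    by (rule pobj_factor[OF Y pobj_Obj[OF Z] dinatural_comp[OF dinatural_pelt[OF Z] u]]) auto
  then have h: "lin k (pobj (Dom C u)) (pobj (Cod C u)) (SOME h. lin k (pobj (Dom C u)) (pobj (Cod C u)) h \<and>
        (\<forall>f g. (f, g) \<in> gens (Dom C u) \<longrightarrow> h (pelt (Dom C u) (f, g)) = pelt (Cod C u) (Cmp C u f, g))) \<and>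
      (\<forall>f g. (f, g) \<in> gens (Dom C u) \<longrightarrow> (SOME h. lin k (pobj (Dom C u)) (pobj (Cod C u)) h \<and>
        (\<forall>f g. (f, g) \<in> gens (Dom C u) \<longrightarrow> h (pelt (Dom C u) (f, g)) = pelt (Cod C u) (Cmp C u f, g))) (pelt (Dom C u) (f, g)) = pelt (Cod C u) (Cmp C u f, g))"
    unfolding U(2,3) by (rule someI_ex)
  show "farr pfun u \<in> homs (Vect k) (pobj Y) (pobj Z)"
    using h U vmk_homs[OF pobj_Obj[OF Y] pobj_Obj[OF Z]] by (simp add: pfun_def)
  show "ap (farr pfun u) (pelt Y (f, g)) = pelt Z (Cmp C u f, g)" if "(f, g) \<in> gens Y"
    using h U that pelt_closed[OF Y that] by (simp add: pfun_def)
qed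

lemma pfun_arr_eqI:
  assumes "F \<in> homs (Vect k) (pobj Y) W" "G \<in> homs (Vect k) (pobj Y) W" "Y \<in> Obj C"
    "\<And>f g. (f, g) \<in> gens Y \<Longrightarrow> ap F (pelt Y (f, g)) = ap G (pelt Y (f, g))"
  shows "F = G"
  by (rule Vect_arr_eqI[OF assms(1,2)],
      rule pobj_eq[OF assms(3) Vect_homsD(2)[OF assms(1)] Vect_homsD(3)[OF assms(1)] Vect_homsD(3)[OF assms(2)] assms(4)])

lemma is_functor_pfun: "is_functor C (Vect k) pfun"
proof (rule is_functorI[OF category_C category_Vect])
  show "fobj pfun Z \<in> Obj (Vect k)" if "Z \<in> Obj C" for Z using pobj_Obj[OF that] by simp
  show "farr pfun u \<in> homs (Vect k) (fobj pfun (Dom C u)) (fobj pfun (Cod C u))" if "u \<in> Arr C" for u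
    using pfun_arr(1)[of u "Dom C u" "Cod C u"] that by (simp add: in_homs_iff)
  show "farr pfun (Idt C Z) = Idt (Vect k) (fobj pfun Z)" if Z: "Z \<in> Obj C" for Z
  proof -
    have i: "Idt C Z \<in> homs C Z Z" using Z by (simp add: in_homs_iff)
    have "farr pfun (Idt C Z) = Idt (Vect k) (pobj Z)"
    proof (rule pfun_arr_eqI[OF pfun_arr(1)[OF i] Idt_Vect_homs[OF pobj_Obj[OF Z]] Z])
      fix f g assume fg: "(f, g) \<in> gens Z"
      have "Cmp C (Idt C Z) f = f" using fg by (auto simp: gens_def in_homs_iff)
      then show "ap (farr pfun (Idt C Z)) (pelt Z (f, g)) = ap (Idt (Vect k) (pobj Z)) (pelt Z (f, g))"
        using pfun_arr(2)[OF i fg] pelt_closed[OF Z fg] by simp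
    qed
    then show ?thesis by simp
  qed
  show "farr pfun (Cmp C v u) = Cmp (Vect k) (farr pfun v) (farr pfun u)"
    if "u \<in> Arr C" "v \<in> Arr C" "Cod C u = Dom C v" for u v
  proof -
    have u: "u \<in> homs C (Dom C u) (Dom C v)" and v: "v \<in> homs C (Dom C v) (Cod C v)" using that by (auto simp: in_homs_iff)
    note vu = Cmp_in_homs[OF category_C u v]
    have Y: "Dom C u \<in> Obj C" using that by simp
    show ?thesis
    proof (rule pfun_arr_eqI[OF pfun_arr(1)[OF vu] Cmp_Vect_homs(1)[OF pfun_arr(1)[OF u] pfun_arr(1)[OF v]] Y])
      fix f g assume fg: "(f, g) \<in> gens (Dom C u)"
      have "Cmp C (Cmp C v u) f = Cmp C v (Cmp C u f)" using fg that by (auto simp: gens_def in_homs_iff)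
      then show "ap (farr pfun (Cmp C v u)) (pelt (Dom C u) (f, g)) = ap (Cmp (Vect k) (farr pfun v) (farr pfun u)) (pelt (Dom C u) (f, g))"
        using pfun_arr(2)[OF vu fg] Cmp_Vect_homs(2)[OF pfun_arr(1)[OF u] pfun_arr(1)[OF v] pelt_closed[OF Y fg]]
          pfun_arr(2)[OF u fg] pfun_arr(2)[OF v gens_comp[OF fg u]] by simp
    qed
  qed
qed

lemma compact_projective_hom:
  fixes J :: "('u, 'u) cat"
  assumes "compact_projective k C P" "small_category J" "is_colimit J C E Z \<iota>"
  shows "is_colimit J (Vect k) (comp_fun (hom_functor C P) E) (hom_space C P Z) (\<lambda>j. farr (hom_functor C P) (\<iota> j))"
  using preserves_colimitsD[where P = "\<lambda>_. True", OF assms(1)[unfolded compact_projective_def, THEN conjunct2] assms(2) TrueI assms(3)]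
  unfolding hom_functor_simps(1) .

lemma ap_HAdd:
  assumes "F \<in> homs (Vect k) V W" "G \<in> homs (Vect k) V W" "x \<in> carrier V"
  shows "ap (HAdd (Vect k) F G) x = ap F x \<oplus>\<^bsub>W\<^esub> ap G x"
  using assms by (simp add: HAdd_Vect Vect_homs_iff)

lemma ap_HScale:
  assumes "F \<in> homs (Vect k) V W" "x \<in> carrier V"
  shows "ap (HScale (Vect k) a F) x = a \<odot>\<^bsub>W\<^esub> ap F x"
  using assms by (simp add: HScale_Vect Vect_homs_iff)

text \<open>A coend commutes with colimits, and so does each \<open>Hom(P, -)\<close> that occurs in
  this one. On elements this means factoring a cocone for each pair of \<open>P\<close> and
  \<open>g\<close> separately and then checking that the factorizations fit together
  dinaturally.\<close>

lemma cocontinuous_pfun: "cocontinuous k C (Vect k) pfun"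
proof (rule cocontinuousI)
  note LV = linear_category_Vect[OF field_k]
  show "linear_functor k C (Vect k) pfun"
  proof (rule linear_functorI[OF linear LV is_functor_pfun])
    fix u v assume uv: "u \<in> Arr C" "v \<in> Arr C" "Dom C u = Dom C v" "Cod C u = Cod C v"
    let ?Y = "Dom C v" and ?Z = "Cod C v"
    have u: "u \<in> homs C ?Y ?Z" and v: "v \<in> homs C ?Y ?Z" using uv by (auto simp: in_homs_iff)
    have O: "?Y \<in> Obj C" "?Z \<in> Obj C" using uv by auto
    note s = HAdd_homs[OF linear u v] and S = HAdd_homs[OF LV pfun_arr(1)[OF u] pfun_arr(1)[OF v]]
    show "farr pfun (HAdd C u v) = HAdd (Vect k) (farr pfun u) (farr pfun v)"
    proof (rule pfun_arr_eqI[OF pfun_arr(1)[OF s] S O(1)])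
      fix f g assume fg: "(f, g) \<in> gens ?Y"
      obtain P where P: "P \<in> PP" "f \<in> homs C P ?Y" "g \<in> homs C I P" using gensE[OF fg] .
      have "Cmp C (HAdd C u v) f = HAdd C (Cmp C u f) (Cmp C v f)"
        using P uv by (simp add: in_homs_iff Cmp_HAdd_left[OF linear])
      then show "ap (farr pfun (HAdd C u v)) (pelt ?Y (f, g)) = ap (HAdd (Vect k) (farr pfun u) (farr pfun v)) (pelt ?Y (f, g))"
        using pfun_arr(2)[OF s fg] pfun_arr(2)[OF u fg] pfun_arr(2)[OF v fg] ap_HAdd[OF pfun_arr(1)[OF u] pfun_arr(1)[OF v] pelt_closed[OF O(1) fg]]
          dinaturalD(2)[OF dinatural_pelt[OF O(2)] P(1) Cmp_in_homs[OF category_C P(2) u] P(3) Cmp_in_homs[OF category_C P(2) v]]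
        by simp
    qed
  next
    fix u a assume uv: "u \<in> Arr C" and a: "a \<in> carrier k"
    let ?Y = "Dom C u" and ?Z = "Cod C u"
    have u: "u \<in> homs C ?Y ?Z" using uv by (auto simp: in_homs_iff)
    have O: "?Y \<in> Obj C" "?Z \<in> Obj C" using uv by auto
    note s = HScale_homs[OF linear u a] and S = HScale_homs[OF LV pfun_arr(1)[OF u] a]
    show "farr pfun (HScale C a u) = HScale (Vect k) a (farr pfun u)"
    proof (rule pfun_arr_eqI[OF pfun_arr(1)[OF s] S O(1)])
      fix f g assume fg: "(f, g) \<in> gens ?Y"
      obtain P where P: "P \<in> PP" "f \<in> homs C P ?Y" "g \<in> homs C I P" using gensE[OF fg] .
      have "Cmp C (HScale C a u) f = HScale C a (Cmp C u f)"
        using P uv a by (simp add: in_homs_iff Cmp_HScale[OF linear])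
      then show "ap (farr pfun (HScale C a u)) (pelt ?Y (f, g)) = ap (HScale (Vect k) a (farr pfun u)) (pelt ?Y (f, g))"
        using pfun_arr(2)[OF s fg] pfun_arr(2)[OF u fg] ap_HScale[OF pfun_arr(1)[OF u] pelt_closed[OF O(1) fg]]
          dinaturalD(4)[OF dinatural_pelt[OF O(2)] P(1) Cmp_in_homs[OF category_C P(2) u] P(3) a]
        by simp
    qed
  qed
  fix J :: "('u, 'u) cat" and E Z \<iota>
  assume J: "small_category J" and l: "is_colimit J C E Z \<iota>"
  note co = is_colimit_cocone[OF l]
  note E = is_coconeD(1)[OF co] and Z = is_coconeD(2)[OF co]
  have catJ: "category J" using is_functor_category(1)[OF E] .
  note [simp] = catJ Z is_coconeD(3-5)[OF co] functor_Obj[OF E] functor_arr[OF E]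
  have i: "\<iota> j \<in> homs C (fobj E j) Z" if "j \<in> Obj J" for j using that by (simp add: in_homs_iff)
  have Eu: "farr E u \<in> homs C (fobj E (Dom J u)) (fobj E (Cod J u))" if "u \<in> Arr J" for u using that by (simp add: in_homs_iff)
  have lP: "is_colimit J (Vect k) (comp_fun (hom_functor C P) E) (hom_space C P Z) (\<lambda>j. farr (hom_functor C P) (\<iota> j))"
    if "P \<in> PP" for P using compact_projective_hom[OF PP[OF that] J l] .
  show "is_colimit J (Vect k) (comp_fun pfun E) (fobj pfun Z) (\<lambda>j. farr pfun (\<iota> j))"
  proof (rule Vect_is_colimitI[OF is_cocone_comp_fun[OF co is_functor_pfun]])
    fix W t assume W: "W \<in> Obj (Vect k)" and t0: "\<And>j. j \<in> Obj J \<Longrightarrow> lin k (fobj (comp_fun pfun E) j) W (t j)"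
      and tc0: "\<And>u x. u \<in> Arr J \<Longrightarrow> x \<in> carrier (fobj (comp_fun pfun E) (Dom J u)) \<Longrightarrow>
          t (Cod J u) (ap (farr (comp_fun pfun E) u) x) = t (Dom J u) x"
    have t: "lin k (pobj (fobj E j)) W (t j)" if "j \<in> Obj J" for j using t0[OF that] by simp
    define T where "T j f g = t j (pelt (fobj E j) (f, g))" for j f g
    have d: "dinatural (fobj E j) W (\<lambda>s. t j (pelt (fobj E j) s))" if "j \<in> Obj J" for j
      using that by (intro dinatural_lin[OF dinatural_pelt t]) auto
    note D = dinaturalD[OF d, folded T_def]
    have Tc: "T (Cod J u) (Cmp C (farr E u) f) g = T (Dom J u) f g"
      if u: "u \<in> Arr J" and f: "P \<in> PP" "f \<in> homs C P (fobj E (Dom J u))" "g \<in> homs C I P" for u P f g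
      using tc0[OF u, of "pelt (fobj E (Dom J u)) (f, g)"] pfun_arr(2)[OF Eu[OF u] gensI[OF f]] pelt_closed[OF _ gensI[OF f]] u
      by (simp add: T_def)
    \<comment> \<open>For fixed \<open>g\<close>, evaluating \<open>t j\<close> at the generators
      \<open>(f, g)\<close> gives a cocone on the spaces \<open>Hom(P, E j)\<close>. Their colimit
      is \<open>Hom(P, Z)\<close> because \<open>P\<close> is compact projective.\<close>
    have "\<exists>h. lin k (hom_space C P Z) W h \<and> (\<forall>j\<in>Obj J. \<forall>f\<in>homs C P (fobj E j). h (Cmp C (\<iota> j) f) = T j f g)"
      if P: "P \<in> PP" and g: "g \<in> homs C I P" for P g
    proof -
      have "lin k (fobj (comp_fun (hom_functor C P) E) j) W (\<lambda>f. T j f g)" if "j \<in> Obj J" for j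
        using D(1)[OF that P _ g] D(2)[OF that P _ g] D(4)[OF that P _ g] by (intro linI) auto
      moreover have "T (Cod J u) (ap (farr (comp_fun (hom_functor C P) E) u) f) g = T (Dom J u) f g"
        if "u \<in> Arr J" "f \<in> carrier (fobj (comp_fun (hom_functor C P) E) (Dom J u))" for u f
        using Tc[OF that(1) P _ g, of f] that by simp
      ultimately obtain h where h: "lin k (hom_space C P Z) W h"
        "\<And>j f. j \<in> Obj J \<Longrightarrow> f \<in> carrier (fobj (comp_fun (hom_functor C P) E) j) \<Longrightarrow> h (ap (farr (hom_functor C P) (\<iota> j)) f) = T j f g"
        using Vect_colimit_factor[OF lP[OF P] W, of "\<lambda>j f. T j f g"] by blast
      show ?thesis
      proof (intro exI[of _ h] conjI ballI h(1))
        fix j f assume "j \<in> Obj J" "f \<in> homs C P (fobj E j)"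
        then show "h (Cmp C (\<iota> j) f) = T j f g" using h(2)[of j f] by simp
      qed
    qed
    then obtain H where H: "\<And>P g. P \<in> PP \<Longrightarrow> g \<in> homs C I P \<Longrightarrow> lin k (hom_space C P Z) W (H P g)"
      and HT: "\<And>P g j f. P \<in> PP \<Longrightarrow> g \<in> homs C I P \<Longrightarrow> j \<in> Obj J \<Longrightarrow> f \<in> homs C P (fobj E j) \<Longrightarrow> H P g (Cmp C (\<iota> j) f) = T j f g"
      by metis
    have Heq: "h f = h' f" if P: "P \<in> PP" and h: "lin k (hom_space C P Z) W h" "lin k (hom_space C P Z) W h'"
      and e: "\<And>j f. j \<in> Obj J \<Longrightarrow> f \<in> homs C P (fobj E j) \<Longrightarrow> h (Cmp C (\<iota> j) f) = h' (Cmp C (\<iota> j) f)"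
      and f: "f \<in> homs C P Z" for P h h' f
      by (rule Vect_colimit_eq[OF lP[OF P] h W]) (use e f in auto)
    \<comment> \<open>The object \<open>P\<close> that selects the map \<open>H P g\<close> is
      recovered as the domain of \<open>f\<close>.\<close>
    define \<tau> where "\<tau> = (\<lambda>(f, g). H (Dom C f) g f)"
    have \<tau>: "\<tau> (f, g) = H P g f" if "f \<in> homs C P Z" for P f g using that by (simp add: \<tau>_def in_homs_iff)
    have mW: "module k W" using module_Vect[OF W] .
    have "dinatural Z W \<tau>"
    proof (rule dinaturalI)
      fix P f g assume P: "P \<in> PP" and f: "f \<in> homs C P Z" and g: "g \<in> homs C I P"
      note L = linD[OF H[OF P g], unfolded hom_space_simps]
      show "\<tau> (f, g) \<in> carrier W" using L(1)[OF f] \<tau>[OF f] by simp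
      {
        fix f' assume f': "f' \<in> homs C P Z"
        show "\<tau> (HAdd C f f', g) = \<tau> (f, g) \<oplus>\<^bsub>W\<^esub> \<tau> (f', g)"
          using L(2)[OF f f'] \<tau>[OF f] \<tau>[OF f'] \<tau>[OF HAdd_homs[OF linear f f']] by simp
      next
        fix g' assume g': "g' \<in> homs C I P"
        have "H P (HAdd C g g') f = H P g f \<oplus>\<^bsub>W\<^esub> H P g' f"
          by (rule Heq[OF P H[OF P HAdd_homs[OF linear g g']] lin_add[OF mW H[OF P g] H[OF P g']] _ f])
            (use D(3)[OF _ P _ g g'] HT[OF P g] HT[OF P g'] HT[OF P HAdd_homs[OF linear g g']] in simp)
        then show "\<tau> (f, HAdd C g g') = \<tau> (f, g) \<oplus>\<^bsub>W\<^esub> \<tau> (f, g')" using \<tau>[OF f] by simp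
      next
        fix a assume a: "a \<in> carrier k"
        show "\<tau> (HScale C a f, g) = a \<odot>\<^bsub>W\<^esub> \<tau> (f, g)"
          using L(3)[OF a f] \<tau>[OF f] \<tau>[OF HScale_homs[OF linear f a]] by simp
        have "H P (HScale C a g) f = a \<odot>\<^bsub>W\<^esub> H P g f"
          by (rule Heq[OF P H[OF P HScale_homs[OF linear g a]] lin_smult[OF mW H[OF P g] a] _ f])
            (use D(5)[OF _ P _ g a] HT[OF P g] HT[OF P HScale_homs[OF linear g a]] in simp)
        then show "\<tau> (f, HScale C a g) = a \<odot>\<^bsub>W\<^esub> \<tau> (f, g)" using \<tau>[OF f] by simp
      }
    next
      fix P Q f v g assume P: "P \<in> PP" "Q \<in> PP" and f: "f \<in> homs C Q Z" and v: "v \<in> homs C P Q" and g: "g \<in> homs C I P"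
      note vg = Cmp_in_homs[OF category_C g v] and fv = Cmp_in_homs[OF category_C v f]
      have "H P g (Cmp C f v) = H Q (Cmp C v g) f"
      proof (rule Heq[OF P(2) _ H[OF P(2) vg] _ f, where h = "\<lambda>f. H P g (Cmp C f v)"])
        show "lin k (hom_space C Q Z) W (\<lambda>f. H P g (Cmp C f v))"
          using lin_comp[OF lin_Cmp_left[OF linear v] H[OF P(1) g]] .
        fix j f assume j: "j \<in> Obj J" and f: "f \<in> homs C Q (fobj E j)"
        have "Cmp C (Cmp C (\<iota> j) f) v = Cmp C (\<iota> j) (Cmp C f v)" using f v j by (simp add: in_homs_iff)
        then show "H P g (Cmp C (Cmp C (\<iota> j) f) v) = H Q (Cmp C v g) (Cmp C (\<iota> j) f)"
          using HT[OF P(1) g j Cmp_in_homs[OF category_C v f]] HT[OF P(2) vg j f] D(6)[OF j P(2) f vg P(1) v g] by simp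
      qed
      then show "\<tau> (Cmp C f v, g) = \<tau> (f, Cmp C v g)" using \<tau>[OF f] \<tau>[OF fv] by simp
    qed
    then obtain h where h: "lin k (pobj Z) W h" "\<And>f g. (f, g) \<in> gens Z \<Longrightarrow> h (pelt Z (f, g)) = \<tau> (f, g)"
      using pobj_factor[OF Z W] by blast
    have "h (ap (farr pfun (\<iota> j)) x) = t j x" if j: "j \<in> Obj J" and x: "x \<in> carrier (pobj (fobj E j))" for j x
    proof (rule pobj_eq[of "fobj E j" W "\<lambda>x. h (ap (farr pfun (\<iota> j)) x)" "t j" x])
      show "lin k (pobj (fobj E j)) W (\<lambda>x. h (ap (farr pfun (\<iota> j)) x))"
        using lin_comp[OF Vect_homsD(3)[OF pfun_arr(1)[OF i[OF j]]] h(1)] .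
      fix f g assume fg: "(f, g) \<in> gens (fobj E j)"
      obtain P where P: "P \<in> PP" "f \<in> homs C P (fobj E j)" "g \<in> homs C I P" using gensE[OF fg] .
      show "h (ap (farr pfun (\<iota> j)) (pelt (fobj E j) (f, g))) = t j (pelt (fobj E j) (f, g))"
        using pfun_arr(2)[OF i[OF j] fg] h(2)[OF gens_comp[OF fg i[OF j]]] \<tau>[OF Cmp_in_homs[OF category_C P(2) i[OF j]]]
          HT[OF P(1,3) j P(2)] by (simp add: T_def)
    qed (use j x W t in auto)
    then show "\<exists>h. lin k (fobj pfun Z) W h \<and> (\<forall>j\<in>Obj J. \<forall>x\<in>carrier (fobj (comp_fun pfun E) j). h (ap (farr pfun (\<iota> j)) x) = t j x)"
      using h(1) by auto
  next
    fix W h h' x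
    assume W: "W \<in> Obj (Vect k)" and h0: "lin k (fobj pfun Z) W h" "lin k (fobj pfun Z) W h'"
      and e: "\<And>j x. j \<in> Obj J \<Longrightarrow> x \<in> carrier (fobj (comp_fun pfun E) j) \<Longrightarrow> h (ap (farr pfun (\<iota> j)) x) = h' (ap (farr pfun (\<iota> j)) x)"
      and x: "x \<in> carrier (fobj pfun Z)"
    have h: "lin k (pobj Z) W h" "lin k (pobj Z) W h'" using h0 by auto
    show "h x = h' x"
    proof (rule pobj_eq[OF Z W h])
      show "x \<in> carrier (pobj Z)" using x by simp
      fix f g assume fg: "(f, g) \<in> gens Z"
      obtain P where P: "P \<in> PP" "f \<in> homs C P Z" "g \<in> homs C I P" using gensE[OF fg] .
      have L: "lin k (hom_space C P Z) W (\<lambda>f. h (pelt Z (f, g)))" if "lin k (pobj Z) W h" for h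
        using dinaturalD[OF dinatural_lin[OF dinatural_pelt[OF Z] that] P(1) _ P(3)] by (intro linI) auto
      show "h (pelt Z (f, g)) = h' (pelt Z (f, g))"
      proof (rule Vect_colimit_eq[OF lP[OF P(1)] L[OF h(1)] L[OF h(2)] W])
        fix j f assume j: "j \<in> Obj J" and f: "f \<in> carrier (fobj (comp_fun (hom_functor C P) E) j)"
        have f: "f \<in> homs C P (fobj E j)" using f by simp
        have a: "ap (farr (hom_functor C P) (\<iota> j)) f = Cmp C (\<iota> j) f" using f j by simp
        show "h (pelt Z (ap (farr (hom_functor C P) (\<iota> j)) f, g)) = h' (pelt Z (ap (farr (hom_functor C P) (\<iota> j)) f, g))"
          unfolding a using e[OF j, of "pelt (fobj E j) (f, g)"] pfun_arr(2)[OF i[OF j] gensI[OF P(1) f P(3)]]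
            pelt_closed[OF functor_Obj[OF E j] gensI[OF P(1) f P(3)]] by simp
      qed (use P in simp)
    qed
  qed
qed

text \<open>The comparison map of the Kan extension, induced by composition. It is invertible at
  compact projective objects; elsewhere \<open>\<phi>\<close> may differ from
  \<open>Hom(I, -)\<close>.\<close>

definition counit :: "'u \<Rightarrow> 'u \<Rightarrow> 'u" where
  "counit Z = (SOME h. lin k (pobj Z) (hom_space C I Z) h \<and> (\<forall>f g. (f, g) \<in> gens Z \<longrightarrow> h (pelt Z (f, g)) = Cmp C f g))"

lemma counit:
  assumes Z: "Z \<in> Obj C"
  shows "lin k (pobj Z) (hom_space C I Z) (counit Z)" "(f, g) \<in> gens Z \<Longrightarrow> counit Z (pelt Z (f, g)) = Cmp C f g"
proof -
  have "dinatural Z (hom_space C I Z) (\<lambda>(f, g). Cmp C f g)"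
    by (rule dinaturalI) (auto simp: in_homs_iff Cmp_HAdd_left[OF linear] Cmp_HAdd_right[OF linear] Cmp_HScale[OF linear])
  then have "\<exists>h. lin k (pobj Z) (hom_space C I Z) h \<and> (\<forall>f g. (f, g) \<in> gens Z \<longrightarrow> h (pelt Z (f, g)) = Cmp C f g)"
    by (rule pobj_factor[OF Z hom_space_Obj[OF linear locally_small I Z]]) auto
  from someI_ex[OF this]
  show "lin k (pobj Z) (hom_space C I Z) (counit Z)" "(f, g) \<in> gens Z \<Longrightarrow> counit Z (pelt Z (f, g)) = Cmp C f g"
    by (auto simp: counit_def)
qed

lemma counit_natural:
  assumes u: "u \<in> homs C Y Z" and x: "x \<in> carrier (pobj Y)"
  shows "counit Z (ap (farr pfun u) x) = Cmp C u (counit Y x)"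
proof -
  have Y: "Y \<in> Obj C" and Z: "Z \<in> Obj C" using u by (auto simp: in_homs_iff)
  show ?thesis
  proof (rule pobj_eq[OF Y hom_space_Obj[OF linear locally_small I Z] _ _ _ x, where h = "\<lambda>x. counit Z (ap (farr pfun u) x)"])
    show "lin k (pobj Y) (hom_space C I Z) (\<lambda>x. counit Z (ap (farr pfun u) x))"
      using lin_comp[OF Vect_homsD(3)[OF pfun_arr(1)[OF u]] counit(1)[OF Z]] .
    show "lin k (pobj Y) (hom_space C I Z) (\<lambda>x. Cmp C u (counit Y x))"
      using lin_comp[OF counit(1)[OF Y] lin_Cmp_right[OF linear u]] .
    fix f g assume fg: "(f, g) \<in> gens Y"
    have "Cmp C (Cmp C u f) g = Cmp C u (Cmp C f g)" using fg u by (auto simp: gens_def in_homs_iff)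
    then show "counit Z (ap (farr pfun u) (pelt Y (f, g))) = Cmp C u (counit Y (pelt Y (f, g)))"
      using pfun_arr(2)[OF u fg] counit(2)[OF Y fg] counit(2)[OF Z gens_comp[OF fg u]] by simp
  qed
qed

text \<open>By the co-Yoneda lemma\<close>

lemma counit_bij:
  assumes Q: "compact_projective k C Q"
  shows "bij_betw (counit Q) (carrier (pobj Q)) (homs C I Q)"
proof -
  have QO: "Q \<in> Obj C" using Q by (simp add: compact_projective_def)
  obtain P u where P: "P \<in> PP" and u: "u \<in> homs C Q P" and iso: "is_iso C u" using PP_all[OF Q] by blast
  define v where "v = inv_arr C u"
  have v: "v \<in> homs C P Q" and uv: "Cmp C v u = Idt C Q" "Cmp C u v = Idt C P"
    using u iso by (auto simp: v_def in_homs_iff)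
  note ug = Cmp_in_homs[OF category_C _ u]
  \<comment> \<open>The usual inverse sends \<open>g\<close> to the class of the pair of the
    identity and \<open>g\<close>, but \<open>Q\<close> need not belong to \<open>PP\<close>. Hence
    the detour through the isomorphic object \<open>P\<close> in \<open>PP\<close>.\<close>
  define s where "s g = pelt Q (v, Cmp C u g)" for g
  have s: "s g \<in> carrier (pobj Q)" if "g \<in> homs C I Q" for g
    unfolding s_def using pelt_closed[OF QO gensI[OF P v ug[OF that]]] .
  have cs: "counit Q (s g) = g" if g: "g \<in> homs C I Q" for g
  proof -
    have "Cmp C v (Cmp C u g) = Cmp C (Cmp C v u) g" using g u v by (simp add: in_homs_iff)
    then show ?thesis unfolding s_def counit(2)[OF QO gensI[OF P v ug[OF g]]] using uv g by (simp add: in_homs_iff)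
  qed
  have lin_s: "lin k (hom_space C I Q) (pobj Q) s"
  proof (rule linI)
    fix g g' assume "g \<in> carrier (hom_space C I Q)" "g' \<in> carrier (hom_space C I Q)"
    then have g: "g \<in> homs C I Q" "g' \<in> homs C I Q" by auto
    have "Cmp C u (HAdd C g g') = HAdd C (Cmp C u g) (Cmp C u g')" using g u by (simp add: in_homs_iff Cmp_HAdd_right[OF linear])
    then show "s (g \<oplus>\<^bsub>hom_space C I Q\<^esub> g') = s g \<oplus>\<^bsub>pobj Q\<^esub> s g'"
      using dinaturalD(3)[OF dinatural_pelt[OF QO] P v ug[OF g(1)] ug[OF g(2)]] by (simp add: s_def)
  next
    fix a g assume a: "a \<in> carrier k" and "g \<in> carrier (hom_space C I Q)"
    then have g: "g \<in> homs C I Q" by auto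
    have "Cmp C u (HScale C a g) = HScale C a (Cmp C u g)" using g u a by (simp add: in_homs_iff Cmp_HScale[OF linear])
    then show "s (a \<odot>\<^bsub>hom_space C I Q\<^esub> g) = a \<odot>\<^bsub>pobj Q\<^esub> s g"
      using dinaturalD(5)[OF dinatural_pelt[OF QO] P v ug[OF g(1)] a] by (simp add: s_def)
  qed (use s in simp)
  have sc: "s (counit Q x) = x" if x: "x \<in> carrier (pobj Q)" for x
  proof (rule pobj_eq[OF QO pobj_Obj[OF QO] lin_comp[OF counit(1)[OF QO] lin_s] lin_id _ x])
    fix f g assume fg: "(f, g) \<in> gens Q"
    obtain P' where P': "P' \<in> PP" and f: "f \<in> homs C P' Q" and g: "g \<in> homs C I P'" using gensE[OF fg] .
    have "s (counit Q (pelt Q (f, g))) = pelt Q (v, Cmp C (Cmp C u f) g)"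
      unfolding s_def counit(2)[OF QO fg] using u f g by (simp add: in_homs_iff)
    also have "\<dots> = pelt Q (Cmp C v (Cmp C u f), g)"
      using dinaturalD(6)[OF dinatural_pelt[OF QO] P v Cmp_in_homs[OF category_C g ug[OF f]] P' ug[OF f] g] by simp
    also have "Cmp C v (Cmp C u f) = Cmp C (Cmp C v u) f" using u v f by (simp add: in_homs_iff)
    also have "\<dots> = f" using uv f by (simp add: in_homs_iff)
    finally show "s (counit Q (pelt Q (f, g))) = pelt Q (f, g)" .
  qed
  have cl: "counit Q x \<in> homs C I Q" if "x \<in> carrier (pobj Q)" for x
    using linD(1)[OF counit(1)[OF QO], of x] that by simp
  show ?thesis by (rule bij_betwI[of _ _ _ s]) (use s cs sc cl in auto)
qed

end

section \<open>Duals and compactness in a monoidal category\<close>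

lemma Cmp_rewrite:
  assumes "category C" "Cmp C g f = u" "f \<in> Arr C" "g \<in> Arr C" "h \<in> Arr C" "Cod C f = Dom C g" "Cod C h = Dom C f"
  shows "Cmp C g (Cmp C f h) = Cmp C u h"
  using Cmp_assoc[OF assms(1,5,3,4,7,6)] assms(2) by simp

lemma inv_arr_Cmp:
  assumes C: "category C" and f: "is_iso C f" "is_iso C g" "Cod C f = Dom C g"
  shows "inv_arr C (Cmp C g f) = Cmp C (inv_arr C f) (inv_arr C g)"
proof (rule inv_arrI[OF C], rule inverse_arrowsI[OF C])
  note [simp] = C is_iso_Arr[OF C f(1)] is_iso_Arr[OF C f(2)] f
  show "Cmp C g f \<in> homs C (Dom C f) (Cod C g)" "Cmp C (inv_arr C f) (inv_arr C g) \<in> homs C (Cod C g) (Dom C f)"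
    by (simp_all add: in_homs_iff)
  show "Cmp C (Cmp C (inv_arr C f) (inv_arr C g)) (Cmp C g f) = Idt C (Dom C f)"
    using f(3) by simp
  show "Cmp C (Cmp C g f) (Cmp C (inv_arr C f) (inv_arr C g)) = Idt C (Cod C g)"
    using f(3) by simp
qed

lemma inv_arr_Idt:
  assumes "category C" "X \<in> Obj C" shows "inv_arr C (Idt C X) = Idt C X"
  using assms by (intro inv_arrI) (auto simp: inverse_arrows_def in_homs_iff)

lemma preserves_colimits_mono:
  fixes P :: "('u, 'u) cat \<Rightarrow> bool"
  shows "preserves_colimits (\<lambda>J :: ('u, 'u) cat. True) C D F \<Longrightarrow> preserves_colimits P C D F"
  by (auto simp: preserves_colimits_def)

text \<open>Precomposition with \<open>p\<close> and \<open>s\<close> exhibits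
  \<open>Hom(R, -)\<close> as a natural retract of \<open>Hom(X, -)\<close>.\<close>

lemma (in linear_cocomplete) preserves_colimits_hom_retract:
  assumes s: "s \<in> homs C R X" and p: "p \<in> homs C X R" and ps: "Cmp C p s = Idt C R"
    and pr: "preserves_colimits Q C (Vect k) (hom_functor C X)"
  shows "preserves_colimits Q C (Vect k) (hom_functor C R)"
proof -
  note [simp] = homsD[OF s] homsD[OF p]
  have O: "R \<in> Obj C" "X \<in> Obj C" using Obj_Dom[OF category_C homsD(1)[OF s]] Obj_Dom[OF category_C homsD(1)[OF p]] by auto
  note HR = is_functor_hom_functor[OF linear locally_small O(1)] and HX = is_functor_hom_functor[OF linear locally_small O(2)]
  note hO = hom_space_Obj[OF linear locally_small]
  have nat: "nat_trans C (Vect k) (hom_functor C U) (hom_functor C V) (\<lambda>Y. vmk (hom_space C U Y) (hom_space C V Y) (\<lambda>h. Cmp C h q))"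
    if q: "q \<in> homs C V U" for q U V
  proof (rule nat_transI)
    have O: "U \<in> Obj C" "V \<in> Obj C" using Obj_Dom[OF category_C homsD(1)[OF q]] Obj_Cod[OF category_C homsD(1)[OF q]] homsD[OF q] by auto
    show "is_functor C (Vect k) (hom_functor C U)" "is_functor C (Vect k) (hom_functor C V)"
      using O is_functor_hom_functor[OF linear locally_small] by auto
    have m: "vmk (hom_space C U Y) (hom_space C V Y) (\<lambda>h. Cmp C h q) \<in> homs (Vect k) (hom_space C U Y) (hom_space C V Y)" if "Y \<in> Obj C" for Y
      using that O by (intro vmk_homs hO lin_Cmp_left[OF linear q])
    then show "vmk (hom_space C U Y) (hom_space C V Y) (\<lambda>h. Cmp C h q) \<in> homs (Vect k) (fobj (hom_functor C U) Y) (fobj (hom_functor C V) Y)" if "Y \<in> Obj C" for Y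
      using that by simp
    fix f assume f: "f \<in> Arr C"
    have hf: "farr (hom_functor C Z) f \<in> homs (Vect k) (hom_space C Z (Dom C f)) (hom_space C Z (Cod C f))" if "Z \<in> Obj C" for Z
      using functor_arr[OF is_functor_hom_functor[OF linear locally_small that] f] by (simp add: in_homs_iff)
    show "Cmp (Vect k) (vmk (hom_space C U (Cod C f)) (hom_space C V (Cod C f)) (\<lambda>h. Cmp C h q)) (farr (hom_functor C U) f) =
      Cmp (Vect k) (farr (hom_functor C V) f) (vmk (hom_space C U (Dom C f)) (hom_space C V (Dom C f)) (\<lambda>h. Cmp C h q))"
      by (rule Vect_arr_eqI[OF Cmp_Vect_homs(1)[OF hf[OF O(1)] m] Cmp_Vect_homs(1)[OF m hf[OF O(2)]]])
        (use f q in \<open>auto simp: in_homs_iff\<close>)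
  qed
  show ?thesis
  proof (rule preserves_colimits_retract[OF nat[OF p] nat[OF s] _ pr])
    fix Y assume Y: "Y \<in> Obj C"
    have m: "vmk (hom_space C U Y) (hom_space C V Y) (\<lambda>h. Cmp C h q) \<in> homs (Vect k) (hom_space C U Y) (hom_space C V Y)"
      if q: "q \<in> homs C V U" "U \<in> Obj C" "V \<in> Obj C" for q U V
      using that Y by (intro vmk_homs hO lin_Cmp_left[OF linear q(1)])
    have "Cmp (Vect k) (vmk (hom_space C X Y) (hom_space C R Y) (\<lambda>h. Cmp C h s)) (vmk (hom_space C R Y) (hom_space C X Y) (\<lambda>h. Cmp C h p)) = Idt (Vect k) (hom_space C R Y)"
      by (rule Vect_arr_eqI[OF Cmp_Vect_homs(1)[OF m[OF p O] m[OF s O(2,1)]] Idt_Vect_homs[OF hO[OF O(1) Y]]])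
        (use ps in \<open>auto simp: in_homs_iff\<close>)
    then show "Cmp (Vect k) (vmk (hom_space C X Y) (hom_space C R Y) (\<lambda>h. Cmp C h s)) (vmk (hom_space C R Y) (hom_space C X Y) (\<lambda>h. Cmp C h p)) =
        Idt (Vect k) (fobj (hom_functor C R) Y)" by simp
  qed
qed

text \<open>Laws are assumed for the monoidal structure alone, neither for the braiding nor for the
  balancing, so that the reversed tensor product is again an instance.\<close>

locale cocontinuous_monoidal = linear_cocomplete k A + balanced_data A M
  for k :: "'u ring" and A :: "('u, 'u, 'u) lincat" and M :: "'u balanced_struct" +
  assumes tensor: "bicocontinuous k A A A (tens M)" and laws: monoidal_laws
begin

lemma tensor_functor: "is_functor (prod_cat A A) A (tens M)"
  using bicocontinuousD(1)[OF tensor] .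

lemma tensor_obj [simp]: "X \<in> Obj A \<Longrightarrow> Y \<in> Obj A \<Longrightarrow> X \<star> Y \<in> Obj A"
  using functor_Obj[OF tensor_functor, of "(X, Y)"] by simp

lemma tensor_arr [simp]:
  assumes "f \<in> Arr A" "g \<in> Arr A"
  shows "f \<bullet> g \<in> Arr A" "Dom A (f \<bullet> g) = Dom A f \<star> Dom A g" "Cod A (f \<bullet> g) = Cod A f \<star> Cod A g"
  using functor_arr[OF tensor_functor, of "(f, g)"] assms by simp_all

lemma tensor_Idt [simp]: "X \<in> Obj A \<Longrightarrow> Y \<in> Obj A \<Longrightarrow> \<iota> X \<bullet> \<iota> Y = \<iota> (X \<star> Y)"
  using functor_Idt[OF tensor_functor, of "(X, Y)"] by simp

lemma interchange:
  assumes "f \<in> Arr A" "f' \<in> Arr A" "g \<in> Arr A" "g' \<in> Arr A" "Cod A f = Dom A f'" "Cod A g = Dom A g'"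
  shows "f' \<bullet> g' \<diamondop> f \<bullet> g = (f' \<diamondop> f) \<bullet> (g' \<diamondop> g)"
  using functor_Cmp[OF tensor_functor, of "(f, g)" "(f', g')"] assms by simp

lemma tensor_left_Cmp:
  assumes "X \<in> Obj A" "f \<in> Arr A" "g \<in> Arr A" "Cod A f = Dom A g"
  shows "\<iota> X \<bullet> (g \<diamondop> f) = \<iota> X \<bullet> g \<diamondop> \<iota> X \<bullet> f"
  using assms by (simp add: interchange)

lemma tensor_right_Cmp:
  assumes "X \<in> Obj A" "f \<in> Arr A" "g \<in> Arr A" "Cod A f = Dom A g"
  shows "(g \<diamondop> f) \<bullet> \<iota> X = g \<bullet> \<iota> X \<diamondop> f \<bullet> \<iota> X"
  using assms by (simp add: interchange)

lemma tensor_slide: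
  assumes "f \<in> Arr A" "g \<in> Arr A" "Dom A f = X" "Cod A f = X'" "Dom A g = Y" "Cod A g = Y'"
  shows "\<iota> X' \<bullet> g \<diamondop> f \<bullet> \<iota> Y = f \<bullet> \<iota> Y' \<diamondop> \<iota> X \<bullet> g"
  using assms(1,2) unfolding assms(3-6)[symmetric] by (simp add: interchange)

lemma tensor_is_iso [simp]:
  assumes "is_iso A f" "is_iso A g"
  shows "is_iso A (f \<bullet> g)" "inv_iso (f \<bullet> g) = inv_iso f \<bullet> inv_iso g"
proof -
  note [simp] = is_iso_Arr[OF category_C assms(1)] is_iso_Arr[OF category_C assms(2)] assms
  have "inverse_arrows A (f \<bullet> g) (inv_iso f \<bullet> inv_iso g)"
    by (rule inverse_arrowsI[OF category_C, of _ "Dom A f \<star> Dom A g" "Cod A f \<star> Cod A g"]) (simp_all add: in_homs_iff interchange)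
  then show "is_iso A (f \<bullet> g)" "inv_iso (f \<bullet> g) = inv_iso f \<bullet> inv_iso g"
    using inv_arrI[OF category_C] by (auto simp: is_iso_def)
qed

lemma unit_Obj [simp]: "I \<in> Obj A"
  using laws by (simp add: monoidal_laws_def)

lemma assoc_simps [simp]:
  assumes "X \<in> Obj A" "Y \<in> Obj A" "Z \<in> Obj A"
  shows "\<a> X Y Z \<in> Arr A" "Dom A (\<a> X Y Z) = (X \<star> Y) \<star> Z" "Cod A (\<a> X Y Z) = X \<star> (Y \<star> Z)" "is_iso A (\<a> X Y Z)"
  using laws assms by (auto simp: monoidal_laws_def in_homs_iff)

lemma unitor_simps [simp]:
  assumes "X \<in> Obj A"
  shows "\<l> X \<in> Arr A" "Dom A (\<l> X) = I \<star> X" "Cod A (\<l> X) = X" "is_iso A (\<l> X)"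
    "\<r> X \<in> Arr A" "Dom A (\<r> X) = X \<star> I" "Cod A (\<r> X) = X" "is_iso A (\<r> X)"
  using laws assms by (auto simp: monoidal_laws_def in_homs_iff)

lemma assoc_natural:
  assumes "f \<in> Arr A" "g \<in> Arr A" "h \<in> Arr A"
    "Dom A f = X" "Dom A g = Y" "Dom A h = Z" "Cod A f = X'" "Cod A g = Y'" "Cod A h = Z'"
  shows "\<a> X' Y' Z' \<diamondop> (f \<bullet> g) \<bullet> h = f \<bullet> (g \<bullet> h) \<diamondop> \<a> X Y Z"
proof -
  have "X \<in> Obj A" "Y \<in> Obj A" "Z \<in> Obj A" "X' \<in> Obj A" "Y' \<in> Obj A" "Z' \<in> Obj A"
    "f \<in> homs A X X'" "g \<in> homs A Y Y'" "h \<in> homs A Z Z'"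
    using assms by (auto simp: in_homs_iff)
  then show ?thesis using laws unfolding monoidal_laws_def by blast
qed

lemma assoc_inv_natural:
  assumes "f \<in> Arr A" "g \<in> Arr A" "h \<in> Arr A"
    "Dom A f = X" "Dom A g = Y" "Dom A h = Z" "Cod A f = X'" "Cod A g = Y'" "Cod A h = Z'"
  shows "inv_iso (\<a> X' Y' Z') \<diamondop> f \<bullet> (g \<bullet> h) = (f \<bullet> g) \<bullet> h \<diamondop> inv_iso (\<a> X Y Z)"
proof (rule iso_mono[OF category_C, of "\<a> X' Y' Z'"], goal_cases)
  note [simp] = assms(1-3) assms(4-9)[symmetric]
  { case 2
    have "\<a> X' Y' Z' \<diamondop> (f \<bullet> g) \<bullet> h \<diamondop> inv_iso (\<a> X Y Z) = f \<bullet> (g \<bullet> h) \<diamondop> \<a> X Y Z \<diamondop> inv_iso (\<a> X Y Z)"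
      by (subst Cmp_rewrite[OF category_C assoc_natural[OF assms]]) simp_all
    then show ?case by simp }
qed (simp_all add: assms(1-3) assms(4-9)[symmetric])

lemma unitor_natural:
  assumes "f \<in> Arr A" "Dom A f = X" "Cod A f = Y"
  shows "\<l> Y \<diamondop> \<iota> I \<bullet> f = f \<diamondop> \<l> X" "\<r> Y \<diamondop> f \<bullet> \<iota> I = f \<diamondop> \<r> X"
proof -
  have "X \<in> Obj A" "Y \<in> Obj A" "f \<in> homs A X Y" using assms by (auto simp: in_homs_iff)
  then show "\<l> Y \<diamondop> \<iota> I \<bullet> f = f \<diamondop> \<l> X" "\<r> Y \<diamondop> f \<bullet> \<iota> I = f \<diamondop> \<r> X"
    using laws unfolding monoidal_laws_def by blast+
qed

lemma runit_inv_natural: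
  assumes "f \<in> Arr A" "Dom A f = X" "Cod A f = Y"
  shows "f \<bullet> \<iota> I \<diamondop> inv_iso (\<r> X) = inv_iso (\<r> Y) \<diamondop> f"
proof (rule iso_mono[OF category_C, of "\<r> Y"], goal_cases)
  note [simp] = assms(1) assms(2-3)[symmetric]
  { case 2
    have "\<r> Y \<diamondop> f \<bullet> \<iota> I \<diamondop> inv_iso (\<r> X) = f \<diamondop> \<r> X \<diamondop> inv_iso (\<r> X)"
      by (subst Cmp_rewrite[OF category_C unitor_natural(2)[OF assms]]) simp_all
    then show ?case by simp }
qed (simp_all add: assms(1) assms(2-3)[symmetric])

lemma pentagon:
  assumes "W \<in> Obj A" "X \<in> Obj A" "Y \<in> Obj A" "Z \<in> Obj A"
  shows "\<a> W X (Y \<star> Z) \<diamondop> \<a> (W \<star> X) Y Z = \<iota> W \<bullet> \<a> X Y Z \<diamondop> \<a> W (X \<star> Y) Z \<diamondop> \<a> W X Y \<bullet> \<iota> Z"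
  using laws assms by (simp add: monoidal_laws_def)

lemma triangle:
  assumes "X \<in> Obj A" "Y \<in> Obj A"
  shows "\<iota> X \<bullet> \<l> Y \<diamondop> \<a> X I Y = \<r> X \<bullet> \<iota> Y"
  using laws assms by (simp add: monoidal_laws_def)

text \<open>Kelly's argument: after tensoring with \<open>I\<close> on the right and composing with
  an associator, both sides agree by the triangle and the pentagon. Tensoring with \<open>I\<close>
  is faithful because \<open>\<r>\<close> is a natural isomorphism.\<close>

lemma runit_tensor:
  assumes X: "X \<in> Obj A" and Y: "Y \<in> Obj A"
  shows "\<r> (X \<star> Y) = \<iota> X \<bullet> \<r> Y \<diamondop> \<a> X Y I"
proof -
  note [simp] = X Y
  have "\<a> X Y I \<diamondop> \<r> (X \<star> Y) \<bullet> \<iota> I = \<a> X Y I \<diamondop> \<iota> (X \<star> Y) \<bullet> \<l> I \<diamondop> \<a> (X \<star> Y) I I"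
    using triangle[of "X \<star> Y" I] by simp
  also have "\<dots> = (\<a> X Y I \<diamondop> (\<iota> X \<bullet> \<iota> Y) \<bullet> \<l> I) \<diamondop> \<a> (X \<star> Y) I I"
    by simp
  also have "\<dots> = \<iota> X \<bullet> (\<iota> Y \<bullet> \<l> I) \<diamondop> \<a> X Y (I \<star> I) \<diamondop> \<a> (X \<star> Y) I I"
    by (subst assoc_natural[where X = X and Y = Y and Z = "I \<star> I"]) simp_all
  also have "\<dots> = \<iota> X \<bullet> (\<iota> Y \<bullet> \<l> I) \<diamondop> \<iota> X \<bullet> \<a> Y I I \<diamondop> \<a> X (Y \<star> I) I \<diamondop> \<a> X Y I \<bullet> \<iota> I"
    by (simp add: pentagon)
  also have "\<dots> = \<iota> X \<bullet> (\<iota> Y \<bullet> \<l> I \<diamondop> \<a> Y I I) \<diamondop> \<a> X (Y \<star> I) I \<diamondop> \<a> X Y I \<bullet> \<iota> I"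
    by (simp add: tensor_left_Cmp del: tensor_Idt)
  also have "\<dots> = (\<iota> X \<bullet> (\<r> Y \<bullet> \<iota> I) \<diamondop> \<a> X (Y \<star> I) I) \<diamondop> \<a> X Y I \<bullet> \<iota> I"
    by (simp add: triangle)
  also have "\<dots> = \<a> X Y I \<diamondop> (\<iota> X \<bullet> \<r> Y) \<bullet> \<iota> I \<diamondop> \<a> X Y I \<bullet> \<iota> I"
    by (subst assoc_natural[symmetric, where X' = X and Y' = Y and Z' = I]) simp_all
  finally have e: "\<a> X Y I \<diamondop> \<r> (X \<star> Y) \<bullet> \<iota> I = \<a> X Y I \<diamondop> (\<iota> X \<bullet> \<r> Y \<diamondop> \<a> X Y I) \<bullet> \<iota> I"
    by (simp add: tensor_right_Cmp)
  have e: "\<r> (X \<star> Y) \<bullet> \<iota> I = (\<iota> X \<bullet> \<r> Y \<diamondop> \<a> X Y I) \<bullet> \<iota> I"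
    by (rule iso_mono[OF category_C _ e]) simp_all
  have "\<r> (X \<star> Y) \<diamondop> \<r> (X \<star> Y) \<bullet> \<iota> I = \<r> (X \<star> Y) \<diamondop> (\<iota> X \<bullet> \<r> Y \<diamondop> \<a> X Y I) \<bullet> \<iota> I"
    using e by simp
  then have e: "\<r> (X \<star> Y) \<diamondop> \<r> ((X \<star> Y) \<star> I) = (\<iota> X \<bullet> \<r> Y \<diamondop> \<a> X Y I) \<diamondop> \<r> ((X \<star> Y) \<star> I)"
    using unitor_natural(2)[of "\<r> (X \<star> Y)" "(X \<star> Y) \<star> I" "X \<star> Y"]
      unitor_natural(2)[of "\<iota> X \<bullet> \<r> Y \<diamondop> \<a> X Y I" "(X \<star> Y) \<star> I" "X \<star> Y"] by simp
  show ?thesis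
    by (rule iso_epi[OF category_C _ e]) simp_all
qed

text \<open>For a left dual \<open>L\<close> of \<open>R\<close>, tensoring with \<open>R\<close> on
  the right is left adjoint to tensoring with \<open>L\<close> on the right. \<open>bend\<close> is
  the bijection from \<open>Hom(X \<otimes> R, Y)\<close> to \<open>Hom(X, Y \<otimes> L)\<close>,
  and \<open>unbend\<close> its inverse.\<close>

definition bend :: "'u \<Rightarrow> 'u \<Rightarrow> 'u \<Rightarrow> 'u \<Rightarrow> 'u \<Rightarrow> 'u" where
  "bend R L d X h = h \<bullet> \<iota> L \<diamondop> inv_iso (\<a> X R L) \<diamondop> \<iota> X \<bullet> d \<diamondop> inv_iso (\<r> X)"

definition unbend :: "'u \<Rightarrow> 'u \<Rightarrow> 'u \<Rightarrow> 'u \<Rightarrow> 'u \<Rightarrow> 'u" where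
  "unbend R L e Y g = \<r> Y \<diamondop> \<iota> Y \<bullet> e \<diamondop> \<a> Y L R \<diamondop> g \<bullet> \<iota> R"

lemma left_dualD:
  assumes "left_dual R L e d"
  shows "R \<in> Obj A" "L \<in> Obj A" "e \<in> Arr A" "Dom A e = L \<star> R" "Cod A e = I" "d \<in> Arr A" "Dom A d = I" "Cod A d = R \<star> L"
    "\<r> R \<diamondop> \<iota> R \<bullet> e \<diamondop> \<a> R L R \<diamondop> d \<bullet> \<iota> R \<diamondop> inv_iso (\<l> R) = \<iota> R"
    "\<l> L \<diamondop> e \<bullet> \<iota> L \<diamondop> inv_iso (\<a> L R L) \<diamondop> \<iota> L \<bullet> d \<diamondop> inv_iso (\<r> L) = \<iota> L"
  using assms by (auto simp: left_dual_def in_homs_iff)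

context
  fixes R L e d assumes dual: "left_dual R L e d"
begin

lemmas dual_simps [simp] = left_dualD(1-8)[OF dual]

lemma bend_homs:
  assumes "h \<in> homs A (X \<star> R) Y" "X \<in> Obj A"
  shows "bend R L d X h \<in> homs A X (Y \<star> L)"
  using assms by (simp add: bend_def in_homs_iff)

lemma unbend_homs:
  assumes "g \<in> homs A X (Y \<star> L)" "Y \<in> Obj A"
  shows "unbend R L e Y g \<in> homs A (X \<star> R) Y"
  using assms by (simp add: unbend_def in_homs_iff)

lemma bend_Cmp:
  assumes "h \<in> homs A (X \<star> R) Y" "X \<in> Obj A" "y \<in> homs A Y Y'"
  shows "bend R L d X (y \<diamondop> h) = y \<bullet> \<iota> L \<diamondop> bend R L d X h"
  using assms by (simp add: bend_def in_homs_iff tensor_right_Cmp)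

lemma unbend_Cmp:
  assumes "g \<in> homs A X (Y \<star> L)" "y \<in> homs A Y Y'"
  shows "unbend R L e Y' (y \<bullet> \<iota> L \<diamondop> g) = y \<diamondop> unbend R L e Y g"
proof -
  note [simp] = homsD[OF assms(1)] homsD[OF assms(2)]
  have [simp]: "Y \<in> Obj A" "Y' \<in> Obj A" using Obj_Dom[OF category_C homsD(1)[OF assms(2)]] Obj_Cod[OF category_C homsD(1)[OF assms(2)]] by auto
  have "unbend R L e Y' (y \<bullet> \<iota> L \<diamondop> g) = \<r> Y' \<diamondop> \<iota> Y' \<bullet> e \<diamondop> (\<a> Y' L R \<diamondop> (y \<bullet> \<iota> L) \<bullet> \<iota> R) \<diamondop> g \<bullet> \<iota> R"
    by (simp add: unbend_def tensor_right_Cmp)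
  also have "\<dots> = \<r> Y' \<diamondop> (\<iota> Y' \<bullet> e \<diamondop> y \<bullet> \<iota> (L \<star> R)) \<diamondop> \<a> Y L R \<diamondop> g \<bullet> \<iota> R"
    by (subst assoc_natural[where X = Y and Y = L and Z = R]) simp_all
  also have "\<dots> = (\<r> Y' \<diamondop> y \<bullet> \<iota> I) \<diamondop> \<iota> Y \<bullet> e \<diamondop> \<a> Y L R \<diamondop> g \<bullet> \<iota> R"
    by (subst tensor_slide[where X = Y and Y' = I]) simp_all
  also have "\<dots> = y \<diamondop> unbend R L e Y g"
    by (subst unitor_natural(2)[where X = Y]) (simp_all add: unbend_def)
  finally show ?thesis .
qed

text \<open>Naturality in \<open>Y\<close> reduces the claim to the identity of
  \<open>X \<otimes> R\<close>. There the associators are rearranged by the pentagon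
  (\<open>P\<close>), the triangle (\<open>T\<close>) and \<open>runit_tensor\<close>
  (\<open>K\<close>) until the first snake identity, tensored with \<open>X\<close>,
  remains.\<close>

lemma unbend_bend:
  assumes h: "h \<in> homs A (X \<star> R) Y" and X: "X \<in> Obj A"
  shows "unbend R L e Y (bend R L d X h) = h"
proof -
  note [simp] = homsD[OF h] X
  have [simp]: "Y \<in> Obj A" using Obj_Cod[OF category_C homsD(1)[OF h]] by simp
  have i: "\<iota> (X \<star> R) \<in> homs A (X \<star> R) (X \<star> R)" by (simp add: in_homs_iff)
  have P: "\<a> (X \<star> R) L R \<diamondop> inv_iso (\<a> X R L) \<bullet> \<iota> R =
      inv_iso (\<a> X R (L \<star> R)) \<diamondop> \<iota> X \<bullet> \<a> R L R \<diamondop> \<a> X (R \<star> L) R"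
  proof -
    have "\<a> X R (L \<star> R) \<diamondop> \<a> (X \<star> R) L R \<diamondop> inv_iso (\<a> X R L) \<bullet> \<iota> R =
      (\<a> X R (L \<star> R) \<diamondop> \<a> (X \<star> R) L R) \<diamondop> inv_iso (\<a> X R L) \<bullet> \<iota> R" by simp
    also have "\<dots> = \<iota> X \<bullet> \<a> R L R \<diamondop> \<a> X (R \<star> L) R \<diamondop> \<a> X R L \<bullet> \<iota> R \<diamondop> inv_iso (\<a> X R L) \<bullet> \<iota> R"
      by (subst pentagon) simp_all
    also have "\<a> X R L \<bullet> \<iota> R \<diamondop> inv_iso (\<a> X R L) \<bullet> \<iota> R = \<iota> ((X \<star> (R \<star> L)) \<star> R)"
      by (subst interchange) simp_all
    finally have "\<a> X R (L \<star> R) \<diamondop> \<a> (X \<star> R) L R \<diamondop> inv_iso (\<a> X R L) \<bullet> \<iota> R = \<iota> X \<bullet> \<a> R L R \<diamondop> \<a> X (R \<star> L) R"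
      by simp
    then have "inv_iso (\<a> X R (L \<star> R)) \<diamondop> \<a> X R (L \<star> R) \<diamondop> \<a> (X \<star> R) L R \<diamondop> inv_iso (\<a> X R L) \<bullet> \<iota> R =
      inv_iso (\<a> X R (L \<star> R)) \<diamondop> \<iota> X \<bullet> \<a> R L R \<diamondop> \<a> X (R \<star> L) R" by simp
    then show ?thesis by simp
  qed
  have T: "\<a> X I R \<diamondop> inv_iso (\<r> X) \<bullet> \<iota> R = \<iota> X \<bullet> inv_iso (\<l> R)"
  proof (rule iso_mono[OF category_C, of "\<iota> X \<bullet> \<l> R"])
    have "\<iota> X \<bullet> \<l> R \<diamondop> \<a> X I R \<diamondop> inv_iso (\<r> X) \<bullet> \<iota> R = \<r> X \<bullet> \<iota> R \<diamondop> inv_iso (\<r> X) \<bullet> \<iota> R"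
      by (subst Cmp_rewrite[OF category_C triangle]) simp_all
    then show "\<iota> X \<bullet> \<l> R \<diamondop> \<a> X I R \<diamondop> inv_iso (\<r> X) \<bullet> \<iota> R = \<iota> X \<bullet> \<l> R \<diamondop> \<iota> X \<bullet> inv_iso (\<l> R)"
      by (simp add: interchange)
  qed simp_all
  have K: "\<r> (X \<star> R) \<diamondop> inv_iso (\<a> X R I) = \<iota> X \<bullet> \<r> R"
    by (simp add: runit_tensor)
  have "unbend R L e (X \<star> R) (bend R L d X (\<iota> (X \<star> R))) =
    \<r> (X \<star> R) \<diamondop> \<iota> (X \<star> R) \<bullet> e \<diamondop> (\<a> (X \<star> R) L R \<diamondop> inv_iso (\<a> X R L) \<bullet> \<iota> R) \<diamondop> (\<iota> X \<bullet> d) \<bullet> \<iota> R \<diamondop> inv_iso (\<r> X) \<bullet> \<iota> R"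
    by (simp add: unbend_def bend_def tensor_right_Cmp)
  also have "\<dots> = \<r> (X \<star> R) \<diamondop> (\<iota> (X \<star> R) \<bullet> e \<diamondop> inv_iso (\<a> X R (L \<star> R))) \<diamondop> \<iota> X \<bullet> \<a> R L R \<diamondop> (\<a> X (R \<star> L) R \<diamondop> (\<iota> X \<bullet> d) \<bullet> \<iota> R) \<diamondop> inv_iso (\<r> X) \<bullet> \<iota> R"
    unfolding P by simp
  also have "\<iota> (X \<star> R) \<bullet> e \<diamondop> inv_iso (\<a> X R (L \<star> R)) = inv_iso (\<a> X R I) \<diamondop> \<iota> X \<bullet> (\<iota> R \<bullet> e)"
    by (subst assoc_inv_natural[where X = X and Y = R and Z = "L \<star> R"]) simp_all
  also have "\<a> X (R \<star> L) R \<diamondop> (\<iota> X \<bullet> d) \<bullet> \<iota> R = \<iota> X \<bullet> (d \<bullet> \<iota> R) \<diamondop> \<a> X I R"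
    by (rule assoc_natural) simp_all
  also have "\<r> (X \<star> R) \<diamondop> (inv_iso (\<a> X R I) \<diamondop> \<iota> X \<bullet> (\<iota> R \<bullet> e)) \<diamondop> \<iota> X \<bullet> \<a> R L R \<diamondop> (\<iota> X \<bullet> (d \<bullet> \<iota> R) \<diamondop> \<a> X I R) \<diamondop> inv_iso (\<r> X) \<bullet> \<iota> R =
    (\<r> (X \<star> R) \<diamondop> inv_iso (\<a> X R I)) \<diamondop> \<iota> X \<bullet> (\<iota> R \<bullet> e) \<diamondop> \<iota> X \<bullet> \<a> R L R \<diamondop> \<iota> X \<bullet> (d \<bullet> \<iota> R) \<diamondop> (\<a> X I R \<diamondop> inv_iso (\<r> X) \<bullet> \<iota> R)"
    by simp
  also have "\<dots> = \<iota> X \<bullet> (\<r> R \<diamondop> \<iota> R \<bullet> e \<diamondop> \<a> R L R \<diamondop> d \<bullet> \<iota> R \<diamondop> inv_iso (\<l> R))"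
    unfolding K T by (simp add: tensor_left_Cmp)
  also have "\<dots> = \<iota> (X \<star> R)" using left_dualD(9)[OF dual] by simp
  finally have "unbend R L e (X \<star> R) (bend R L d X (\<iota> (X \<star> R))) = \<iota> (X \<star> R)" .
  then show ?thesis
    using bend_Cmp[OF i X h] unbend_Cmp[OF bend_homs[OF i X] h] by simp
qed

text \<open>Here \<open>g\<close> is moved to the front of the composite by naturality. What
  remains, \<open>Z\<close>, is the second snake identity tensored with \<open>Y\<close>.\<close>

lemma bend_unbend:
  assumes g: "g \<in> homs A X (Y \<star> L)" and Y: "Y \<in> Obj A"
  shows "bend R L d X (unbend R L e Y g) = g"
proof -
  note [simp] = homsD[OF g] Y
  have [simp]: "X \<in> Obj A" using Obj_Dom[OF category_C homsD(1)[OF g]] by simp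
  \<comment> \<open>The counit of the adjunction at \<open>Y\<close>.\<close>
  define m where "m = \<r> Y \<diamondop> \<iota> Y \<bullet> e \<diamondop> \<a> Y L R"
  have m [simp]: "m \<in> Arr A" "Dom A m = (Y \<star> L) \<star> R" "Cod A m = Y" by (simp_all add: m_def)
  have P: "\<a> Y L R \<bullet> \<iota> L \<diamondop> inv_iso (\<a> (Y \<star> L) R L) =
      inv_iso (\<a> Y (L \<star> R) L) \<diamondop> \<iota> Y \<bullet> inv_iso (\<a> L R L) \<diamondop> \<a> Y L (R \<star> L)"
  proof (rule iso_epi[OF category_C, of "\<a> (Y \<star> L) R L"])
    have "(inv_iso (\<a> Y (L \<star> R) L) \<diamondop> \<iota> Y \<bullet> inv_iso (\<a> L R L) \<diamondop> \<a> Y L (R \<star> L)) \<diamondop> \<a> (Y \<star> L) R L =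
      inv_iso (\<a> Y (L \<star> R) L) \<diamondop> \<iota> Y \<bullet> inv_iso (\<a> L R L) \<diamondop> \<iota> Y \<bullet> \<a> L R L \<diamondop> \<a> Y (L \<star> R) L \<diamondop> \<a> Y L R \<bullet> \<iota> L"
      by (simp add: pentagon)
    also have "\<dots> = inv_iso (\<a> Y (L \<star> R) L) \<diamondop> (\<iota> Y \<bullet> inv_iso (\<a> L R L) \<diamondop> \<iota> Y \<bullet> \<a> L R L) \<diamondop> \<a> Y (L \<star> R) L \<diamondop> \<a> Y L R \<bullet> \<iota> L"
      by simp
    also have "\<iota> Y \<bullet> inv_iso (\<a> L R L) \<diamondop> \<iota> Y \<bullet> \<a> L R L = \<iota> (Y \<star> ((L \<star> R) \<star> L))"
      by (subst interchange) simp_all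
    finally show "(\<a> Y L R \<bullet> \<iota> L \<diamondop> inv_iso (\<a> (Y \<star> L) R L)) \<diamondop> \<a> (Y \<star> L) R L =
      (inv_iso (\<a> Y (L \<star> R) L) \<diamondop> \<iota> Y \<bullet> inv_iso (\<a> L R L) \<diamondop> \<a> Y L (R \<star> L)) \<diamondop> \<a> (Y \<star> L) R L"
      by simp
  qed simp_all
  have T: "\<r> Y \<bullet> \<iota> L \<diamondop> inv_iso (\<a> Y I L) = \<iota> Y \<bullet> \<l> L"
    by (simp add: triangle[symmetric])
  have K: "\<a> Y L I \<diamondop> inv_iso (\<r> (Y \<star> L)) = \<iota> Y \<bullet> inv_iso (\<r> L)"
    by (simp add: runit_tensor inv_arr_Cmp[OF category_C] inv_arr_Idt[OF category_C])
  have "m \<bullet> \<iota> L \<diamondop> inv_iso (\<a> (Y \<star> L) R L) \<diamondop> \<iota> (Y \<star> L) \<bullet> d \<diamondop> inv_iso (\<r> (Y \<star> L)) =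
    \<r> Y \<bullet> \<iota> L \<diamondop> (\<iota> Y \<bullet> e) \<bullet> \<iota> L \<diamondop> (\<a> Y L R \<bullet> \<iota> L \<diamondop> inv_iso (\<a> (Y \<star> L) R L)) \<diamondop> \<iota> (Y \<star> L) \<bullet> d \<diamondop> inv_iso (\<r> (Y \<star> L))"
    by (simp add: m_def tensor_right_Cmp)
  also have "\<dots> = \<r> Y \<bullet> \<iota> L \<diamondop> ((\<iota> Y \<bullet> e) \<bullet> \<iota> L \<diamondop> inv_iso (\<a> Y (L \<star> R) L)) \<diamondop> \<iota> Y \<bullet> inv_iso (\<a> L R L) \<diamondop> (\<a> Y L (R \<star> L) \<diamondop> \<iota> (Y \<star> L) \<bullet> d) \<diamondop> inv_iso (\<r> (Y \<star> L))"
    unfolding P by simp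
  also have "(\<iota> Y \<bullet> e) \<bullet> \<iota> L \<diamondop> inv_iso (\<a> Y (L \<star> R) L) = inv_iso (\<a> Y I L) \<diamondop> \<iota> Y \<bullet> (e \<bullet> \<iota> L)"
    by (subst assoc_inv_natural[where X = Y and Y = "L \<star> R" and Z = L]) simp_all
  also have "\<a> Y L (R \<star> L) \<diamondop> \<iota> (Y \<star> L) \<bullet> d = \<iota> Y \<bullet> (\<iota> L \<bullet> d) \<diamondop> \<a> Y L I"
    by (subst assoc_natural[symmetric, where X' = Y and Y' = L and Z' = "R \<star> L"]) simp_all
  also have "\<r> Y \<bullet> \<iota> L \<diamondop> (inv_iso (\<a> Y I L) \<diamondop> \<iota> Y \<bullet> (e \<bullet> \<iota> L)) \<diamondop> \<iota> Y \<bullet> inv_iso (\<a> L R L) \<diamondop> (\<iota> Y \<bullet> (\<iota> L \<bullet> d) \<diamondop> \<a> Y L I) \<diamondop> inv_iso (\<r> (Y \<star> L)) =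
    (\<r> Y \<bullet> \<iota> L \<diamondop> inv_iso (\<a> Y I L)) \<diamondop> \<iota> Y \<bullet> (e \<bullet> \<iota> L) \<diamondop> \<iota> Y \<bullet> inv_iso (\<a> L R L) \<diamondop> \<iota> Y \<bullet> (\<iota> L \<bullet> d) \<diamondop> (\<a> Y L I \<diamondop> inv_iso (\<r> (Y \<star> L)))"
    by simp
  also have "\<dots> = \<iota> Y \<bullet> (\<l> L \<diamondop> e \<bullet> \<iota> L \<diamondop> inv_iso (\<a> L R L) \<diamondop> \<iota> L \<bullet> d \<diamondop> inv_iso (\<r> L))"
    unfolding K T by (simp add: tensor_left_Cmp)
  also have "\<dots> = \<iota> (Y \<star> L)" using left_dualD(10)[OF dual] by simp
  finally have Z: "m \<bullet> \<iota> L \<diamondop> inv_iso (\<a> (Y \<star> L) R L) \<diamondop> \<iota> (Y \<star> L) \<bullet> d \<diamondop> inv_iso (\<r> (Y \<star> L)) = \<iota> (Y \<star> L)" .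
  have "bend R L d X (unbend R L e Y g) = m \<bullet> \<iota> L \<diamondop> ((g \<bullet> \<iota> R) \<bullet> \<iota> L \<diamondop> inv_iso (\<a> X R L)) \<diamondop> \<iota> X \<bullet> d \<diamondop> inv_iso (\<r> X)"
    by (simp add: unbend_def bend_def m_def tensor_right_Cmp)
  also have "(g \<bullet> \<iota> R) \<bullet> \<iota> L \<diamondop> inv_iso (\<a> X R L) = inv_iso (\<a> (Y \<star> L) R L) \<diamondop> g \<bullet> \<iota> (R \<star> L)"
    by (subst assoc_inv_natural[symmetric, where X' = "Y \<star> L" and Y' = R and Z' = L]) simp_all
  also have "m \<bullet> \<iota> L \<diamondop> (inv_iso (\<a> (Y \<star> L) R L) \<diamondop> g \<bullet> \<iota> (R \<star> L)) \<diamondop> \<iota> X \<bullet> d \<diamondop> inv_iso (\<r> X) =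
    m \<bullet> \<iota> L \<diamondop> inv_iso (\<a> (Y \<star> L) R L) \<diamondop> (g \<bullet> \<iota> (R \<star> L) \<diamondop> \<iota> X \<bullet> d) \<diamondop> inv_iso (\<r> X)"
    by simp
  also have "g \<bullet> \<iota> (R \<star> L) \<diamondop> \<iota> X \<bullet> d = \<iota> (Y \<star> L) \<bullet> d \<diamondop> g \<bullet> \<iota> I"
    by (subst tensor_slide[where X = X and Y' = "R \<star> L" and X' = "Y \<star> L" and Y = I]) simp_all
  also have "m \<bullet> \<iota> L \<diamondop> inv_iso (\<a> (Y \<star> L) R L) \<diamondop> (\<iota> (Y \<star> L) \<bullet> d \<diamondop> g \<bullet> \<iota> I) \<diamondop> inv_iso (\<r> X) =
    m \<bullet> \<iota> L \<diamondop> inv_iso (\<a> (Y \<star> L) R L) \<diamondop> \<iota> (Y \<star> L) \<bullet> d \<diamondop> (g \<bullet> \<iota> I \<diamondop> inv_iso (\<r> X))"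
    by simp
  also have "g \<bullet> \<iota> I \<diamondop> inv_iso (\<r> X) = inv_iso (\<r> (Y \<star> L)) \<diamondop> g"
    by (rule runit_inv_natural) simp_all
  also have "m \<bullet> \<iota> L \<diamondop> inv_iso (\<a> (Y \<star> L) R L) \<diamondop> \<iota> (Y \<star> L) \<bullet> d \<diamondop> (inv_iso (\<r> (Y \<star> L)) \<diamondop> g) =
    (m \<bullet> \<iota> L \<diamondop> inv_iso (\<a> (Y \<star> L) R L) \<diamondop> \<iota> (Y \<star> L) \<bullet> d \<diamondop> inv_iso (\<r> (Y \<star> L))) \<diamondop> g"
    by simp
  also have "\<dots> = g" unfolding Z by simp
  finally show ?thesis .
qed

end

end

text \<open>The opposite tensor product, for which left and right duals trade places. The fields
  \<open>braid\<close> and \<open>twist\<close> are carried over unchanged; only the monoidal laws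
  are transferred.\<close>

definition (in balanced_data) reversed :: "'u balanced_struct" where
  "reversed = M\<lparr>tens := comp_fun (tens M) swap_fun, assoc := (\<lambda>X Y Z. inv_iso (\<a> Z Y X)),
     lunit := \<r>, runit := \<l>\<rparr>"

context cocontinuous_monoidal
begin

lemma lin_tensor_right:
  assumes "Z \<in> Obj A" "X \<in> Obj A" "Y \<in> Obj A"
  shows "lin k (hom_space A X Y) (hom_space A (X \<star> Z) (Y \<star> Z)) (\<lambda>h. h \<bullet> \<iota> Z)"
  using linear_functorD(4,5)[OF cocontinuousD(1)[OF bicocontinuousD(3)[OF tensor assms(1)]]] assms
  by (intro linI) (auto simp: in_homs_iff)

lemma lin_bend:
  assumes dual: "left_dual R L e d" and X: "X \<in> Obj A" "Y \<in> Obj A"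
  shows "lin k (hom_space A (X \<star> R) Y) (hom_space A X (Y \<star> L)) (bend R L d X)"
proof -
  note [simp] = left_dualD(1-8)[OF dual] X
  have "lin k (hom_space A (X \<star> R) Y) (hom_space A ((X \<star> R) \<star> L) (Y \<star> L)) (\<lambda>h. h \<bullet> \<iota> L)"
    by (rule lin_tensor_right) simp_all
  moreover have "lin k (hom_space A ((X \<star> R) \<star> L) (Y \<star> L)) (hom_space A X (Y \<star> L)) (\<lambda>h. h \<diamondop> (inv_iso (\<a> X R L) \<diamondop> \<iota> X \<bullet> d \<diamondop> inv_iso (\<r> X)))"
    by (rule lin_Cmp_left[OF linear]) (simp add: in_homs_iff)
  ultimately show ?thesis unfolding bend_def by (rule lin_comp)
qed

lemma lin_unbend:
  assumes dual: "left_dual R L e d" and X: "X \<in> Obj A" "Y \<in> Obj A"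
  shows "lin k (hom_space A X (Y \<star> L)) (hom_space A (X \<star> R) Y) (unbend R L e Y)"
proof -
  note [simp] = left_dualD(1-8)[OF dual] X
  have 1: "lin k (hom_space A X (Y \<star> L)) (hom_space A (X \<star> R) ((Y \<star> L) \<star> R)) (\<lambda>h. h \<bullet> \<iota> R)"
    by (rule lin_tensor_right) simp_all
  have 2: "lin k (hom_space A (X \<star> R) ((Y \<star> L) \<star> R)) (hom_space A (X \<star> R) Y) (\<lambda>h. (\<r> Y \<diamondop> \<iota> Y \<bullet> e \<diamondop> \<a> Y L R) \<diamondop> h)"
    by (rule lin_Cmp_right[OF linear]) (simp add: in_homs_iff)
  have "unbend R L e Y g = (\<r> Y \<diamondop> \<iota> Y \<bullet> e \<diamondop> \<a> Y L R) \<diamondop> g \<bullet> \<iota> R" if "g \<in> homs A X (Y \<star> L)" for g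
    using that by (simp add: unbend_def in_homs_iff)
  then show ?thesis using lin_comp[OF 1 2] linear_category_category[OF linear]
    unfolding lin_def using HAdd_homs[OF linear] HScale_homs[OF linear] by simp
qed

text \<open>\<open>bend\<close> and \<open>unbend\<close> make \<open>Hom(P \<otimes> R, -)\<close>
  a retract of \<open>Hom(P, - \<otimes> L)\<close>, and tensoring with \<open>L\<close> is
  cocontinuous. The class \<open>Q\<close> of shapes is a parameter: filtered shapes are needed for
  compact objects, all shapes for compact projective ones.\<close>

lemma preserves_colimits_hom_tensor:
  fixes Q :: "('u, 'u) cat \<Rightarrow> bool"
  assumes dual: "left_dual R L e d" and P: "P \<in> Obj A" and pr: "preserves_colimits Q A (Vect k) (hom_functor A P)"
  shows "preserves_colimits Q A (Vect k) (hom_functor A (P \<star> R))"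
proof -
  note [simp] = left_dualD(1-8)[OF dual] P
  let ?T = "fix_right A (tens M) L"
  let ?F = "hom_functor A (P \<star> R)" and ?G = "comp_fun (hom_functor A P) ?T"
  have T: "cocontinuous k A A ?T" using bicocontinuousD(3)[OF tensor] by simp
  have F: "is_functor A (Vect k) ?F" by (rule is_functor_hom_functor[OF linear locally_small]) simp
  have HP: "is_functor A (Vect k) (hom_functor A P)" by (rule is_functor_hom_functor[OF linear locally_small]) simp
  have G: "is_functor A (Vect k) ?G" using is_functor_comp_fun[OF cocontinuousD(4)[OF T] HP] .
  have prG: "preserves_colimits Q A (Vect k) ?G"
    using preserves_colimits_comp_fun[OF preserves_colimits_mono pr] T by (auto simp: cocontinuous_def)
  define s where "s Y = vmk (hom_space A (P \<star> R) Y) (hom_space A P (Y \<star> L)) (bend R L d P)" for Y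
  define p where "p Y = vmk (hom_space A P (Y \<star> L)) (hom_space A (P \<star> R) Y) (unbend R L e Y)" for Y
  have s: "s Y \<in> homs (Vect k) (hom_space A (P \<star> R) Y) (hom_space A P (Y \<star> L))" if "Y \<in> Obj A" for Y
    unfolding s_def using that by (intro vmk_homs hom_space_Obj[OF linear locally_small] lin_bend[OF dual]) simp_all
  have p: "p Y \<in> homs (Vect k) (hom_space A P (Y \<star> L)) (hom_space A (P \<star> R) Y)" if "Y \<in> Obj A" for Y
    unfolding p_def using that by (intro vmk_homs hom_space_Obj[OF linear locally_small] lin_unbend[OF dual]) simp_all
  have Ff: "farr ?F f \<in> homs (Vect k) (hom_space A (P \<star> R) (Dom A f)) (hom_space A (P \<star> R) (Cod A f))" if "f \<in> Arr A" for f
    using functor_arr[OF F that] by (simp add: in_homs_iff)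
  have Gf: "farr ?G f \<in> homs (Vect k) (hom_space A P (Dom A f \<star> L)) (hom_space A P (Cod A f \<star> L))" if "f \<in> Arr A" for f
    using functor_arr[OF G that] by (simp add: in_homs_iff)
  have ns: "nat_trans A (Vect k) ?F ?G s"
  proof (rule nat_transI[OF F G])
    show "s Y \<in> homs (Vect k) (fobj ?F Y) (fobj ?G Y)" if "Y \<in> Obj A" for Y using s[OF that] by simp
    fix f assume f: "f \<in> Arr A"
    have o: "Dom A f \<in> Obj A" "Cod A f \<in> Obj A" using f by auto
    show "Cmp (Vect k) (s (Cod A f)) (farr ?F f) = Cmp (Vect k) (farr ?G f) (s (Dom A f))"
    proof (rule Vect_arr_eqI[OF Cmp_Vect_homs(1)[OF Ff[OF f] s[OF o(2)]] Cmp_Vect_homs(1)[OF s[OF o(1)] Gf[OF f]]])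
      fix h assume "h \<in> carrier (hom_space A (P \<star> R) (Dom A f))"
      then have h: "h \<in> homs A (P \<star> R) (Dom A f)" by simp
      have f': "f \<in> homs A (Dom A f) (Cod A f)" using f by (simp add: in_homs_iff)
      show "ap (Cmp (Vect k) (s (Cod A f)) (farr ?F f)) h = ap (Cmp (Vect k) (farr ?G f) (s (Dom A f))) h"
        using h f o bend_Cmp[OF dual h P f'] bend_homs[OF dual h P] Cmp_in_homs[OF category_C h f']
        by (simp add: s_def)
    qed
  qed
  have np: "nat_trans A (Vect k) ?G ?F p"
  proof (rule nat_transI[OF G F])
    show "p Y \<in> homs (Vect k) (fobj ?G Y) (fobj ?F Y)" if "Y \<in> Obj A" for Y using p[OF that] by simp
    fix f assume f: "f \<in> Arr A"
    have o: "Dom A f \<in> Obj A" "Cod A f \<in> Obj A" using f by auto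
    show "Cmp (Vect k) (p (Cod A f)) (farr ?G f) = Cmp (Vect k) (farr ?F f) (p (Dom A f))"
    proof (rule Vect_arr_eqI[OF Cmp_Vect_homs(1)[OF Gf[OF f] p[OF o(2)]] Cmp_Vect_homs(1)[OF p[OF o(1)] Ff[OF f]]])
      fix g assume "g \<in> carrier (hom_space A P (Dom A f \<star> L))"
      then have g: "g \<in> homs A P (Dom A f \<star> L)" by simp
      have f': "f \<in> homs A (Dom A f) (Cod A f)" using f by (simp add: in_homs_iff)
      have fl: "f \<bullet> \<iota> L \<in> homs A (Dom A f \<star> L) (Cod A f \<star> L)" using f by (simp add: in_homs_iff)
      show "ap (Cmp (Vect k) (p (Cod A f)) (farr ?G f)) g = ap (Cmp (Vect k) (farr ?F f) (p (Dom A f))) g"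
        using g f o unbend_Cmp[OF dual g f'] unbend_homs[OF dual g o(1)] Cmp_in_homs[OF category_C g fl]
        by (simp add: p_def)
    qed
  qed
  show ?thesis
  proof (rule preserves_colimits_retract[OF ns np _ prG])
    fix Y assume Y: "Y \<in> Obj A"
    have "Cmp (Vect k) (p Y) (s Y) = Idt (Vect k) (hom_space A (P \<star> R) Y)"
    proof (rule Vect_arr_eqI[OF Cmp_Vect_homs(1)[OF s[OF Y] p[OF Y]] Idt_Vect_homs])
      show "hom_space A (P \<star> R) Y \<in> Obj (Vect k)" using Y by (intro hom_space_Obj[OF linear locally_small]) simp_all
      fix h assume "h \<in> carrier (hom_space A (P \<star> R) Y)"
      then have h: "h \<in> homs A (P \<star> R) Y" by simp
      show "ap (Cmp (Vect k) (p Y) (s Y)) h = ap (Idt (Vect k) (hom_space A (P \<star> R) Y)) h"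
        using h bend_homs[OF dual h P] unbend_bend[OF dual h P] by (simp add: s_def p_def)
    qed
    then show "Cmp (Vect k) (p Y) (s Y) = Idt (Vect k) (fobj ?F Y)" by simp
  qed
qed

text \<open>Naturality of \<open>\<l>\<close> at the arrow \<open>\<l> X\<close>, with the
  isomorphism \<open>\<l> X\<close> cancelled. Axiom (U) for the pairing comes down to this.\<close>

lemma tensor_lunit_inv:
  assumes X: "X \<in> Obj A" shows "\<l> (I \<star> X) = \<iota> I \<bullet> \<l> X"
proof -
  have e: "\<l> X \<diamondop> \<l> (I \<star> X) = \<l> X \<diamondop> \<iota> I \<bullet> \<l> X"
    by (rule unitor_natural(1)[symmetric]) (use X in simp_all)
  show ?thesis by (rule iso_mono[OF category_C _ e]) (use X in simp_all)
qed

lemma reversed_simps [simp]: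
  "fobj (tens reversed) (X, Y) = Y \<star> X" "farr (tens reversed) (f, g) = g \<bullet> f" "unt reversed = I"
  "assoc reversed X Y Z = inv_iso (\<a> Z Y X)" "lunit reversed = \<r>" "runit reversed = \<l>"
  by (simp_all add: reversed_def)

lemma cocontinuous_monoidal_reversed: "cocontinuous_monoidal k A reversed"
proof -
  have f: "is_functor (prod_cat A A) A (tens reversed)"
    unfolding reversed_def by (simp add: is_functor_comp_fun[OF is_functor_swap_fun tensor_functor])
  have "fix_left A (tens reversed) X = fix_right A (tens M) X" "fix_right A (tens reversed) X = fix_left A (tens M) X" for X
    by (simp_all add: fix_left_def fix_right_def)
  then have bi: "bicocontinuous k A A A (tens reversed)"
    using f tensor by (simp add: bicocontinuous_def)
  \<comment> \<open>Both sides of the pentagon for the objects in the opposite order,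
    inverted.\<close>
  have pent: "inv_iso (\<a> (Z \<star> Y) X W) \<diamondop> inv_iso (\<a> Z Y (X \<star> W)) =
      inv_iso (\<a> Z Y X) \<bullet> \<iota> W \<diamondop> inv_iso (\<a> Z (Y \<star> X) W) \<diamondop> \<iota> Z \<bullet> inv_iso (\<a> Y X W)"
    if O: "W \<in> Obj A" "X \<in> Obj A" "Y \<in> Obj A" "Z \<in> Obj A" for W X Y Z
  proof -
    note [simp] = O inv_arr_Cmp[OF category_C] inv_arr_Idt[OF category_C] is_iso_Cmp[OF category_C]
    have "inv_iso (\<a> Z Y (X \<star> W) \<diamondop> \<a> (Z \<star> Y) X W) = inv_iso (\<iota> Z \<bullet> \<a> Y X W \<diamondop> \<a> Z (Y \<star> X) W \<diamondop> \<a> Z Y X \<bullet> \<iota> W)"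
      by (simp only: pentagon[OF O(4,3,2,1)])
    then show ?thesis by simp
  qed
  have tri: "\<r> Y \<bullet> \<iota> X \<diamondop> inv_iso (\<a> Y I X) = \<iota> Y \<bullet> \<l> X" if "X \<in> Obj A" "Y \<in> Obj A" for X Y
    using that by (simp add: triangle[symmetric])
  have nat: "inv_iso (\<a> Z' Y' X') \<diamondop> h \<bullet> (g \<bullet> f) = (h \<bullet> g) \<bullet> f \<diamondop> inv_iso (\<a> Z Y X)"
    if "f \<in> homs A X X'" "g \<in> homs A Y Y'" "h \<in> homs A Z Z'" for f g h X X' Y Y' Z Z'
    using that by (intro assoc_inv_natural) (auto simp: in_homs_iff)
  have "balanced_data.monoidal_laws A reversed"
    unfolding balanced_data.monoidal_laws_def
    by (intro conjI ballI)
      (simp_all add: in_homs_iff pent tri nat[unfolded in_homs_iff] unitor_natural)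
  then show ?thesis
    using bi linear_cocomplete_axioms by (intro cocontinuous_monoidal.intro cocontinuous_monoidal_axioms.intro)
qed

text \<open>The same evaluation and coevaluation serve; reversal exchanges the two snake
  identities.\<close>

lemma left_dual_reversed: "balanced_data.left_dual A reversed L R e d \<longleftrightarrow> left_dual R L e d"
  unfolding balanced_data.left_dual_def reversed_simps
  by (cases "R \<in> Obj A \<and> L \<in> Obj A") (auto simp: in_homs_iff)

lemma dualizable_reversed: "balanced_data.dualizable A reversed X \<longleftrightarrow> dualizable X"
  unfolding balanced_data.dualizable_def left_dual_reversed by blast

lemma compact_rigid_reversed: "balanced_data.compact_rigid A reversed k \<longleftrightarrow> compact_rigid k"
  unfolding balanced_data.compact_rigid_def dualizable_reversed ..

section \<open>Stability of compact and compact projective objects under tensor products and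
  duals\<close>

lemma compact_projective_compact: "compact_projective k A P \<Longrightarrow> compact_obj k A P"
  unfolding compact_projective_def compact_obj_def using preserves_colimits_mono by blast

lemma compact_projective_tensor_right:
  assumes "left_dual R L e d" "compact_projective k A P"
  shows "compact_projective k A (P \<star> R)"
  using preserves_colimits_hom_tensor[OF assms(1)] left_dualD(1)[OF assms(1)] assms(2)
  by (simp add: compact_projective_def)

text \<open>\<open>R\<close> is isomorphic to \<open>I \<otimes> R\<close>, whose Hom functor
  inherits the preservation of filtered colimits from \<open>I\<close>. The compactness assumption
  on the unit is used here.\<close>

lemma compact_right_dual:
  assumes dual: "left_dual R L e d" and I: "compact_obj k A I"
  shows "compact_obj k A R"
proof -
  note [simp] = left_dualD(1-8)[OF dual]
  have "preserves_colimits (filtered :: ('u, 'u) cat \<Rightarrow> bool) A (Vect k) (hom_functor A (I \<star> R))"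
    using preserves_colimits_hom_tensor[OF dual unit_Obj] I by (simp add: compact_obj_def)
  then have "preserves_colimits (filtered :: ('u, 'u) cat \<Rightarrow> bool) A (Vect k) (hom_functor A R)"
    by (rule preserves_colimits_hom_retract[of "inv_iso (\<l> R)" _ _ "\<l> R", rotated 3]) (simp_all add: in_homs_iff)
  then show ?thesis by (simp add: compact_obj_def)
qed

text \<open>Over the unit, bending takes the usual form of a mate: the coevaluation followed by
  \<open>h\<close> tensored with \<open>L\<close>. This is the form in which mates are compared
  later.\<close>

lemma bend_unit:
  assumes dual: "left_dual R L e d" and X: "X \<in> Obj A" and h: "h \<in> homs A R X"
  shows "bend R L d I (h \<diamondop> \<l> R) = h \<bullet> \<iota> L \<diamondop> d"
proof -
  note [simp] = left_dualD(1-8)[OF dual] X homsD[OF h]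
  note rev = cocontinuous_monoidal_reversed
  have lt: "\<l> (R \<star> L) \<diamondop> \<a> I R L = \<l> R \<bullet> \<iota> L"
    using cocontinuous_monoidal.runit_tensor[OF rev, of L R] by simp
  \<comment> \<open>The two unitors agree at \<open>I\<close>: they do so after tensoring with
    \<open>I\<close>, by the triangle and the unit coherence of the reversed product, and tensoring
    with \<open>I\<close> is faithful.\<close>
  have lr: "\<l> I = \<r> I"
  proof -
    have "\<l> I \<bullet> \<iota> I = \<r> I \<bullet> \<iota> I"
      using cocontinuous_monoidal.runit_tensor[OF rev, of I I] triangle[of I I] by (simp add: tensor_lunit_inv)
    then have "\<r> I \<diamondop> \<l> I \<bullet> \<iota> I = \<r> I \<diamondop> \<r> I \<bullet> \<iota> I" by simp
    then have "\<l> I \<diamondop> \<r> (I \<star> I) = \<r> I \<diamondop> \<r> (I \<star> I)"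
      using unitor_natural(2)[of "\<l> I" "I \<star> I" I] unitor_natural(2)[of "\<r> I" "I \<star> I" I] by simp
    then show ?thesis by (rule iso_epi[OF category_C, rotated]) simp_all
  qed
  have "bend R L d I (h \<diamondop> \<l> R) = h \<bullet> \<iota> L \<diamondop> (\<l> R \<bullet> \<iota> L \<diamondop> inv_iso (\<a> I R L)) \<diamondop> \<iota> I \<bullet> d \<diamondop> inv_iso (\<r> I)"
    by (simp add: bend_def tensor_right_Cmp)
  also have "\<l> R \<bullet> \<iota> L \<diamondop> inv_iso (\<a> I R L) = \<l> (R \<star> L)"
    by (simp add: lt[symmetric])
  also have "h \<bullet> \<iota> L \<diamondop> \<l> (R \<star> L) \<diamondop> \<iota> I \<bullet> d \<diamondop> inv_iso (\<r> I) = h \<bullet> \<iota> L \<diamondop> (\<l> (R \<star> L) \<diamondop> \<iota> I \<bullet> d) \<diamondop> inv_iso (\<r> I)"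
    by simp
  also have "\<l> (R \<star> L) \<diamondop> \<iota> I \<bullet> d = d \<diamondop> \<l> I" by (rule unitor_natural) simp_all
  finally show ?thesis by (simp add: lr)
qed

lemma unbend_unit:
  assumes dual: "left_dual R L e d" and X: "X \<in> Obj A" and g: "g \<in> homs A I (X \<star> L)"
  shows "(unbend R L e X g \<diamondop> inv_iso (\<l> R)) \<bullet> \<iota> L \<diamondop> d = g"
proof -
  note [simp] = left_dualD(1-8)[OF dual] X
  note u = unbend_homs[OF dual g X]
  have i: "unbend R L e X g \<diamondop> inv_iso (\<l> R) \<in> homs A R X" using u by (simp add: in_homs_iff)
  have "(unbend R L e X g \<diamondop> inv_iso (\<l> R)) \<bullet> \<iota> L \<diamondop> d = bend R L d I ((unbend R L e X g \<diamondop> inv_iso (\<l> R)) \<diamondop> \<l> R)"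
    using bend_unit[OF dual X i] by simp
  also have "(unbend R L e X g \<diamondop> inv_iso (\<l> R)) \<diamondop> \<l> R = unbend R L e X g"
    using u by (simp add: in_homs_iff)
  also have "bend R L d I (unbend R L e X g) = g" by (rule bend_unbend[OF dual g X])
  finally show ?thesis .
qed

lemma bij_bend:
  assumes dual: "left_dual R L e d" and X: "X \<in> Obj A"
  shows "bij_betw (\<lambda>h. h \<bullet> \<iota> L \<diamondop> d) (homs A R X) (homs A I (X \<star> L))"
proof (rule bij_betwI[of _ _ _ "\<lambda>g. unbend R L e X g \<diamondop> inv_iso (\<l> R)"])
  note [simp] = left_dualD(1-8)[OF dual] X
  have hl: "h \<diamondop> \<l> R \<in> homs A (I \<star> R) X" if "h \<in> homs A R X" for h
    using that by (simp add: in_homs_iff)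
  show "(\<lambda>h. h \<bullet> \<iota> L \<diamondop> d) \<in> homs A R X \<rightarrow> homs A I (X \<star> L)"
    by (auto simp: in_homs_iff)
  show "(\<lambda>g. unbend R L e X g \<diamondop> inv_iso (\<l> R)) \<in> homs A I (X \<star> L) \<rightarrow> homs A R X"
    using unbend_homs[OF dual _ X] by (auto simp: in_homs_iff)
  show "unbend R L e X (h \<bullet> \<iota> L \<diamondop> d) \<diamondop> inv_iso (\<l> R) = h" if h: "h \<in> homs A R X" for h
    using bend_unit[OF dual X h] unbend_bend[OF dual hl[OF h] unit_Obj] h by (simp add: in_homs_iff)
qed (rule unbend_unit[OF dual X])

text \<open>Each claim comes from a lemma applied to the reversed tensor product, where
  \<open>L\<close> and \<open>R\<close> trade places. The last one identifies
  \<open>dual_arr\<close> through mates: an endomorphism of \<open>R\<close> and its dual arrow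
  determine the same element of \<open>Hom(I, R \<otimes> L)\<close>.\<close>

lemma reverse_dual:
  assumes dual: "left_dual R L e d"
  shows "compact_projective k A P \<Longrightarrow> compact_projective k A (L \<star> P)"
    "compact_obj k A I \<Longrightarrow> compact_obj k A L"
    "X \<in> Obj A \<Longrightarrow> bij_betw (\<lambda>h. \<iota> R \<bullet> h \<diamondop> d) (homs A L X) (homs A I (R \<star> X))"
    "f \<in> homs A R R \<Longrightarrow> \<iota> R \<bullet> dual_arr L d R L e f \<diamondop> d = f \<bullet> \<iota> L \<diamondop> d"
proof -
  note rev = cocontinuous_monoidal_reversed
  have d: "balanced_data.left_dual A reversed L R e d" using dual by (simp add: left_dual_reversed)
  show "compact_projective k A P \<Longrightarrow> compact_projective k A (L \<star> P)"
    using cocontinuous_monoidal.compact_projective_tensor_right[OF rev d, of P] by simp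
  show "compact_obj k A I \<Longrightarrow> compact_obj k A L"
    using cocontinuous_monoidal.compact_right_dual[OF rev d] by simp
  show "X \<in> Obj A \<Longrightarrow> bij_betw (\<lambda>h. \<iota> R \<bullet> h \<diamondop> d) (homs A L X) (homs A I (R \<star> X))"
    using cocontinuous_monoidal.bij_bend[OF rev d] by simp
  show "\<iota> R \<bullet> dual_arr L d R L e f \<diamondop> d = f \<bullet> \<iota> L \<diamondop> d" if "f \<in> homs A R R"
  proof -
    note [simp] = left_dualD(1-8)[OF dual] homsD[OF that]
    have g: "f \<bullet> \<iota> L \<diamondop> d \<in> homs A I (R \<star> L)" by (simp add: in_homs_iff)
    have "dual_arr L d R L e f = cocontinuous_monoidal.unbend A reversed L R e L (f \<bullet> \<iota> L \<diamondop> d) \<diamondop> inv_iso (\<r> L)"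
      by (simp add: cocontinuous_monoidal.unbend_def[OF rev] dual_arr_def tensor_left_Cmp)
    then show ?thesis using cocontinuous_monoidal.unbend_unit[OF rev d, of L] g by simp
  qed
qed

lemma compact_projective_tensor:
  assumes rigid: "compact_rigid k" and P: "compact_projective k A P" and Q: "compact_projective k A Q"
  shows "compact_projective k A (P \<star> Q)"
proof -
  obtain L e d where "left_dual Q L e d"
    using rigid compact_projective_compact[OF Q] unfolding compact_rigid_def dualizable_def by blast
  then show ?thesis using compact_projective_tensor_right P by blast
qed

text \<open>A dual \<open>L\<close> of \<open>R\<close> is a retract of \<open>L \<otimes> (R \<otimes> L)\<close>.\<close>

lemma compact_projective_left_dual:
  assumes rigid: "compact_rigid k" and I: "compact_obj k A I" and dual: "left_dual R L e d" and R: "compact_projective k A R"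
  shows "compact_projective k A L"
proof -
  note [simp] = left_dualD(1-8)[OF dual]
  \<comment> \<open>Since the unit is compact, so is \<open>L\<close>, and by rigidity
    \<open>L\<close> has a left dual of its own. Tensoring with \<open>L\<close> on the right
    therefore preserves compact projective objects.\<close>
  obtain L' e' d' where "left_dual L L' e' d'"
    using rigid reverse_dual(2)[OF dual I] unfolding compact_rigid_def dualizable_def by blast
  then have "compact_projective k A (L \<star> (R \<star> L))"
    using compact_projective_tensor_right R reverse_dual(1)[OF dual] by blast
  then have "preserves_colimits (\<lambda>J :: ('u, 'u) cat. True) A (Vect k) (hom_functor A (L \<star> (R \<star> L)))"
    by (simp add: compact_projective_def)
  then have "preserves_colimits (\<lambda>J :: ('u, 'u) cat. True) A (Vect k) (hom_functor A L)"
    by (rule preserves_colimits_hom_retract[of "\<iota> L \<bullet> d \<diamondop> inv_iso (\<r> L)" _ _ "\<l> L \<diamondop> e \<bullet> \<iota> L \<diamondop> inv_iso (\<a> L R L)", rotated 3])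
      (use left_dualD(10)[OF dual] in \<open>simp_all add: in_homs_iff\<close>)
  then show ?thesis by (simp add: compact_projective_def)
qed

lemma compact_projective_right_dual:
  assumes rigid: "compact_rigid k" and I: "compact_obj k A I" and dual: "left_dual R L e d" and L: "compact_projective k A L"
  shows "compact_projective k A R"
proof -
  note rev = cocontinuous_monoidal_reversed
  have d: "balanced_data.left_dual A reversed L R e d" using dual by (simp add: left_dual_reversed)
  show ?thesis
    using cocontinuous_monoidal.compact_projective_left_dual[OF rev _ _ d L] rigid I by (simp add: compact_rigid_reversed)
qed

end

section \<open>The snake relation\<close>

context linear_cocomplete
begin

text \<open>If \<open>D\<close> is glued from the objects \<open>L\<^sub>i \<boxtimes> R\<^sub>i\<close>, then \<open>F(X, D)\<close> is glued from the objects
  \<open>\<kappa>(X, L\<^sub>i) \<otimes> R\<^sub>i\<close>. For \<open>X = R\<^sub>j\<close> these are \<open>Hom(R\<^sub>i, X) \<otimes> R\<^sub>i\<close>, and their glueing is \<open>X\<close> by the co-Yoneda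
  lemma; the general case follows because both sides are cocontinuous in \<open>X\<close>.\<close>

lemma snake_iso:
  fixes R L :: "'i \<Rightarrow> 'u" and T :: "('u, 'u, 'u) lincat"
  assumes T: "category T" and t: "is_functor (prod_cat C C) T t" and \<kappa>: "is_functor (prod_cat C C) (Vect k) \<kappa>"
    and F: "bicocontinuous k C T C F"
    and \<beta>: "nat_iso (prod_cat C (prod_cat C C)) C (comp_fun F (prod_fun id_fun t))
      (comp_fun copower (comp_fun (prod_fun \<kappa> id_fun) rebracket)) \<beta>"
    and RL: "\<And>i. i \<in> II \<Longrightarrow> R i \<in> Obj C" "\<And>i. i \<in> II \<Longrightarrow> L i \<in> Obj C"
    and AA: "\<And>i j f f'. (i, j, f, f') \<in> AA \<Longrightarrow> i \<in> II \<and> j \<in> II \<and> f \<in> homs C (R i) (R j) \<and> f' \<in> homs C (L j) (L i)"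
    and full: "\<And>i j f. i \<in> II \<Longrightarrow> j \<in> II \<Longrightarrow> f \<in> homs C (R i) (R j) \<Longrightarrow> \<exists>f'. (i, j, f, f') \<in> AA"
    and D: "D \<in> Obj T" "\<And>i. i \<in> II \<Longrightarrow> dd i \<in> homs T (fobj t (L i, R i)) D"
    and gl: "\<And>X. X \<in> Obj C \<Longrightarrow> glueing C II AA (\<lambda>(i, j, f, f'). i) (\<lambda>(i, j, f, f'). j)
      (\<lambda>i. fobj F (X, fobj t (L i, R i))) (\<lambda>(i, j, f, f'). farr F (Idt C X, farr t (f', Idt C (R i))))
      (\<lambda>(i, j, f, f'). farr F (Idt C X, farr t (Idt C (L j), f))) (fobj F (X, D)) (\<lambda>i. farr F (Idt C X, dd i))"
    and m: "\<And>i X. i \<in> II \<Longrightarrow> X \<in> Obj C \<Longrightarrow> lin k (fobj \<kappa> (X, L i)) (hom_space C (R i) X) (m i X)"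
    and m_natural: "\<And>i x X X' z. i \<in> II \<Longrightarrow> x \<in> homs C X X' \<Longrightarrow> z \<in> carrier (fobj \<kappa> (X, L i)) \<Longrightarrow>
      m i X' (ap (farr \<kappa> (x, Idt C (L i))) z) = Cmp C x (m i X z)"
    and m_dinatural: "\<And>i j f f' X z. (i, j, f, f') \<in> AA \<Longrightarrow> X \<in> Obj C \<Longrightarrow> z \<in> carrier (fobj \<kappa> (X, L j)) \<Longrightarrow>
      m i X (ap (farr \<kappa> (Idt C X, f')) z) = Cmp C (m j X z) f"
    and m_bij: "\<And>i j. i \<in> II \<Longrightarrow> j \<in> II \<Longrightarrow> bij_betw (m i (R j)) (carrier (fobj \<kappa> (R j, L i))) (homs C (R i) (R j))"
    and dense: "\<And>X. X \<in> Obj C \<Longrightarrow> \<exists>(J :: ('u, 'u) cat) E \<iota>. small_category J \<and> is_colimit J C E X \<iota> \<and>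
      (\<forall>j\<in>Obj J. \<exists>i\<in>II. \<exists>u\<in>homs C (fobj E j) (R i). is_iso C u)"
  shows "\<exists>\<alpha>. nat_iso C C (fix_right T F D) id_fun \<alpha>"
proof -
  note F1 = bicocontinuousD(1)[OF F]
  have FD: "cocontinuous k C C (fix_right T F D)" using bicocontinuousD(3)[OF F D(1)] .
  note FDf = cocontinuousD(4)[OF FD]
  note [simp] = T
  note \<beta>inv = nat_iso_inverse[OF \<beta>]
  \<comment> \<open>Directed from the copower to \<open>F\<close>, so that elements of
    \<open>\<kappa>(X, Y)\<close> yield arrows from \<open>Z\<close> to
    \<open>F(X, t(Y, Z))\<close>.\<close>
  define B where "B X Y Z = inv_arr C (\<beta> (X, Y, Z))" for X Y Z
  have \<kappa>O [simp]: "fobj \<kappa> (X, Y) \<in> Obj (Vect k)" if "X \<in> Obj C" "Y \<in> Obj C" for X Y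
    using functor_Obj[OF \<kappa>, of "(X, Y)"] that by simp
  have \<kappa>A [simp]: "farr \<kappa> (x, y) \<in> Arr (Vect k)" "fst (farr \<kappa> (x, y)) = fobj \<kappa> (Dom C x, Dom C y)"
    "fst (snd (farr \<kappa> (x, y))) = fobj \<kappa> (Cod C x, Cod C y)" if "x \<in> Arr C" "y \<in> Arr C" for x y
    using functor_arr[OF \<kappa>, of "(x, y)"] that by simp_all
  have \<kappa>I [simp]: "farr \<kappa> (Idt C X, Idt C Y) = Idt (Vect k) (fobj \<kappa> (X, Y))" if "X \<in> Obj C" "Y \<in> Obj C" for X Y
    using functor_Idt[OF \<kappa>, of "(X, Y)"] that by simp
  have tO [simp]: "fobj t (X, Y) \<in> Obj T" if "X \<in> Obj C" "Y \<in> Obj C" for X Y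
    using functor_Obj[OF t, of "(X, Y)"] that by simp
  have tA [simp]: "farr t (x, y) \<in> Arr T" "Dom T (farr t (x, y)) = fobj t (Dom C x, Dom C y)"
    "Cod T (farr t (x, y)) = fobj t (Cod C x, Cod C y)" if "x \<in> Arr C" "y \<in> Arr C" for x y
    using functor_arr[OF t, of "(x, y)"] that by simp_all
  have tI [simp]: "farr t (Idt C X, Idt C Y) = Idt T (fobj t (X, Y))" if "X \<in> Obj C" "Y \<in> Obj C" for X Y
    using functor_Idt[OF t, of "(X, Y)"] that by simp
  have FO [simp]: "fobj F (X, W) \<in> Obj C" if "X \<in> Obj C" "W \<in> Obj T" for X W
    using functor_Obj[OF F1, of "(X, W)"] that by simp
  have FA [simp]: "farr F (x, w) \<in> Arr C" "Dom C (farr F (x, w)) = fobj F (Dom C x, Dom T w)"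
    "Cod C (farr F (x, w)) = fobj F (Cod C x, Cod T w)" if "x \<in> Arr C" "w \<in> Arr T" for x w
    using functor_arr[OF F1, of "(x, w)"] that by simp_all
  have BA [simp]: "B X Y Z \<in> Arr C" "Dom C (B X Y Z) = cpo (fobj \<kappa> (X, Y)) Z" "Cod C (B X Y Z) = fobj F (X, fobj t (Y, Z))"
    "is_iso C (B X Y Z)" if "X \<in> Obj C" "Y \<in> Obj C" "Z \<in> Obj C" for X Y Z
    using nat_trans_simps[OF nat_isoD(1)[OF \<beta>inv], of "(X, Y, Z)"] nat_isoD(2)[OF \<beta>inv, of "(X, Y, Z)"] that by (simp_all add: B_def)
  have Bn: "Cmp C (B (Cod C x) (Cod C y) (Cod C z)) (farr copower (farr \<kappa> (x, y), z)) = Cmp C (farr F (x, farr t (y, z))) (B (Dom C x) (Dom C y) (Dom C z))"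
    if "x \<in> Arr C" "y \<in> Arr C" "z \<in> Arr C" for x y z
    using nat_trans_naturality[OF nat_isoD(1)[OF \<beta>inv], of "(x, y, z)"] that by (simp add: B_def)
  have ddA [simp]: "dd i \<in> Arr T" "Dom T (dd i) = fobj t (L i, R i)" "Cod T (dd i) = D" if "i \<in> II" for i
    using D(2)[OF that] by (auto simp: in_homs_iff)
  note [simp] = RL D(1)
  have AAs: "i \<in> II" "j \<in> II" "f \<in> Arr C" "Dom C f = R i" "Cod C f = R j" "f' \<in> Arr C" "Dom C f' = L j" "Cod C f' = L i"
    if "(i, j, f, f') \<in> AA" for i j f f'
    using AA[OF that] by (auto simp: in_homs_iff)
  \<comment> \<open>The leg of \<open>F(X, D)\<close> at \<open>i\<close>, restricted along
    \<open>B\<close> and the copower injection at \<open>z\<close>. These arrows are the universal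
    family that makes \<open>F(X, D)\<close> the coend of the objects
    \<open>\<kappa>(X, L i) \<otimes> R i\<close>.\<close>
  define n where "n X i z = Cmp C (farr F (Idt C X, dd i)) (Cmp C (B X (L i) (R i)) (cpi (fobj \<kappa> (X, L i)) (R i) z))" for X i z
  have nh: "n X i z \<in> homs C (R i) (fobj F (X, D))" if "X \<in> Obj C" "i \<in> II" "z \<in> carrier (fobj \<kappa> (X, L i))" for X i z
    using that by (simp add: n_def in_homs_iff)
  have ap_cl [simp]: "ap (farr \<kappa> (x, y)) z \<in> carrier (fobj \<kappa> (Cod C x, Cod C y))"
    if "x \<in> Arr C" "y \<in> Arr C" "z \<in> carrier (fobj \<kappa> (Dom C x, Dom C y))" for x y z
    using Vect_arr(1)[OF \<kappa>A(1)[OF that(1,2)], of z] that by simp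
  \<comment> \<open>With \<open>unique\<close>, this is the universal property of
    \<open>F(X, D)\<close> expressed by the arrows \<open>n\<close>. A dinatural family
    \<open>\<mu>\<close> first gives arrows \<open>u i\<close> out of the copowers; carried over by
    \<open>B\<close>, they respect the relations of the glueing.\<close>
  have factor: "\<exists>h\<in>homs C (fobj F (X, D)) Y. \<forall>i\<in>II. \<forall>z\<in>carrier (fobj \<kappa> (X, L i)). Cmp C h (n X i z) = \<mu> i z"
    if X: "X \<in> Obj C" and Y: "Y \<in> Obj C" and \<mu>: "\<And>i. i \<in> II \<Longrightarrow> lin k (fobj \<kappa> (X, L i)) (hom_space C (R i) Y) (\<mu> i)"
      and c: "\<And>i j f f' z. (i, j, f, f') \<in> AA \<Longrightarrow> z \<in> carrier (fobj \<kappa> (X, L j)) \<Longrightarrow> \<mu> i (ap (farr \<kappa> (Idt C X, f')) z) = Cmp C (\<mu> j z) f"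
    for X Y \<mu>
  proof -
    note [simp] = X Y
    have "\<exists>u. u \<in> homs C (cpo (fobj \<kappa> (X, L i)) (R i)) Y \<and> (\<forall>z\<in>carrier (fobj \<kappa> (X, L i)). Cmp C u (cpi (fobj \<kappa> (X, L i)) (R i) z) = \<mu> i z)"
      if "i \<in> II" for i
      by (rule cpo_factor[OF _ _ Y \<mu>[OF that]]) (use that in auto)
    then obtain u where u: "\<And>i. i \<in> II \<Longrightarrow> u i \<in> homs C (cpo (fobj \<kappa> (X, L i)) (R i)) Y"
      "\<And>i z. i \<in> II \<Longrightarrow> z \<in> carrier (fobj \<kappa> (X, L i)) \<Longrightarrow> Cmp C (u i) (cpi (fobj \<kappa> (X, L i)) (R i) z) = \<mu> i z" by metis
    have uA [simp]: "u i \<in> Arr C" "Dom C (u i) = cpo (fobj \<kappa> (X, L i)) (R i)" "Cod C (u i) = Y" if "i \<in> II" for i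
      using u(1)[OF that] by (auto simp: in_homs_iff)
    obtain h where h: "h \<in> homs C (fobj F (X, D)) Y" "\<And>i. i \<in> II \<Longrightarrow> Cmp C h (farr F (Idt C X, dd i)) = Cmp C (u i) (inv_arr C (B X (L i) (R i)))"
    proof (rule glueing_factor[OF gl[OF X] Y, of "\<lambda>i. Cmp C (u i) (inv_arr C (B X (L i) (R i)))"])
      show "Cmp C (u i) (inv_arr C (B X (L i) (R i))) \<in> homs C (fobj F (X, fobj t (L i, R i))) Y" if "i \<in> II" for i
        using that by (simp add: in_homs_iff)
      fix r assume r: "r \<in> AA"
      obtain i j f f' where r': "r = (i, j, f, f')" by (cases r) auto
      note a [simp] = AAs[OF r[unfolded r']]
      have *: "Cmp C (Cmp C (u i) (inv_arr C (B X (L i) (R i)))) (farr F (Idt C X, farr t (f', Idt C (R i)))) =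
        Cmp C (Cmp C (u j) (inv_arr C (B X (L j) (R j)))) (farr F (Idt C X, farr t (Idt C (L j), f)))"
      proof (rule iso_epi[OF category_C BA(4)[OF X RL(2)[OF a(2)] RL(1)[OF a(1)]]])
        have "Cmp C (Cmp C (Cmp C (u i) (inv_arr C (B X (L i) (R i)))) (farr F (Idt C X, farr t (f', Idt C (R i))))) (B X (L j) (R i)) =
          Cmp C (u i) (Cmp C (inv_arr C (B X (L i) (R i))) (Cmp C (farr F (Idt C X, farr t (f', Idt C (R i)))) (B X (L j) (R i))))"
          by simp
        also have "Cmp C (farr F (Idt C X, farr t (f', Idt C (R i)))) (B X (L j) (R i)) =
            Cmp C (B X (L i) (R i)) (farr copower (farr \<kappa> (Idt C X, f'), Idt C (R i)))"
          using Bn[of "Idt C X" f' "Idt C (R i)"] by simp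
        also have "Cmp C (u i) (Cmp C (inv_arr C (B X (L i) (R i))) (Cmp C (B X (L i) (R i)) (farr copower (farr \<kappa> (Idt C X, f'), Idt C (R i))))) =
            Cmp C (u i) (farr copower (farr \<kappa> (Idt C X, f'), Idt C (R i)))"
          by simp
        also have "\<dots> = Cmp C (u j) (farr copower (Idt (Vect k) (fobj \<kappa> (X, L j)), f))"
        proof (rule cpo_eq[of "fobj \<kappa> (X, L j)" "R i"])
          fix z assume z: "z \<in> carrier (fobj \<kappa> (X, L j))"
          have z': "ap (farr \<kappa> (Idt C X, f')) z \<in> carrier (fobj \<kappa> (X, L i))" using ap_cl[of "Idt C X" f' z] z by simp
          show "Cmp C (Cmp C (u i) (farr copower (farr \<kappa> (Idt C X, f'), Idt C (R i)))) (cpi (fobj \<kappa> (X, L j)) (R i) z) =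
            Cmp C (Cmp C (u j) (farr copower (Idt (Vect k) (fobj \<kappa> (X, L j)), f))) (cpi (fobj \<kappa> (X, L j)) (R i) z)"
            using z z' u(2)[OF a(1) z'] Cmp_rewrite[OF category_C u(2)[OF a(2) z]] c[OF r[unfolded r'] z] by (simp add: copower_cpi)
        qed (simp_all add: in_homs_iff)
        also have "\<dots> = Cmp C (u j) (Cmp C (inv_arr C (B X (L j) (R j))) (Cmp C (B X (L j) (R j)) (farr copower (farr \<kappa> (Idt C X, Idt C (L j)), f))))"
          by simp
        also have "Cmp C (B X (L j) (R j)) (farr copower (farr \<kappa> (Idt C X, Idt C (L j)), f)) = Cmp C (farr F (Idt C X, farr t (Idt C (L j), f))) (B X (L j) (R i))"
          using Bn[of "Idt C X" "Idt C (L j)" f] by simp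
        finally show "Cmp C (Cmp C (Cmp C (u i) (inv_arr C (B X (L i) (R i)))) (farr F (Idt C X, farr t (f', Idt C (R i))))) (B X (L j) (R i)) =
          Cmp C (Cmp C (Cmp C (u j) (inv_arr C (B X (L j) (R j)))) (farr F (Idt C X, farr t (Idt C (L j), f)))) (B X (L j) (R i))"
          by simp
      qed simp_all
      then show "Cmp C (Cmp C (u (case r of (i, j, f, f') \<Rightarrow> i)) (inv_arr C (B X (L (case r of (i, j, f, f') \<Rightarrow> i)) (R (case r of (i, j, f, f') \<Rightarrow> i)))))
           (case r of (i, j, f, f') \<Rightarrow> farr F (Idt C X, farr t (f', Idt C (R i)))) =
          Cmp C (Cmp C (u (case r of (i, j, f, f') \<Rightarrow> j)) (inv_arr C (B X (L (case r of (i, j, f, f') \<Rightarrow> j)) (R (case r of (i, j, f, f') \<Rightarrow> j)))))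
           (case r of (i, j, f, f') \<Rightarrow> farr F (Idt C X, farr t (Idt C (L j), f)))"
        unfolding r' by simp
    qed (rule that)
    show ?thesis
    proof (intro bexI[OF _ h(1)] ballI)
      fix i z assume i: "i \<in> II" and z: "z \<in> carrier (fobj \<kappa> (X, L i))"
      have "Cmp C h (n X i z) = Cmp C (Cmp C h (farr F (Idt C X, dd i))) (Cmp C (B X (L i) (R i)) (cpi (fobj \<kappa> (X, L i)) (R i) z))"
        using i z homsD[OF h(1)] by (simp add: n_def)
      then show "Cmp C h (n X i z) = \<mu> i z" using i z u(2)[OF i z] by (simp add: h(2))
    qed
  qed
  have unique: "h = h'" if X: "X \<in> Obj C" and h: "h \<in> homs C (fobj F (X, D)) Y" "h' \<in> homs C (fobj F (X, D)) Y"
      and e: "\<And>i z. i \<in> II \<Longrightarrow> z \<in> carrier (fobj \<kappa> (X, L i)) \<Longrightarrow> Cmp C h (n X i z) = Cmp C h' (n X i z)" for X Y h h'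
  proof (rule glueing_eq[OF gl[OF X] category_C _ _ _ _ h, where Z = "\<lambda>(i, j, f, f'). fobj F (X, fobj t (L j, R i))"])
    note [simp] = X homsD[OF h(1)] homsD[OF h(2)]
    fix i assume i: "i \<in> II"
    have "Cmp C (Cmp C h (farr F (Idt C X, dd i))) (B X (L i) (R i)) = Cmp C (Cmp C h' (farr F (Idt C X, dd i))) (B X (L i) (R i))"
      by (rule cpo_eq[of "fobj \<kappa> (X, L i)" "R i"]) (use i e[OF i] in \<open>auto simp: in_homs_iff n_def\<close>)
    then show "Cmp C h (farr F (Idt C X, dd i)) = Cmp C h' (farr F (Idt C X, dd i))"
      by (rule iso_epi[OF category_C BA(4), rotated 3]) (use i in simp_all)
  qed (use X AAs in \<open>auto simp: in_homs_iff\<close>)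
  have n_dinatural: "n X i (ap (farr \<kappa> (Idt C X, f')) z) = Cmp C (n X j z) f"
    if X: "X \<in> Obj C" and r: "(i, j, f, f') \<in> AA" and z: "z \<in> carrier (fobj \<kappa> (X, L j))" for X i j f f' z
  proof -
    note a [simp] = AAs[OF r]
    note [simp] = X
    have z': "ap (farr \<kappa> (Idt C X, f')) z \<in> carrier (fobj \<kappa> (X, L i))" using ap_cl[of "Idt C X" f' z] z by simp
    have g: "Cmp C (farr F (Idt C X, dd i)) (farr F (Idt C X, farr t (f', Idt C (R i)))) = Cmp C (farr F (Idt C X, dd j)) (farr F (Idt C X, farr t (Idt C (L j), f)))"
      using gl[OF X] r unfolding glueing_def glue_cocone_def by fastforce
    have "n X i (ap (farr \<kappa> (Idt C X, f')) z) =
      Cmp C (farr F (Idt C X, dd i)) (Cmp C (Cmp C (B X (L i) (R i)) (farr copower (farr \<kappa> (Idt C X, f'), Idt C (R i)))) (cpi (fobj \<kappa> (X, L j)) (R i) z))"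
      using z z' by (simp add: n_def copower_cpi)
    also have "Cmp C (B X (L i) (R i)) (farr copower (farr \<kappa> (Idt C X, f'), Idt C (R i))) = Cmp C (farr F (Idt C X, farr t (f', Idt C (R i)))) (B X (L j) (R i))"
      using Bn[of "Idt C X" f' "Idt C (R i)"] by simp
    also have "Cmp C (farr F (Idt C X, dd i)) (Cmp C (Cmp C (farr F (Idt C X, farr t (f', Idt C (R i)))) (B X (L j) (R i))) (cpi (fobj \<kappa> (X, L j)) (R i) z)) =
      Cmp C (Cmp C (farr F (Idt C X, dd i)) (farr F (Idt C X, farr t (f', Idt C (R i))))) (Cmp C (B X (L j) (R i)) (cpi (fobj \<kappa> (X, L j)) (R i) z))"
      using z by simp
    also have "\<dots> = Cmp C (farr F (Idt C X, dd j)) (Cmp C (Cmp C (farr F (Idt C X, farr t (Idt C (L j), f))) (B X (L j) (R i))) (cpi (fobj \<kappa> (X, L j)) (R i) z))"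
      unfolding g using z by simp
    also have "Cmp C (farr F (Idt C X, farr t (Idt C (L j), f))) (B X (L j) (R i)) = Cmp C (B X (L j) (R j)) (farr copower (Idt (Vect k) (fobj \<kappa> (X, L j)), f))"
      using Bn[of "Idt C X" "Idt C (L j)" f] by simp
    also have "Cmp C (farr F (Idt C X, dd j)) (Cmp C (Cmp C (B X (L j) (R j)) (farr copower (Idt (Vect k) (fobj \<kappa> (X, L j)), f))) (cpi (fobj \<kappa> (X, L j)) (R i) z)) =
      Cmp C (n X j z) f"
      using z by (simp add: n_def copower_cpi)
    finally show ?thesis .
  qed
  have n_natural: "Cmp C (farr F (x, Idt T D)) (n X i z) = n X' i (ap (farr \<kappa> (x, Idt C (L i))) z)"
    if x: "x \<in> homs C X X'" and i [simp]: "i \<in> II" and z: "z \<in> carrier (fobj \<kappa> (X, L i))" for x X X' i z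
  proof -
    note [simp] = homsD[OF x]
    have [simp]: "X \<in> Obj C" "X' \<in> Obj C" using Obj_Dom[OF category_C homsD(1)[OF x]] Obj_Cod[OF category_C homsD(1)[OF x]] by auto
    have z': "ap (farr \<kappa> (x, Idt C (L i))) z \<in> carrier (fobj \<kappa> (X', L i))" using ap_cl[of x "Idt C (L i)" z] z by simp
    have "Cmp C (farr F (x, Idt T D)) (n X i z) =
      Cmp C (Cmp C (farr F (x, Idt T D)) (farr F (Idt C X, dd i))) (Cmp C (B X (L i) (R i)) (cpi (fobj \<kappa> (X, L i)) (R i) z))"
      using z by (simp add: n_def)
    also have "Cmp C (farr F (x, Idt T D)) (farr F (Idt C X, dd i)) = Cmp C (farr F (Idt C X', dd i)) (farr F (x, Idt T (fobj t (L i, R i))))"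
      using functor_split_left[OF F1 category_C T, of x "dd i"] functor_split_right[OF F1 category_C T, of x "dd i"] by simp
    also have "Cmp C (Cmp C (farr F (Idt C X', dd i)) (farr F (x, Idt T (fobj t (L i, R i))))) (Cmp C (B X (L i) (R i)) (cpi (fobj \<kappa> (X, L i)) (R i) z)) =
      Cmp C (farr F (Idt C X', dd i)) (Cmp C (Cmp C (farr F (x, Idt T (fobj t (L i, R i)))) (B X (L i) (R i))) (cpi (fobj \<kappa> (X, L i)) (R i) z))"
      using z by simp
    also have "Cmp C (farr F (x, Idt T (fobj t (L i, R i)))) (B X (L i) (R i)) = Cmp C (B X' (L i) (R i)) (farr copower (farr \<kappa> (x, Idt C (L i)), Idt C (R i)))"
      using Bn[of x "Idt C (L i)" "Idt C (R i)"] by simp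
    finally show ?thesis using z z' by (simp add: n_def copower_cpi)
  qed
  have "\<exists>h\<in>homs C (fobj F (X, D)) X. \<forall>i\<in>II. \<forall>z\<in>carrier (fobj \<kappa> (X, L i)). Cmp C h (n X i z) = m i X z" if X: "X \<in> Obj C" for X
    by (rule factor[OF X X m[OF _ X] m_dinatural[OF _ X]])
  then obtain \<alpha> where \<alpha>: "\<And>X. X \<in> Obj C \<Longrightarrow> \<alpha> X \<in> homs C (fobj F (X, D)) X"
    "\<And>X i z. X \<in> Obj C \<Longrightarrow> i \<in> II \<Longrightarrow> z \<in> carrier (fobj \<kappa> (X, L i)) \<Longrightarrow> Cmp C (\<alpha> X) (n X i z) = m i X z" by metis
  have \<alpha>A [simp]: "\<alpha> X \<in> Arr C" "Dom C (\<alpha> X) = fobj F (X, D)" "Cod C (\<alpha> X) = X" if "X \<in> Obj C" for X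
    using \<alpha>(1)[OF that] by (auto simp: in_homs_iff)
  have nat: "nat_trans C C (fix_right T F D) id_fun \<alpha>"
  proof (rule nat_transI[OF FDf is_functor_id_fun[OF category_C]])
    show "\<alpha> X \<in> homs C (fobj (fix_right T F D) X) (fobj id_fun X)" if "X \<in> Obj C" for X using \<alpha>(1)[OF that] by simp
    fix x assume x: "x \<in> Arr C"
    let ?X = "Dom C x" and ?X' = "Cod C x"
    have o: "?X \<in> Obj C" "?X' \<in> Obj C" using x by auto
    have xh: "x \<in> homs C ?X ?X'" using x by (simp add: in_homs_iff)
    have "Cmp C (\<alpha> ?X') (farr F (x, Idt T D)) = Cmp C x (\<alpha> ?X)"
    proof (rule unique[OF o(1)])
      fix i z assume i: "i \<in> II" and z: "z \<in> carrier (fobj \<kappa> (?X, L i))"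
      have z': "ap (farr \<kappa> (x, Idt C (L i))) z \<in> carrier (fobj \<kappa> (?X', L i))" using ap_cl[of x "Idt C (L i)" z] x i z by simp
      note nA = homsD[OF nh[OF o(1) i z]]
      have "Cmp C (Cmp C (\<alpha> ?X') (farr F (x, Idt T D))) (n ?X i z) = Cmp C (\<alpha> ?X') (n ?X' i (ap (farr \<kappa> (x, Idt C (L i))) z))"
        using x nA n_natural[OF xh i z] by simp
      also have "\<dots> = Cmp C x (m i ?X z)" using \<alpha>(2)[OF o(2) i z'] m_natural[OF i xh z] by simp
      also have "\<dots> = Cmp C (Cmp C x (\<alpha> ?X)) (n ?X i z)" using \<alpha>(2)[OF o(1) i z] x nA by simp
      finally show "Cmp C (Cmp C (\<alpha> ?X') (farr F (x, Idt T D))) (n ?X i z) = Cmp C (Cmp C x (\<alpha> ?X)) (n ?X i z)" .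
    qed (use x in \<open>auto simp: in_homs_iff\<close>)
    then show "Cmp C (\<alpha> (Cod C x)) (farr (fix_right T F D) x) = Cmp C (farr id_fun x) (\<alpha> (Dom C x))" by simp
  qed
  have isoR: "is_iso C (\<alpha> (R j))" if j: "j \<in> II" for j
  proof -
    note Rj = RL(1)[OF j]
    have "Idt C (R j) \<in> m j (R j) ` carrier (fobj \<kappa> (R j, L j))"
      using m_bij[OF j j] Rj by (simp add: bij_betw_def in_homs_iff)
    then obtain z0 where z0: "z0 \<in> carrier (fobj \<kappa> (R j, L j))" "m j (R j) z0 = Idt C (R j)" by auto
    define \<sigma> where "\<sigma> = n (R j) j z0"
    have \<sigma>: "\<sigma> \<in> homs C (R j) (fobj F (R j, D))" unfolding \<sigma>_def by (rule nh[OF Rj j z0(1)])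
    note [simp] = homsD[OF \<sigma>] Rj
    show ?thesis
    proof (rule is_isoI[OF category_C \<alpha>(1)[OF Rj] \<sigma>])
      show "Cmp C (\<alpha> (R j)) \<sigma> = Idt C (R j)" unfolding \<sigma>_def using \<alpha>(2)[OF Rj j z0(1)] z0(2) by simp
      show "Cmp C \<sigma> (\<alpha> (R j)) = Idt C (fobj F (R j, D))"
      proof (rule unique[OF Rj])
        fix i z assume i: "i \<in> II" and z: "z \<in> carrier (fobj \<kappa> (R j, L i))"
        note nA = homsD[OF nh[OF Rj i z]]
        define f where "f = m i (R j) z"
        have f: "f \<in> homs C (R i) (R j)" unfolding f_def using linD(1)[OF m[OF i Rj] z] by simp
        \<comment> \<open>By dinaturality at a mate \<open>f'\<close>, composing
          \<open>\<sigma>\<close> with \<open>f\<close> amounts to moving \<open>z0\<close> along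
          \<open>f'\<close>. Since \<open>m\<close> is injective, the element obtained is
          \<open>z\<close>.\<close>
        obtain f' where r: "(i, j, f, f') \<in> AA" using full[OF i j f] by blast
        note AAs[OF r]
        have z': "ap (farr \<kappa> (Idt C (R j), f')) z0 \<in> carrier (fobj \<kappa> (R j, L i))"
          using ap_cl[of "Idt C (R j)" f' z0] AAs[OF r] z0 by simp
        have "m i (R j) (ap (farr \<kappa> (Idt C (R j), f')) z0) = m i (R j) z"
          using m_dinatural[OF r Rj z0(1)] z0(2) f by (simp add: f_def in_homs_iff)
        then have zz: "ap (farr \<kappa> (Idt C (R j), f')) z0 = z"
          using m_bij[OF i j] z z' by (auto simp: bij_betw_def dest: inj_onD)
        \<comment> \<open>As in the Yoneda lemma, \<open>\<sigma>\<close> is the member of the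
          universal family at the element that \<open>m\<close> sends to the identity, and it is
          recovered as an inverse by testing on the arrows \<open>n\<close>.\<close>
        have "Cmp C (Cmp C \<sigma> (\<alpha> (R j))) (n (R j) i z) = Cmp C \<sigma> f"
          using nA \<alpha>(2)[OF Rj i z] by (simp add: f_def)
        also have "\<dots> = n (R j) i z" unfolding \<sigma>_def using n_dinatural[OF Rj r z0(1)] zz by simp
        finally show "Cmp C (Cmp C \<sigma> (\<alpha> (R j))) (n (R j) i z) = Cmp C (Idt C (fobj F (R j, D))) (n (R j) i z)"
          using nA by simp
      qed (auto simp: in_homs_iff)
    qed
  qed
  have isoQ: "is_iso C (\<alpha> Q)" if Q: "u \<in> homs C Q (R i)" "is_iso C u" "i \<in> II" for Q u i
  proof -
    note [simp] = homsD[OF Q(1)]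
    have QO [simp]: "Q \<in> Obj C" using Obj_Dom[OF category_C homsD(1)[OF Q(1)]] by simp
    have iu: "is_iso C (farr (fix_right T F D) u)" using functor_is_iso(1)[OF FDf Q(2)] .
    have "Cmp C (\<alpha> (R i)) (farr F (u, Idt T D)) = Cmp C u (\<alpha> Q)"
      using nat_trans_naturality[OF nat, of u] by simp
    then have "\<alpha> Q = Cmp C (inv_arr C u) (Cmp C (\<alpha> (R i)) (farr F (u, Idt T D)))"
      using Q(2) by simp
    moreover have "is_iso C \<dots>"
      using iu isoR[OF Q(3)] Q by (intro is_iso_Cmp[OF category_C]) auto
    ultimately show ?thesis by simp
  qed
  have "is_iso C (\<alpha> X)" if X: "X \<in> Obj C" for X
  proof -
    obtain J :: "('u, 'u) cat" and E \<iota> where J: "small_category J" "is_colimit J C E X \<iota>"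
      "\<And>j. j \<in> Obj J \<Longrightarrow> \<exists>i\<in>II. \<exists>u\<in>homs C (fobj E j) (R i). is_iso C u" using dense[OF X] by blast
    have G: "is_colimit J C (comp_fun id_fun E) (fobj id_fun X) (\<lambda>j. farr id_fun (\<iota> j))"
      using J(2) by (cases E) (simp add: comp_fun_def id_fun_def comp_def)
    show ?thesis
      by (rule is_iso_at_colimit[OF nat is_colimit_cocone[OF J(2)] cocontinuous_colimit[OF FD J(1,2)] G]) (use J(3) isoQ in blast)
  qed
  then have "nat_iso C C (fix_right T F D) id_fun \<alpha>" using nat by (simp add: nat_iso_def)
  then show ?thesis by blast
qed

end

section \<open>The pairing\<close>

locale rigid_extension = cocontinuous_monoidal k A M + projective_extension k A "unt M" PP
  for k :: "'u ring" and A :: "('u, 'u, 'u) lincat" and M :: "'u balanced_struct" and PP :: "'u set" +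
  assumes rigid: "compact_rigid k" and unit_compact: "compact_obj k A (unt M)"
begin

abbreviation pairing where "pairing \<equiv> comp_fun pfun (tens M)"

lemma bicocontinuous_pairing: "bicocontinuous k A A (Vect k) pairing"
  using tensor cocontinuous_pfun by (rule bicocontinuous_comp_fun)

text \<open>The functor \<open>\<phi>\<close> depends on the unit but not on the tensor product, so
  it is common to both structures; reversal only exchanges the arguments of the pairing.\<close>

lemma rigid_extension_reversed: "rigid_extension k A reversed PP"
proof -
  interpret rev: cocontinuous_monoidal k A reversed by (rule cocontinuous_monoidal_reversed)
  have "projective_extension k A (unt reversed) PP" using projective_extension_axioms by simp
  then show ?thesis
    using rigid unit_compact cocontinuous_monoidal_reversed
    by (intro rigid_extension.intro rigid_extension_axioms.intro) (simp_all add: compact_rigid_reversed)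
qed

text \<open>The equation says that \<open>f'\<close> is the dual of \<open>f\<close>, in a form
  without evaluations that is symmetric: under reversal it is again such an equation, with
  \<open>f\<close> and \<open>f'\<close> exchanged.\<close>

definition mates :: "'i set \<Rightarrow> ('i \<Rightarrow> 'u) \<Rightarrow> ('i \<Rightarrow> 'u) \<Rightarrow> ('i \<Rightarrow> 'u) \<Rightarrow> ('i \<times> 'i \<times> 'u \<times> 'u) set" where
  "mates II R L d = {(i, j, f, f'). i \<in> II \<and> j \<in> II \<and> f \<in> homs A (R i) (R j) \<and> f' \<in> homs A (L j) (L i) \<and>
     f \<bullet> \<iota> (L i) \<diamondop> d i = \<iota> (R j) \<bullet> f' \<diamondop> d j}"

text \<open>An element of \<open>\<phi>(X \<otimes> L i)\<close> is sent by \<open>counit\<close> to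
  \<open>Hom(I, X \<otimes> L i)\<close> and by the inverse of bending to
  \<open>Hom(R i, X)\<close>; this is the family \<open>m\<close> for \<open>snake_iso\<close>. At
  \<open>X = R j\<close> it is bijective, because \<open>R j \<otimes> L i\<close> is compact
  projective.\<close>

lemma left_snake:
  fixes R L e d :: "'i \<Rightarrow> 'u" and T :: "('u, 'u, 'u) lincat"
  assumes T: "category T" and t: "is_functor (prod_cat A A) T t" and F: "bicocontinuous k A T A F"
    and \<beta>: "nat_iso (prod_cat A (prod_cat A A)) A (comp_fun F (prod_fun id_fun t))
      (comp_fun copower (comp_fun (prod_fun pairing id_fun) rebracket)) \<beta>"
    and dual: "\<And>i. i \<in> II \<Longrightarrow> left_dual (R i) (L i) (e i) (d i)"
    and R: "\<And>i. i \<in> II \<Longrightarrow> compact_projective k A (R i)" and L: "\<And>i. i \<in> II \<Longrightarrow> compact_projective k A (L i)"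
    and D: "D \<in> Obj T" "\<And>i. i \<in> II \<Longrightarrow> dd i \<in> homs T (fobj t (L i, R i)) D"
    and gl: "\<And>X. X \<in> Obj A \<Longrightarrow> glueing A II (mates II R L d) (\<lambda>(i, j, f, f'). i) (\<lambda>(i, j, f, f'). j)
      (\<lambda>i. fobj F (X, fobj t (L i, R i))) (\<lambda>(i, j, f, f'). farr F (Idt A X, farr t (f', Idt A (R i))))
      (\<lambda>(i, j, f, f'). farr F (Idt A X, farr t (Idt A (L j), f))) (fobj F (X, D)) (\<lambda>i. farr F (Idt A X, dd i))"
    and dense: "\<And>X. X \<in> Obj A \<Longrightarrow> \<exists>(J :: ('u, 'u) cat) E c. small_category J \<and> is_colimit J A E X c \<and>
      (\<forall>j\<in>Obj J. \<exists>i\<in>II. \<exists>u\<in>homs A (fobj E j) (R i). is_iso A u)"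
  shows "\<exists>\<alpha>. nat_iso A A (fix_right T F D) id_fun \<alpha>"
proof -
  note ds = left_dualD(1-8)[OF dual]
  define B where "B i h = h \<bullet> \<iota> (L i) \<diamondop> d i" for i h
  have Bbij: "bij_betw (B i) (homs A (R i) X) (homs A I (X \<star> L i))" if "i \<in> II" "X \<in> Obj A" for i X
    using bij_bend[OF dual[OF that(1)] that(2)] unfolding B_def .
  define m where "m i X z = inv_into (homs A (R i) X) (B i) (counit (X \<star> L i) z)" for i X z
  have XL [simp]: "X \<star> L i \<in> Obj A" if "i \<in> II" "X \<in> Obj A" for i X using ds that by simp
  have cu: "counit (X \<star> L i) z \<in> homs A I (X \<star> L i)" if "i \<in> II" "X \<in> Obj A" "z \<in> carrier (pobj (X \<star> L i))" for i X z
    using linD(1)[OF counit(1)[OF XL[OF that(1,2)]] that(3)] by simp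
  have mh: "m i X z \<in> homs A (R i) X" and Bm: "B i (m i X z) = counit (X \<star> L i) z"
    if "i \<in> II" "X \<in> Obj A" "z \<in> carrier (pobj (X \<star> L i))" for i X z
    unfolding m_def using Bbij[OF that(1,2)] cu[OF that] by (auto simp: bij_betw_def inv_into_into f_inv_into_f)
  have inj: "h = h'" if "i \<in> II" "X \<in> Obj A" "h \<in> homs A (R i) X" "h' \<in> homs A (R i) X" "B i h = B i h'" for i X h h'
    using Bbij[OF that(1,2)] that(3-) by (auto simp: bij_betw_def dest: inj_onD)
  have Blin: "lin k (hom_space A (R i) X) (hom_space A I (X \<star> L i)) (B i)" if "i \<in> II" "X \<in> Obj A" for i X
    unfolding B_def using that ds[OF that(1)]
    by (intro lin_comp[OF lin_tensor_right lin_Cmp_left[OF linear]]) (simp_all add: in_homs_iff)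
  show ?thesis
  proof (rule snake_iso[OF T t bicocontinuousD(1)[OF bicocontinuous_pairing] F \<beta> _ _ _ _ D gl _ _ _ _ dense, where m = m])
    show "R i \<in> Obj A" "L i \<in> Obj A" if "i \<in> II" for i using ds[OF that] by auto
    show "i \<in> II \<and> j \<in> II \<and> f \<in> homs A (R i) (R j) \<and> f' \<in> homs A (L j) (L i)" if "(i, j, f, f') \<in> mates II R L d" for i j f f'
      using that by (auto simp: mates_def)
    \<comment> \<open>Each \<open>f\<close> has a mate, because precomposition of
      \<open>R j \<otimes> -\<close> with \<open>d j\<close> is a bijection from
      \<open>Hom(L j, L i)\<close> onto \<open>Hom(I, R j \<otimes> L i)\<close>.\<close>
    show "\<exists>f'. (i, j, f, f') \<in> mates II R L d" if i: "i \<in> II" and j: "j \<in> II" and f: "f \<in> homs A (R i) (R j)" for i j f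
    proof -
      have "f \<bullet> \<iota> (L i) \<diamondop> d i \<in> homs A I (R j \<star> L i)" using ds[OF i] f by (simp add: in_homs_iff)
      then obtain f' where "f' \<in> homs A (L j) (L i)" "\<iota> (R j) \<bullet> f' \<diamondop> d j = f \<bullet> \<iota> (L i) \<diamondop> d i"
        using bij_betw_imp_surj_on[OF reverse_dual(3)[OF dual[OF j] ds(2)[OF i]]] by force
      then show ?thesis using i j f by (auto simp: mates_def)
    qed
    show "lin k (fobj pairing (X, L i)) (hom_space A (R i) X) (m i X)" if i: "i \<in> II" and X: "X \<in> Obj A" for i X
    proof (rule linI)
      note c = counit(1)[OF XL[OF i X]]
      have Vm: "module k (pobj (X \<star> L i))" using module_Vect[OF pobj_Obj[OF XL[OF i X]]] .
      show "m i X z \<in> carrier (hom_space A (R i) X)" if "z \<in> carrier (fobj pairing (X, L i))" for z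
        using mh[OF i X] that by simp
      show "m i X (z \<oplus>\<^bsub>fobj pairing (X, L i)\<^esub> w) = m i X z \<oplus>\<^bsub>hom_space A (R i) X\<^esub> m i X w"
        if z: "z \<in> carrier (fobj pairing (X, L i))" and w: "w \<in> carrier (fobj pairing (X, L i))" for z w
      proof -
        have z': "z \<in> carrier (pobj (X \<star> L i))" and w': "w \<in> carrier (pobj (X \<star> L i))" using z w by auto
        have "m i X (z \<oplus>\<^bsub>pobj (X \<star> L i)\<^esub> w) = HAdd A (m i X z) (m i X w)"
        proof (rule inj[OF i X mh[OF i X module_add_closed[OF Vm z' w']] HAdd_homs[OF linear mh[OF i X z'] mh[OF i X w']]])
          show "B i (m i X (z \<oplus>\<^bsub>pobj (X \<star> L i)\<^esub> w)) = B i (HAdd A (m i X z) (m i X w))"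
            using Bm[OF i X z'] Bm[OF i X w'] Bm[OF i X module_add_closed[OF Vm z' w']] linD(2)[OF c z' w']
              linD(2)[OF Blin[OF i X], of "m i X z" "m i X w"] mh[OF i X z'] mh[OF i X w'] by simp
        qed
        then show ?thesis by simp
      qed
      show "m i X (a \<odot>\<^bsub>fobj pairing (X, L i)\<^esub> z) = a \<odot>\<^bsub>hom_space A (R i) X\<^esub> m i X z"
        if a: "a \<in> carrier k" and z: "z \<in> carrier (fobj pairing (X, L i))" for a z
      proof -
        have z': "z \<in> carrier (pobj (X \<star> L i))" using z by auto
        have "m i X (a \<odot>\<^bsub>pobj (X \<star> L i)\<^esub> z) = HScale A a (m i X z)"
        proof (rule inj[OF i X mh[OF i X module_smult_closed[OF Vm a z']] HScale_homs[OF linear mh[OF i X z'] a]])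
          show "B i (m i X (a \<odot>\<^bsub>pobj (X \<star> L i)\<^esub> z)) = B i (HScale A a (m i X z))"
            using Bm[OF i X z'] Bm[OF i X module_smult_closed[OF Vm a z']] linD(3)[OF c a z']
              linD(3)[OF Blin[OF i X] a, of "m i X z"] mh[OF i X z'] by simp
        qed
        then show ?thesis by simp
      qed
    qed
    show "m i X' (ap (farr pairing (x, \<iota> (L i))) z) = x \<diamondop> m i X z"
      if i: "i \<in> II" and x: "x \<in> homs A X X'" and z: "z \<in> carrier (fobj pairing (X, L i))" for i x X X' z
    proof -
      have X: "X \<in> Obj A" "X' \<in> Obj A" using x by (auto simp: in_homs_iff)
      have z': "z \<in> carrier (pobj (X \<star> L i))" using z by simp
      have xl: "x \<bullet> \<iota> (L i) \<in> homs A (X \<star> L i) (X' \<star> L i)" using x ds[OF i] by (simp add: in_homs_iff)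
      have w: "ap (farr pfun (x \<bullet> \<iota> (L i))) z \<in> carrier (pobj (X' \<star> L i))"
        using linD(1)[OF Vect_homsD(3)[OF pfun_arr(1)[OF xl]] z'] .
      note mz = mh[OF i X(1) z']
      have "B i (m i X' (ap (farr pfun (x \<bullet> \<iota> (L i))) z)) = x \<bullet> \<iota> (L i) \<diamondop> B i (m i X z)"
        using Bm[OF i X(2) w] Bm[OF i X(1) z'] counit_natural[OF xl z'] by simp
      also have "\<dots> = B i (x \<diamondop> m i X z)"
        using x mz ds[OF i] by (simp add: B_def in_homs_iff tensor_right_Cmp)
      finally show ?thesis
        using inj[OF i X(2) mh[OF i X(2) w] Cmp_in_homs[OF category_C mz x]] by simp
    qed
    show "m i X (ap (farr pairing (\<iota> X, f')) z) = m j X z \<diamondop> f"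
      if r: "(i, j, f, f') \<in> mates II R L d" and X: "X \<in> Obj A" and z: "z \<in> carrier (fobj pairing (X, L j))" for i j f f' X z
    proof -
      have i: "i \<in> II" and j: "j \<in> II" and f: "f \<in> homs A (R i) (R j)" and f': "f' \<in> homs A (L j) (L i)"
        and ff: "f \<bullet> \<iota> (L i) \<diamondop> d i = \<iota> (R j) \<bullet> f' \<diamondop> d j" using r by (auto simp: mates_def)
      note [simp] = X ds[OF i] ds[OF j] homsD[OF f] homsD[OF f']
      have z': "z \<in> carrier (pobj (X \<star> L j))" using z by simp
      have xf: "\<iota> X \<bullet> f' \<in> homs A (X \<star> L j) (X \<star> L i)" by (simp add: in_homs_iff)
      have w: "ap (farr pfun (\<iota> X \<bullet> f')) z \<in> carrier (pobj (X \<star> L i))"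
        using linD(1)[OF Vect_homsD(3)[OF pfun_arr(1)[OF xf]] z'] .
      note h = mh[OF j X z']
      note [simp] = homsD[OF h]
      have "B i (m i X (ap (farr pfun (\<iota> X \<bullet> f')) z)) = (\<iota> X \<bullet> f' \<diamondop> m j X z \<bullet> \<iota> (L j)) \<diamondop> d j"
        using Bm[OF i X w] Bm[OF j X z'] counit_natural[OF xf z'] by (simp add: B_def)
      also have "\<iota> X \<bullet> f' \<diamondop> m j X z \<bullet> \<iota> (L j) = m j X z \<bullet> \<iota> (L i) \<diamondop> \<iota> (R j) \<bullet> f'"
        by (rule tensor_slide) simp_all
      also have "(m j X z \<bullet> \<iota> (L i) \<diamondop> \<iota> (R j) \<bullet> f') \<diamondop> d j = m j X z \<bullet> \<iota> (L i) \<diamondop> f \<bullet> \<iota> (L i) \<diamondop> d i"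
        using ff by simp
      also have "\<dots> = B i (m j X z \<diamondop> f)" by (simp add: B_def tensor_right_Cmp)
      finally show ?thesis
        using inj[OF i X mh[OF i X w] Cmp_in_homs[OF category_C f h]] by simp
    qed
    show "bij_betw (m i (R j)) (carrier (fobj pairing (R j, L i))) (homs A (R i) (R j))" if i: "i \<in> II" and j: "j \<in> II" for i j
    proof -
      have Rj: "R j \<in> Obj A" using ds[OF j] by simp
      have "bij_betw (counit (R j \<star> L i)) (carrier (pobj (R j \<star> L i))) (homs A I (R j \<star> L i))"
        by (rule counit_bij[OF compact_projective_tensor[OF rigid R[OF j] L[OF i]]])
      from bij_betw_trans[OF this bij_betw_inv_into[OF Bbij[OF i Rj]]]
      show ?thesis by (simp add: m_def [abs_def] comp_def)
    qed
  qed
qed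

lemma pairing_twist:
  assumes bal: balancing_laws and comp: balancing_compatible_with_duals and enough: "enough_compact_projectives k A"
    and X: "X \<in> Obj A" and Y: "Y \<in> Obj A"
  shows "farr pairing (\<theta> X, \<iota> Y) = farr pairing (\<iota> X, \<theta> Y)"
proof -
  have \<theta>A [simp]: "\<theta> X \<in> Arr A" "Dom A (\<theta> X) = X" "Cod A (\<theta> X) = X" if "X \<in> Obj A" for X
    using bal that by (auto simp: balancing_laws_def in_homs_iff)
  have \<theta>n: "\<theta> Y \<diamondop> f = f \<diamondop> \<theta> X" if "f \<in> homs A X Y" for X Y f
  proof -
    have "X \<in> Obj A" "Y \<in> Obj A" using that by (auto simp: in_homs_iff)
    then show ?thesis using bal that unfolding balancing_laws_def by blast
  qed
  note Kf = bicocontinuousD(1)[OF bicocontinuous_pairing]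
  have KC: "farr pairing (f' \<diamondop> f, g' \<diamondop> g) = Cmp (Vect k) (farr pairing (f', g')) (farr pairing (f, g))"
    if "f \<in> Arr A" "f' \<in> Arr A" "g \<in> Arr A" "g' \<in> Arr A" "Cod A f = Dom A f'" "Cod A g = Dom A g'" for f f' g g'
    using functor_Cmp[OF Kf, of "(f, g)" "(f', g')"] that by simp
  have Kh: "farr pairing (f, g) \<in> homs (Vect k) (fobj pairing (Dom A f, Dom A g)) (fobj pairing (Cod A f, Cod A g))"
    if "f \<in> Arr A" "g \<in> Arr A" for f g
    using functor_arr[OF Kf, of "(f, g)"] that by (simp add: in_homs_iff)
  have base: "farr pairing (\<theta> P, \<iota> Q) = farr pairing (\<iota> P, \<theta> Q)" if P: "compact_projective k A P" and Q: "compact_projective k A Q" for P Q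
  proof -
    have O [simp]: "P \<in> Obj A" "Q \<in> Obj A" using P Q by (auto simp: compact_projective_def)
    have dz: "dualizable P" using rigid compact_projective_compact[OF P] by (auto simp: compact_rigid_def)
    then obtain L e d where dual: "left_dual P L e d" unfolding dualizable_def by blast
    note [simp] = left_dualD(1-8)[OF dual]
    \<comment> \<open>By compatibility the dual arrow of \<open>\<theta> P\<close> is
      \<open>\<theta> L\<close>, and a dual arrow has the same mate as the arrow itself.\<close>
    have \<theta>L: "\<iota> P \<bullet> \<theta> L \<diamondop> d = \<theta> P \<bullet> \<iota> L \<diamondop> d"
      using reverse_dual(4)[OF dual, of "\<theta> P"] comp dz dual unfolding balancing_compatible_with_duals_def
      by (auto simp: in_homs_iff)
    have eq: "\<theta> P \<bullet> \<iota> Q \<diamondop> g = \<iota> P \<bullet> \<theta> Q \<diamondop> g" if g: "g \<in> homs A I (P \<star> Q)" for g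
    proof -
      obtain h where h: "h \<in> homs A L Q" "\<iota> P \<bullet> h \<diamondop> d = g"
        using bij_betw_imp_surj_on[OF reverse_dual(3)[OF dual O(2)]] g by force
      note [simp] = homsD[OF h(1)]
      have "\<theta> P \<bullet> \<iota> Q \<diamondop> g = (\<theta> P \<bullet> \<iota> Q \<diamondop> \<iota> P \<bullet> h) \<diamondop> d" by (simp add: h(2)[symmetric])
      also have "\<dots> = \<iota> P \<bullet> h \<diamondop> \<theta> P \<bullet> \<iota> L \<diamondop> d"
        by (subst tensor_slide[symmetric, where Y = L and X' = P]) simp_all
      also have "\<dots> = (\<iota> P \<bullet> h \<diamondop> \<iota> P \<bullet> \<theta> L) \<diamondop> d" by (simp add: \<theta>L)
      also have "\<dots> = \<iota> P \<bullet> (\<theta> Q \<diamondop> h) \<diamondop> d" by (simp add: interchange \<theta>n[OF h(1)])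
      also have "\<dots> = \<iota> P \<bullet> \<theta> Q \<diamondop> g" by (simp add: tensor_left_Cmp h(2)[symmetric])
      finally show ?thesis .
    qed
    have a: "\<theta> P \<bullet> \<iota> Q \<in> homs A (P \<star> Q) (P \<star> Q)" "\<iota> P \<bullet> \<theta> Q \<in> homs A (P \<star> Q) (P \<star> Q)" by (simp_all add: in_homs_iff)
    have PQ: "P \<star> Q \<in> Obj A" by simp
    have "farr pfun (\<theta> P \<bullet> \<iota> Q) = farr pfun (\<iota> P \<bullet> \<theta> Q)"
    proof (rule Vect_arr_eqI[OF pfun_arr(1)[OF a(1)] pfun_arr(1)[OF a(2)]])
      fix z assume z: "z \<in> carrier (pobj (P \<star> Q))"
      have cz: "counit (P \<star> Q) z \<in> homs A I (P \<star> Q)" using linD(1)[OF counit(1)[OF PQ] z] by simp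
      \<comment> \<open>At the compact projective object \<open>P \<otimes> Q\<close> the counit is
        injective, so the two endomorphisms of \<open>\<phi>(P \<otimes> Q)\<close> may be compared
        in \<open>Hom(I, P \<otimes> Q)\<close>.\<close>
      have "counit (P \<star> Q) (ap (farr pfun (\<theta> P \<bullet> \<iota> Q)) z) = counit (P \<star> Q) (ap (farr pfun (\<iota> P \<bullet> \<theta> Q)) z)"
        using counit_natural[OF a(1) z] counit_natural[OF a(2) z] eq[OF cz] by simp
      then show "ap (farr pfun (\<theta> P \<bullet> \<iota> Q)) z = ap (farr pfun (\<iota> P \<bullet> \<theta> Q)) z"
        using counit_bij[OF compact_projective_tensor[OF rigid P Q]] linD(1)[OF Vect_homsD(3)[OF pfun_arr(1)[OF a(1)]] z]
          linD(1)[OF Vect_homsD(3)[OF pfun_arr(1)[OF a(2)]] z] by (auto simp: bij_betw_def dest: inj_onD)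
    qed
    then show ?thesis by simp
  qed
  \<comment> \<open>Both sides are arrows out of a colimit in \<open>Vect\<close>, and by naturality
    of \<open>\<theta>\<close> they agree on its legs. The second variable is freed here, the first
    one afterwards in the same way.\<close>
  have right: "farr pairing (\<theta> P, \<iota> Y) = farr pairing (\<iota> P, \<theta> Y)" if P: "compact_projective k A P" and Y: "Y \<in> Obj A" for P Y
  proof -
    have O [simp]: "P \<in> Obj A" "Y \<in> Obj A" using P Y by (auto simp: compact_projective_def)
    obtain J :: "('u, 'u) cat" and E c where J: "small_category J" "\<And>j. j \<in> Obj J \<Longrightarrow> compact_projective k A (fobj E j)"
      and l: "is_colimit J A E Y c" using enough Y unfolding enough_compact_projectives_def by blast
    note cA [simp] = is_coconeD(3-5)[OF is_colimit_cocone[OF l]]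
    note l' = cocontinuous_colimit[OF bicocontinuousD(2)[OF bicocontinuous_pairing O(1)] J(1) l]
    show ?thesis
    proof (rule is_colimit_eq[OF l'])
      show "farr pairing (\<theta> P, \<iota> Y) \<in> homs (Vect k) (fobj (fix_left A pairing P) Y) (fobj pairing (P, Y))"
        "farr pairing (\<iota> P, \<theta> Y) \<in> homs (Vect k) (fobj (fix_left A pairing P) Y) (fobj pairing (P, Y))"
        using Kh[of "\<theta> P" "\<iota> Y"] Kh[of "\<iota> P" "\<theta> Y"] by simp_all
      fix j assume j: "j \<in> Obj J"
      have Ej [simp]: "fobj E j \<in> Obj A" using J(2)[OF j] by (simp add: compact_projective_def)
      have ch: "c j \<in> homs A (fobj E j) Y" using j by (simp add: in_homs_iff)
      have "Cmp (Vect k) (farr pairing (\<theta> P, \<iota> Y)) (farr pairing (\<iota> P, c j)) = Cmp (Vect k) (farr pairing (\<iota> P, c j)) (farr pairing (\<theta> P, \<iota> (fobj E j)))"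
        using KC[of "\<iota> P" "\<theta> P" "c j" "\<iota> Y"] KC[of "\<theta> P" "\<iota> P" "\<iota> (fobj E j)" "c j"] j by simp
      also have "\<dots> = Cmp (Vect k) (farr pairing (\<iota> P, c j)) (farr pairing (\<iota> P, \<theta> (fobj E j)))"
        using base[OF P J(2)[OF j]] by simp
      also have "\<dots> = Cmp (Vect k) (farr pairing (\<iota> P, \<theta> Y)) (farr pairing (\<iota> P, c j))"
        using KC[of "\<iota> P" "\<iota> P" "c j" "\<theta> Y"] KC[of "\<iota> P" "\<iota> P" "\<theta> (fobj E j)" "c j"] j \<theta>n[OF ch] by simp
      finally show "Cmp (Vect k) (farr pairing (\<theta> P, \<iota> Y)) (farr (fix_left A pairing P) (c j)) =
        Cmp (Vect k) (farr pairing (\<iota> P, \<theta> Y)) (farr (fix_left A pairing P) (c j))" by simp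
    qed
  qed
  obtain J :: "('u, 'u) cat" and E c where J: "small_category J" "\<And>j. j \<in> Obj J \<Longrightarrow> compact_projective k A (fobj E j)"
    and l: "is_colimit J A E X c" using enough X unfolding enough_compact_projectives_def by blast
  note cA [simp] = is_coconeD(3-5)[OF is_colimit_cocone[OF l]]
  note [simp] = X Y
  note l' = cocontinuous_colimit[OF bicocontinuousD(3)[OF bicocontinuous_pairing Y] J(1) l]
  show ?thesis
  proof (rule is_colimit_eq[OF l'])
    show "farr pairing (\<theta> X, \<iota> Y) \<in> homs (Vect k) (fobj (fix_right A pairing Y) X) (fobj pairing (X, Y))"
      "farr pairing (\<iota> X, \<theta> Y) \<in> homs (Vect k) (fobj (fix_right A pairing Y) X) (fobj pairing (X, Y))"
      using Kh[of "\<theta> X" "\<iota> Y"] Kh[of "\<iota> X" "\<theta> Y"] by simp_all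
    fix j assume j: "j \<in> Obj J"
    have Ej [simp]: "fobj E j \<in> Obj A" using J(2)[OF j] by (simp add: compact_projective_def)
    have ch: "c j \<in> homs A (fobj E j) X" using j by (simp add: in_homs_iff)
    have "Cmp (Vect k) (farr pairing (\<theta> X, \<iota> Y)) (farr pairing (c j, \<iota> Y)) = Cmp (Vect k) (farr pairing (c j, \<iota> Y)) (farr pairing (\<theta> (fobj E j), \<iota> Y))"
      using KC[of "c j" "\<theta> X" "\<iota> Y" "\<iota> Y"] KC[of "\<theta> (fobj E j)" "c j" "\<iota> Y" "\<iota> Y"] j \<theta>n[OF ch] by simp
    also have "\<dots> = Cmp (Vect k) (farr pairing (c j, \<iota> Y)) (farr pairing (\<iota> (fobj E j), \<theta> Y))"
      using right[OF J(2)[OF j] Y] by simp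
    also have "\<dots> = Cmp (Vect k) (farr pairing (\<iota> X, \<theta> Y)) (farr pairing (c j, \<iota> Y))"
      using KC[of "c j" "\<iota> X" "\<iota> Y" "\<theta> Y"] KC[of "\<iota> (fobj E j)" "c j" "\<theta> Y" "\<iota> Y"] j by simp
    finally show "Cmp (Vect k) (farr pairing (\<theta> X, \<iota> Y)) (farr (fix_right A pairing Y) (c j)) =
      Cmp (Vect k) (farr pairing (\<iota> X, \<theta> Y)) (farr (fix_right A pairing Y) (c j))" by simp
  qed
qed

end

section \<open>Nondegeneracy\<close>

context rigid_extension
begin

text \<open>The glueing is demanded for all cocontinuous \<open>H\<close>, because it is needed for
  the functors \<open>F(X, -)\<close>, and \<open>F\<close> is only produced inside the
  proof.\<close>

lemma exists_snake:
  fixes R L e d :: "'i \<Rightarrow> 'u" and T :: "('u, 'u, 'u) lincat"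
  assumes kt: "kelly_tensor k A A T t"
    and dual: "\<And>i. i \<in> II \<Longrightarrow> left_dual (R i) (L i) (e i) (d i)"
    and R: "\<And>i. i \<in> II \<Longrightarrow> compact_projective k A (R i)" and L: "\<And>i. i \<in> II \<Longrightarrow> compact_projective k A (L i)"
    and D: "D \<in> Obj T" "\<And>i. i \<in> II \<Longrightarrow> dd i \<in> homs T (fobj t (L i, R i)) D"
    and gl: "\<And>H. cocontinuous k T A H \<Longrightarrow> glueing A II (mates II R L d) (\<lambda>(i, j, f, f'). i) (\<lambda>(i, j, f, f'). j)
      (\<lambda>i. fobj H (fobj t (L i, R i))) (\<lambda>(i, j, f, f'). farr H (farr t (f', Idt A (R i))))
      (\<lambda>(i, j, f, f'). farr H (farr t (Idt A (L j), f))) (fobj H D) (\<lambda>i. farr H (dd i))"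
    and dense: "\<And>X. X \<in> Obj A \<Longrightarrow> \<exists>(J :: ('u, 'u) cat) E c. small_category J \<and> is_colimit J A E X c \<and>
      (\<forall>j\<in>Obj J. \<exists>i\<in>II. \<exists>u\<in>homs A (fobj E j) (R i). is_iso A u)"
  obtains F \<beta> \<alpha> where "bicocontinuous k A T A F"
    "nat_iso (prod_cat A (prod_cat A A)) A (comp_fun F (prod_fun id_fun t))
      (comp_fun copower (comp_fun (prod_fun pairing id_fun) rebracket)) \<beta>"
    "nat_iso A A (fix_right T F D) id_fun \<alpha>"
proof -
  have p: "presentable k A" "presentable k T" and t: "is_functor (prod_cat A A) T t"
    using kt by (auto simp: kelly_tensor_def bicocontinuous_def)
  obtain F \<beta> where F: "bicocontinuous k A T A F"
    and \<beta>: "nat_iso (prod_cat A (prod_cat A A)) A (comp_fun F (prod_fun id_fun t))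
      (comp_fun copower (comp_fun (prod_fun pairing id_fun) rebracket)) \<beta>"
    using exists_kelly_extension[OF kt p(1) linear copower_pairing[OF bicocontinuous_pairing]] by blast
  have "glueing A II (mates II R L d) (\<lambda>(i, j, f, f'). i) (\<lambda>(i, j, f, f'). j)
      (\<lambda>i. fobj F (X, fobj t (L i, R i))) (\<lambda>(i, j, f, f'). farr F (Idt A X, farr t (f', Idt A (R i))))
      (\<lambda>(i, j, f, f'). farr F (Idt A X, farr t (Idt A (L j), f))) (fobj F (X, D)) (\<lambda>i. farr F (Idt A X, dd i))"
    if "X \<in> Obj A" for X
    using gl[OF bicocontinuousD(2)[OF F that]] by simp
  from left_snake[OF presentableD(5)[OF p(2)] t F \<beta> dual R L D this dense] F \<beta> show thesis
    using that by blast
qed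

lemma exists_dual_family:
  obtains II where "|II| <o |UNIV :: 'u set|"
    "\<And>R L e d. (R, L, e, d) \<in> II \<Longrightarrow> left_dual R L e d \<and> compact_projective k A R \<and> compact_projective k A L"
    "\<And>Q. compact_projective k A Q \<Longrightarrow> \<exists>(R, L, e, d)\<in>II. \<exists>u\<in>homs A Q R. is_iso A u"
    "\<And>Q. compact_projective k A Q \<Longrightarrow> \<exists>(R, L, e, d)\<in>II. \<exists>u\<in>homs A Q L. is_iso A u"
proof -
  have dz: "dualizable P" if "P \<in> PP" for P
    using rigid compact_projective_compact[OF PP[OF that]] by (auto simp: compact_rigid_def)
  have "\<forall>P\<in>PP. \<exists>x. left_dual P (fst x) (fst (snd x)) (snd (snd x))" "\<forall>P\<in>PP. \<exists>x. left_dual (fst x) P (fst (snd x)) (snd (snd x))"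
    using dz unfolding dualizable_def by force+
  then obtain a b where a: "\<forall>P\<in>PP. left_dual P (fst (a P)) (fst (snd (a P))) (snd (snd (a P)))"
    and b: "\<forall>P\<in>PP. left_dual (fst (b P)) P (fst (snd (b P))) (snd (snd (b P)))"
    by (elim bchoice[elim_format] exE) blast
  \<comment> \<open>Each \<open>P\<close> enters once with a left dual and once as a left dual. The
    first entries then serve to resolve objects in the left snake relation, the second entries in
    the right one.\<close>
  define II where "II = (\<lambda>P. (P, fst (a P), fst (snd (a P)), snd (snd (a P)))) ` PP \<union> (\<lambda>P. (fst (b P), P, fst (snd (b P)), snd (snd (b P)))) ` PP"
  show thesis
  proof (rule that)
    show "|II| <o |UNIV :: 'u set|"
      unfolding II_def by (rule card_of_Un_ordLess_infinite[OF infinite_universe[OF universe]]) (rule card_less_image[OF small_PP])+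
    show "left_dual R L e d \<and> compact_projective k A R \<and> compact_projective k A L" if "(R, L, e, d) \<in> II" for R L e d
    proof -
      have "left_dual R L e d \<and> (R \<in> PP \<or> L \<in> PP)"
        using that a b by (auto simp: II_def simp del: prod.collapse)
      then show ?thesis
        using PP compact_projective_left_dual[OF rigid unit_compact] compact_projective_right_dual[OF rigid unit_compact] by blast
    qed
    show "\<exists>(R, L, e, d)\<in>II. \<exists>u\<in>homs A Q R. is_iso A u" "\<exists>(R, L, e, d)\<in>II. \<exists>u\<in>homs A Q L. is_iso A u"
      if "compact_projective k A Q" for Q
      using PP_all[OF that] by (force simp: II_def simp del: prod.collapse)+
  qed
qed

lemma nondegenerate_pairing:
  fixes T :: "('u, 'u, 'u) lincat"
  assumes kt: "kelly_tensor k A A T t" and enough: "enough_compact_projectives k A"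
  shows "nondegenerate k A T t pairing"
proof -
  have pT: "presentable k T" and tb: "bicocontinuous k A A T t" using kt by (auto simp: kelly_tensor_def)
  note t = bicocontinuousD(1)[OF tb]
  interpret T: linear_cocomplete k T
    using presentableD[OF pT] universe small_k by (simp add: linear_cocomplete_def)
  obtain II where II: "|II| <o |UNIV :: 'u set|"
    "\<And>R L e d. (R, L, e, d) \<in> II \<Longrightarrow> left_dual R L e d \<and> compact_projective k A R \<and> compact_projective k A L"
    "\<And>Q. compact_projective k A Q \<Longrightarrow> \<exists>(R, L, e, d)\<in>II. \<exists>u\<in>homs A Q R. is_iso A u"
    "\<And>Q. compact_projective k A Q \<Longrightarrow> \<exists>(R, L, e, d)\<in>II. \<exists>u\<in>homs A Q L. is_iso A u"
    using exists_dual_family by blast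
  define R L e d where "R = (fst :: 'u \<times> 'u \<times> 'u \<times> 'u \<Rightarrow> 'u)" and "L = (\<lambda>i :: 'u \<times> 'u \<times> 'u \<times> 'u. fst (snd i))"
    and "e = (\<lambda>i :: 'u \<times> 'u \<times> 'u \<times> 'u. fst (snd (snd i)))" and "d = (\<lambda>i :: 'u \<times> 'u \<times> 'u \<times> 'u. snd (snd (snd i)))"
  note defs = R_def L_def e_def d_def
  have dual: "left_dual (R i) (L i) (e i) (d i)" and cR: "compact_projective k A (R i)" and cL: "compact_projective k A (L i)"
    if "i \<in> II" for i using II(2)[of "R i" "L i" "e i" "d i"] that by (simp_all add: defs)
  note ds [simp] = left_dualD(1-8)[OF dual]
  have dR: "\<exists>(J :: ('u, 'u) cat) E c. small_category J \<and> is_colimit J A E X c \<and> (\<forall>j\<in>Obj J. \<exists>i\<in>II. \<exists>u\<in>homs A (fobj E j) (R i). is_iso A u)"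
    and dL: "\<exists>(J :: ('u, 'u) cat) E c. small_category J \<and> is_colimit J A E X c \<and> (\<forall>j\<in>Obj J. \<exists>i\<in>II. \<exists>u\<in>homs A (fobj E j) (L i). is_iso A u)"
    if X: "X \<in> Obj A" for X
  proof -
    obtain J :: "('u, 'u) cat" and E c where J: "small_category J" "is_colimit J A E X c" "\<And>j. j \<in> Obj J \<Longrightarrow> compact_projective k A (fobj E j)"
      using enough X unfolding enough_compact_projectives_def by blast
    have "\<exists>i\<in>II. \<exists>u\<in>homs A Q (R i). is_iso A u" "\<exists>i\<in>II. \<exists>u\<in>homs A Q (L i). is_iso A u" if "compact_projective k A Q" for Q
      using II(3,4)[OF that] by (force simp: defs)+
    with J show "\<exists>(J :: ('u, 'u) cat) E c. small_category J \<and> is_colimit J A E X c \<and> (\<forall>j\<in>Obj J. \<exists>i\<in>II. \<exists>u\<in>homs A (fobj E j) (R i). is_iso A u)"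
      "\<exists>(J :: ('u, 'u) cat) E c. small_category J \<and> is_colimit J A E X c \<and> (\<forall>j\<in>Obj J. \<exists>i\<in>II. \<exists>u\<in>homs A (fobj E j) (L i). is_iso A u)"
      by blast+
  qed
  have small: "|mates II R L d| <o |UNIV :: 'u set|"
  proof (rule card_less_subset)
    show "mates II R L d \<subseteq> (SIGMA i:II. SIGMA j:II. homs A (R i) (R j) \<times> homs A (L j) (L i))" by (auto simp: mates_def)
    show "|SIGMA i:II. SIGMA j:II. homs A (R i) (R j) \<times> homs A (L j) (L i)| <o |UNIV :: 'u set|"
      by (rule card_less_Sigma[OF universe II(1)] card_less_Times[OF universe] | use locally_small in \<open>simp add: locally_small_def small_def; fail\<close>)+
  qed
  have tO [simp]: "fobj t (X, Y) \<in> Obj T" if "X \<in> Obj A" "Y \<in> Obj A" for X Y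
    using functor_Obj[OF t, of "(X, Y)"] that by simp
  have tA: "farr t (f, g) \<in> homs T (fobj t (Dom A f, Dom A g)) (fobj t (Cod A f, Cod A g))" if "f \<in> Arr A" "g \<in> Arr A" for f g
    using functor_arr[OF t, of "(f, g)"] that by (simp add: in_homs_iff)
  \<comment> \<open>A pair of mates identifies the two arrows out of
    \<open>L j \<boxtimes> R i\<close>, one into \<open>L i \<boxtimes> R i\<close> and one into
    \<open>L j \<boxtimes> R j\<close>. \<open>D1\<close> carries the glueing along cocontinuous
    functors from \<open>T\<close> to \<open>A\<close>.\<close>
  obtain D dd where D0: "glueing T II (mates II R L d) (\<lambda>(i, j, f, f'). i) (\<lambda>(i, j, f, f'). j) (\<lambda>i. fobj t (L i, R i))
      (\<lambda>(i, j, f, f'). farr t (f', Idt A (R i))) (\<lambda>(i, j, f, f'). farr t (Idt A (L j), f)) D dd"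
    and D1: "\<And>H. preserves_colimits (\<lambda>J :: ('u, 'u) cat. True) T A H \<Longrightarrow>
      glueing A II (mates II R L d) (\<lambda>(i, j, f, f'). i) (\<lambda>(i, j, f, f'). j) (\<lambda>s. fobj H (fobj t (L s, R s)))
        (\<lambda>r. farr H (case r of (i, j, f, f') \<Rightarrow> farr t (f', Idt A (R i)))) (\<lambda>r. farr H (case r of (i, j, f, f') \<Rightarrow> farr t (Idt A (L j), f)))
        (fobj H D) (\<lambda>s. farr H (dd s))"
  proof (rule exists_glueing[OF universe T.cocomplete T.category_C II(1) small, where Z = "\<lambda>(i, j, f, f'). fobj t (L j, R i)"])
    show "(case r of (i, j, f, f') \<Rightarrow> i) \<in> II" "(case r of (i, j, f, f') \<Rightarrow> j) \<in> II" if "r \<in> mates II R L d" for r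
      using that by (auto simp: mates_def)
    show "fobj t (L i, R i) \<in> Obj T" if "i \<in> II" for i using that by simp
    show "(case r of (i, j, f, f') \<Rightarrow> farr t (f', \<iota> (R i))) \<in> homs T (case r of (i, j, f, f') \<Rightarrow> fobj t (L j, R i)) (fobj t (L (case r of (i, j, f, f') \<Rightarrow> i), R (case r of (i, j, f, f') \<Rightarrow> i)))"
      "(case r of (i, j, f, f') \<Rightarrow> farr t (\<iota> (L j), f)) \<in> homs T (case r of (i, j, f, f') \<Rightarrow> fobj t (L j, R i)) (fobj t (L (case r of (i, j, f, f') \<Rightarrow> j), R (case r of (i, j, f, f') \<Rightarrow> j)))"
      if "r \<in> mates II R L d" for r
    proof -
      obtain i j f f' where r: "r = (i, j, f, f')" by (cases r)
      then have h: "i \<in> II" "j \<in> II" "f \<in> homs A (R i) (R j)" "f' \<in> homs A (L j) (L i)" using that by (auto simp: mates_def)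
      then show "(case r of (i, j, f, f') \<Rightarrow> farr t (f', \<iota> (R i))) \<in> homs T (case r of (i, j, f, f') \<Rightarrow> fobj t (L j, R i)) (fobj t (L (case r of (i, j, f, f') \<Rightarrow> i), R (case r of (i, j, f, f') \<Rightarrow> i)))"
        "(case r of (i, j, f, f') \<Rightarrow> farr t (\<iota> (L j), f)) \<in> homs T (case r of (i, j, f, f') \<Rightarrow> fobj t (L j, R i)) (fobj t (L (case r of (i, j, f, f') \<Rightarrow> j), R (case r of (i, j, f, f') \<Rightarrow> j)))"
        using tA[of f' "\<iota> (R i)"] tA[of "\<iota> (L j)" f] homsD[OF h(3)] homsD[OF h(4)] by (simp_all add: r)
    qed
  qed (rule that, assumption, blast)
  have D: "D \<in> Obj T" "\<And>i. i \<in> II \<Longrightarrow> dd i \<in> homs T (fobj t (L i, R i)) D"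
    using D0 by (auto simp: glueing_def glue_cocone_def)
  have gl: "glueing A II (mates II R L d) (\<lambda>(i, j, f, f'). i) (\<lambda>(i, j, f, f'). j)
      (\<lambda>i. fobj H (fobj t (L i, R i))) (\<lambda>(i, j, f, f'). farr H (farr t (f', Idt A (R i))))
      (\<lambda>(i, j, f, f'). farr H (farr t (Idt A (L j), f))) (fobj H D) (\<lambda>i. farr H (dd i))" if "cocontinuous k T A H" for H
    using D1[of H] that by (simp add: cocontinuous_def case_prod_unfold)
  \<comment> \<open>A cocontinuous functor on \<open>Vect\<close> is determined by its value at
    \<open>k\<close>; taking copowers of \<open>D\<close> makes this value \<open>D\<close>, up to
    the isomorphism \<open>w\<close> below.\<close>
  let ?\<Delta> = "fix_right T T.copower D"
  have \<Delta>: "cocontinuous k (Vect k) T ?\<Delta>" using bicocontinuousD(3)[OF T.bicocontinuous_copower D(1)] .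
  obtain w where w: "w \<in> homs T (fobj ?\<Delta> (unit_space k)) D" "is_iso T w"
  proof -
    obtain \<beta> where \<beta>: "nat_iso T T (fix_left (Vect k) T.copower (unit_space k)) id_fun \<beta>"
      using T.left_unitor_copower unfolding left_unitor_def by blast
    have "\<beta> D \<in> homs T (fobj ?\<Delta> (unit_space k)) D" "is_iso T (\<beta> D)"
      using nat_trans_simps[OF nat_isoD(1)[OF \<beta>] D(1)] nat_isoD(2)[OF \<beta> D(1)] by (simp_all add: in_homs_iff)
    then show thesis by (rule that)
  qed
  have transfer: "\<exists>\<alpha>. nat_iso A A (fix_right T F (fobj ?\<Delta> (unit_space k))) id_fun \<alpha>"
    if F: "bicocontinuous k A T A F" and \<alpha>: "nat_iso A A (fix_right T F D) id_fun \<alpha>" for F \<alpha>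
    using nat_iso_Cmp[OF fix_right_iso[OF category_C T.category_C bicocontinuousD(1)[OF F] w] \<alpha>] by blast
  have "snake_left k A T t pairing ?\<Delta>"
  proof -
    obtain F \<beta> \<alpha> where F: "bicocontinuous k A T A F"
      and \<beta>: "nat_iso (prod_cat A (prod_cat A A)) A (comp_fun F (prod_fun id_fun t))
        (comp_fun copower (comp_fun (prod_fun pairing id_fun) rebracket)) \<beta>"
      and \<alpha>: "nat_iso A A (fix_right T F D) id_fun \<alpha>"
      using exists_snake[OF kt dual cR cL D gl dR] by blast
    show ?thesis
      unfolding snake_left_def using left_unitor_copower F \<beta> transfer[OF F \<alpha>] by blast
  qed
  moreover have "snake_right k A T t pairing ?\<Delta>"
  proof -
    let ?t = "comp_fun t swap_fun"
    note rev = rigid_extension_reversed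
    \<comment> \<open>Reversal exchanges \<open>f\<close> with \<open>f'\<close> and
      \<open>i\<close> with \<open>j\<close>, hence the two legs of each relation;
      \<open>glueing_flip\<close> absorbs the difference.\<close>
    have mates': "rigid_extension.mates A reversed II L R d = {(i, j, f, f'). (j, i, f', f) \<in> mates II R L d}"
      unfolding rigid_extension.mates_def[OF rev] mates_def by (auto simp: eq_commute)
    have dual': "balanced_data.left_dual A reversed (L i) (R i) (e i) (d i)" if "i \<in> II" for i
      using dual[OF that] by (simp add: left_dual_reversed)
    have D': "dd i \<in> homs T (fobj ?t (R i, L i)) D" if "i \<in> II" for i using D(2)[OF that] by simp
    have gl': "glueing A II (rigid_extension.mates A reversed II L R d) (\<lambda>(i, j, f, f'). i) (\<lambda>(i, j, f, f'). j)
        (\<lambda>i. fobj H (fobj ?t (R i, L i))) (\<lambda>(i, j, f, f'). farr H (farr ?t (f', Idt A (L i))))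
        (\<lambda>(i, j, f, f'). farr H (farr ?t (Idt A (R j), f))) (fobj H D) (\<lambda>i. farr H (dd i))" if "cocontinuous k T A H" for H
    proof -
      have "bij_betw (\<lambda>(i, j, f, f'). (j, i, f', f)) (rigid_extension.mates A reversed II L R d) (mates II R L d)"
        unfolding mates' by (rule bij_betw_byWitness[where f' = "\<lambda>(i, j, f, f'). (j, i, f', f)"]) auto
      from glueing_flip[OF gl[OF that] this] show ?thesis by (simp add: case_prod_unfold)
    qed
    obtain F \<beta> \<alpha> where F: "bicocontinuous k A T A F"
      and \<beta>: "nat_iso (prod_cat A (prod_cat A A)) A (comp_fun F (prod_fun id_fun ?t))
        (comp_fun copower (comp_fun (prod_fun (comp_fun (projective_extension.pfun k A (unt reversed) PP) (tens reversed)) id_fun) rebracket)) \<beta>"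
      and \<alpha>: "nat_iso A A (fix_right T F D) id_fun \<alpha>"
      using rigid_extension.exists_snake[OF rev kelly_tensor_swap[OF kt] dual' cL cR D(1) D' gl' dL] by blast
    \<comment> \<open>Reversing the order of the three factors turns the isomorphism obtained for
      the reversed structure into the one that the right snake relation requires.\<close>
    let ?\<sigma> = "\<lparr>fobj = \<lambda>(X, Y, Z). (Z, Y, X), farr = \<lambda>(f, g, h). (h, g, f)\<rparr> :: ('u \<times> 'u \<times> 'u, 'u \<times> 'u \<times> 'u, 'u \<times> 'u \<times> 'u, 'u \<times> 'u \<times> 'u) functr"
    have \<sigma>: "is_functor (prod_cat A (prod_cat A A)) (prod_cat A (prod_cat A A)) ?\<sigma>"
      by (rule is_functorI) (auto simp: in_homs_iff)
    let ?F = "comp_fun F swap_fun"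
    have "comp_fun (comp_fun F (prod_fun id_fun ?t)) ?\<sigma> = comp_fun ?F (comp_fun (prod_fun t id_fun) rebracket)"
      "comp_fun (comp_fun copower (comp_fun (prod_fun (comp_fun (projective_extension.pfun k A (unt reversed) PP) (tens reversed)) id_fun) rebracket)) ?\<sigma> =
        comp_fun copower (comp_fun swap_fun (prod_fun id_fun pairing))"
      by (simp_all add: comp_fun_def prod_fun_def id_fun_def swap_fun_def rebracket_def fun_eq_iff)
    then have "\<exists>\<beta>. nat_iso (prod_cat A (prod_cat A A)) A (comp_fun ?F (comp_fun (prod_fun t id_fun) rebracket))
        (comp_fun copower (comp_fun swap_fun (prod_fun id_fun pairing))) \<beta>"
      using nat_iso_whisker[OF \<beta> \<sigma>] by auto
    moreover have "fix_left T ?F W = fix_right T F W" for W by (simp add: fix_left_def fix_right_def)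
    ultimately show ?thesis
      unfolding snake_right_def using left_unitor_copower bicocontinuous_swap[OF category_C T.category_C F] transfer[OF F \<alpha>] by metis
  qed
  ultimately show ?thesis unfolding nondegenerate_def using \<Delta> by blast
qed

text \<open>The first claim is naturality of the left unitor, carried along \<open>\<phi>\<close>.
  The second is axiom (U): the unitor at \<open>I \<otimes> Y\<close> is the unitor at
  \<open>Y\<close> tensored with \<open>I\<close>.\<close>

lemma pairing_unitor:
  shows "nat_iso (prod_cat A A) (Vect k) pairing (comp_fun (fix_left A pairing I) (tens M)) (\<lambda>(X, Y). farr pfun (inv_iso (\<l> (X \<star> Y))))"
    (is "nat_iso _ _ _ ?G ?\<gamma>")
    and "Y \<in> Obj A \<Longrightarrow> farr pfun (inv_iso (\<l> (I \<star> Y))) = farr pairing (\<iota> I, inv_iso (\<l> Y))"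
proof -
  note K = bicocontinuousD[OF bicocontinuous_pairing]
  note P = cocontinuousD(4)[OF cocontinuous_pfun]
  have \<gamma>: "?\<gamma> p \<in> homs (Vect k) (fobj pairing p) (fobj ?G p) \<and> is_iso (Vect k) (?\<gamma> p)" if "p \<in> Obj (prod_cat A A)" for p
  proof (cases p)
    case (Pair X Y)
    then have [simp]: "X \<in> Obj A" "Y \<in> Obj A" using that by auto
    show ?thesis
      using functor_is_iso(1)[OF P, of "inv_iso (\<l> (X \<star> Y))"] functor_homs[OF P, of "inv_iso (\<l> (X \<star> Y))" "X \<star> Y" "I \<star> (X \<star> Y)"]
      by (simp add: Pair in_homs_iff)
  qed
  have nat: "Cmp (Vect k) (?\<gamma> (Cod (prod_cat A A) f)) (farr pairing f) = Cmp (Vect k) (farr ?G f) (?\<gamma> (Dom (prod_cat A A) f))"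
    if "f \<in> Arr (prod_cat A A)" for f
  proof (cases f)
    case (Pair g h)
    then have [simp]: "g \<in> Arr A" "h \<in> Arr A" using that by auto
    have "inv_iso (\<l> (Cod A g \<star> Cod A h)) \<diamondop> g \<bullet> h = \<iota> I \<bullet> (g \<bullet> h) \<diamondop> inv_iso (\<l> (Dom A g \<star> Dom A h))"
    proof (rule iso_mono[OF category_C, of "\<l> (Cod A g \<star> Cod A h)"])
      show "\<l> (Cod A g \<star> Cod A h) \<diamondop> inv_iso (\<l> (Cod A g \<star> Cod A h)) \<diamondop> g \<bullet> h =
          \<l> (Cod A g \<star> Cod A h) \<diamondop> \<iota> I \<bullet> (g \<bullet> h) \<diamondop> inv_iso (\<l> (Dom A g \<star> Dom A h))"
        by (subst Cmp_rewrite[OF category_C unitor_natural(1)[where X = "Dom A g \<star> Dom A h"]]) simp_all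
    qed simp_all
    then show ?thesis
      using functor_Cmp[OF P, of "g \<bullet> h" "inv_iso (\<l> (Cod A g \<star> Cod A h))"]
        functor_Cmp[OF P, of "inv_iso (\<l> (Dom A g \<star> Dom A h))" "\<iota> I \<bullet> (g \<bullet> h)"] by (simp add: Pair)
  qed
  show "nat_iso (prod_cat A A) (Vect k) pairing ?G ?\<gamma>"
    unfolding nat_iso_def
    by (intro conjI nat_transI K(1) is_functor_comp_fun[OF tensor_functor] is_functor_fix_left[OF K(1)] nat ballI)
      (use \<gamma> in auto)
  show "farr pfun (inv_iso (\<l> (I \<star> Y))) = farr pairing (\<iota> I, inv_iso (\<l> Y))" if "Y \<in> Obj A"
    using that by (simp add: tensor_lunit_inv inv_arr_Idt)
qed

end

theorem proposition3p2:
  fixes k :: "'u ring"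
    and A :: "('u, 'u, 'u) lincat"
    and M :: "'u balanced_struct"
    and T :: "('u, 'u, 'u) lincat"
    and t :: "('u \<times> 'u, 'u \<times> 'u, 'u, 'u) functr"
  assumes "regular_universe TYPE('u)"
    and "algebraically_closed k" and "small (carrier k)"
    and "balanced_data.framed_E2_algebra A M k"
    and "enough_compact_projectives k A"
    and "balanced_data.compact_rigid A M k"
    and "compact_obj k A (unt M)"
    and "balanced_data.balancing_compatible_with_duals A M"
    and "kelly_tensor k A A T t"
  shows "\<exists>\<kappa> \<gamma>. cyclic_framed_E2_algebra k A M T t \<kappa> \<gamma>"
proof -
  have A: "presentable k A" and tens: "bicocontinuous k A A A (tens M)" and laws: "balanced_data.monoidal_laws A M"
    and bal: "balanced_data.balancing_laws A M"
    using assms(4) by (auto simp: balanced_data.framed_E2_algebra_def)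
  obtain PP where PP: "|PP| <o |UNIV :: 'u set|" "\<And>P. P \<in> PP \<Longrightarrow> compact_projective k A P"
    "\<And>Q. compact_projective k A Q \<Longrightarrow> \<exists>P\<in>PP. \<exists>f\<in>homs A Q P. is_iso A f"
    using exists_small_compact_projectives[OF assms(1) A] by blast
  \<comment> \<open>The uncountability of the universe that the locale asks for follows from the
    accessibility of \<open>A\<close>.\<close>
  interpret rigid_extension k A M PP
    by unfold_locales
      (use assms tens laws PP presentableD[OF A] accessible_natLeq in \<open>auto simp: compact_obj_def\<close>)
  have "cyclic_framed_E2_algebra k A M T t pairing (\<lambda>(X, Y). farr pfun (inv_iso (\<l> (X \<star> Y))))"
    unfolding cyclic_framed_E2_algebra_def
    using assms(4) bicocontinuous_pairing nondegenerate_pairing[OF assms(9,5)] pairing_unitor pairing_twist[OF bal assms(8,5)]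
    by simp
  then show ?thesis by blast
qed

end
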